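(* Let $\mathfrak g$ be any nonexceptional affine algebra and let $a,b$ be integers with $a-2\ge b\ge0$. Then there is an injective $U_q(\bar{\mathfrak g})$-crystal morphism $$\mathrm{rs}_{1;a,b}:B^{1,a}\otimes B^{1,b}\to B^{1,a-1}\otimes B^{1,b+1}$$ such that for any crystal $B$ which is a tensor product of Kirillov–Reshetikhin crystals of the form $B^{1,s}$ ($s\ge1$), the map $$1_B\otimes\mathrm{rs}_{1;a,b}:B\otimes B^{1,a}\otimes B^{1,b}\to B\otimes B^{1,a-1}\otimes B^{1,b+1}$$ is an injective $U_q(\bar{\mathfrak g})$-crystal morphism which preserves intrinsic coenergy.
   Context: $\mathfrak g$ is of type $A_n^{(1)},B_n^{(1)},C_n^{(1)},D_n^{(1)},A_{2n-1}^{(2)},A_{2n}^{(2)},A_{2n}^{(2)\dagger}$ or $D_{n+1}^{(2)}$, where $A_{2n}^{(2)}$ and $A_{2n}^{(2)\dagger}$ are the two labelings of the same Dynkin diagram in which $\alpha_0$ is the extra short, resp. extra long, root. Nodes: $\{0\}\cup\bar I$; $\bar{\mathfrak g}$ is the simple Lie algebra with nodes $\bar I=\{1,\dots,n\}$. A $U_q(\bar{\mathfrak g})$-crystal morphism commutes with $e_i,f_i$ for $i\in\bar I$. Tensor products: $e_i(b_2\otimes b_1)=e_i(b_2)\otimes b_1$ if $\varepsilon_i(b_2)>\varphi_i(b_1)$, else $b_2\otimes e_i(b_1)$; $f_i(b_2\otimes b_1)=f_i(b_2)\otimes b_1$ if $\varepsilon_i(b_2)\ge\varphi_i(b_1)$,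 else $b_2\otimes f_i(b_1)$. $B^s=B^{1,s}$ is the Kirillov–Reshetikhin crystal (Kang–Kashiwara–Misra), with $B^{1,0}$ the trivial one-element crystal. As $U_q(\bar{\mathfrak g})$-crystals, $B^s\cong B(s\bar\Lambda_1)$ for $A_n^{(1)},B_n^{(1)},D_n^{(1)},A_{2n-1}^{(2)}$; $B^s\cong\bigoplus_{r=0}^sB((s-r)\bar\Lambda_1)$ for $A_{2n}^{(2)},D_{n+1}^{(2)}$; $B^s\cong\bigoplus_{r=0}^{\lfloor s/2\rfloor}B((s-2r)\bar\Lambda_1)$ for $C_n^{(1)},A_{2n}^{(2)\dagger}$. $u(B^s)$ is the unique vector of weight $s\bar\Lambda_1$, $u(B\otimes B')=u(B)\otimes u(B')$. For tensor products $B,B'$ of such crystals, $R_{B,B'}:B\otimes B'\to B'\otimes B$ is the unique $U_q'(\mathfrak g)$-crystal isomorphism. The local coenergy $H_{B,B'}:B\otimes B'\to\mathbb Z_{\ge0}$ is the unique function constant on classical components (components after removing $0$-arrows), zero on $u(B\otimes B')$, such that if $R(b\otimes b')=c'\otimes c$, $H(e_0(b\otimes b'))-H(b\otimes b')$ equals $1$ if $e_0$ acts on the left factor of both $b\otimes b'$ and $c'\otimes c$, $-1$ if on the right factor of both, $0$ otherwise. $R_j,H_j$ act on the $(j+1)$-th and $j$-th factors from the right. The intrinsic coenergy $D_{B^s}$ is identically $0$ for $A_n^{(1)},B_n^{(1)},D_n^{(1)},A_{2n-1}^{(2)}$, has value $r$ on the summand $B((s-r)\bar\Lambda_1)$ of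 $B^s\cong\bigoplus_{r=0}^sB((s-r)\bar\Lambda_1)$ for $A_{2n}^{(2)},D_{n+1}^{(2)}$, and has value $r$ on the summand $B((s-2r)\bar\Lambda_1)$ of $B^s\cong\bigoplus_{r=0}^{\lfloor s/2\rfloor}B((s-2r)\bar\Lambda_1)$ for $C_n^{(1)},A_{2n}^{(2)\dagger}$; and for $B=B_N\otimes\cdots\otimes B_1$, $D_B=\sum_{1\le i<j\le N}H_iR_{i+1}R_{i+2}\cdots R_{j-1}+\sum_{j=1}^ND_{B_j}R_1R_2\cdots R_{j-1}$, where $D_{B_j}$ acts on the rightmost factor. A map $g:B\to B'$ preserves intrinsic coenergy if $D_{B'}\circ g=D_B$. *)

theory Defs
  imports Main "HOL-Library.FuncSet"
begin

section \<open>Crystals\<close>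

text \<open>
  The operators \<open>eop\<close>, \<open>fop\<close> are partial: \<open>None\<close> plays the role of the crystal zero.  The field
  \<open>uvec\<close> is the distinguished vector \<open>u(B)\<close>.
\<close>

record 'b crystal =
  carr :: "'b set"
  eop :: "nat \<Rightarrow> 'b \<Rightarrow> 'b option"
  fop :: "nat \<Rightarrow> 'b \<Rightarrow> 'b option"
  uvec :: 'b

definition string_len :: "('b \<Rightarrow> 'b option) \<Rightarrow> 'b \<Rightarrow> nat" where
  "string_len g b = (GREATEST k. ((\<lambda>x. Option.bind x g) ^^ k) (Some b) \<noteq> None)"

definition eps :: "'b crystal \<Rightarrow> nat \<Rightarrow> 'b \<Rightarrow> nat" where
  "eps B i b = string_len (eop B i) b"

definition phi :: "'b crystal \<Rightarrow> nat \<Rightarrow> 'b \<Rightarrow> nat" where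
  "phi B i b = string_len (fop B i) b"

text \<open>The tensor product convention is opposite to Kashiwara's.\<close>

definition tensor :: "'a crystal \<Rightarrow> 'b crystal \<Rightarrow> ('a \<times> 'b) crystal" (infixr "\<otimes>\<^sub>c" 70) where
  "B2 \<otimes>\<^sub>c B1 =
    \<lparr> carr = carr B2 \<times> carr B1,
      eop = (\<lambda>i (b2, b1). if eps B2 i b2 > phi B1 i b1
               then map_option (\<lambda>x. (x, b1)) (eop B2 i b2)
               else map_option (\<lambda>x. (b2, x)) (eop B1 i b1)),
      fop = (\<lambda>i (b2, b1). if eps B2 i b2 \<ge> phi B1 i b1
               then map_option (\<lambda>x. (x, b1)) (fop B2 i b2)
               else map_option (\<lambda>x. (b2, x)) (fop B1 i b1)),
      uvec = (uvec B2, uvec B1) \<rparr>"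

text \<open>
  Iterated tensor product, written left to right: the list \<open>[B_N, \<dots>, B_1]\<close> gives the crystal
  of \<open>B_N \<otimes> \<dots> \<otimes> B_1\<close> on lists \<open>[b_N, \<dots>, b_1]\<close>.  The empty product is the trivial one-element
  crystal.
\<close>

primrec tensor_list :: "'b crystal list \<Rightarrow> 'b list crystal" where
  "tensor_list [] =
    \<lparr> carr = {[]}, eop = (\<lambda>i b. None), fop = (\<lambda>i b. None), uvec = [] \<rparr>"
| "tensor_list (B # Bs) =
    (let T = B \<otimes>\<^sub>c tensor_list Bs; cons = (\<lambda>(x, xs). x # xs) in
    \<lparr> carr = cons ` carr T,
      eop = (\<lambda>i b. map_option cons (eop T i (hd b, tl b))),
      fop = (\<lambda>i b. map_option cons (fop T i (hd b, tl b))),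
      uvec = cons (uvec T) \<rparr>)"

text \<open>Morphisms commute with \<open>e_i\<close>, \<open>f_i\<close> for \<open>i \<in> J\<close>, also where these give zero.\<close>

definition crystal_morphism :: "nat set \<Rightarrow> 'a crystal \<Rightarrow> 'b crystal \<Rightarrow> ('a \<Rightarrow> 'b) \<Rightarrow> bool" where
  "crystal_morphism J B B' g \<longleftrightarrow>
     g \<in> carr B \<rightarrow> carr B' \<and>
     (\<forall>i\<in>J. \<forall>b\<in>carr B. eop B' i (g b) = map_option g (eop B i b)
                    \<and> fop B' i (g b) = map_option g (fop B i b))"

definition crystal_iso :: "nat set \<Rightarrow> 'a crystal \<Rightarrow> 'b crystal \<Rightarrow> ('a \<Rightarrow> 'b) \<Rightarrow> bool" where
  "crystal_iso J B B' g \<longleftrightarrow> crystal_morphism J B B' g \<and> bij_betw g (carr B) (carr B')"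

definition same_component :: "nat set \<Rightarrow> 'b crystal \<Rightarrow> 'b \<Rightarrow> 'b \<Rightarrow> bool" where
  "same_component J B =
     (\<lambda>b b'. \<exists>i\<in>J. eop B i b = Some b' \<or> fop B i b = Some b')\<^sup>*\<^sup>*"

section \<open>Kirillov--Reshetikhin crystals of single rows\<close>

text \<open>
  \<open>A2_odd\<close> with parameter \<open>n\<close> is $A_{2n-1}^{(2)}$; \<open>A2_even\<close> and \<open>A2_even_dagger\<close> are
  $A_{2n}^{(2)}$ and $A_{2n}^{(2)\dagger}$ (\<open>\<alpha>_0\<close> extra short resp. extra long);
  \<open>D2\<close> is $D_{n+1}^{(2)}$.
\<close>

datatype affine_type = A1 | B1 | C1 | D1 | A2_odd | A2_even | A2_even_dagger | D2

fun rank_ok :: "affine_type \<Rightarrow> nat \<Rightarrow> bool" where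
  "rank_ok A1 n \<longleftrightarrow> n \<ge> 1"
| "rank_ok B1 n \<longleftrightarrow> n \<ge> 3"
| "rank_ok C1 n \<longleftrightarrow> n \<ge> 2"
| "rank_ok D1 n \<longleftrightarrow> n \<ge> 4"
| "rank_ok A2_odd n \<longleftrightarrow> n \<ge> 3"
| "rank_ok A2_even n \<longleftrightarrow> n \<ge> 1"
| "rank_ok A2_even_dagger n \<longleftrightarrow> n \<ge> 1"
| "rank_ok D2 n \<longleftrightarrow> n \<ge> 2"

text \<open>
  Kang--Kashiwara--Misra coordinates.  A row is given by its letter multiplicities
  \<open>x_i = b i\<close>, \<open>x_0 = b 0\<close> and \<open>\<bar>x_i = b (-i)\<close>, extended by zero to non-letters.  Multiplicities are
  integers so that a move may leave the crystal, which is then read as zero.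
\<close>

type_synonym row = "int \<Rightarrow> int"

definition letters :: "affine_type \<Rightarrow> nat \<Rightarrow> int set" where
  "letters X n =
    (if X = A1 then {1..int n + 1}
     else if X \<in> {B1, D2, A2_even_dagger} then {- int n..int n}
     else {- int n..int n} - {0})"

definition row_size :: "affine_type \<Rightarrow> nat \<Rightarrow> row \<Rightarrow> int" where
  "row_size X n b = (\<Sum>l\<in>letters X n. b l)"

definition size_ok :: "affine_type \<Rightarrow> nat \<Rightarrow> int \<Rightarrow> bool" where
  "size_ok X s m \<longleftrightarrow>
    (if X \<in> {A1, B1, D1, A2_odd} then m = int s
     else if X \<in> {A2_even, D2} then m \<le> int s
     else m \<le> int s \<and> even (int s - m))"

definition KR_rows :: "affine_type \<Rightarrow> nat \<Rightarrow> nat \<Rightarrow> row set" where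
  "KR_rows X n s =
    {b. (\<forall>l. b l \<ge> 0) \<and> (\<forall>l. l \<notin> letters X n \<longrightarrow> b l = 0)
      \<and> size_ok X s (row_size X n b)
      \<and> (X \<in> {B1, D2, A2_even_dagger} \<longrightarrow> b 0 \<le> 1)
      \<and> (X = D1 \<longrightarrow> b (int n) = 0 \<or> b (- int n) = 0)}"

definition add_letter :: "int \<Rightarrow> int \<Rightarrow> row \<Rightarrow> row" where
  "add_letter l d b = b(l := b l + d)"

text \<open>\<open>change p q\<close> turns one letter \<open>p\<close> into a letter \<open>q\<close>.\<close>

definition change :: "int \<Rightarrow> int \<Rightarrow> row \<Rightarrow> row" where
  "change p q b = add_letter q 1 (add_letter p (-1) b)"

definition e_zero :: "affine_type \<Rightarrow> nat \<Rightarrow> row \<Rightarrow> row" where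
  "e_zero X n b =
    (if X = A1 then change 1 (int n + 1) b
     else if X \<in> {B1, D1, A2_odd} then
       (if b 2 > b (-2) then change 2 (-1) b else change 1 (-2) b)
     else if X \<in> {A2_even, D2} then
       (if b 1 > b (-1) then add_letter 1 (-1) b else add_letter (-1) 1 b)
     else
       (if b 1 \<ge> b (-1) + 2 then add_letter 1 (-2) b
        else if b 1 = b (-1) + 1 then change 1 (-1) b
        else add_letter (-1) 2 b))"

definition f_zero :: "affine_type \<Rightarrow> nat \<Rightarrow> row \<Rightarrow> row" where
  "f_zero X n b =
    (if X = A1 then change (int n + 1) 1 b
     else if X \<in> {B1, D1, A2_odd} then
       (if b 2 \<ge> b (-2) then change (-1) 2 b else change (-2) 1 b)
     else if X \<in> {A2_even, D2} then
       (if b 1 \<ge> b (-1) then add_letter 1 1 b else add_letter (-1) (-1) b)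
     else
       (if b 1 \<ge> b (-1) then add_letter 1 2 b
        else if b 1 = b (-1) - 1 then change (-1) 1 b
        else add_letter (-1) (-2) b))"

definition e_last :: "affine_type \<Rightarrow> int \<Rightarrow> row \<Rightarrow> row" where
  "e_last X n b =
    (if X = A1 then change (n + 1) n b
     else if X \<in> {C1, A2_odd, A2_even} then change (-n) n b
     else if X = D1 then
       (if b (-n) = 0 then change (-(n - 1)) n b else change (-n) (n - 1) b)
     else (if b 0 = 0 then change (-n) 0 b else change 0 n b))"

definition f_last :: "affine_type \<Rightarrow> int \<Rightarrow> row \<Rightarrow> row" where
  "f_last X n b =
    (if X = A1 then change n (n + 1) b
     else if X \<in> {C1, A2_odd, A2_even} then change n (-n) b
     else if X = D1 then
       (if b n \<ge> 1 then change n (-(n - 1)) b else change (n - 1) (-n) b)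
     else (if b 0 = 0 then change n 0 b else change 0 (-n) b))"

definition e_mid :: "affine_type \<Rightarrow> int \<Rightarrow> row \<Rightarrow> row" where
  "e_mid X i b =
    (if X = A1 \<or> b (i + 1) > b (-(i + 1)) then change (i + 1) i b
     else change (-i) (-(i + 1)) b)"

definition f_mid :: "affine_type \<Rightarrow> int \<Rightarrow> row \<Rightarrow> row" where
  "f_mid X i b =
    (if X = A1 \<or> b (i + 1) \<ge> b (-(i + 1)) then change i (i + 1) b
     else change (-(i + 1)) (-i) b)"

definition e_row :: "affine_type \<Rightarrow> nat \<Rightarrow> nat \<Rightarrow> row \<Rightarrow> row" where
  "e_row X n i = (if i = 0 then e_zero X n else if i = n then e_last X (int n) else e_mid X (int i))"

definition f_row :: "affine_type \<Rightarrow> nat \<Rightarrow> nat \<Rightarrow> row \<Rightarrow> row" where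
  "f_row X n i = (if i = 0 then f_zero X n else if i = n then f_last X (int n) else f_mid X (int i))"

text \<open>
  The crystal $B^{1,s}$.  The row \<open>1\<dots>1\<close> of length \<open>s\<close> is its unique vector of weight
  \<open>s\<Lambda>\<^sub>1\<close>.  The rows of size \<open>m\<close> form the classical summand \<open>B(m\<Lambda>\<^sub>1)\<close>.
\<close>

definition KR :: "affine_type \<Rightarrow> nat \<Rightarrow> nat \<Rightarrow> row crystal" where
  "KR X n s =
    \<lparr> carr = KR_rows X n s,
      eop = (\<lambda>i b. if i \<le> n \<and> e_row X n i b \<in> KR_rows X n s then Some (e_row X n i b) else None),
      fop = (\<lambda>i b. if i \<le> n \<and> f_row X n i b \<in> KR_rows X n s then Some (f_row X n i b) else None),
      uvec = (\<lambda>l. if l = 1 then int s else 0) \<rparr>"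

text \<open>\<open>KR_tensor X n [s_N, \<dots>, s_1]\<close> is $B^{1,s_N} \otimes \cdots \otimes B^{1,s_1}$.\<close>

definition KR_tensor :: "affine_type \<Rightarrow> nat \<Rightarrow> nat list \<Rightarrow> row list crystal" where
  "KR_tensor X n ss = tensor_list (map (KR X n) ss)"

section \<open>Combinatorial R-matrix and coenergy\<close>

text \<open>
  Uniqueness is up to values outside the underlying sets, hence the restriction to
  extensional functions.
\<close>

definition comb_R ::
    "nat \<Rightarrow> 'a crystal \<Rightarrow> 'b crystal \<Rightarrow> 'a \<times> 'b \<Rightarrow> 'b \<times> 'a" where
  "comb_R n B B' =
    (THE R. crystal_iso {0..n} (B \<otimes>\<^sub>c B') (B' \<otimes>\<^sub>c B) R \<and> R \<in> extensional (carr (B \<otimes>\<^sub>c B')))"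

definition e0_left :: "'a crystal \<Rightarrow> 'b crystal \<Rightarrow> 'a \<times> 'b \<Rightarrow> bool" where
  "e0_left B B' = (\<lambda>(b, b'). eps B 0 b > phi B' 0 b')"

definition is_local_coenergy ::
    "nat \<Rightarrow> 'a crystal \<Rightarrow> 'b crystal \<Rightarrow> ('a \<times> 'b \<Rightarrow> nat) \<Rightarrow> bool" where
  "is_local_coenergy n B B' H \<longleftrightarrow>
     H \<in> extensional (carr (B \<otimes>\<^sub>c B')) \<and>
     (\<forall>p\<in>carr (B \<otimes>\<^sub>c B'). \<forall>q\<in>carr (B \<otimes>\<^sub>c B').
        same_component {1..n} (B \<otimes>\<^sub>c B') p q \<longrightarrow> H p = H q) \<and>
     H (uvec (B \<otimes>\<^sub>c B')) = 0 \<and>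
     (\<forall>p\<in>carr (B \<otimes>\<^sub>c B'). \<forall>p'. eop (B \<otimes>\<^sub>c B') 0 p = Some p' \<longrightarrow>
        int (H p') - int (H p) =
          (let l = e0_left B B' p; r = e0_left B' B (comb_R n B B' p) in
           if l \<and> r then 1 else if \<not> l \<and> \<not> r then -1 else 0))"

definition local_coenergy :: "nat \<Rightarrow> 'a crystal \<Rightarrow> 'b crystal \<Rightarrow> 'a \<times> 'b \<Rightarrow> nat" where
  "local_coenergy n B B' = (THE H. is_local_coenergy n B B' H)"

definition row_coenergy :: "affine_type \<Rightarrow> nat \<Rightarrow> nat \<Rightarrow> row \<Rightarrow> nat" where
  "row_coenergy X n s b =
    (if X \<in> {A1, B1, D1, A2_odd} then 0
     else if X \<in> {A2_even, D2} then nat (int s - row_size X n b)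
     else nat ((int s - row_size X n b) div 2))"

text \<open>
  Since R permutes the factors, elements of tensor products are carried along as lists of
  pairs \<open>(s, b)\<close> with \<open>b\<close> in $B^{1,s}$.  \<open>R_at j\<close> and \<open>H_at j\<close> act on the factors \<open>j + 1\<close> and \<open>j\<close>,
  counted from the right starting at 1; the \<open>j\<close>-th one is at list position \<open>length p - j\<close>.
\<close>

definition R_at :: "affine_type \<Rightarrow> nat \<Rightarrow> nat \<Rightarrow> (nat \<times> row) list \<Rightarrow> (nat \<times> row) list" where
  "R_at X n j p =
    (let k = length p - (j + 1); l = length p - j; (s, b) = p ! k; (t, c) = p ! l;
         (c', b') = comb_R n (KR X n s) (KR X n t) (b, c)
     in p[k := (t, c'), l := (s, b')])"

definition H_at :: "affine_type \<Rightarrow> nat \<Rightarrow> nat \<Rightarrow> (nat \<times> row) list \<Rightarrow> nat" where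
  "H_at X n j p =
    (let (s, b) = p ! (length p - (j + 1)); (t, c) = p ! (length p - j)
     in local_coenergy n (KR X n s) (KR X n t) (b, c))"

text \<open>In \<open>foldr (R_at X n) [i+1..<j]\<close> the operator \<open>R_at X n (j - 1)\<close> is applied first.\<close>

definition intrinsic_coenergy :: "affine_type \<Rightarrow> nat \<Rightarrow> nat list \<Rightarrow> row list \<Rightarrow> nat" where
  "intrinsic_coenergy X n ss bs =
    (let p = zip ss bs; N = length ss in
      (\<Sum>(i, j)\<in>{(i, j). 1 \<le> i \<and> i < j \<and> j \<le> N}. H_at X n i (foldr (R_at X n) [i+1..<j] p))
    + (\<Sum>j = 1..N. case last (foldr (R_at X n) [1..<j] p) of (s, b) \<Rightarrow> row_coenergy X n s b))"

definition preserves_coenergy ::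
    "affine_type \<Rightarrow> nat \<Rightarrow> nat list \<Rightarrow> nat list \<Rightarrow> (row list \<Rightarrow> row list) \<Rightarrow> bool" where
  "preserves_coenergy X n ss ss' g \<longleftrightarrow>
    (\<forall>b\<in>carr (KR_tensor X n ss). intrinsic_coenergy X n ss' (g b) = intrinsic_coenergy X n ss b)"

text \<open>\<open>1_B \<otimes> g\<close> for \<open>B\<close> with \<open>m\<close> factors and \<open>g\<close> acting on the last two factors.\<close>

definition id_tensor :: "nat \<Rightarrow> ('b \<times> 'b \<Rightarrow> 'b \<times> 'b) \<Rightarrow> 'b list \<Rightarrow> 'b list" where
  "id_tensor m g b = take m b @ (case g (b ! m, b ! (m + 1)) of (x, y) \<Rightarrow> [x, y])"

end

theory Submission
  imports Defs
begin

text \<open>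
  Put \<open>c = a - 1 - b\<close>.  Adding \<open>c\<close> copies of the last letter to the right factor \<open>y\<close> of \<open>x \<otimes> y\<close> does not
  change any \<open>\<phi>\<^sub>i\<close> with \<open>i \<noteq> 0\<close>, so it is compatible with tensoring on the left.  The R-matrix moves the padded
  pair from $B^{1,a} \<otimes> B^{1,a-1}$ to $B^{1,a-1} \<otimes> B^{1,a}$, and the right factor of the result still contains the
  \<open>c\<close> added letters; removing them gives \<open>rs\<close>.  The intrinsic coenergy is the sum of the costs of passing
  factors to the right end, and the R-matrix preserves it by the Yang--Baxter argument; hence it suffices that the
  padding does not affect the cost of passing a row across \<open>y\<close>, the intrinsic coenergy of the passed row included.

  This requires some knowledge of the R-matrix.  A bisimulation between two tensor products, i.e. a
  relation that is compatible with string lengths and with the moves of all nodes, is the graph of an isomorphism as soon as it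
  relates the two vectors \<open>uvec\<close>, because every vector can be raised to \<open>uvec\<close>.  In type A the graph of an explicit
  piecewise linear map is such a relation.  In type D the relation is the equality of certain piecewise linear
  invariants of the two pairs of rows, one tuple for each absolute value of letters.  All other types embed into type D, where
  each move becomes a word of moves that all act on the same tensor factor.
\<close>

section \<open>Regular crystals\<close>

text \<open>The number \<open>c\<close> is forced by the lengths: the padded right factor has length
  \<open>a - 1\<close>, so the R-matrix exchanges the lengths \<open>a\<close> and
  \<open>a - 1\<close>, and \<open>a - c = b + 1\<close> remains after stripping. Padding commutes
  with lowering at the nodes other than 0, but not with raising, since it lengthens some
  \<epsilon>-strings. The lengthening is the same before and after the exchange, so raising is
  recovered from lowering and the string lengths. The R-matrix and the local coenergy are definite
  descriptions. Existence comes first; identities between them are then checked at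
  \<open>uvec\<close> and carried along raising paths, which is why products of two and of three
  rows must be connected. If boxes may be missing, padding is only shown to fix the sum of the local
  coenergy and the coenergy of the passed row. The embedding makes this sum visible by storing
  missing boxes as equally many letters \<open>1\<close> and \<open>-1\<close>. A word of type D
  moves stays on one factor because at all its nodes the string lengths are the same multiple of the
  original ones.\<close>

lemma funpow_bind_Some:
  fixes g :: "'b \<Rightarrow> 'b option"
  shows "((\<lambda>x. Option.bind x g) ^^ Suc k) (Some b) = ((\<lambda>x. Option.bind x g) ^^ k) (g b)"
  by (simp add: funpow_Suc_right del: funpow.simps)

lemma funpow_bind_None:
  fixes g :: "'b \<Rightarrow> 'b option"
  shows "((\<lambda>x. Option.bind x g) ^^ k) None = None"
  by (induction k) auto

text \<open>The \<open>GREATEST\<close> in \<open>string_len\<close> is meaningful only if the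
  iteration stops. A natural number that drops by one at each application and is zero exactly where
  \<open>g\<close> stops provides the bound and is the value.\<close>

lemma string_len_eqI:
  assumes "b \<in> S"
    and "\<And>b b'. b \<in> S \<Longrightarrow> g b = Some b' \<Longrightarrow> b' \<in> S \<and> l b = Suc (l b')"
    and "\<And>b. b \<in> S \<Longrightarrow> g b = None \<longleftrightarrow> l b = 0"
  shows "string_len g b = l b"
proof -
  have "((\<lambda>x. Option.bind x g) ^^ k) (Some b) \<noteq> None \<longleftrightarrow> k \<le> l b" for k
    using assms(1)
  proof (induction k arbitrary: b)
    case (Suc k)
    show ?case
    proof (cases "g b")
      case None
      then show ?thesis using assms(3)[OF Suc.prems] by (simp add: funpow_bind_Some funpow_bind_None del: funpow.simps)
    next
      case (Some b')
      then show ?thesis using assms(2)[OF Suc.prems Some] Suc.IH[of b'] by (simp add: funpow_bind_Some del: funpow.simps)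
    qed
  qed simp
  then show ?thesis unfolding string_len_def by (intro Greatest_equality) auto
qed

lemma string_len_map:
  assumes "b \<in> S" "\<And>b b'. b \<in> S \<Longrightarrow> g b = Some b' \<Longrightarrow> b' \<in> S"
    and "\<And>b. b \<in> S \<Longrightarrow> g' (c b) = map_option c (g b)"
  shows "string_len g' (c b) = string_len g b"
proof -
  have "((\<lambda>x. Option.bind x g') ^^ k) (Some (c b)) = map_option c (((\<lambda>x. Option.bind x g) ^^ k) (Some b))" for k
    using assms(1)
  proof (induction k arbitrary: b)
    case (Suc k)
    then show ?case using assms(2,3)[OF Suc.prems]
      by (cases "g b") (simp_all add: funpow_bind_Some funpow_bind_None del: funpow.simps)
  qed simp
  then show ?thesis unfolding string_len_def by simp
qed

text \<open>Lengths are controlled along \<open>eop\<close> only; their behaviour along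
  \<open>fop\<close> follows because the two operators invert each other.\<close>

definition regular :: "nat set \<Rightarrow> 'b crystal \<Rightarrow> bool" where
  "regular I B \<longleftrightarrow> finite (carr B) \<and> uvec B \<in> carr B \<and> (\<forall>i\<in>I. \<forall>b\<in>carr B.
     (\<forall>b'. eop B i b = Some b' \<longrightarrow> b' \<in> carr B \<and> fop B i b' = Some b
        \<and> eps B i b = Suc (eps B i b') \<and> phi B i b' = Suc (phi B i b)) \<and>
     (\<forall>b'. fop B i b = Some b' \<longrightarrow> b' \<in> carr B \<and> eop B i b' = Some b) \<and>
     (eop B i b = None \<longleftrightarrow> eps B i b = 0) \<and> (fop B i b = None \<longleftrightarrow> phi B i b = 0))"

text \<open>Candidate formulas \<open>ep\<close> and \<open>ph\<close> are certified as the true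
  string lengths by their behaviour along single arrows, so concrete crystals never have to unfold
  \<open>GREATEST\<close>.\<close>

lemma regularI:
  fixes ep ph :: "nat \<Rightarrow> 'b \<Rightarrow> nat"
  assumes fin: "finite (carr B)" and u: "uvec B \<in> carr B"
    and e: "\<And>i b b'. i \<in> I \<Longrightarrow> b \<in> carr B \<Longrightarrow> eop B i b = Some b' \<Longrightarrow>
      b' \<in> carr B \<and> fop B i b' = Some b \<and> ep i b = Suc (ep i b') \<and> ph i b' = Suc (ph i b)"
    and f: "\<And>i b b'. i \<in> I \<Longrightarrow> b \<in> carr B \<Longrightarrow> fop B i b = Some b' \<Longrightarrow> b' \<in> carr B \<and> eop B i b' = Some b"
    and e0: "\<And>i b. i \<in> I \<Longrightarrow> b \<in> carr B \<Longrightarrow> eop B i b = None \<longleftrightarrow> ep i b = 0"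
    and f0: "\<And>i b. i \<in> I \<Longrightarrow> b \<in> carr B \<Longrightarrow> fop B i b = None \<longleftrightarrow> ph i b = 0"
  shows "regular I B \<and> (\<forall>i\<in>I. \<forall>b\<in>carr B. eps B i b = ep i b \<and> phi B i b = ph i b)"
proof -
  have ep: "eps B i b = ep i b" if "i \<in> I" "b \<in> carr B" for i b
    unfolding eps_def
    by (rule string_len_eqI[where S = "carr B", OF that(2)]) (use e[OF that(1)] e0[OF that(1)] in \<open>simp_all\<close>)
  have ph: "phi B i b = ph i b" if "i \<in> I" "b \<in> carr B" for i b
    unfolding phi_def
  proof (rule string_len_eqI[where S = "carr B", OF that(2)])
    fix c c' assume "c \<in> carr B" "fop B i c = Some c'"
    then show "c' \<in> carr B \<and> ph i c = Suc (ph i c')" using f[OF that(1)] e[OF that(1)] by metis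
  qed (rule f0[OF that(1)])
  have "regular I B"
    unfolding regular_def
  proof (intro conjI ballI allI impI fin u)
    fix i b assume ib: "i \<in> I" "b \<in> carr B"
    show "eop B i b = None \<longleftrightarrow> eps B i b = 0" "fop B i b = None \<longleftrightarrow> phi B i b = 0"
      using e0[OF ib] f0[OF ib] by (simp_all add: ep[OF ib] ph[OF ib])
    show "b' \<in> carr B" "eop B i b' = Some b" if "fop B i b = Some b'" for b' using f[OF ib that] by auto
    show "b' \<in> carr B" "fop B i b' = Some b" "eps B i b = Suc (eps B i b')" "phi B i b' = Suc (phi B i b)"
      if "eop B i b = Some b'" for b' using e[OF ib that] by (simp_all add: ep ph ib)
  qed
then show ?thesis using ep ph by blast
qed

context
  fixes I B assumes R: "regular I B"
begin

lemma regular_finite: "finite (carr B)" and regular_uvec: "uvec B \<in> carr B"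
  using R unfolding regular_def by auto

lemma regular_e:
  assumes "i \<in> I" "b \<in> carr B" "eop B i b = Some b'"
  shows "b' \<in> carr B" "fop B i b' = Some b" "eps B i b = Suc (eps B i b')" "phi B i b' = Suc (phi B i b)"
  using R assms unfolding regular_def by blast+

lemma regular_f:
  assumes "i \<in> I" "b \<in> carr B" "fop B i b = Some b'"
  shows "b' \<in> carr B" "eop B i b' = Some b" "eps B i b' = Suc (eps B i b)" "phi B i b = Suc (phi B i b')"
proof -
  show *: "b' \<in> carr B" "eop B i b' = Some b" using R assms unfolding regular_def by blast+
  show "eps B i b' = Suc (eps B i b)" "phi B i b = Suc (phi B i b')" using regular_e[OF assms(1) *] by auto
qed

lemma regular_e_None: "i \<in> I \<Longrightarrow> b \<in> carr B \<Longrightarrow> eop B i b = None \<longleftrightarrow> eps B i b = 0"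
  and regular_f_None: "i \<in> I \<Longrightarrow> b \<in> carr B \<Longrightarrow> fop B i b = None \<longleftrightarrow> phi B i b = 0"
  using R unfolding regular_def by blast+

lemma regular_e_ex: "i \<in> I \<Longrightarrow> b \<in> carr B \<Longrightarrow> 0 < eps B i b \<Longrightarrow> \<exists>b'. eop B i b = Some b'"
  and regular_f_ex: "i \<in> I \<Longrightarrow> b \<in> carr B \<Longrightarrow> 0 < phi B i b \<Longrightarrow> \<exists>b'. fop B i b = Some b'"
  using regular_e_None[of i b] regular_f_None[of i b] by (cases "eop B i b"; cases "fop B i b"; simp)+

end

lemma carr_tensor [simp]: "carr (B \<otimes>\<^sub>c C) = carr B \<times> carr C"
  and uvec_tensor [simp]: "uvec (B \<otimes>\<^sub>c C) = (uvec B, uvec C)"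
  and eop_tensor: "eop (B \<otimes>\<^sub>c C) i (x, y) = (if phi C i y < eps B i x
      then map_option (\<lambda>x'. (x', y)) (eop B i x) else map_option (\<lambda>y'. (x, y')) (eop C i y))"
  and fop_tensor: "fop (B \<otimes>\<^sub>c C) i (x, y) = (if phi C i y \<le> eps B i x
      then map_option (\<lambda>x'. (x', y)) (fop B i x) else map_option (\<lambda>y'. (x, y')) (fop C i y))"
  by (simp_all add: tensor_def)

text \<open>The truncated subtraction of naturals is the positive part in the usual tensor formulas.
  A move shifts the compared lengths by one, which is just enough for the inverse move to choose the
  same factor.\<close>

lemma
  assumes B: "regular I B" and C: "regular I C"
  shows regular_tensor: "regular I (B \<otimes>\<^sub>c C)"
    and eps_tensor: "\<And>i x y. i \<in> I \<Longrightarrow> x \<in> carr B \<Longrightarrow> y \<in> carr C \<Longrightarrow>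
      eps (B \<otimes>\<^sub>c C) i (x, y) = eps C i y + (eps B i x - phi C i y)"
    and phi_tensor: "\<And>i x y. i \<in> I \<Longrightarrow> x \<in> carr B \<Longrightarrow> y \<in> carr C \<Longrightarrow>
      phi (B \<otimes>\<^sub>c C) i (x, y) = phi B i x + (phi C i y - eps B i x)"
proof -
  define ep where "ep = (\<lambda>i (x, y). eps C i y + (eps B i x - phi C i y))"
  define ph where "ph = (\<lambda>i (x, y). phi B i x + (phi C i y - eps B i x))"
  have e: "b' \<in> carr (B \<otimes>\<^sub>c C) \<and> fop (B \<otimes>\<^sub>c C) i b' = Some b \<and> ep i b = Suc (ep i b') \<and> ph i b' = Suc (ph i b)"
    if i: "i \<in> I" and b: "b \<in> carr (B \<otimes>\<^sub>c C)" and b': "eop (B \<otimes>\<^sub>c C) i b = Some b'" for i b b'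
  proof -
    obtain x y where xy: "b = (x, y)" "x \<in> carr B" "y \<in> carr C" using b by auto
    show ?thesis
    proof (cases "phi C i y < eps B i x")
      case True
      then obtain x' where x': "eop B i x = Some x'" "b' = (x', y)" using b' xy(1) by (auto simp: eop_tensor)
      show ?thesis using regular_e[OF B i xy(2) x'(1)] True xy x'(2) by (auto simp: fop_tensor ep_def ph_def)
    next
      case False
      then obtain y' where y': "eop C i y = Some y'" "b' = (x, y')" using b' xy(1) by (auto simp: eop_tensor)
      show ?thesis using regular_e[OF C i xy(3) y'(1)] False xy y'(2) by (auto simp: fop_tensor ep_def ph_def)
    qed
  qed
  have f: "b' \<in> carr (B \<otimes>\<^sub>c C) \<and> eop (B \<otimes>\<^sub>c C) i b' = Some b"
    if i: "i \<in> I" and b: "b \<in> carr (B \<otimes>\<^sub>c C)" and b': "fop (B \<otimes>\<^sub>c C) i b = Some b'" for i b b'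
  proof -
    obtain x y where xy: "b = (x, y)" "x \<in> carr B" "y \<in> carr C" using b by auto
    show ?thesis
    proof (cases "phi C i y \<le> eps B i x")
      case True
      then obtain x' where x': "fop B i x = Some x'" "b' = (x', y)" using b' xy(1) by (auto simp: fop_tensor)
      show ?thesis using regular_f[OF B i xy(2) x'(1)] True xy x'(2) by (auto simp: eop_tensor)
    next
      case False
      then obtain y' where y': "fop C i y = Some y'" "b' = (x, y')" using b' xy(1) by (auto simp: fop_tensor)
      show ?thesis using regular_f[OF C i xy(3) y'(1)] False xy y'(2) by (auto simp: eop_tensor)
    qed
  qed
  have e0: "eop (B \<otimes>\<^sub>c C) i b = None \<longleftrightarrow> ep i b = 0" if "i \<in> I" "b \<in> carr (B \<otimes>\<^sub>c C)" for i b
    using that by (cases b) (auto simp: eop_tensor ep_def regular_e_None[OF B] regular_e_None[OF C])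
  have f0: "fop (B \<otimes>\<^sub>c C) i b = None \<longleftrightarrow> ph i b = 0" if "i \<in> I" "b \<in> carr (B \<otimes>\<^sub>c C)" for i b
    using that by (cases b) (auto simp: fop_tensor ph_def regular_f_None[OF B] regular_f_None[OF C])
  have fin: "finite (carr (B \<otimes>\<^sub>c C))" and u: "uvec (B \<otimes>\<^sub>c C) \<in> carr (B \<otimes>\<^sub>c C)"
    using regular_finite[OF B] regular_finite[OF C] regular_uvec[OF B] regular_uvec[OF C] by auto
  have *: "regular I (B \<otimes>\<^sub>c C) \<and> (\<forall>i\<in>I. \<forall>b\<in>carr (B \<otimes>\<^sub>c C). eps (B \<otimes>\<^sub>c C) i b = ep i b \<and> phi (B \<otimes>\<^sub>c C) i b = ph i b)"
    by (rule regularI, rule fin, rule u, rule e, assumption+, rule f, assumption+, rule e0, assumption+, rule f0, assumption+)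
  then show "regular I (B \<otimes>\<^sub>c C)" by blast
  show "eps (B \<otimes>\<^sub>c C) i (x, y) = eps C i y + (eps B i x - phi C i y)"
    "phi (B \<otimes>\<^sub>c C) i (x, y) = phi B i x + (phi C i y - eps B i x)"
    if "i \<in> I" "x \<in> carr B" "y \<in> carr C" for i x y
    using conjunct2[OF *, rule_format, of i "(x, y)"] that by (simp_all add: ep_def ph_def)
qed

lemma eop_assoc:
  assumes "regular I A" "regular I B" "regular I C" "i \<in> I" "a \<in> carr A" "b \<in> carr B" "c \<in> carr C"
  shows "eop (A \<otimes>\<^sub>c (B \<otimes>\<^sub>c C)) i (a, (b, c)) =
    map_option (\<lambda>((x, y), z). (x, (y, z))) (eop ((A \<otimes>\<^sub>c B) \<otimes>\<^sub>c C) i ((a, b), c))"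
  using assms by (auto simp: eop_tensor eps_tensor phi_tensor option.map_comp comp_def)

lemma fop_assoc:
  assumes "regular I A" "regular I B" "regular I C" "i \<in> I" "a \<in> carr A" "b \<in> carr B" "c \<in> carr C"
  shows "fop (A \<otimes>\<^sub>c (B \<otimes>\<^sub>c C)) i (a, (b, c)) =
    map_option (\<lambda>((x, y), z). (x, (y, z))) (fop ((A \<otimes>\<^sub>c B) \<otimes>\<^sub>c C) i ((a, b), c))"
  using assms by (auto simp: fop_tensor eps_tensor phi_tensor option.map_comp comp_def)

section \<open>Morphisms and lists\<close>

text \<open>A morphism commutes with the operators also where they give \<open>None\<close>, so
  strings stop at the same place.\<close>

lemma morphism_eps:
  assumes m: "crystal_morphism I B B' g" and R: "regular I B" and i: "i \<in> I" and b: "b \<in> carr B"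
  shows "eps B' i (g b) = eps B i b" "phi B' i (g b) = phi B i b"
proof -
  have "string_len (eop B' i) (g b) = string_len (eop B i) b"
    by (rule string_len_map[where S = "carr B" and c = g, OF b])
      (use regular_e(1)[OF R i] in blast, use m i in \<open>simp add: crystal_morphism_def\<close>)
  moreover have "string_len (fop B' i) (g b) = string_len (fop B i) b"
    by (rule string_len_map[where S = "carr B" and c = g, OF b])
      (use regular_f(1)[OF R i] in blast, use m i in \<open>simp add: crystal_morphism_def\<close>)
  ultimately show "eps B' i (g b) = eps B i b" "phi B' i (g b) = phi B i b"
    by (simp_all add: eps_def phi_def)
qed

lemma morphism_tensor_id:
  assumes g: "crystal_morphism I B B' g" and R: "regular I B"
  shows "crystal_morphism I (A \<otimes>\<^sub>c B) (A \<otimes>\<^sub>c B') (\<lambda>(a, b). (a, g b))"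
proof -
  have "eop (A \<otimes>\<^sub>c B') i (a, g b) = map_option (\<lambda>(a, b). (a, g b)) (eop (A \<otimes>\<^sub>c B) i (a, b))"
    "fop (A \<otimes>\<^sub>c B') i (a, g b) = map_option (\<lambda>(a, b). (a, g b)) (fop (A \<otimes>\<^sub>c B) i (a, b))"
    if "i \<in> I" "b \<in> carr B" for i a b
    using g that morphism_eps[OF g R that]
    by (simp_all add: crystal_morphism_def eop_tensor fop_tensor option.map_comp comp_def)
  then show ?thesis using g by (auto simp: crystal_morphism_def)
qed

section \<open>Raising paths\<close>

text \<open>Most inductions below run backwards along a path of raising steps that ends at
  \<open>uvec\<close>.\<close>

definition epath :: "nat set \<Rightarrow> 'b crystal \<Rightarrow> 'b \<Rightarrow> 'b \<Rightarrow> bool" where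
  "epath J B = (\<lambda>b b'. \<exists>i\<in>J. eop B i b = Some b')\<^sup>*\<^sup>*"

lemma epath_refl [simp]: "epath J B b b"
  by (simp add: epath_def)

lemma epath_trans [trans]: "epath J B b b' \<Longrightarrow> epath J B b' b'' \<Longrightarrow> epath J B b b''"
  unfolding epath_def by (rule rtranclp_trans)

lemma epath_step: "i \<in> J \<Longrightarrow> eop B i b = Some b' \<Longrightarrow> epath J B b b'"
  unfolding epath_def by (rule r_into_rtranclp) auto

lemma epath_mono: "epath J B b b' \<Longrightarrow> J \<subseteq> K \<Longrightarrow> epath K B b b'"
  unfolding epath_def by (erule rtranclp_mono[THEN predicate2D, rotated]) auto

lemma epath_induct [consumes 1, case_names refl step]:
  assumes "epath J B b c" "P c"
    and "\<And>i b b'. i \<in> J \<Longrightarrow> eop B i b = Some b' \<Longrightarrow> epath J B b' c \<Longrightarrow> P b' \<Longrightarrow> P b"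
  shows "P b"
  using assms(1)[unfolded epath_def] by (induction rule: converse_rtranclp_induct) (use assms(2,3) in \<open>auto simp: epath_def\<close>)

lemma epath_carr:
  assumes "regular I B" "J \<subseteq> I" "epath J B b b'" "b \<in> carr B"
  shows "b' \<in> carr B"
  using assms(3)[unfolded epath_def]
proof (induction rule: rtranclp_induct)
  case (step c d)
  then obtain i where i: "i \<in> J" "eop B i c = Some d" by auto
  show ?case by (rule regular_e(1)[OF assms(1) _ step.IH i(2)]) (use i(1) assms(2) in blast)
qed (rule assms(4))

text \<open>Where the right factor has \<open>phi\<close> zero, any positive \<open>eps\<close> on
  the left wins the comparison.\<close>

lemma epath_left:
  assumes A: "regular I A" and J: "J \<subseteq> I" and p: "epath J A x x'" and x: "x \<in> carr A"
    and y: "\<And>i. i \<in> J \<Longrightarrow> phi C i y = 0"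
  shows "epath J (A \<otimes>\<^sub>c C) (x, y) (x', y)"
  using p[unfolded epath_def]
proof (induction rule: rtranclp_induct)
  case (step b c)
  then obtain i where i: "i \<in> J" "eop A i b = Some c" by auto
  have "b \<in> carr A" using epath_carr[OF A J _ x] step.hyps(1) unfolding epath_def by blast
  then have "eop (A \<otimes>\<^sub>c C) i (b, y) = Some (c, y)"
    using i J regular_e(3)[OF A] by (auto simp: eop_tensor y subset_iff)
  then show ?case using step.IH epath_step[OF i(1)] epath_trans by metis
qed simp

lemma epath_right:
  assumes p: "epath J C y y'" and x: "\<And>i. i \<in> J \<Longrightarrow> eps A i x = 0"
  shows "epath J (A \<otimes>\<^sub>c C) (x, y) (x, y')"
  using p[unfolded epath_def]
proof (induction rule: rtranclp_induct)
  case (step b c)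
  then obtain i where i: "i \<in> J" "eop C i b = Some c" by auto
  then have "eop (A \<otimes>\<^sub>c C) i (x, b) = Some (x, c)" by (simp add: eop_tensor x)
  then show ?case using step.IH epath_step[OF i(1)] epath_trans by metis
qed simp

text \<open>Before a step at node \<open>i\<close> the left factor is raised at \<open>i\<close>
  until its \<open>eps\<close> no longer exceeds \<open>phi\<close> of the right factor; then
  \<open>e_i\<close> acts on the right. The left factor ends at an uncontrolled place, which
  \<open>rises_tensor\<close> repairs.\<close>

lemma epath_right_lift:
  assumes A: "regular I A" and C: "regular I C" and J: "J \<subseteq> I"
    and p: "epath J C y y'" and x: "x \<in> carr A"
  shows "\<exists>x'\<in>carr A. epath J (A \<otimes>\<^sub>c C) (x, y) (x', y')"
  using p[unfolded epath_def]
proof (induction rule: rtranclp_induct)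
  case (step b c)
  then obtain i where i: "i \<in> J" "eop C i b = Some c" by auto
  obtain x1 where x1: "x1 \<in> carr A" "epath J (A \<otimes>\<^sub>c C) (x, y) (x1, b)" using step.IH by auto
  have "\<exists>x'\<in>carr A. epath J (A \<otimes>\<^sub>c C) (x1, b) (x', b) \<and> eps A i x' \<le> phi C i b"
    using x1(1)
  proof (induction "eps A i x1" arbitrary: x1 rule: less_induct)
    case less
    show ?case
    proof (cases "eps A i x1 \<le> phi C i b")
      case False
      then obtain x2 where x2: "eop A i x1 = Some x2"
        using regular_e_ex[OF A, of i x1] i(1) J less.prems by auto
      note e = regular_e[OF A _ less.prems x2]
      have s: "epath J (A \<otimes>\<^sub>c C) (x1, b) (x2, b)"
        using False x2 by (intro epath_step[OF i(1)]) (simp add: eop_tensor)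
      show ?thesis using less.hyps[of x2] e(1,3) i(1) J s epath_trans by (metis lessI subsetD)
    next
      case True
      then show ?thesis by (intro bexI[of _ x1] conjI epath_refl less.prems)
    qed
  qed
  then obtain x2 where x2: "x2 \<in> carr A" "epath J (A \<otimes>\<^sub>c C) (x1, b) (x2, b)" "eps A i x2 \<le> phi C i b" by auto
  have "eop (A \<otimes>\<^sub>c C) i (x2, b) = Some (x2, c)" using x2(3) i(2) by (simp add: eop_tensor)
  then have "epath J (A \<otimes>\<^sub>c C) (x2, b) (x2, c)" by (rule epath_step[OF i(1)])
  then show ?case using x1(2) x2 epath_trans by metis
next
  case base
  show ?case by (rule bexI[OF epath_refl x])
qed

text \<open>
  If the right factor is at \<open>uvec\<close>, the nodes in \<open>I0\<close> raise the left factor freely; if it is at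
  \<open>z\<close>, those in \<open>I1\<close> do.
\<close>

definition pivot :: "nat set \<Rightarrow> nat set \<Rightarrow> 'b crystal \<Rightarrow> 'b \<Rightarrow> bool" where
  "pivot I1 I0 B z \<longleftrightarrow> z \<in> carr B \<and>
     (\<forall>i\<in>I0. phi B i (uvec B) = 0) \<and> (\<forall>i\<in>I1. eps B i (uvec B) = 0) \<and>
     (\<forall>i\<in>I1. phi B i z = 0) \<and> (\<forall>i\<in>I0. eps B i z = 0) \<and>
     epath I0 B (uvec B) z \<and> epath I1 B z (uvec B)"

definition rises :: "nat set \<Rightarrow> 'b crystal \<Rightarrow> bool" where
  "rises I B \<longleftrightarrow> (\<forall>b\<in>carr B. epath I B b (uvec B))"

text \<open>With \<open>I1\<close> the classical nodes, \<open>b'\<close> is a classical highest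
  vector. In a classically reducible crystal it need not be \<open>uvec\<close>, and then the outer
  nodes \<open>I0\<close> must lead it to \<open>z\<close>.\<close>

definition zigzag :: "nat set \<Rightarrow> nat set \<Rightarrow> 'b crystal \<Rightarrow> 'b \<Rightarrow> bool" where
  "zigzag I1 I0 B z \<longleftrightarrow> (\<forall>b\<in>carr B. \<exists>b'. epath I1 B b b' \<and> (\<forall>i\<in>I1. eps B i b' = 0) \<and>
     (b' = uvec B \<or> epath I0 B b' z))"

text \<open>At the pivot vectors neither factor obstructs the other, so the path of the pair is the
  left path followed by the right one. This admits products as the right factor in
  \<open>rises_tensor\<close>, and thus three rows.\<close>

lemma pivot_tensor:
  assumes A: "regular I A" and C: "regular I C" and I: "I1 \<subseteq> I" "I0 \<subseteq> I"
    and p: "pivot I1 I0 A z" "pivot I1 I0 C z'"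
  shows "pivot I1 I0 (A \<otimes>\<^sub>c C) (z, z')"
proof -
  have u: "uvec A \<in> carr A" "uvec C \<in> carr C" "z \<in> carr A" "z' \<in> carr C"
    using regular_uvec[OF A] regular_uvec[OF C] p by (auto simp: pivot_def)
  have "epath I0 (A \<otimes>\<^sub>c C) (uvec A, uvec C) (z, z')"
    using epath_left[OF A I(2), of "uvec A" z C "uvec C"] epath_right[of I0 C "uvec C" z' A z] p u
    unfolding pivot_def by (blast intro: epath_trans)
  moreover have "epath I1 (A \<otimes>\<^sub>c C) (z, z') (uvec A, uvec C)"
    using epath_left[OF A I(1), of z "uvec A" C z'] epath_right[of I1 C z' "uvec C" A "uvec A"] p u
    unfolding pivot_def by (blast intro: epath_trans)
  ultimately show ?thesis using p u I unfolding pivot_def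
    by (simp add: subset_iff eps_tensor[OF A C] phi_tensor[OF A C])
qed

text \<open>The right factor is driven to \<open>z'\<close> first. There \<open>I1\<close> raises
  the left factor freely to \<open>b\<close>, and since \<open>b\<close> has \<open>eps\<close> zero
  on \<open>I1\<close> the right factor can then rise to \<open>uvec\<close>, where
  \<open>I0\<close> is free for the left factor. If \<open>b\<close> is not yet \<open>uvec\<close>,
  the pair passes through \<open>(z, z')\<close>, from which both factors rise to the top.\<close>

lemma rises_tensor:
  assumes A: "regular I A" and C: "regular I C" and I: "I = I1 \<union> I0"
    and p: "pivot I1 I0 A z" "pivot I1 I0 C z'" and zz: "zigzag I1 I0 A z" and r: "rises I C"
  shows "rises I (A \<otimes>\<^sub>c C)"
  unfolding rises_def
proof safe
  fix x y assume xy: "(x, y) \<in> carr (A \<otimes>\<^sub>c C)"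
  let ?T = "A \<otimes>\<^sub>c C" and ?u = "uvec A" and ?v = "uvec C"
  have sub: "I1 \<subseteq> I" "I0 \<subseteq> I" using I by auto
  note m = epath_mono[OF _ sub(1)] epath_mono[OF _ sub(2)]
  have "epath I C y z'"
    by (rule epath_trans[OF _ m(2), of _ _ ?v]) (use r xy p(2) in \<open>auto simp: rises_def pivot_def\<close>)
  moreover have "x \<in> carr A" using xy by simp
  ultimately obtain x1 where x1: "x1 \<in> carr A" "epath I ?T (x, y) (x1, z')"
    using epath_right_lift[OF A C subset_refl] by blast
  obtain b where b: "epath I1 A x1 b" "\<forall>i\<in>I1. eps A i b = 0" "b = ?u \<or> epath I0 A b z"
    using zz x1(1) unfolding zigzag_def by blast
  have bc: "b \<in> carr A" using epath_carr[OF A sub(1) b(1) x1(1)] .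
  have s1: "epath I1 ?T (x1, z') (b, z')"
    by (rule epath_left[OF A sub(1) b(1) x1(1)]) (use p(2) in \<open>simp add: pivot_def\<close>)
  have s2: "epath I1 ?T (b, z') (b, ?v)"
    by (rule epath_right) (use p(2) b(2) in \<open>simp_all add: pivot_def\<close>)
  have s3: "epath I ?T (b, ?v) (?u, ?v)"
  proof (cases "b = ?u")
    case False
    then have "epath I0 A b z" using b(3) by simp
    then have 1: "epath I0 ?T (b, ?v) (z, ?v)"
      by (rule epath_left[OF A sub(2) _ bc]) (use p(2) in \<open>simp add: pivot_def\<close>)
    have 2: "epath I0 ?T (z, ?v) (z, z')"
      by (rule epath_right) (use p in \<open>simp_all add: pivot_def\<close>)
    have 3: "epath I1 ?T (z, z') (?u, ?v)"
      using pivot_tensor[OF A C sub p] unfolding pivot_def by simp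
    show ?thesis by (rule epath_trans[OF m(2)[OF 1] epath_trans[OF m(2)[OF 2] m(1)[OF 3]]])
  qed simp
  show "epath I ?T (x, y) (uvec ?T)" unfolding uvec_tensor
    by (rule epath_trans[OF x1(2) epath_trans[OF m(1)[OF s1] epath_trans[OF m(1)[OF s2] s3]]])
qed

section \<open>The combinatorial R-matrix and the local coenergy\<close>

text \<open>Existence of the second move is not part of the clauses: in regular crystals equal
  string lengths make both moves exist or neither.\<close>

definition bisim :: "nat set \<Rightarrow> 'a crystal \<Rightarrow> 'b crystal \<Rightarrow> ('a \<Rightarrow> 'b \<Rightarrow> bool) \<Rightarrow> bool" where
  "bisim I P Q r \<longleftrightarrow> (\<forall>p\<in>carr P. \<forall>q\<in>carr Q. r p q \<longrightarrow> (\<forall>i\<in>I.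
     eps P i p = eps Q i q \<and> phi P i p = phi Q i q \<and>
     (\<forall>p' q'. eop P i p = Some p' \<longrightarrow> eop Q i q = Some q' \<longrightarrow> r p' q') \<and>
     (\<forall>p' q'. fop P i p = Some p' \<longrightarrow> fop Q i q = Some q' \<longrightarrow> r p' q')))"

text \<open>A substitute for the uniqueness of the weight of \<open>uvec\<close>: the string lengths
  pin it down, so every isomorphism maps \<open>uvec\<close> to \<open>uvec\<close>.\<close>

definition u_rigid :: "nat set \<Rightarrow> 'a crystal \<Rightarrow> 'b crystal \<Rightarrow> bool" where
  "u_rigid I P Q \<longleftrightarrow> (\<forall>v\<in>carr Q. (\<forall>i\<in>I. eps P i (uvec P) = eps Q i v \<and> phi P i (uvec P) = phi Q i v) \<longrightarrow> v = uvec Q)"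

lemma bisimD:
  assumes "bisim I P Q r" "r p q" "p \<in> carr P" "q \<in> carr Q" "i \<in> I"
  shows "eps P i p = eps Q i q" "phi P i p = phi Q i q"
    and "eop P i p = Some p' \<Longrightarrow> eop Q i q = Some q' \<Longrightarrow> r p' q'"
    and "fop P i p = Some p' \<Longrightarrow> fop Q i q = Some q' \<Longrightarrow> r p' q'"
  using assms unfolding bisim_def by blast+

lemma bisim_converse:
  assumes "bisim I P Q r"
  shows "bisim I Q P (\<lambda>q p. r p q)"
  unfolding bisim_def[of I Q P]
proof (intro ballI impI conjI allI)
  fix p q i assume h: "p \<in> carr Q" "q \<in> carr P" "r q p" "i \<in> I"
  note b = bisimD[OF assms h(3,2,1,4)]
  show "eps Q i p = eps P i q" "phi Q i p = phi P i q" using b(1,2) by simp_all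
  show "r q' p'" if "eop Q i p = Some p'" "eop P i q = Some q'" for p' q' by (rule b(3)[OF that(2,1)])
  show "r q' p'" if "fop Q i p = Some p'" "fop P i q = Some q'" for p' q' by (rule b(4)[OF that(2,1)])
qed

text \<open>The induction descends from \<open>uvec\<close>: a partner of \<open>p'\<close> can be
  lowered at \<open>i\<close> because its \<open>phi\<close> equals that of \<open>p'\<close>, which
  is positive.\<close>

lemma bisim_total:
  assumes P: "regular I P" and Q: "regular I Q" and r: "rises I P" and b: "bisim I P Q r"
    and u: "r (uvec P) (uvec Q)" and p: "p \<in> carr P"
  shows "\<exists>q\<in>carr Q. r p q"
proof -
  have "epath I P p (uvec P)" using r p unfolding rises_def by blast
  then show ?thesis using p
  proof (induction rule: epath_induct)
    case refl
    then show ?case using u regular_uvec[OF Q] by blast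
  next
    case (step i p p')
    note e = regular_e[OF P step.hyps(1) step.prems step.hyps(2)]
    obtain q' where q': "q' \<in> carr Q" "r p' q'" using step.IH e(1) by blast
    note bs = bisimD[OF b q'(2) e(1) q'(1) step.hyps(1)]
    obtain q where q: "fop Q i q' = Some q" using regular_f_ex[OF Q step.hyps(1) q'(1)] e(4) bs(2) by auto
    show ?case by (rule bexI, rule bs(4)[OF e(2) q], rule regular_f(1)[OF Q step.hyps(1) q'(1) q])
  qed
qed

text \<open>Two partners of \<open>p\<close> are raised in parallel with \<open>p\<close> until
  rigidity identifies them at \<open>uvec\<close>; lowering the common vector returns both.\<close>

lemma bisim_unique:
  assumes P: "regular I P" and Q: "regular I Q" and r: "rises I P" and b: "bisim I P Q r"
    and u: "u_rigid I P Q" and p: "p \<in> carr P"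
    and q: "q \<in> carr Q" "r p q" and q': "q' \<in> carr Q" "r p q'"
  shows "q = q'"
proof -
  have "epath I P p (uvec P)" using r p unfolding rises_def by blast
  then show ?thesis using p q q'
  proof (induction arbitrary: q q' rule: epath_induct)
    case refl
    have "v = uvec Q" if v: "v \<in> carr Q" "r (uvec P) v" for v
    proof -
      have "\<forall>i\<in>I. eps P i (uvec P) = eps Q i v \<and> phi P i (uvec P) = phi Q i v"
        using bisimD(1,2)[OF b v(2) refl(1) v(1)] by blast
      then show ?thesis using u v(1) unfolding u_rigid_def by blast
    qed
    then show ?case using refl by blast
  next
    case (step i p p')
    note e = regular_e[OF P step.hyps(1) step.prems(1) step.hyps(2)]
    have ex: "\<exists>c'. eop Q i c = Some c' \<and> c' \<in> carr Q \<and> r p' c' \<and> fop Q i c' = Some c" if c: "c \<in> carr Q" "r p c" for c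
    proof -
      note bs = bisimD[OF b c(2) step.prems(1) c(1) step.hyps(1)]
      obtain c' where c': "eop Q i c = Some c'" using regular_e_ex[OF Q step.hyps(1) c(1)] e(3) bs(1) by auto
      then show ?thesis using bs(3)[OF step.hyps(2) c'] regular_e(1,2)[OF Q step.hyps(1) c(1) c'] by blast
    qed
    show ?case using ex[OF step.prems(2,3)] ex[OF step.prems(4,5)] step.IH[OF e(1)] by force
  qed
qed

lemma bisim_iso:
  assumes P: "regular I P" and Q: "regular I Q" and r: "rises I P" "rises I Q" and b: "bisim I P Q r"
    and u: "r (uvec P) (uvec Q)" "u_rigid I P Q" "u_rigid I Q P"
  obtains g where "crystal_iso I P Q g" "\<And>p. p \<in> carr P \<Longrightarrow> r p (g p)"
proof -
  obtain g where g: "\<And>p. p \<in> carr P \<Longrightarrow> g p \<in> carr Q \<and> r p (g p)"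
    using bisim_total[OF P Q r(1) b u(1)] by metis
  note b' = bisim_converse[OF b]
  have "inj_on g (carr P)"
    using bisim_unique[OF Q P r(2) b' u(3)] g by (intro inj_onI) metis
  moreover have "g ` carr P = carr Q"
  proof safe
    fix q assume q: "q \<in> carr Q"
    obtain p where p: "p \<in> carr P" "r p q" using bisim_total[OF Q P r(2) b' u(1) q] by blast
    then show "q \<in> g ` carr P" using bisim_unique[OF P Q r(1) b u(2) p(1) q p(2)] g by blast
  qed (use g in blast)
  moreover have "eop Q i (g p) = map_option g (eop P i p)" if ip: "i \<in> I" "p \<in> carr P" for i p
  proof -
    have gp: "g p \<in> carr Q" "r p (g p)" using g[OF ip(2)] by auto
    note bs = bisimD[OF b gp(2) ip(2) gp(1) ip(1)]
    show ?thesis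
    proof (cases "eop P i p")
      case None
      then show ?thesis using bs(1) regular_e_None[OF P ip] regular_e_None[OF Q ip(1) gp(1)] by simp
    next
      case (Some p')
      note e = regular_e[OF P ip Some]
      obtain q' where q': "eop Q i (g p) = Some q'" using regular_e_ex[OF Q ip(1) gp(1)] e(3) bs(1) by auto
      have "q' = g p'"
        using bisim_unique[OF P Q r(1) b u(2) e(1)] regular_e(1)[OF Q ip(1) gp(1) q'] bs(3)[OF Some q'] g[OF e(1)] by blast
      then show ?thesis using Some q' by simp
    qed
  qed
  moreover have "fop Q i (g p) = map_option g (fop P i p)" if ip: "i \<in> I" "p \<in> carr P" for i p
  proof -
    have gp: "g p \<in> carr Q" "r p (g p)" using g[OF ip(2)] by auto
    note bs = bisimD[OF b gp(2) ip(2) gp(1) ip(1)]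
    show ?thesis
    proof (cases "fop P i p")
      case None
      then show ?thesis using bs(2) regular_f_None[OF P ip] regular_f_None[OF Q ip(1) gp(1)] by simp
    next
      case (Some p')
      note e = regular_f[OF P ip Some]
      obtain q' where q': "fop Q i (g p) = Some q'" using regular_f_ex[OF Q ip(1) gp(1)] e(4) bs(2) by auto
      have "q' = g p'"
        using bisim_unique[OF P Q r(1) b u(2) e(1)] regular_f(1)[OF Q ip(1) gp(1) q'] bs(4)[OF Some q'] g[OF e(1)] by blast
      then show ?thesis using Some q' by simp
    qed
  qed
  ultimately have "crystal_iso I P Q g"
    using g unfolding crystal_iso_def crystal_morphism_def bij_betw_def by blast
  then show ?thesis using that g by blast
qed

lemma iso_eps:
  assumes "crystal_iso I P Q g" "regular I P" "i \<in> I" "p \<in> carr P"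
  shows "eps Q i (g p) = eps P i p" "phi Q i (g p) = phi P i p"
  using morphism_eps[of I P Q g i p] assms unfolding crystal_iso_def by blast+

lemma iso_u:
  assumes "crystal_iso I P Q g" "regular I P" "u_rigid I P Q"
  shows "g (uvec P) = uvec Q"
  using assms iso_eps[OF assms(1,2) _ regular_uvec[OF assms(2)]] regular_uvec[OF assms(2)]
  unfolding u_rigid_def crystal_iso_def crystal_morphism_def by (metis PiE)

lemma iso_unique:
  assumes P: "regular I P" and Q: "regular I Q" and r: "rises I P" and u: "u_rigid I P Q"
    and g: "crystal_iso I P Q g" and h: "crystal_iso I P Q h" and p: "p \<in> carr P"
  shows "g p = h p"
proof -
  have "epath I P p (uvec P)" using r p unfolding rises_def by blast
  then show ?thesis using p
  proof (induction rule: epath_induct)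
    case refl
    then show ?case using iso_u[OF g P u] iso_u[OF h P u] by simp
  next
    case (step i p p')
    note e = regular_e[OF P step.hyps(1) step.prems step.hyps(2)]
    have "eop Q i (g p) = Some (g p')" "eop Q i (h p) = Some (h p')" "g p \<in> carr Q" "h p \<in> carr Q"
      using g h step.hyps(1,2) step.prems unfolding crystal_iso_def crystal_morphism_def by auto
    then show ?case using regular_e(2)[OF Q step.hyps(1)] step.IH[OF e(1)] by (metis option.inject)
  qed
qed

lemma comb_R_iso:
  assumes "regular {0..n} B" "regular {0..n} C" "rises {0..n} (B \<otimes>\<^sub>c C)" "u_rigid {0..n} (B \<otimes>\<^sub>c C) (C \<otimes>\<^sub>c B)"
    and g: "crystal_iso {0..n} (B \<otimes>\<^sub>c C) (C \<otimes>\<^sub>c B) g"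
  shows "crystal_iso {0..n} (B \<otimes>\<^sub>c C) (C \<otimes>\<^sub>c B) (comb_R n B C)"
    and "\<And>p. p \<in> carr (B \<otimes>\<^sub>c C) \<Longrightarrow> comb_R n B C p = g p"
proof -
  let ?P = "B \<otimes>\<^sub>c C" and ?Q = "C \<otimes>\<^sub>c B"
  note reg = regular_tensor[OF assms(1,2)] regular_tensor[OF assms(2,1)]
  \<comment> \<open>\<open>comb_R\<close> describes an extensional function, so the given
    isomorphism is cut down to the underlying set before it can be the one described.\<close>
  define h where "h = restrict g (carr ?P)"
  have cl: "b' \<in> carr ?P" if "i \<in> {0..n}" "b \<in> carr ?P" "eop ?P i b = Some b' \<or> fop ?P i b = Some b'" for i b b'
    using regular_e(1)[OF reg(1) that(1,2)] regular_f(1)[OF reg(1) that(1,2)] that(3) by blast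
  have h: "crystal_iso {0..n} ?P ?Q h"
  proof -
    have 1: "h \<in> carr ?P \<rightarrow> carr ?Q" using g unfolding h_def crystal_iso_def crystal_morphism_def by auto
    have 2: "map_option h (eop ?P i b) = map_option g (eop ?P i b)" "map_option h (fop ?P i b) = map_option g (fop ?P i b)"
      if "i \<in> {0..n}" "b \<in> carr ?P" for i b
      using cl[OF that] unfolding h_def by (auto intro!: option.map_cong0 simp del: carr_tensor simp: restrict_apply)
    have 3: "bij_betw h (carr ?P) (carr ?Q)" using g unfolding crystal_iso_def h_def
      by (metis bij_betw_restrict_eq)
    show ?thesis unfolding crystal_iso_def crystal_morphism_def
      using 1 2 3 g unfolding crystal_iso_def crystal_morphism_def by (simp add: h_def del: carr_tensor)
  qed
  have "comb_R n B C = h"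
    unfolding comb_R_def
  proof (rule the_equality)
    show "crystal_iso {0..n} ?P ?Q h \<and> h \<in> extensional (carr ?P)" using h by (simp add: h_def)
    fix R assume R: "crystal_iso {0..n} ?P ?Q R \<and> R \<in> extensional (carr ?P)"
    then show "R = h"
      using iso_unique[OF reg assms(3,4) _ h] by (intro extensionalityI[of R "carr ?P"]) (auto simp: h_def)
  qed
  then show "crystal_iso {0..n} ?P ?Q (comb_R n B C)" "\<And>p. p \<in> carr ?P \<Longrightarrow> comb_R n B C p = g p"
    using h by (auto simp: h_def)
qed

definition coenergy_step :: "bool \<Rightarrow> bool \<Rightarrow> int" where
  "coenergy_step l r = (if l \<and> r then 1 else if \<not> l \<and> \<not> r then -1 else 0)"

text \<open>Raising arrows suffice in the hypotheses since lowering arrows are their inverses.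
  Uniqueness holds because the prescribed differences, summed along a raising path, fix every value
  from the value 0 at \<open>uvec\<close>.\<close>

lemma local_coenergy_eq:
  fixes h :: "'a \<times> 'b \<Rightarrow> nat"
  assumes B: "regular {0..n} B" and C: "regular {0..n} C" and r: "rises {0..n} (B \<otimes>\<^sub>c C)"
    and cl: "\<And>i p p'. i \<in> {1..n} \<Longrightarrow> p \<in> carr (B \<otimes>\<^sub>c C) \<Longrightarrow> eop (B \<otimes>\<^sub>c C) i p = Some p' \<Longrightarrow> h p' = h p"
    and u: "h (uvec (B \<otimes>\<^sub>c C)) = 0"
    and st: "\<And>p p'. p \<in> carr (B \<otimes>\<^sub>c C) \<Longrightarrow> eop (B \<otimes>\<^sub>c C) 0 p = Some p' \<Longrightarrow>
      int (h p') - int (h p) = coenergy_step (e0_left B C p) (e0_left C B (comb_R n B C p))"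
    and p: "p \<in> carr (B \<otimes>\<^sub>c C)"
  shows "local_coenergy n B C p = h p"
proof -
  let ?P = "B \<otimes>\<^sub>c C"
  note P = regular_tensor[OF B C]
  have n1: "{1..n} \<subseteq> {0..n}" by auto
  have comp: "h q = h p \<and> q \<in> carr ?P" if "same_component {1..n} ?P p q" "p \<in> carr ?P" for p q
    using that(1)[unfolded same_component_def]
  proof (induction rule: rtranclp_induct)
    case (step b c)
    then obtain i where i: "i \<in> {1..n}" "eop ?P i b = Some c \<or> fop ?P i b = Some c" and b: "b \<in> carr ?P" by blast
    have i0: "i \<in> {0..n}" using i by auto
    show ?case using i(2) cl[OF i(1)] regular_e(1)[OF P i0 b] regular_f(1,2)[OF P i0 b] step.IH b by metis
  qed (use that in auto)
  define h' where "h' = restrict h (carr ?P)"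
  have h': "is_local_coenergy n B C h'"
    unfolding is_local_coenergy_def Let_def
  proof (intro conjI ballI allI impI)
    show "h' (uvec ?P) = 0" using u regular_uvec[OF P] by (simp add: h'_def del: carr_tensor)
    show "h' p = h' q" if "p \<in> carr ?P" "q \<in> carr ?P" "same_component {1..n} ?P p q" for p q
      using comp[OF that(3,1)] that by (simp add: h'_def del: carr_tensor)
    show "int (h' p') - int (h' p) = (if e0_left B C p \<and> e0_left C B (comb_R n B C p) then 1
        else if \<not> e0_left B C p \<and> \<not> e0_left C B (comb_R n B C p) then -1 else 0)"
      if "p \<in> carr ?P" "eop ?P 0 p = Some p'" for p p'
      using st[OF that] regular_e(1)[OF P _ that] that by (simp add: h'_def coenergy_step_def del: carr_tensor)
  qed (simp add: h'_def)
  have uniq: "H q = H' q" if H: "is_local_coenergy n B C H" "is_local_coenergy n B C H'" and q: "q \<in> carr ?P" for H H' q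
  proof -
    have "epath {0..n} ?P q (uvec ?P)" using r q unfolding rises_def by blast
    then show ?thesis using q
    proof (induction rule: epath_induct)
      case refl
      then show ?case using H unfolding is_local_coenergy_def by simp
    next
      case (step i q q')
      note e = regular_e[OF P step.hyps(1) step.prems step.hyps(2)]
      show ?case
      proof (cases "i = 0")
        case True
        then have "int (H q') - int (H q) = int (H' q') - int (H' q)"
          using H e(1) step.hyps(2) step.prems unfolding is_local_coenergy_def Let_def by metis
        then show ?thesis using step.IH[OF e(1)] by simp
      next
        case False
        then have "same_component {1..n} ?P q q'"
          unfolding same_component_def using step.hyps(1,2) by (intro r_into_rtranclp bexI[of _ i]) auto
        then show ?thesis using H e(1) step.prems step.IH[OF e(1)] unfolding is_local_coenergy_def by metis
      qed
    qed
  qed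
  have "local_coenergy n B C = h'"
    unfolding local_coenergy_def
  proof (rule the_equality, rule h')
    fix H assume H: "is_local_coenergy n B C H"
    then show "H = h'" using uniq[OF H h'] h' unfolding is_local_coenergy_def
      by (intro extensionalityI[of H "carr ?P"]) auto
  qed
  then show ?thesis using p by (simp add: h'_def del: carr_tensor)
qed

section \<open>Passing one factor through the others\<close>

text \<open>The two hits separate additively: one term sees only the pair, the other only its image.
  This lets the costs of several crossings telescope.\<close>

lemma coenergy_step_alt: "coenergy_step l r = (if l then 1 else 0) - (if r then 0 else 1)"
  by (simp add: coenergy_step_def)

text \<open>\<open>coenergy_ex\<close> claims only some function with the right differences; that it
  is \<open>local_coenergy\<close> follows from uniqueness.\<close>

locale KR_family =
  fixes X :: affine_type and n :: nat
  assumes reg: "regular {0..n} (KR X n s)"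
    and conn2: "rises {0..n} (KR X n s \<otimes>\<^sub>c KR X n t)"
    and conn3: "rises {0..n} (KR X n r \<otimes>\<^sub>c (KR X n s \<otimes>\<^sub>c KR X n t))"
    and rigid: "u_rigid {0..n} (KR X n s \<otimes>\<^sub>c KR X n t) (KR X n t \<otimes>\<^sub>c KR X n s)"
    and iso_ex: "\<exists>g. crystal_iso {0..n} (KR X n s \<otimes>\<^sub>c KR X n t) (KR X n t \<otimes>\<^sub>c KR X n s) g"
    and coenergy_ex: "\<exists>h :: row \<times> row \<Rightarrow> nat. h (uvec (KR X n s \<otimes>\<^sub>c KR X n t)) = 0 \<and>
      (\<forall>i\<in>{1..n}. \<forall>p\<in>carr (KR X n s \<otimes>\<^sub>c KR X n t). \<forall>p'. eop (KR X n s \<otimes>\<^sub>c KR X n t) i p = Some p' \<longrightarrow> h p' = h p) \<and>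
      (\<forall>p\<in>carr (KR X n s \<otimes>\<^sub>c KR X n t). \<forall>p'. eop (KR X n s \<otimes>\<^sub>c KR X n t) 0 p = Some p' \<longrightarrow> int (h p') - int (h p) =
        coenergy_step (e0_left (KR X n s) (KR X n t) p)
          (e0_left (KR X n t) (KR X n s) (comb_R n (KR X n s) (KR X n t) p)))"
begin

abbreviation K :: "nat \<Rightarrow> row crystal" where "K \<equiv> KR X n"
abbreviation R :: "nat \<Rightarrow> nat \<Rightarrow> row \<times> row \<Rightarrow> row \<times> row" where "R s t \<equiv> comb_R n (K s) (K t)"
abbreviation H :: "nat \<Rightarrow> nat \<Rightarrow> row \<times> row \<Rightarrow> nat" where "H s t \<equiv> local_coenergy n (K s) (K t)"

lemma reg2: "regular {0..n} (K s \<otimes>\<^sub>c K t)"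
  by (rule regular_tensor[OF reg reg])

lemma reg3: "regular {0..n} (K r \<otimes>\<^sub>c (K s \<otimes>\<^sub>c K t))"
  by (rule regular_tensor[OF reg reg2])

lemma R_iso: "crystal_iso {0..n} (K s \<otimes>\<^sub>c K t) (K t \<otimes>\<^sub>c K s) (R s t)"
  using iso_ex[of s t] comb_R_iso(1)[OF reg reg conn2 rigid] by blast

lemma R_carr: "x \<in> carr (K s) \<Longrightarrow> y \<in> carr (K t) \<Longrightarrow> R s t (x, y) = (y', x') \<Longrightarrow> y' \<in> carr (K t) \<and> x' \<in> carr (K s)"
  using R_iso[of s t] unfolding crystal_iso_def crystal_morphism_def
  by (metis PiE carr_tensor mem_Sigma_iff)

lemma R_e: "i \<le> n \<Longrightarrow> p \<in> carr (K s \<otimes>\<^sub>c K t) \<Longrightarrow> eop (K t \<otimes>\<^sub>c K s) i (R s t p) = map_option (R s t) (eop (K s \<otimes>\<^sub>c K t) i p)"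
  and R_f: "i \<le> n \<Longrightarrow> p \<in> carr (K s \<otimes>\<^sub>c K t) \<Longrightarrow> fop (K t \<otimes>\<^sub>c K s) i (R s t p) = map_option (R s t) (fop (K s \<otimes>\<^sub>c K t) i p)"
  using R_iso[of s t] unfolding crystal_iso_def crystal_morphism_def by auto

lemma R_eps: "i \<le> n \<Longrightarrow> p \<in> carr (K s \<otimes>\<^sub>c K t) \<Longrightarrow> eps (K t \<otimes>\<^sub>c K s) i (R s t p) = eps (K s \<otimes>\<^sub>c K t) i p"
  and R_phi: "i \<le> n \<Longrightarrow> p \<in> carr (K s \<otimes>\<^sub>c K t) \<Longrightarrow> phi (K t \<otimes>\<^sub>c K s) i (R s t p) = phi (K s \<otimes>\<^sub>c K t) i p"
  using iso_eps[OF R_iso reg2] by auto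

lemma R_inj: "inj_on (R s t) (carr (K s) \<times> carr (K t))"
  using R_iso[of s t] unfolding crystal_iso_def bij_betw_def by simp

lemma R_u: "R s t (uvec (K s), uvec (K t)) = (uvec (K t), uvec (K s))"
  using iso_u[OF R_iso reg2 rigid, of s t] by simp

lemma u_carr: "uvec (K s) \<in> carr (K s)"
  by (rule regular_uvec[OF reg])

text \<open>The composite fixes \<open>uvec\<close>, and lowering a fixed vector gives a fixed
  vector.\<close>

lemma R_R:
  assumes "x \<in> carr (K s)" "y \<in> carr (K t)"
  shows "R t s (R s t (x, y)) = (x, y)"
proof -
  have "crystal_iso {0..n} (K s \<otimes>\<^sub>c K t) (K s \<otimes>\<^sub>c K t) (R t s \<circ> R s t)"
    unfolding crystal_iso_def
  proof (intro conjI)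
    show "bij_betw (R t s \<circ> R s t) (carr (K s \<otimes>\<^sub>c K t)) (carr (K s \<otimes>\<^sub>c K t))"
      using R_iso[of s t] R_iso[of t s] bij_betw_trans unfolding crystal_iso_def by blast
    have c: "R s t p \<in> carr (K t \<otimes>\<^sub>c K s)" if "p \<in> carr (K s \<otimes>\<^sub>c K t)" for p
      using R_iso[of s t] that unfolding crystal_iso_def crystal_morphism_def by blast
    have c': "R t s p \<in> carr (K s \<otimes>\<^sub>c K t)" if "p \<in> carr (K t \<otimes>\<^sub>c K s)" for p
      using R_iso[of t s] that unfolding crystal_iso_def crystal_morphism_def by blast
    show "crystal_morphism {0..n} (K s \<otimes>\<^sub>c K t) (K s \<otimes>\<^sub>c K t) (R t s \<circ> R s t)"
      unfolding crystal_morphism_def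
    proof (intro conjI ballI)
      show "R t s \<circ> R s t \<in> carr (K s \<otimes>\<^sub>c K t) \<rightarrow> carr (K s \<otimes>\<^sub>c K t)" using c c' by auto
      fix i p assume ip: "i \<in> {0..n}" "p \<in> carr (K s \<otimes>\<^sub>c K t)"
      show "eop (K s \<otimes>\<^sub>c K t) i ((R t s \<circ> R s t) p) = map_option (R t s \<circ> R s t) (eop (K s \<otimes>\<^sub>c K t) i p)"
        using ip R_e[of i p s t] R_e[of i "R s t p" t s] c[OF ip(2)] by (simp add: option.map_comp del: carr_tensor)
      show "fop (K s \<otimes>\<^sub>c K t) i ((R t s \<circ> R s t) p) = map_option (R t s \<circ> R s t) (fop (K s \<otimes>\<^sub>c K t) i p)"
        using ip R_f[of i p s t] R_f[of i "R s t p" t s] c[OF ip(2)] by (simp add: option.map_comp del: carr_tensor)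
    qed
  qed
  moreover have "crystal_iso {0..n} (K s \<otimes>\<^sub>c K t) (K s \<otimes>\<^sub>c K t) id"
    by (simp add: crystal_iso_def crystal_morphism_def option.map_id)
  moreover have "epath {0..n} (K s \<otimes>\<^sub>c K t) (x, y) (uvec (K s \<otimes>\<^sub>c K t))"
    using conn2[of s t] assms unfolding rises_def by simp
  then have "(R t s \<circ> R s t) p = id p" if "p = (x, y)" for p
    unfolding that
  proof -
    have st: "P p" if "epath {0..n} (K s \<otimes>\<^sub>c K t) p (uvec (K s \<otimes>\<^sub>c K t))" "p \<in> carr (K s \<otimes>\<^sub>c K t)"
      "P = (\<lambda>p. R t s (R s t p) = p)" for p P
      using that(1,2)
    proof (induction rule: epath_induct)
      case refl
      then show ?case by (simp add: that(3) R_u)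
    next
      case (step i p p')
      note e = regular_e[OF reg2 step.hyps(1) step.prems step.hyps(2)]
      let ?S = "R t s \<circ> R s t"
      have "eop (K s \<otimes>\<^sub>c K t) i (?S p) = Some (?S p')" and c: "?S p \<in> carr (K s \<otimes>\<^sub>c K t)"
        using \<open>crystal_iso {0..n} (K s \<otimes>\<^sub>c K t) (K s \<otimes>\<^sub>c K t) (R t s \<circ> R s t)\<close> step.hyps(1,2) step.prems
        unfolding crystal_iso_def crystal_morphism_def by (auto simp del: carr_tensor)
      then have "fop (K s \<otimes>\<^sub>c K t) i p' = Some (?S p)"
        using regular_e(2)[OF reg2 step.hyps(1) c] step.IH[OF e(1)] that(3) by simp
      then show ?case using e(2) that(3) by simp
    qed
    show "(R t s \<circ> R s t) (x, y) = id (x, y)"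
      using st[OF \<open>epath _ _ _ _\<close>] assms by simp
  qed
  ultimately show ?thesis by simp
qed

lemma H_props:
  shows H_u: "H s t (uvec (K s), uvec (K t)) = 0"
    and H_e: "\<And>i p p'. 1 \<le> i \<Longrightarrow> i \<le> n \<Longrightarrow> p \<in> carr (K s \<otimes>\<^sub>c K t) \<Longrightarrow> eop (K s \<otimes>\<^sub>c K t) i p = Some p' \<Longrightarrow> H s t p' = H s t p"
    and H_e0: "\<And>p p'. p \<in> carr (K s \<otimes>\<^sub>c K t) \<Longrightarrow> eop (K s \<otimes>\<^sub>c K t) 0 p = Some p' \<Longrightarrow>
      int (H s t p') - int (H s t p) = coenergy_step (e0_left (K s) (K t) p) (e0_left (K t) (K s) (R s t p))"
proof -
  obtain h :: "row \<times> row \<Rightarrow> nat" where h: "h (uvec (K s \<otimes>\<^sub>c K t)) = 0"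
    "\<And>i p p'. i \<in> {1..n} \<Longrightarrow> p \<in> carr (K s \<otimes>\<^sub>c K t) \<Longrightarrow> eop (K s \<otimes>\<^sub>c K t) i p = Some p' \<Longrightarrow> h p' = h p"
    "\<And>p p'. p \<in> carr (K s \<otimes>\<^sub>c K t) \<Longrightarrow> eop (K s \<otimes>\<^sub>c K t) 0 p = Some p' \<Longrightarrow> int (h p') - int (h p) =
        coenergy_step (e0_left (K s) (K t) p) (e0_left (K t) (K s) (R s t p))"
    using coenergy_ex[of s t] by metis
  have eq: "H s t p = h p" if "p \<in> carr (K s \<otimes>\<^sub>c K t)" for p
    by (rule local_coenergy_eq[where h = h, OF reg reg conn2 h(2) h(1) h(3) that])
  show "H s t (uvec (K s), uvec (K t)) = 0"
    using eq[of "uvec (K s \<otimes>\<^sub>c K t)"] h(1) u_carr by simp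
  show "H s t p' = H s t p" if i: "1 \<le> i" "i \<le> n" and p: "p \<in> carr (K s \<otimes>\<^sub>c K t)" "eop (K s \<otimes>\<^sub>c K t) i p = Some p'" for i p p'
    using eq[OF p(1)] eq[OF regular_e(1)[OF reg2 _ p]] h(2)[of i, OF _ p] i by simp
  show "int (H s t p') - int (H s t p) = coenergy_step (e0_left (K s) (K t) p) (e0_left (K t) (K s) (R s t p))"
    if p: "p \<in> carr (K s \<otimes>\<^sub>c K t)" "eop (K s \<otimes>\<^sub>c K t) 0 p = Some p'" for p p'
    using eq[OF p(1)] eq[OF regular_e(1)[OF reg2 _ p]] h(3)[OF p] by simp
qed

text \<open>\<open>coenergy_step\<close> is symmetric in its two arguments, and by
  \<open>R_R\<close> the pair and its image just exchange roles.\<close>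

lemma H_R:
  assumes "x \<in> carr (K s)" "y \<in> carr (K t)"
  shows "H t s (R s t (x, y)) = H s t (x, y)"
proof -
  have "epath {0..n} (K s \<otimes>\<^sub>c K t) (x, y) (uvec (K s \<otimes>\<^sub>c K t))"
    using conn2[of s t] assms unfolding rises_def by simp
  moreover have "(x, y) \<in> carr (K s \<otimes>\<^sub>c K t)" using assms by simp
  ultimately show ?thesis
  proof (induction rule: epath_induct)
    case refl
    then show ?case by (simp add: R_u H_u)
  next
    case (step i p p')
    have c: "R s t p \<in> carr (K t \<otimes>\<^sub>c K s)"
      using R_iso[of s t] step.prems unfolding crystal_iso_def crystal_morphism_def by blast
    have R': "eop (K t \<otimes>\<^sub>c K s) i (R s t p) = Some (R s t p')" using R_e[of i p s t] step.hyps(1,2) step.prems by simp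
    note e = regular_e[OF reg2 step.hyps(1) step.prems step.hyps(2)]
    have RR: "R t s (R s t p) = p" using R_R step.prems by (cases p) simp
    show ?case
    proof (cases "i = 0")
      case True
      then show ?thesis using H_e0[OF step.prems] H_e0[OF c] R' step.hyps(2) step.IH[OF e(1)]
        by (simp add: RR coenergy_step_def split: if_splits)
    next
      case False
      then show ?thesis using H_e[OF _ _ step.prems, of i] H_e[OF _ _ c, of i] R' step.hyps(1,2) step.IH[OF e(1)] by simp
    qed
  qed
qed

end

lemma morphism_comp:
  assumes "crystal_morphism I A B f" "crystal_morphism I B C g"
  shows "crystal_morphism I A C (g \<circ> f)"
  using assms unfolding crystal_morphism_def by (auto simp: Pi_iff option.map_comp)

lemma morphism_id_tensor:
  assumes g: "crystal_morphism I A A' g" and R: "regular I A"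
  shows "crystal_morphism I (A \<otimes>\<^sub>c B) (A' \<otimes>\<^sub>c B) (\<lambda>(a, b). (g a, b))"
proof -
  have "eop (A' \<otimes>\<^sub>c B) i (g a, b) = map_option (\<lambda>(a, b). (g a, b)) (eop (A \<otimes>\<^sub>c B) i (a, b))"
    "fop (A' \<otimes>\<^sub>c B) i (g a, b) = map_option (\<lambda>(a, b). (g a, b)) (fop (A \<otimes>\<^sub>c B) i (a, b))"
    if "i \<in> I" "a \<in> carr A" for i a b
    using g that morphism_eps[OF g R that]
    by (simp_all add: crystal_morphism_def eop_tensor fop_tensor option.map_comp comp_def)
  then show ?thesis using g by (auto simp: crystal_morphism_def)
qed

lemma morphism_assoc:
  assumes "regular I A" "regular I B" "regular I C"
  shows "crystal_morphism I (A \<otimes>\<^sub>c (B \<otimes>\<^sub>c C)) ((A \<otimes>\<^sub>c B) \<otimes>\<^sub>c C) (\<lambda>(a, (b, c)). ((a, b), c))"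
    and "crystal_morphism I ((A \<otimes>\<^sub>c B) \<otimes>\<^sub>c C) (A \<otimes>\<^sub>c (B \<otimes>\<^sub>c C)) (\<lambda>((a, b), c). (a, (b, c)))"
proof -
  have 1: "map_option (\<lambda>(a, (b, c)). ((a, b), c)) (map_option (\<lambda>((x, y), z). (x, (y, z))) v) = v" for v :: "(('a \<times> 'b) \<times> 'c) option"
    by (cases v) auto
  show "crystal_morphism I (A \<otimes>\<^sub>c (B \<otimes>\<^sub>c C)) ((A \<otimes>\<^sub>c B) \<otimes>\<^sub>c C) (\<lambda>(a, (b, c)). ((a, b), c))"
    unfolding crystal_morphism_def using eop_assoc[OF assms] fop_assoc[OF assms] 1 by auto
  show "crystal_morphism I ((A \<otimes>\<^sub>c B) \<otimes>\<^sub>c C) (A \<otimes>\<^sub>c (B \<otimes>\<^sub>c C)) (\<lambda>((a, b), c). (a, (b, c)))"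
    unfolding crystal_morphism_def using eop_assoc[OF assms] fop_assoc[OF assms] by auto
qed

section \<open>The Yang-Baxter argument: one row crossing two others\<close>

context KR_family
begin

definition pass2 :: "nat \<Rightarrow> nat \<Rightarrow> nat \<Rightarrow> row \<times> row \<times> row \<Rightarrow> row \<times> row \<times> row" where
  "pass2 r s t = (\<lambda>(w, x, y). case R r s (w, x) of (x', w') \<Rightarrow> case R r t (w', y) of (y', w'') \<Rightarrow> (x', y', w''))"

definition cost2 :: "nat \<Rightarrow> nat \<Rightarrow> nat \<Rightarrow> row \<times> row \<times> row \<Rightarrow> nat" where
  "cost2 r s t = (\<lambda>(w, x, y). H r s (w, x) + (case R r s (w, x) of (x', w') \<Rightarrow> H r t (w', y)))"

definition pass1 :: "nat \<Rightarrow> nat \<Rightarrow> nat \<Rightarrow> row \<times> row \<times> row \<Rightarrow> row \<times> row \<times> row" where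
  "pass1 r s t = (\<lambda>(w, x, y). case R r s (w, x) of (x', w') \<Rightarrow> (x', w', y))"

lemma R_morphism: "crystal_morphism {0..n} (K s \<otimes>\<^sub>c K t) (K t \<otimes>\<^sub>c K s) (R s t)"
  using R_iso unfolding crystal_iso_def by blast

lemma pass1_morphism: "crystal_morphism {0..n} (K r \<otimes>\<^sub>c (K s \<otimes>\<^sub>c K t)) (K s \<otimes>\<^sub>c (K r \<otimes>\<^sub>c K t)) (pass1 r s t)"
proof -
  have "pass1 r s t = (\<lambda>((a, b), c). (a, (b, c))) \<circ> ((\<lambda>(p, c). (R r s p, c)) \<circ> (\<lambda>(a, (b, c)). ((a, b), c)))"
    by (rule ext) (auto simp: pass1_def split: prod.splits)
  then show ?thesis
    using morphism_comp[OF morphism_comp[OF morphism_assoc(1)[OF reg reg reg] morphism_id_tensor[OF R_morphism reg2]]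
      morphism_assoc(2)[OF reg reg reg], of r s t] by simp
qed

lemma pass2_morphism: "crystal_morphism {0..n} (K r \<otimes>\<^sub>c (K s \<otimes>\<^sub>c K t)) (K s \<otimes>\<^sub>c (K t \<otimes>\<^sub>c K r)) (pass2 r s t)"
proof -
  have "pass2 r s t = (\<lambda>(a, p). (a, R r t p)) \<circ> pass1 r s t"
    by (rule ext) (auto simp: pass1_def pass2_def split: prod.splits)
  then show ?thesis
    using morphism_comp[OF pass1_morphism morphism_tensor_id[OF R_morphism reg2], of r s t] by simp
qed

text \<open>The right side is \<open>coenergy_step\<close> for the crossing of \<open>w\<close> with
  \<open>x \<otimes> y\<close> taken as one factor. If the arrow hits the intermediate row
  \<open>w'\<close>, the first crossing loses 1 and the second gains 1, and these cancel.\<close>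

lemma cost2_e0:
  assumes c: "w \<in> carr (K r)" "x \<in> carr (K s)" "y \<in> carr (K t)"
    and e: "eop (K r \<otimes>\<^sub>c (K s \<otimes>\<^sub>c K t)) 0 (w, x, y) = Some p2" and ps: "pass2 r s t (w, x, y) = (x', y', w'')"
  shows "int (cost2 r s t p2) - int (cost2 r s t (w, x, y)) =
    (if eps (K r) 0 w > phi (K s \<otimes>\<^sub>c K t) 0 (x, y) then 1 else 0) -
    (if eps (K s \<otimes>\<^sub>c K t) 0 (x', y') > phi (K r) 0 w'' then 0 else 1)"
proof -
  obtain w' where w': "R r s (w, x) = (x', w')" "R r t (w', y) = (y', w'')"
    using ps by (auto simp: pass2_def split: prod.splits)
  have c': "x' \<in> carr (K s)" "w' \<in> carr (K r)" using R_carr[OF c(1,2) w'(1)] by auto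
  have c'': "y' \<in> carr (K t)" "w'' \<in> carr (K r)" using R_carr[OF c'(2) c(3) w'(2)] by auto
  note [simp] = eps_tensor[OF reg reg] phi_tensor[OF reg reg] c c' c''
  have q: "(w, x) \<in> carr (K r \<otimes>\<^sub>c K s)" "(w', y) \<in> carr (K r \<otimes>\<^sub>c K t)" by simp_all
  note n1 = R_eps[OF _ q(1), of 0] R_phi[OF _ q(1), of 0] R_eps[OF _ q(2), of 0] R_phi[OF _ q(2), of 0]
  note nums = n1[simplified w', simplified]
  show ?thesis
  \<comment> \<open>In the intermediate product of \<open>x'\<close>, \<open>w'\<close> and
    \<open>y\<close> the arrow hits exactly one of the three rows, which gives the three cases
    below.\<close>
  proof (cases "eps (K r \<otimes>\<^sub>c K s) 0 (w, x) > phi (K t) 0 y")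
    case A: True
    then obtain w2 x2 where wx2: "eop (K r \<otimes>\<^sub>c K s) 0 (w, x) = Some (w2, x2)"
      using regular_e_ex[OF reg2, of 0 "(w, x)"] by force
    have p2: "p2 = (w2, x2, y)"
      using e eop_assoc[OF reg reg reg _ c, of 0] A wx2 by (simp add: eop_tensor[of "K r \<otimes>\<^sub>c K s"] del: eps_tensor)
    have R2: "eop (K s \<otimes>\<^sub>c K r) 0 (x', w') = Some (R r s (w2, x2))"
      using R_e[OF _ q(1), of 0] wx2 w' by simp
    have H1: "int (H r s (w2, x2)) - int (H r s (w, x)) = coenergy_step (eps (K r) 0 w > phi (K s) 0 x) (eps (K s) 0 x' > phi (K r) 0 w')"
      using H_e0[OF q(1) wx2] by (simp add: e0_left_def w')
    show ?thesis
    proof (cases "eps (K s) 0 x' > phi (K r) 0 w'")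
      case True
      then obtain x2' where x2': "R r s (w2, x2) = (x2', w')" using R2 True by (cases "R r s (w2, x2)") (auto simp: eop_tensor)
      then have "int (cost2 r s t p2) - int (cost2 r s t (w, x, y)) = (if eps (K r) 0 w > phi (K s) 0 x then 1 else 0)"
        using H1 True by (simp add: cost2_def p2 w' coenergy_step_def)
      moreover have "phi (K r) 0 w' + (phi (K t) 0 y - eps (K r) 0 w') < eps (K s) 0 x'"
        using A True nums(1) by simp
      then have "eps (K s \<otimes>\<^sub>c K t) 0 (x', y') > phi (K r) 0 w''" using nums(4) by simp
      moreover have "eps (K r) 0 w > phi (K s \<otimes>\<^sub>c K t) 0 (x, y) \<longleftrightarrow> eps (K r) 0 w > phi (K s) 0 x"
        using A by simp linarith
      ultimately show ?thesis by simp
    next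
      case False
      then obtain w2' where w2': "R r s (w2, x2) = (x', w2')" "eop (K r) 0 w' = Some w2'" using R2 False by (cases "R r s (w2, x2)") (auto simp: eop_tensor)
      have "eps (K r) 0 w' > phi (K t) 0 y" using A False nums by simp
      then have "eop (K r \<otimes>\<^sub>c K t) 0 (w', y) = Some (w2', y)" using w2' by (simp add: eop_tensor)
      then have H2: "int (H r t (w2', y)) - int (H r t (w', y)) = coenergy_step True (eps (K t) 0 y' > phi (K r) 0 w'')"
        using H_e0[OF q(2)] \<open>eps (K r) 0 w' > phi (K t) 0 y\<close> by (simp add: e0_left_def w')
      have "int (cost2 r s t p2) - int (cost2 r s t (w, x, y)) =
          (if eps (K r) 0 w > phi (K s) 0 x then 1 else 0) - (if eps (K t) 0 y' > phi (K r) 0 w'' then 0 else 1)"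
        using H1 H2 False by (simp add: cost2_def p2 w' w2'(1) coenergy_step_def split: if_splits)
      moreover have "phi (K r) 0 w' + (phi (K t) 0 y - eps (K r) 0 w') \<ge> eps (K s) 0 x'"
        using False by simp
      then have "eps (K s \<otimes>\<^sub>c K t) 0 (x', y') > phi (K r) 0 w'' \<longleftrightarrow> eps (K t) 0 y' > phi (K r) 0 w''" using nums(4) by simp linarith
      moreover have "eps (K r) 0 w > phi (K s \<otimes>\<^sub>c K t) 0 (x, y) \<longleftrightarrow> eps (K r) 0 w > phi (K s) 0 x"
        using A by simp linarith
      ultimately show ?thesis by simp
    qed
  next
    case B: False
    then obtain y2 where p2: "p2 = (w, x, y2)" "eop (K t) 0 y = Some y2"
      using e eop_assoc[OF reg reg reg _ c, of 0] by (auto simp: eop_tensor[of "K r \<otimes>\<^sub>c K s"])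
    have "eps (K r) 0 w' \<le> phi (K t) 0 y" using B nums by simp
    then have "eop (K r \<otimes>\<^sub>c K t) 0 (w', y) = Some (w', y2)" using p2(2) by (simp add: eop_tensor)
    then have H2: "int (H r t (w', y2)) - int (H r t (w', y)) = coenergy_step False (eps (K t) 0 y' > phi (K r) 0 w'')"
      using H_e0[OF q(2)] \<open>eps (K r) 0 w' \<le> phi (K t) 0 y\<close> by (simp add: e0_left_def w')
    have "int (cost2 r s t p2) - int (cost2 r s t (w, x, y)) = - (if eps (K t) 0 y' > phi (K r) 0 w'' then 0 else 1)"
      using H2 by (simp add: cost2_def p2 w' coenergy_step_def split: if_splits)
    moreover have "phi (K r) 0 w' + (phi (K t) 0 y - eps (K r) 0 w') \<ge> eps (K s) 0 x'"
      using B nums(1) by simp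
    then have "eps (K s \<otimes>\<^sub>c K t) 0 (x', y') > phi (K r) 0 w'' \<longleftrightarrow> eps (K t) 0 y' > phi (K r) 0 w''" using nums(4) by simp linarith
    moreover have "\<not> eps (K r) 0 w > phi (K s \<otimes>\<^sub>c K t) 0 (x, y)"
      using B by simp
    ultimately show ?thesis by simp
  qed
qed

lemma cost2_e:
  assumes i: "1 \<le> i" "i \<le> n" and c: "w \<in> carr (K r)" "x \<in> carr (K s)" "y \<in> carr (K t)"
    and e: "eop (K r \<otimes>\<^sub>c (K s \<otimes>\<^sub>c K t)) i (w, x, y) = Some p2"
  shows "cost2 r s t p2 = cost2 r s t (w, x, y)"
proof -
  obtain x' w' where w': "R r s (w, x) = (x', w')" by fastforce
  have c': "x' \<in> carr (K s)" "w' \<in> carr (K r)" using R_carr[OF c(1,2) w'(1)] by auto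
  have q: "(w, x) \<in> carr (K r \<otimes>\<^sub>c K s)" "(w', y) \<in> carr (K r \<otimes>\<^sub>c K t)" using c c' by simp_all
  have in_: "i \<in> {0..n}" using i by simp
  have w3: "(w, x, y) \<in> carr (K r \<otimes>\<^sub>c (K s \<otimes>\<^sub>c K t))" using c by simp
  obtain w2 x2 y2 where p2: "p2 = (w2, x2, y2)" by (cases p2) auto
  obtain x2' w2' where R2: "R r s (w2, x2) = (x2', w2')" by fastforce
  have "eop (K s \<otimes>\<^sub>c (K r \<otimes>\<^sub>c K t)) i (pass1 r s t (w, x, y)) = Some (pass1 r s t p2)"
    using pass1_morphism[of r s t] e w3 in_ unfolding crystal_morphism_def by (simp del: carr_tensor)
  then have "eop (K s \<otimes>\<^sub>c (K r \<otimes>\<^sub>c K t)) i (x', w', y) = Some (x2', w2', y2)"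
    by (simp add: pass1_def w' p2 R2)
  then have H2: "H r t (w2', y2) = H r t (w', y)"
    using H_e[OF i q(2)] by (auto simp: eop_tensor[of "K s"] split: if_splits)
  have "eop ((K r \<otimes>\<^sub>c K s) \<otimes>\<^sub>c K t) i ((w, x), y) = Some ((w2, x2), y2)"
    using e eop_assoc[OF reg reg reg in_ c] by (auto simp: p2)
  then have "H r s (w2, x2) = H r s (w, x)"
    using H_e[OF i q(1)] by (auto simp: eop_tensor[of "K r \<otimes>\<^sub>c K s"] split: if_splits)
  then show ?thesis using H2 by (simp add: cost2_def p2 w' R2)
qed

text \<open>
  Under \<open>e\<^sub>0\<close> the cost grows by 1 if \<open>w\<close> is hit on the left and drops by 1 if it is hit on the right.
  Both conditions only involve the crystals \<open>x \<otimes> y\<close> and \<open>x' \<otimes> y'\<close> up to isomorphism.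
\<close>

lemma pass2_R:
  assumes c: "w \<in> carr (K r)" "x \<in> carr (K s)" "y \<in> carr (K t)"
    and ps: "pass2 r s t (w, x, y) = (x', y', w'')" and R: "R s t (x, y) = (y1, x1)"
  shows "cost2 r t s (w, y1, x1) = cost2 r s t (w, x, y)"
    and "\<exists>y2 x2. R s t (x', y') = (y2, x2) \<and> pass2 r t s (w, y1, x1) = (y2, x2, w'')"
proof -
  let ?T = "K r \<otimes>\<^sub>c (K s \<otimes>\<^sub>c K t)" and ?T' = "K r \<otimes>\<^sub>c (K t \<otimes>\<^sub>c K s)"
  let ?U = "K s \<otimes>\<^sub>c (K t \<otimes>\<^sub>c K r)" and ?V = "K t \<otimes>\<^sub>c (K s \<otimes>\<^sub>c K r)"
  let ?g = "\<lambda>(w, p). (w, R s t p)"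
  have g: "crystal_morphism {0..n} ?T ?T' ?g" by (rule morphism_tensor_id[OF R_morphism reg2])
  have a: "crystal_morphism {0..n} ?T ?V (pass2 r t s \<circ> ?g)" by (rule morphism_comp[OF g pass2_morphism])
  have b: "crystal_morphism {0..n} ?T ?V (pass1 s t r \<circ> pass2 r s t)" by (rule morphism_comp[OF pass2_morphism pass1_morphism])
  define P where "P p \<longleftrightarrow> cost2 r t s (?g p) = cost2 r s t p \<and> pass2 r t s (?g p) = pass1 s t r (pass2 r s t p)" for p
  have "epath {0..n} ?T (w, x, y) (uvec ?T)" "(w, x, y) \<in> carr ?T" using conn3[of r s t] c unfolding rises_def by simp_all
  then have "P (w, x, y)"
  proof (induction rule: epath_induct)
    case refl
    then show ?case by (simp add: P_def cost2_def pass2_def pass1_def R_u H_u)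
  next
    case (step i p p')
    note e = regular_e[OF reg3 step.hyps(1) step.prems step.hyps(2)]
    note IH = step.IH[OF e(1), unfolded P_def]
    have ea: "eop ?V i (pass2 r t s (?g p)) = Some (pass2 r t s (?g p'))" and ca: "pass2 r t s (?g p) \<in> carr ?V"
      using a step.hyps(1,2) step.prems unfolding crystal_morphism_def by (auto simp del: carr_tensor)
    have eb: "eop ?V i (pass1 s t r (pass2 r s t p)) = Some (pass1 s t r (pass2 r s t p'))"
      and cb: "pass1 s t r (pass2 r s t p) \<in> carr ?V"
      using b step.hyps(1,2) step.prems unfolding crystal_morphism_def by (auto simp del: carr_tensor)
    \<comment> \<open>The induction hypothesis concerns \<open>p'\<close>. Both sides at
      \<open>p\<close> raise to the same vector and are recovered from it by lowering.\<close>
    have ps: "pass2 r t s (?g p) = pass1 s t r (pass2 r s t p)"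
      using regular_e(2)[OF reg3 step.hyps(1) ca ea] regular_e(2)[OF reg3 step.hyps(1) cb eb] IH by simp
    have eg: "eop ?T' i (?g p) = Some (?g p')" and cg: "?g p \<in> carr ?T'"
      using g step.hyps(1,2) step.prems unfolding crystal_morphism_def by (auto simp del: carr_tensor)
    obtain w x y where p: "p = (w, x, y)" by (cases p) auto
    obtain y1 x1 where xy1: "R s t (x, y) = (y1, x1)" by fastforce
    have c: "w \<in> carr (K r)" "x \<in> carr (K s)" "y \<in> carr (K t)" using step.prems p by auto
    have c1: "y1 \<in> carr (K t)" "x1 \<in> carr (K s)" using R_carr[OF c(2,3) xy1] by auto
    have gp: "?g p = (w, y1, x1)" by (simp add: p xy1)
    have "cost2 r t s (?g p) = cost2 r s t p"
    proof (cases "i = 0")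
      case False
      then show ?thesis
        using cost2_e[of i, OF _ _ c] cost2_e[of i, OF _ _ c(1) c1] step.hyps(1,2) eg IH by (simp add: p xy1)
    next
      case True
      obtain x' y' w'' where xyw: "pass2 r s t (w, x, y) = (x', y', w'')" by (metis prod_cases3)
      obtain y2 x2 where xy2: "R s t (x', y') = (y2, x2)" by fastforce
      have ps2: "pass2 r t s (w, y1, x1) = (y2, x2, w'')"
        using ps unfolding gp by (simp add: p xyw pass1_def xy2)
      have "pass2 r s t p \<in> carr ?U" using pass2_morphism[of r s t] step.prems unfolding crystal_morphism_def by (auto simp del: carr_tensor)
      then have c2: "(x', y') \<in> carr (K s \<otimes>\<^sub>c K t)" "(x, y) \<in> carr (K s \<otimes>\<^sub>c K t)" using c by (auto simp: p xyw)
      have "phi (K t \<otimes>\<^sub>c K s) 0 (y1, x1) = phi (K s \<otimes>\<^sub>c K t) 0 (x, y)" using R_phi[OF _ c2(2), of 0] xy1 by simp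
      moreover have "eps (K t \<otimes>\<^sub>c K s) 0 (y2, x2) = eps (K s \<otimes>\<^sub>c K t) 0 (x', y')" using R_eps[OF _ c2(1), of 0] xy2 by simp
      ultimately show ?thesis
        using cost2_e0[OF c step.hyps(2)[unfolded True p] xyw] cost2_e0[OF c(1) c1 eg[unfolded True gp] ps2] IH
        unfolding gp p by (simp add: xy1)
    qed
    then show ?case using ps by (simp add: P_def)
  qed
  then show "cost2 r t s (w, y1, x1) = cost2 r s t (w, x, y)"
    "\<exists>y2 x2. R s t (x', y') = (y2, x2) \<and> pass2 r t s (w, y1, x1) = (y2, x2, w'')"
    by (auto simp: P_def R ps pass1_def split: prod.splits)
qed

end

section \<open>Iterated tensor products\<close>

lemma carr_tensor_list_Nil: "carr (tensor_list []) = {[]}"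
  and carr_tensor_list_Cons: "carr (tensor_list (B # Bs)) = (\<lambda>(x, xs). x # xs) ` (carr B \<times> carr (tensor_list Bs))"
  by (simp_all add: Let_def)

lemma eop_tensor_list_Cons: "eop (tensor_list (B # Bs)) i (x # xs) = map_option (\<lambda>(x, xs). x # xs) (eop (B \<otimes>\<^sub>c tensor_list Bs) i (x, xs))"
  and fop_tensor_list_Cons: "fop (tensor_list (B # Bs)) i (x # xs) = map_option (\<lambda>(x, xs). x # xs) (fop (B \<otimes>\<^sub>c tensor_list Bs) i (x, xs))"
  by (simp_all add: Let_def)

lemma cons_morphism:
  "crystal_morphism I (B \<otimes>\<^sub>c tensor_list Bs) (tensor_list (B # Bs)) (\<lambda>(x, xs). x # xs)"
  unfolding crystal_morphism_def carr_tensor_list_Cons carr_tensor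
  by (auto simp: eop_tensor_list_Cons fop_tensor_list_Cons simp del: tensor_list.simps)

lemma uncons_morphism:
  assumes "regular I B" "regular I (tensor_list Bs)"
  shows "crystal_morphism I (tensor_list (B # Bs)) (B \<otimes>\<^sub>c tensor_list Bs) (\<lambda>xs. (hd xs, tl xs))"
proof -
  have "map_option ((\<lambda>xs. (hd xs, tl xs)) \<circ> (\<lambda>(x, xs). x # xs)) v = v" for v :: "('a \<times> 'a list) option"
    by (cases v) auto
  then show ?thesis
    unfolding crystal_morphism_def carr_tensor_list_Cons carr_tensor
    by (auto simp: eop_tensor_list_Cons fop_tensor_list_Cons option.map_comp simp del: tensor_list.simps)
qed

lemma eps_None: "(\<And>b. eop B i b = None) \<Longrightarrow> eps B i b = 0" and phi_None: "(\<And>b. fop B i b = None) \<Longrightarrow> phi B i b = 0"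
  using string_len_eqI[of b UNIV "eop B i" "\<lambda>_. 0"] string_len_eqI[of b UNIV "fop B i" "\<lambda>_. 0"]
  by (simp_all add: eps_def phi_def)

lemma eps_empty [simp]: "eps \<lparr>carr = c, eop = \<lambda>i b. None, fop = f, uvec = u\<rparr> i b = 0"
  and phi_empty [simp]: "phi \<lparr>carr = c, eop = e, fop = \<lambda>i b. None, uvec = u\<rparr> i b = 0"
  by (rule eps_None phi_None; simp)+

lemma regular_tensor_list: "(\<And>B. B \<in> set Bs \<Longrightarrow> regular I B) \<Longrightarrow> regular I (tensor_list Bs)"
proof (induction Bs)
  case Nil
  show ?case unfolding regular_def by simp
next
  case (Cons B Bs)
  let ?P = "B \<otimes>\<^sub>c tensor_list Bs" and ?Q = "tensor_list (B # Bs)" and ?g = "\<lambda>(x, xs). x # xs"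
  have P: "regular I ?P" using Cons by (intro regular_tensor) auto
  note m = cons_morphism[of I B Bs]
  have c: "carr ?Q = ?g ` carr ?P" unfolding carr_tensor_list_Cons by simp
  have ep: "eps ?Q i (?g p) = eps ?P i p" "phi ?Q i (?g p) = phi ?P i p" if "i \<in> I" "p \<in> carr ?P" for i p
    by (rule morphism_eps[OF m P that])+
  have eo: "eop ?Q i (?g p) = map_option ?g (eop ?P i p)" "fop ?Q i (?g p) = map_option ?g (fop ?P i p)"
    if "i \<in> I" "p \<in> carr ?P" for i p
    using m that unfolding crystal_morphism_def by blast+
  have fin: "finite (carr ?Q)" using regular_finite[OF P] c by simp
  have u: "uvec ?Q \<in> carr ?Q" using regular_uvec[OF P] c by (auto simp: Let_def)
  show ?case unfolding regular_def
  proof (intro conjI ballI allI impI fin u)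
    fix i q assume i: "i \<in> I" and q: "q \<in> carr ?Q"
    obtain p where p: "p \<in> carr ?P" "q = ?g p" using q c by blast
    show "eop ?Q i q = None \<longleftrightarrow> eps ?Q i q = 0" "fop ?Q i q = None \<longleftrightarrow> phi ?Q i q = 0"
      using regular_e_None[OF P i p(1)] regular_f_None[OF P i p(1)] unfolding p(2) eo[OF i p(1)] ep[OF i p(1)] by auto
    fix q'
    show "q' \<in> carr ?Q" "fop ?Q i q' = Some q" "eps ?Q i q = Suc (eps ?Q i q')" "phi ?Q i q' = Suc (phi ?Q i q)"
      if e: "eop ?Q i q = Some q'"
    proof -
      obtain p' where p': "eop ?P i p = Some p'" "q' = ?g p'" using e unfolding p(2) eo[OF i p(1)] by blast
      note r = regular_e[OF P i p(1) p'(1)]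
      show "q' \<in> carr ?Q" using r(1) c p'(2) by blast
      show "fop ?Q i q' = Some q" "eps ?Q i q = Suc (eps ?Q i q')" "phi ?Q i q' = Suc (phi ?Q i q)"
        unfolding p(2) p'(2) eo[OF i r(1)] ep[OF i r(1)] ep[OF i p(1)] using r(2-4) by simp_all
    qed
    show "q' \<in> carr ?Q" "eop ?Q i q' = Some q" if e: "fop ?Q i q = Some q'"
    proof -
      obtain p' where p': "fop ?P i p = Some p'" "q' = ?g p'" using e unfolding p(2) eo[OF i p(1)] by blast
      note r = regular_f[OF P i p(1) p'(1)]
      show "q' \<in> carr ?Q" using r(1) c p'(2) by blast
      show "eop ?Q i q' = Some q" unfolding p(2) p'(2) eo[OF i r(1)] using r(2) by simp
    qed
  qed
qed

text \<open>\<open>tensor_list [B, C]\<close> has the trivial crystal as an additional last factor.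
  Its string lengths vanish, so inserting it does not affect the choice of a factor.\<close>

lemma pair_list_morphism:
  assumes B: "regular I B" and C: "regular I C"
  shows "crystal_morphism I (B \<otimes>\<^sub>c C) (tensor_list [B, C]) (\<lambda>(x, y). [x, y])"
proof -
  have T: "regular I (tensor_list [])" by (rule regular_tensor_list) simp
  have "crystal_morphism I C (C \<otimes>\<^sub>c tensor_list []) (\<lambda>y. (y, []))"
    unfolding crystal_morphism_def
  proof (intro conjI ballI)
    fix i y assume i: "i \<in> I" and y: "y \<in> carr C"
    show "eop (C \<otimes>\<^sub>c tensor_list []) i (y, []) = map_option (\<lambda>y. (y, [])) (eop C i y)"
      using regular_e_None[OF C i y] by (cases "eop C i y") (auto simp: eop_tensor)
    show "fop (C \<otimes>\<^sub>c tensor_list []) i (y, []) = map_option (\<lambda>y. (y, [])) (fop C i y)"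
      by (simp add: fop_tensor)
  qed auto
  then have 1: "crystal_morphism I C (tensor_list [C]) ((\<lambda>(x, xs). x # xs) \<circ> (\<lambda>y. (y, [])))"
    by (rule morphism_comp[OF _ cons_morphism])
  have "(\<lambda>(x, y). [x, y]) = (\<lambda>(x, xs). x # xs) \<circ> (\<lambda>(x, y). (x, ((\<lambda>(x, xs). x # xs) \<circ> (\<lambda>y. (y, []))) y))"
    by auto
  then show ?thesis using morphism_comp[OF morphism_tensor_id[OF 1 C] cons_morphism] by metis
qed

lemma list_pair_morphism:
  assumes B: "regular I B" and C: "regular I C"
  shows "crystal_morphism I (tensor_list [B, C]) (B \<otimes>\<^sub>c C) (\<lambda>b. (b ! 0, b ! 1))"
proof -
  have 1: "map_option ((\<lambda>b. (b ! 0, b ! 1)) \<circ> (\<lambda>(x, y). [x, y])) v = v" for v :: "('a \<times> 'a) option" by (cases v) auto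
  have 2: "carr (tensor_list [B, C]) = (\<lambda>(x, y). [x, y]) ` (carr B \<times> carr C)"
    by (auto simp: Let_def image_iff)
  have eo: "eop (tensor_list [B, C]) i [x, y] = map_option (\<lambda>(x, y). [x, y]) (eop (B \<otimes>\<^sub>c C) i (x, y))"
    "fop (tensor_list [B, C]) i [x, y] = map_option (\<lambda>(x, y). [x, y]) (fop (B \<otimes>\<^sub>c C) i (x, y))"
    if "i \<in> I" "x \<in> carr B" "y \<in> carr C" for i x y
    using pair_list_morphism[OF B C] that unfolding crystal_morphism_def
    by (auto simp del: tensor_list.simps)
  show ?thesis unfolding crystal_morphism_def 2
    using 1 by (auto simp: eo option.map_comp simp del: tensor_list.simps)
qed

lemma id_tensor_0: "id_tensor 0 g = (\<lambda>(x, y). [x, y]) \<circ> g \<circ> (\<lambda>b. (b ! 0, b ! 1))"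
  by (auto simp: id_tensor_def)

lemma id_tensor_Suc: "b \<noteq> [] \<Longrightarrow> id_tensor (Suc m) g b = hd b # id_tensor m g (tl b)"
  by (cases b) (auto simp: id_tensor_def)

lemma crystal_morphism_cong:
  assumes "crystal_morphism I A B f" "regular I A" "\<And>x. x \<in> carr A \<Longrightarrow> f x = g x"
  shows "crystal_morphism I A B g"
proof -
  have "map_option f (eop A i b) = map_option g (eop A i b)" "map_option f (fop A i b) = map_option g (fop A i b)"
    if "i \<in> I" "b \<in> carr A" for i b
    using regular_e(1)[OF assms(2) that] regular_f(1)[OF assms(2) that] assms(3)
    by (auto intro!: option.map_cong0 simp: option.set_sel)
  then show ?thesis using assms(1,3) unfolding crystal_morphism_def by (auto simp: Pi_iff)
qed

lemma id_tensor_morphism: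
  assumes A: "\<And>A. A \<in> set As \<Longrightarrow> regular I A" and BC: "regular I B" "regular I C" "regular I B'" "regular I C'"
    and g: "crystal_morphism I (B \<otimes>\<^sub>c C) (B' \<otimes>\<^sub>c C') g"
  shows "crystal_morphism I (tensor_list (As @ [B, C])) (tensor_list (As @ [B', C'])) (id_tensor (length As) g)"
  using A
proof (induction As)
  case Nil
  show ?case unfolding list.size append.simps id_tensor_0
    by (rule morphism_comp[OF list_pair_morphism[OF BC(1,2)] morphism_comp[OF g pair_list_morphism[OF BC(3,4)]]])
next
  case (Cons A As)
  let ?T = "tensor_list (As @ [B, C])" and ?T' = "tensor_list (As @ [B', C'])" and ?g = "id_tensor (length As) g"
  have R: "regular I ?T" "regular I A" using Cons.prems BC by (auto intro!: regular_tensor_list)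
  have m: "crystal_morphism I ?T ?T' ?g" using Cons by auto
  have "crystal_morphism I (tensor_list (A # As @ [B, C])) (tensor_list (A # As @ [B', C']))
     ((\<lambda>(x, xs). x # xs) \<circ> ((\<lambda>(x, y). (x, ?g y)) \<circ> (\<lambda>xs. (hd xs, tl xs))))"
    by (rule morphism_comp[OF morphism_comp[OF uncons_morphism[OF R(2,1)] morphism_tensor_id[OF m R(1)]] cons_morphism])
  then show ?case unfolding append.simps
    by (rule crystal_morphism_cong)
      (use R regular_tensor_list[of "A # As @ [B, C]" I] Cons.prems BC in \<open>auto simp: id_tensor_Suc carr_tensor_list_Cons simp del: tensor_list.simps\<close>)
qed

lemma carr_tensor_list: "carr (tensor_list Bs) = {b. list_all2 (\<lambda>B x. x \<in> carr B) Bs b}"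
proof (induction Bs)
  case (Cons B Bs)
  then show ?case unfolding carr_tensor_list_Cons by (force simp: list_all2_Cons1 image_iff)
qed simp

lemma id_tensor_inj:
  assumes "inj_on g (carr B \<times> carr C)"
  shows "inj_on (id_tensor (length As) g) (carr (tensor_list (As @ [B, C])))"
proof (rule inj_onI)
  fix x y assume x: "x \<in> carr (tensor_list (As @ [B, C]))" and y: "y \<in> carr (tensor_list (As @ [B, C]))"
    and eq: "id_tensor (length As) g x = id_tensor (length As) g y"
  obtain x0 x1 x2 where x: "x = x0 @ [x1, x2]" "length x0 = length As" "x1 \<in> carr B" "x2 \<in> carr C"
    using x by (auto simp: carr_tensor_list list_all2_append1 list_all2_Cons1 list_all2_lengthD)
  obtain y0 y1 y2 where y: "y = y0 @ [y1, y2]" "length y0 = length As" "y1 \<in> carr B" "y2 \<in> carr C"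
    using y by (auto simp: carr_tensor_list list_all2_append1 list_all2_Cons1 list_all2_lengthD)
  have "x0 = y0 \<and> g (x1, x2) = g (y1, y2)"
    using eq x(1,2) y(1,2) by (auto simp: id_tensor_def nth_append split: prod.splits)
  then show "x = y" using inj_onD[OF assms, of "(x1, x2)" "(y1, y2)"] x y by simp
qed

section \<open>The intrinsic coenergy as a sum over passing factors\<close>

context
  fixes X :: affine_type and n :: nat
begin

text \<open>The part of the intrinsic coenergy with a fixed index \<open>j\<close>, where
  \<open>(s, b)\<close> is factor \<open>j\<close> and the list holds the factors to its
  right.\<close>

fun pass :: "nat \<times> row \<Rightarrow> (nat \<times> row) list \<Rightarrow> nat" where
  "pass (s, b) [] = row_coenergy X n s b"
| "pass (s, b) ((t, c) # q) = local_coenergy n (KR X n s) (KR X n t) (b, c) +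
    (case comb_R n (KR X n s) (KR X n t) (b, c) of (c', b') \<Rightarrow> pass (s, b') q)"

fun pass_all :: "(nat \<times> row) list \<Rightarrow> nat" where
  "pass_all [] = 0"
| "pass_all (x # q) = pass x q + pass_all q"

text \<open>Positions are counted from the right, so further factors on the left do not shift
  them.\<close>

lemma R_at_Cons: "1 \<le> k \<Longrightarrow> k < length q \<Longrightarrow> R_at X n k (x # q) = x # R_at X n k q"
  and H_at_Cons: "1 \<le> k \<Longrightarrow> k < length q \<Longrightarrow> H_at X n k (x # q) = H_at X n k q"
proof -
  assume "1 \<le> k" "k < length q"
  then obtain m where "length q = Suc (m + k)" using less_imp_Suc_add[of k "length q"] by (auto simp: add.commute)
  then show "R_at X n k (x # q) = x # R_at X n k q" "H_at X n k (x # q) = H_at X n k q"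
    by (auto simp: R_at_def H_at_def Let_def Suc_diff_le split: prod.splits)
qed

lemma length_R_at [simp]: "length (R_at X n k q) = length q"
  by (auto simp: R_at_def Let_def split: prod.splits)

lemma length_foldr_R_at [simp]: "length (foldr (R_at X n) ks q) = length q"
  by (induction ks) auto

lemma foldr_R_at_Cons:
  "(\<And>k. k \<in> set ks \<Longrightarrow> 1 \<le> k \<and> k < length q) \<Longrightarrow> foldr (R_at X n) ks (x # q) = x # foldr (R_at X n) ks q"
  by (induction ks) (auto simp: R_at_Cons)

text \<open>The operator of largest index is applied first and moves the leftmost row across its
  neighbour. The new head is then out of reach of the remaining operators, and the induction
  continues on the tail with \<open>b'\<close>.\<close>

lemma pass_eq:
  "(\<Sum>i = 1..length q. H_at X n i (foldr (R_at X n) [i+1..<Suc (length q)] ((s, b) # q)))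
    + (case last (foldr (R_at X n) [1..<Suc (length q)] ((s, b) # q)) of (s, b) \<Rightarrow> row_coenergy X n s b) = pass (s, b) q"
proof (induction q arbitrary: b)
  case (Cons tc q)
  obtain t c where tc: "tc = (t, c)" by fastforce
  obtain c' b' where R: "comb_R n (KR X n s) (KR X n t) (b, c) = (c', b')" by fastforce
  let ?L = "Suc (length q)"
  have R1: "R_at X n ?L ((s, b) # (t, c) # q) = (t, c') # (s, b') # q"
    by (simp add: R_at_def R)
  have H1: "H_at X n ?L ((s, b) # (t, c) # q) = local_coenergy n (KR X n s) (KR X n t) (b, c)"
    by (simp add: H_at_def)
  have F: "foldr (R_at X n) [j..<Suc ?L] ((s, b) # (t, c) # q) = (t, c') # foldr (R_at X n) [j..<?L] ((s, b') # q)"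
    if "j \<le> ?L" "1 \<le> j" for j
  proof -
    have "foldr (R_at X n) [j..<Suc ?L] ((s, b) # (t, c) # q) = foldr (R_at X n) [j..<?L] ((t, c') # (s, b') # q)"
      using that by (simp add: upt_Suc_append[of j ?L] R1 del: upt_Suc)
    also have "\<dots> = (t, c') # foldr (R_at X n) [j..<?L] ((s, b') # q)"
      by (rule foldr_R_at_Cons) (use that in auto)
    finally show ?thesis .
  qed
  have "(\<Sum>i = 1..length (tc # q). H_at X n i (foldr (R_at X n) [i+1..<Suc (length (tc # q))] ((s, b) # tc # q))) =
      (\<Sum>i = 1..length q. H_at X n i (foldr (R_at X n) [i+1..<Suc ?L] ((s, b) # tc # q))) + local_coenergy n (KR X n s) (KR X n t) (b, c)"
    using H1 by (simp add: tc del: upt_Suc)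
  moreover have "(\<Sum>i = 1..length q. H_at X n i (foldr (R_at X n) [i+1..<Suc ?L] ((s, b) # tc # q))) =
     (\<Sum>i = 1..length q. H_at X n i (foldr (R_at X n) [i+1..<?L] ((s, b') # q)))"
    unfolding tc by (intro sum.cong refl) (subst F; auto simp: H_at_Cons simp del: upt_Suc)
  moreover have ne: "foldr (R_at X n) ks (x # q) \<noteq> []" for ks x
    by (metis length_foldr_R_at length_0_conv list.distinct(1))
  ultimately show ?case
    using Cons.IH[of b'] F[of 1] ne unfolding tc by (simp add: R del: upt_Suc)
qed (simp)

lemma intrinsic_coenergy_eq:
  "length ss = length bs \<Longrightarrow> intrinsic_coenergy X n ss bs = pass_all (zip ss bs)"
proof -
  let ?h = "\<lambda>p i j. H_at X n i (foldr (R_at X n) [i+1..<j] p)"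
  let ?d = "\<lambda>p j. case last (foldr (R_at X n) [1..<j] p) of (s, b) \<Rightarrow> row_coenergy X n s b"
  have S: "(\<Sum>(i, j)\<in>{(i, j). 1 \<le> i \<and> i < j \<and> j \<le> N}. f i j) = (\<Sum>j = 1..N. \<Sum>i = 1..<j. f i j)" for N and f :: "nat \<Rightarrow> nat \<Rightarrow> nat"
  proof -
    have "(\<Sum>j = 1..N. \<Sum>i = 1..<j. f i j) = (\<Sum>(j, i)\<in>Sigma {1..N} (\<lambda>j. {1..<j}). f i j)"
      by (rule sum.Sigma) auto
    also have "\<dots> = (\<Sum>(i, j)\<in>{(i, j). 1 \<le> i \<and> i < j \<and> j \<le> N}. f i j)"
      by (rule sum.reindex_bij_witness[of _ "\<lambda>(i, j). (j, i)" "\<lambda>(j, i). (i, j)"]) auto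
    finally show ?thesis by simp
  qed
  have main: "(\<Sum>j = 1..length p. \<Sum>i = 1..<j. ?h p i j) + (\<Sum>j = 1..length p. ?d p j) = pass_all p" for p
  proof (induction p)
    case (Cons x q)
    obtain s b where x: "x = (s, b)" by fastforce
    have "(\<Sum>i = 1..<j. ?h (x # q) i j) = (\<Sum>i = 1..<j. ?h q i j)" if "j \<le> length q" for j
      using that by (intro sum.cong refl) (subst foldr_R_at_Cons; auto simp: H_at_Cons)
    moreover have "?d (x # q) j = ?d q j" if "j \<le> length q" "1 \<le> j" for j
      using that by (subst foldr_R_at_Cons) (auto simp: length_0_conv[symmetric] simp del: length_0_conv)
    moreover have "(\<Sum>i = 1..<Suc (length q). ?h (x # q) i (Suc (length q))) + ?d (x # q) (Suc (length q)) = pass x q"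
      using pass_eq[of q s b] unfolding x by (simp add: atLeastLessThanSuc_atLeastAtMost del: upt_Suc)
    ultimately show ?case using Cons.IH by (simp del: upt_Suc)
  qed simp
  assume "length ss = length bs"
  then show ?thesis using main[of "zip ss bs"] unfolding intrinsic_coenergy_def Let_def S by simp
qed

end

section \<open>Moving one box through a padding of the right factor\<close>

lemma regular_mono:
  assumes "regular I B" "J \<subseteq> I"
  shows "regular J B"
proof -
  have *: "\<forall>i\<in>J. P i" if "\<forall>i\<in>I. P i" for P using that assms(2) by blast
  show ?thesis using assms(1) unfolding regular_def by (elim conjE) (intro conjI, assumption, assumption, rule *)
qed

text \<open>Padding is required to commute with lowering only; \<open>k c i\<close> measures the
  change of the raising strings. \<open>pad_R\<close> allows the padding to be stripped after the
  exchange, and \<open>pad_H\<close> asks for invariance of a sum, not of its two terms.\<close>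

locale KR_padded = KR_family +
  fixes pad :: "nat \<Rightarrow> row \<Rightarrow> row" and k :: "nat \<Rightarrow> nat \<Rightarrow> nat"
  assumes pad_carr: "y \<in> carr (KR X n t) \<Longrightarrow> pad c y \<in> carr (KR X n (t + c))"
    and pad_phi: "y \<in> carr (KR X n t) \<Longrightarrow> 1 \<le> i \<Longrightarrow> i \<le> n \<Longrightarrow> phi (KR X n (t + c)) i (pad c y) = phi (KR X n t) i y"
    and pad_eps: "y \<in> carr (KR X n t) \<Longrightarrow> 1 \<le> i \<Longrightarrow> i \<le> n \<Longrightarrow> eps (KR X n (t + c)) i (pad c y) = eps (KR X n t) i y + k c i"
    and pad_f: "y \<in> carr (KR X n t) \<Longrightarrow> 1 \<le> i \<Longrightarrow> i \<le> n \<Longrightarrow> fop (KR X n (t + c)) i (pad c y) = map_option (pad c) (fop (KR X n t) i y)"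
    and pad_inj: "inj (pad c)"
    and pad_D: "y \<in> carr (KR X n t) \<Longrightarrow> row_coenergy X n (t + c) (pad c y) = row_coenergy X n t y"
    and pad_R: "x \<in> carr (KR X n (b + c + 1)) \<Longrightarrow> y \<in> carr (KR X n b) \<Longrightarrow>
      comb_R n (KR X n (b + c + 1)) (KR X n (b + c)) (x, pad c y) = (p, q) \<Longrightarrow> \<exists>y'\<in>carr (KR X n (b + 1)). q = pad c y'"
    and pad_H: "w \<in> carr (KR X n r) \<Longrightarrow> y \<in> carr (KR X n t) \<Longrightarrow> comb_R n (KR X n r) (KR X n t) (w, y) = (y1, w1) \<Longrightarrow>
      comb_R n (KR X n r) (KR X n (t + c)) (w, pad c y) = (y2, w2) \<Longrightarrow>
      local_coenergy n (KR X n r) (KR X n (t + c)) (w, pad c y) + row_coenergy X n r w2 =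
      local_coenergy n (KR X n r) (KR X n t) (w, y) + row_coenergy X n r w1"
begin

lemma pass_pad:
  assumes "w \<in> carr (K r)" "y \<in> carr (K t)"
  shows "pass X n (r, w) [(t + c, pad c y)] = pass X n (r, w) [(t, y)]"
  using pad_H[OF assms] by (auto split: prod.splits)

lemma pass_R:
  assumes c: "w \<in> carr (K r)" "x \<in> carr (K s)" "y \<in> carr (K t)" and R: "R s t (x, y) = (y1, x1)"
  shows "pass X n (r, w) [(t, y1), (s, x1)] = pass X n (r, w) [(s, x), (t, y)]"
proof -
  obtain x' y' w'' where p: "pass2 r s t (w, x, y) = (x', y', w'')" by (metis prod_cases3)
  show ?thesis using pass2_R[OF c p R] p by (auto simp: pass2_def cost2_def split: prod.splits)
qed

lemma pass_prefix:
  assumes "\<And>w. w \<in> carr (K r) \<Longrightarrow> pass X n (r, w) p = pass X n (r, w) p'"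
    and "\<And>s b. (s, b) \<in> set q \<Longrightarrow> b \<in> carr (K s)"
  shows "w \<in> carr (K r) \<Longrightarrow> pass X n (r, w) (q @ p) = pass X n (r, w) (q @ p')"
  using assms(2)
proof (induction q arbitrary: w)
  case (Cons sb q)
  obtain s b where sb: "sb = (s, b)" by fastforce
  obtain b' w' where R: "R r s (w, b) = (b', w')" by fastforce
  have "w' \<in> carr (K r)" using R_carr[OF Cons.prems(1) _ R] Cons.prems(2)[of s b] sb by auto
  then show ?case using Cons.IH[of w'] Cons.prems(2) by (simp add: sb R)
qed (use assms(1) in simp)

lemma pass_all_prefix:
  assumes "\<And>r w. w \<in> carr (K r) \<Longrightarrow> pass X n (r, w) p = pass X n (r, w) p'"
    and "\<And>s b. (s, b) \<in> set q \<Longrightarrow> b \<in> carr (K s)" and "pass_all X n p = pass_all X n p'"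
  shows "pass_all X n (q @ p) = pass_all X n (q @ p')"
  using assms(2)
proof (induction q)
  case (Cons sb q)
  obtain s b where sb: "sb = (s, b)" by fastforce
  then show ?case using Cons pass_prefix[OF assms(1), of s q b] by auto
qed (use assms(3) in simp)

lemma row_splitting:
  assumes "b + 2 \<le> a"
  shows "\<exists>rs :: row \<times> row \<Rightarrow> row \<times> row.
    crystal_morphism {1..n} (K a \<otimes>\<^sub>c K b) (K (a - 1) \<otimes>\<^sub>c K (b + 1)) rs \<and>
    inj_on rs (carr (K a \<otimes>\<^sub>c K b)) \<and>
    (\<forall>ss. crystal_morphism {1..n} (KR_tensor X n (ss @ [a, b])) (KR_tensor X n (ss @ [a - 1, b + 1]))
         (id_tensor (length ss) rs) \<and>
       inj_on (id_tensor (length ss) rs) (carr (KR_tensor X n (ss @ [a, b]))) \<and>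
       preserves_coenergy X n (ss @ [a, b]) (ss @ [a - 1, b + 1]) (id_tensor (length ss) rs))"
proof -
  define c where "c = a - 1 - b"
  have a: "a = b + c + 1" using assms by (simp add: c_def)
  let ?P = "K a \<otimes>\<^sub>c K b" and ?P' = "K a \<otimes>\<^sub>c K (b + c)" and ?Q = "K (b + c) \<otimes>\<^sub>c K (b + 1)" and ?Q' = "K (b + c) \<otimes>\<^sub>c K a"
  define g where "g = (\<lambda>(x :: row, y). (x, pad c y))"
  have bc: "a = b + 1 + c" using a by simp
  \<comment> \<open>The map \<open>g\<close> is not onto, so the exchanged pair can be pulled back
    through \<open>g\<close> only because \<open>pad_R\<close> keeps the padding inside the right
    row.\<close>
  have "\<exists>q\<in>carr ?Q. g q = R a (b + c) (g p)" if p: "p \<in> carr ?P" for p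
  proof -
    obtain x y where xy: "p = (x, y)" "x \<in> carr (K a)" "y \<in> carr (K b)" using p by auto
    obtain x' y' where R: "R a (b + c) (x, pad c y) = (x', y')" by fastforce
    obtain y0 where y0: "y0 \<in> carr (K (b + 1))" "y' = pad c y0" using pad_R[OF xy(2)[unfolded a] xy(3) R[unfolded a]] by blast
    have "x' \<in> carr (K (b + c))" using R_carr[OF xy(2) pad_carr[OF xy(3)] R] by simp
    then show ?thesis using y0 R xy(1) by (intro bexI[of _ "(x', y0)"]) (auto simp: g_def)
  qed
  then obtain rs where rs: "\<And>p. p \<in> carr ?P \<Longrightarrow> rs p \<in> carr ?Q" "\<And>p. p \<in> carr ?P \<Longrightarrow> g (rs p) = R a (b + c) (g p)"
    by metis
  have g_inj: "inj g" using pad_inj[of c] by (auto simp: g_def inj_def)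
  have gP: "g p \<in> carr ?P'" if "p \<in> carr ?P" for p using that pad_carr by (auto simp: g_def)
  have gQ: "g q \<in> carr ?Q'" if "q \<in> carr ?Q" for q using that pad_carr[of _ "b + 1" c] by (auto simp: g_def bc)
  have in_: "i \<in> {0..n} \<and> i \<le> n \<and> 1 \<le> i" if "i \<in> {1..n}" for i using that by auto
  have gen: "fop (K m \<otimes>\<^sub>c K (t + c)) i (g p) = map_option g (fop (K m \<otimes>\<^sub>c K t) i p)"
    "eps (K m \<otimes>\<^sub>c K (t + c)) i (g p) = eps (K m \<otimes>\<^sub>c K t) i p + k c i"
    "phi (K m \<otimes>\<^sub>c K (t + c)) i (g p) = phi (K m \<otimes>\<^sub>c K t) i p"
    if i: "i \<in> {1..n}" and p: "p \<in> carr (K m \<otimes>\<^sub>c K t)" for i m t p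
  proof -
    obtain x y where xy: "p = (x, y)" "x \<in> carr (K m)" "y \<in> carr (K t)" using p by auto
    note f = pad_phi[OF xy(3), of i c] pad_eps[OF xy(3), of i c] pad_f[OF xy(3), of i c]
    show "fop (K m \<otimes>\<^sub>c K (t + c)) i (g p) = map_option g (fop (K m \<otimes>\<^sub>c K t) i p)"
      using f in_[OF i] by (simp add: xy(1) g_def fop_tensor option.map_comp comp_def)
    show "eps (K m \<otimes>\<^sub>c K (t + c)) i (g p) = eps (K m \<otimes>\<^sub>c K t) i p + k c i"
      "phi (K m \<otimes>\<^sub>c K (t + c)) i (g p) = phi (K m \<otimes>\<^sub>c K t) i p"
      using f in_[OF i] pad_carr[OF xy(3), of c] xy(2,3)
      by (simp_all add: xy(1) g_def eps_tensor[OF reg reg] phi_tensor[OF reg reg])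
  qed
  have rs_f: "fop ?Q i (rs p) = map_option rs (fop ?P i p)" if i: "i \<in> {1..n}" and p: "p \<in> carr ?P" for i p
  proof -
    have "map_option g (fop ?Q i (rs p)) = fop ?Q' i (g (rs p))" using gen(1)[OF i rs(1)[OF p]] bc by simp
    also have "\<dots> = map_option (R a (b + c)) (map_option g (fop ?P i p))"
      using gen(1)[OF i p] R_f[OF _ gP[OF p], of i] rs(2)[OF p] in_[OF i] by simp
    also have "\<dots> = map_option g (map_option rs (fop ?P i p))"
      using regular_f(1)[OF reg2 _ p, of i] in_[OF i] rs(2) by (cases "fop ?P i p") (auto simp del: carr_tensor)
    finally show ?thesis using option.inj_map[OF g_inj] by (simp add: inj_eq)
  qed
  \<comment> \<open>Both lengths carry the same shift \<open>k c i\<close>, because \<open>c\<close>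
    letters were added on either side.\<close>
  have rs_eps: "eps ?Q i (rs p) = eps ?P i p" if i: "i \<in> {1..n}" and p: "p \<in> carr ?P" for i p
    using gen(2)[OF i p] gen(2)[OF i rs(1)[OF p]] R_eps[OF _ gP[OF p], of i] rs(2)[OF p] in_[OF i] bc by simp
  \<comment> \<open>Raising does not commute with \<open>pad\<close>. It is obtained from
    \<open>rs_f\<close> by inversion, while \<open>rs_eps\<close> decides where the result is
    zero.\<close>
  have rs_e: "eop ?Q i (rs p) = map_option rs (eop ?P i p)" if i: "i \<in> {1..n}" and p: "p \<in> carr ?P" for i p
  proof (cases "eop ?P i p")
    case None
    then show ?thesis
      using rs_eps[OF i p] regular_e_None[OF reg2 _ p, of i] regular_e_None[OF reg2 _ rs(1)[OF p], of i] in_[OF i] by simp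
  next
    case (Some p')
    note e = regular_e[OF reg2 _ p Some]
    have p': "p' \<in> carr ?P" "fop ?P i p' = Some p" using e(1,2) in_[OF i] by auto
    then have "fop ?Q i (rs p') = Some (rs p)" using rs_f[OF i p'(1)] by simp
    then show ?thesis using regular_f(2)[OF reg2 _ rs(1)[OF p'(1)]] in_[OF i] Some by simp
  qed
  have morph: "crystal_morphism {1..n} ?P ?Q rs"
    unfolding crystal_morphism_def using rs(1) rs_e rs_f by auto
  have inj: "inj_on rs (carr ?P)"
  proof (rule inj_onI)
    fix p q assume h: "p \<in> carr ?P" "q \<in> carr ?P" "rs p = rs q"
    then have "R a (b + c) (g p) = R a (b + c) (g q)" using rs(2)[OF h(1)] rs(2)[OF h(2)] by simp
    then have "g p = g q" using inj_onD[OF R_inj, of a "b + c" "g p" "g q"] gP[OF h(1)] gP[OF h(2)] by simp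
    then show "p = q" using g_inj by (simp add: inj_eq)
  qed
  have co: "pass X n (r, w) [(a, x), (b, y)] = pass X n (r, w) [(b + c, x'), (b + 1, y')]"
    and co2: "pass_all X n [(a, x), (b, y)] = pass_all X n [(b + c, x'), (b + 1, y')]"
    if xy: "x \<in> carr (K a)" "y \<in> carr (K b)" and rxy: "rs (x, y) = (x', y')" and w: "w \<in> carr (K r)" for r w x y x' y'
  proof -
    have xy': "x' \<in> carr (K (b + c))" "y' \<in> carr (K (b + 1))" using rs(1)[of "(x, y)"] xy rxy by auto
    have R: "R a (b + c) (x, pad c y) = (x', pad c y')" using rs(2)[of "(x, y)"] xy rxy by (simp add: g_def)
    have py: "pad c y \<in> carr (K (b + c))" "pad c y' \<in> carr (K a)" using pad_carr[OF xy(2), of c] pad_carr[OF xy'(2), of c] by (simp_all add: bc)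
    have tail: "pass X n (r, w) [(s, x), (t + c, pad c y)] = pass X n (r, w) [(s, x), (t, y)]"
      if "x \<in> carr (K s)" "y \<in> carr (K t)" "w \<in> carr (K r)" for s t x y w r
      using pass_prefix[where q = "[(s, x)]" and p = "[(t + c, pad c y)]" and p' = "[(t, y)]" and w = w and r = r]
        pass_pad[of _ r y t c] that by simp
    have "pass X n (r, w) [(b + c, x'), (a, pad c y')] = pass X n (r, w) [(b + c, x'), (b + 1, y')]"
      using tail[OF xy' w] unfolding bc .
    then show "pass X n (r, w) [(a, x), (b, y)] = pass X n (r, w) [(b + c, x'), (b + 1, y')]"
      using pass_R[OF w xy(1) py(1) R] tail[OF xy w] by simp
    have RR: "R (b + c) a (x', pad c y') = (x, pad c y)" using R_R[OF xy(1) py(1)] R by simp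
    have HR: "H (b + c) a (x', pad c y') = H a (b + c) (x, pad c y)" using H_R[OF xy(1) py(1)] R by simp
    \<comment> \<open>On both sides the total is the local coenergy of the padded pair plus the
      coenergies of the padded rows \<open>y\<close> and \<open>y'\<close>; the latter two merely
      change places.\<close>
    have 1: "pass X n (a, x) [(b, y)] = H a (b + c) (x, pad c y) + row_coenergy X n a (pad c y')"
      using pass_pad[OF xy, of c] R by simp
    have 2: "pass X n (b + c, x') [(b + 1, y')] = H a (b + c) (x, pad c y) + row_coenergy X n (b + c) (pad c y)"
      using pass_pad[OF xy', of c, folded bc] RR HR by simp
    have 3: "row_coenergy X n a (pad c y') = row_coenergy X n (b + 1) y'" using pad_D[OF xy'(2), of c] bc by simp
    have 4: "row_coenergy X n (b + c) (pad c y) = row_coenergy X n b y" using pad_D[OF xy(2), of c] .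
    show "pass_all X n [(a, x), (b, y)] = pass_all X n [(b + c, x'), (b + 1, y')]"
      using 1 2 3 4 by (simp del: pass.simps(2))
  qed
  have reg1: "regular {1..n} (K s)" for s by (rule regular_mono[OF reg]) auto
  have ab: "a - 1 = b + c" using a by simp
  have T: "KR_tensor X n (ss @ [s, t]) = tensor_list (map K ss @ [K s, K t])" for ss s t by (simp add: KR_tensor_def)
  have m: "crystal_morphism {1..n} (KR_tensor X n (ss @ [a, b])) (KR_tensor X n (ss @ [b + c, b + 1])) (id_tensor (length ss) rs)" for ss
  proof -
    have "regular {1..n} A" if "A \<in> set (map K ss)" for A using that reg1 by auto
    from id_tensor_morphism[where As = "map K ss", OF this reg1 reg1 reg1 reg1 morph] show ?thesis
      unfolding T length_map .
  qed
  have i: "inj_on (id_tensor (length ss) rs) (carr (KR_tensor X n (ss @ [a, b])))" for ss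
    using id_tensor_inj[of rs "K a" "K b" "map K ss"] inj unfolding T by simp
  have p: "preserves_coenergy X n (ss @ [a, b]) (ss @ [b + c, b + 1]) (id_tensor (length ss) rs)" for ss
    unfolding preserves_coenergy_def
  proof
    fix bs assume "bs \<in> carr (KR_tensor X n (ss @ [a, b]))"
    then obtain b0 x y where bs: "bs = b0 @ [x, y]" "list_all2 (\<lambda>s x. x \<in> carr (K s)) ss b0" "x \<in> carr (K a)" "y \<in> carr (K b)"
      unfolding T carr_tensor_list by (auto simp: list_all2_append1 list_all2_Cons1 list_all2_map1)
    obtain x' y' where xy': "rs (x, y) = (x', y')" by fastforce
    have l: "length b0 = length ss" using bs(2) by (auto dest: list_all2_lengthD)
    have q: "z \<in> carr (K s)" if "(s, z) \<in> set (zip ss b0)" for s z using bs(2) that by (auto simp: list_all2_iff)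
    have "id_tensor (length ss) rs bs = b0 @ [x', y']" using l xy' by (simp add: bs(1) id_tensor_def nth_append)
    then show "intrinsic_coenergy X n (ss @ [b + c, b + 1]) (id_tensor (length ss) rs bs) = intrinsic_coenergy X n (ss @ [a, b]) bs"
      using l pass_all_prefix[OF co[OF bs(3,4) xy'] q co2[OF bs(3,4) xy' bs(3)]]
      by (simp add: intrinsic_coenergy_eq bs(1) del: pass_all.simps)
  qed
  show ?thesis using morph inj m i p unfolding ab by blast
qed

end

section \<open>Piecewise linear invariants of the R-matrix of type D\<close>

declare [[smt_reconstruction_step_timeout = 300]]

definition pos :: "int \<Rightarrow> int" where "pos x = max x 0"

lemma pos_nonneg [simp]: "0 \<le> pos x" and pos_ge: "x \<le> pos x"
  and pos_le: "x \<le> 0 \<Longrightarrow> pos x = 0" and pos_id: "0 \<le> x \<Longrightarrow> pos x = x"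
  by (auto simp: pos_def)

lemma pos_facts: "x \<le> pos x \<and> 0 \<le> pos x \<and> (x \<le> 0 \<longrightarrow> pos x = 0) \<and> (0 \<le> x \<longrightarrow> pos x = x)"
  by (auto simp: pos_def)

text \<open>
  The letters \<open>\<plusminus>i\<close> of a pair of rows, \<open>a, A\<close> of the left and \<open>b, B\<close> of the right one, turn the state
  \<open>(t, s)\<close> left by the letters of larger absolute value into \<open>(tau, sig)\<close>.  The quantities
  \<open>ia, ib, ik, ix\<close> take the same value on a pair and on its image under the R-matrix, and \<open>mv\<close>
  expresses the effect of \<open>e\<^sub>i\<close> on them without reference to the factor it acts on.
\<close>

definition th :: "int \<Rightarrow> int \<Rightarrow> int \<Rightarrow> int" where "th A b t = t - pos (A - b)"
definition et :: "int \<Rightarrow> int \<Rightarrow> int \<Rightarrow> int \<Rightarrow> int" where "et A b t s = A - b + s + pos (th A b t)"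
definition tau :: "int \<Rightarrow> int \<Rightarrow> int \<Rightarrow> int \<Rightarrow> int \<Rightarrow> int" where
  "tau A b B t s = B - A + pos (A - b) + pos (th A b t) + pos (- et A b t s)"
definition sig :: "int \<Rightarrow> int \<Rightarrow> int \<Rightarrow> int \<Rightarrow> int \<Rightarrow> int \<Rightarrow> int" where
  "sig a A b B t s = a - B + et A b t s - pos (th A b t)"
definition ia where "ia a A b t s = a + pos (- et A b t s)"
definition ib where "ib B A b t = B + pos (- th A b t)"
definition ik where "ik A b t s = th A b t + pos (et A b t s)"
definition ix where "ix A b t s = pos (th A b t) + et A b t s - (A - b)"

text \<open>So \<open>sig\<close> merely counts: if it starts as such, it is the number of letters
  read on the left minus the number read on the right.\<close>

lemma sig_lin: "sig a A b B t s = a + A - b - B + s"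
  by (simp add: sig_def et_def)

type_synonym inv8 = "int \<times> int \<times> int \<times> int \<times> int \<times> int \<times> int \<times> int"

text \<open>The arguments \<open>a A b B\<close> belong to the letters \<open>\<plusminus>i\<close>
  and \<open>c C d E\<close> to \<open>\<plusminus>(i + 1)\<close>, which are read first.\<close>

definition inv2 :: "int \<Rightarrow> int \<Rightarrow> int \<Rightarrow> int \<Rightarrow> int \<Rightarrow> int \<Rightarrow> int \<Rightarrow> int \<Rightarrow> int \<Rightarrow> int \<Rightarrow> inv8" where
  "inv2 a A b B c C d E t s = (let T = tau C d E t s; S = sig c C d E t s in
    (ia a A b T S, ib B A b T, ik A b T S, ix A b T S, ia c C d t s, ib E C d t, ik C d t s, ix C d t s))"

definition mv :: "inv8 \<Rightarrow> inv8 \<Rightarrow> bool" where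
  "mv I J \<longleftrightarrow> (case I of (a1, b1, k1, x1, a2, b2, k2, x2) \<Rightarrow>
    let w = x1 - a2 + b2 + k2; f5 = - w; f4 = 2*k2 - w; f3 = 2*x2 - w; f6 = 2*x2 - 2*w; f2 = 2*k1 + 2*x2 - 2*w in
    (0 \<ge> f5 \<and> 0 \<ge> f4 \<and> 0 \<ge> f3 \<and> 0 \<ge> f6 \<and> 0 \<ge> f2 \<and> J = (a1, b1-1, k1+1, x1+1, a2, b2+1, k2, x2)) \<or>
    (f5 > 0 \<and> f5 \<ge> f4 \<and> f5 \<ge> f3 \<and> f5 \<ge> f6 \<and> f5 \<ge> f2 \<and> J = (a1, b1, k1, x1+1, a2-1, b2+1, k2-1, x2)) \<or>
    (f4 > 0 \<and> f4 > f5 \<and> f4 \<ge> f3 \<and> f4 \<ge> f6 \<and> f4 \<ge> f2 \<and> J = (a1, b1, k1, x1+1, a2, b2, k2-1, x2-2)) \<or>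
    (f3 > 0 \<and> f3 > f5 \<and> f3 > f4 \<and> f3 \<ge> f6 \<and> f3 \<ge> f2 \<and> J = (a1, b1, k1, x1+1, a2, b2, k2+1, x2)) \<or>
    (f6 > 0 \<and> f6 > f5 \<and> f6 > f4 \<and> f6 > f3 \<and> f6 \<ge> f2 \<and> J = (a1, b1+1, k1-1, x1+1, a2-1, b2, k2, x2)) \<or>
    (f2 > 0 \<and> f2 > f5 \<and> f2 > f4 \<and> f2 > f3 \<and> f2 > f6 \<and> J = (a1+1, b1, k1-1, x1-1, a2-1, b2, k2, x2)))"

text \<open>Each \<open>pos\<close> is presented through a pair of nonnegative numbers of which one
  is zero. With these facts a claim about one level becomes linear arithmetic with case splits,
  without unfolding the definitions.\<close>

lemma lev_facts:
  "A - b = pos (A - b) - pos (b - A) \<and>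
   0 \<le> pos (A - b) \<and>
   0 \<le> pos (b - A) \<and>
   (pos (A - b) = 0 \<or> pos (b - A) = 0) \<and>
   th A b t = t - pos (A - b) \<and>
   et A b t s = A - b + s + pos (th A b t) \<and>
   th A b t = pos (th A b t) - pos (- th A b t) \<and>
   0 \<le> pos (th A b t) \<and>
   0 \<le> pos (- th A b t) \<and>
   (pos (th A b t) = 0 \<or> pos (- th A b t) = 0) \<and>
   et A b t s = pos (et A b t s) - pos (- et A b t s) \<and>
   0 \<le> pos (et A b t s) \<and>
   0 \<le> pos (- et A b t s) \<and>
   (pos (et A b t s) = 0 \<or> pos (- et A b t s) = 0) \<and>
   tau A b B t s = B - A + pos (A - b) + pos (th A b t) + pos (- et A b t s) \<and>
   sig a A b B t s = a - B + et A b t s - pos (th A b t) \<and>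
   ia a A b t s = a + pos (- et A b t s) \<and>
   ib B A b t = B + pos (- th A b t) \<and>
   ik A b t s = th A b t + pos (et A b t s) \<and>
   ix A b t s = pos (th A b t) + et A b t s - (A - b)"
  unfolding tau_def sig_def ia_def ib_def ik_def ix_def by (auto simp: pos_def th_def et_def)

text \<open>Twice the \<epsilon> of the pair at node \<open>i\<close>, by \<open>mv_eps_eq\<close>;
  the factor 2 keeps all entries integral. The maximum runs over 0 and the \<open>f5\<close>,
  \<open>f4\<close>, \<open>f3\<close>, \<open>f6\<close>, \<open>f2\<close> of \<open>mv\<close>,
  and \<open>mv\<close> branches on the first entry in this order that attains it.\<close>

definition mv_eps :: "inv8 \<Rightarrow> int" where
  "mv_eps I = (case I of (a1, b1, k1, x1, a2, b2, k2, x2) \<Rightarrow>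
    let w = x1 - a2 + b2 + k2 in
    2*b1 + max 0 (max (- w) (max (2*k2 - w) (max (2*x2 - w) (max (2*x2 - 2*w) (2*k1 + 2*x2 - 2*w))))))"

lemma mv_det: "mv I J \<Longrightarrow> mv I J' \<Longrightarrow> J = J'"
proof -
  obtain a1 b1 k1 x1 a2 b2 k2 x2 where I: "I = (a1, b1, k1, x1, a2, b2, k2, x2)" by (cases I) auto
  have *: "(0 \<ge> f5 \<and> 0 \<ge> f4 \<and> 0 \<ge> f3 \<and> 0 \<ge> f6 \<and> 0 \<ge> f2 \<and> J = j1) \<or>
    (f5 > 0 \<and> f5 \<ge> f4 \<and> f5 \<ge> f3 \<and> f5 \<ge> f6 \<and> f5 \<ge> f2 \<and> J = j5) \<or>
    (f4 > 0 \<and> f4 > f5 \<and> f4 \<ge> f3 \<and> f4 \<ge> f6 \<and> f4 \<ge> f2 \<and> J = j4) \<or>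
    (f3 > 0 \<and> f3 > f5 \<and> f3 > f4 \<and> f3 \<ge> f6 \<and> f3 \<ge> f2 \<and> J = j3) \<or>
    (f6 > 0 \<and> f6 > f5 \<and> f6 > f4 \<and> f6 > f3 \<and> f6 \<ge> f2 \<and> J = j6) \<or>
    (f2 > 0 \<and> f2 > f5 \<and> f2 > f4 \<and> f2 > f3 \<and> f2 > f6 \<and> J = j2) \<Longrightarrow>
    (0 \<ge> f5 \<and> 0 \<ge> f4 \<and> 0 \<ge> f3 \<and> 0 \<ge> f6 \<and> 0 \<ge> f2 \<and> J' = j1) \<or>
    (f5 > 0 \<and> f5 \<ge> f4 \<and> f5 \<ge> f3 \<and> f5 \<ge> f6 \<and> f5 \<ge> f2 \<and> J' = j5) \<or>
    (f4 > 0 \<and> f4 > f5 \<and> f4 \<ge> f3 \<and> f4 \<ge> f6 \<and> f4 \<ge> f2 \<and> J' = j4) \<or>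
    (f3 > 0 \<and> f3 > f5 \<and> f3 > f4 \<and> f3 \<ge> f6 \<and> f3 \<ge> f2 \<and> J' = j3) \<or>
    (f6 > 0 \<and> f6 > f5 \<and> f6 > f4 \<and> f6 > f3 \<and> f6 \<ge> f2 \<and> J' = j6) \<or>
    (f2 > 0 \<and> f2 > f5 \<and> f2 > f4 \<and> f2 > f3 \<and> f2 > f6 \<and> J' = j2) \<Longrightarrow> J = J'"
    for f5 f4 f3 f6 f2 :: int and j1 j2 j3 j4 j5 j6 J J' :: inv8
    by (elim disjE conjE) (hypsubst; (rule refl | linarith))+
  show "mv I J \<Longrightarrow> mv I J' \<Longrightarrow> J = J'"
    unfolding mv_def Let_def I prod.case by (rule *)
qed

text \<open>With \<open>mv_det\<close> this makes \<open>mv\<close> a partial bijection, so two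
  pairs have equal invariants before a move exactly if they have them after it. Lowering moves are
  thereby covered too.\<close>

lemma mv_rev:
  assumes "mv I J" "mv I' J" shows "I = I'"
proof -
  obtain a1 b1 k1 x1 a2 b2 k2 x2 where I: "I = (a1, b1, k1, x1, a2, b2, k2, x2)" by (cases I) auto
  obtain a1' b1' k1' x1' a2' b2' k2' x2' where I': "I' = (a1', b1', k1', x1', a2', b2', k2', x2')" by (cases I') auto
  obtain a0 b0 k0 x0 a9 b9 k9 x9 where J: "J = (a0, b0, k0, x0, a9, b9, k9, x9)" by (cases J) auto
  show ?thesis using assms unfolding mv_def Let_def I I' J prod.case prod.inject by (smt (z3))
qed

text \<open>Used for the moves that change \<open>C\<close> or \<open>d\<close>, the arguments of
  \<open>th\<close> itself; splitting into these five regions keeps each arithmetic problem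
  small.\<close>

lemma level_cases:
  obtains "d \<le> C" "0 < th C d t" | "d \<le> C" "th C d t \<le> 0" "0 \<le> et C d t s" | "d \<le> C" "th C d t \<le> 0" "et C d t s < 0"
    | "C < d" "0 \<le> et C d t s" | "C < d" "et C d t s < 0"
  by linarith

context
  fixes a A b B c C d E :: int
  assumes nn: "0 \<le> a" "0 \<le> A" "0 \<le> b" "0 \<le> B" "0 \<le> c" "0 \<le> C" "0 \<le> d" "0 \<le> E"
begin

text \<open>\<open>L\<close> and \<open>R\<close> name the factor hit by \<open>e_i\<close>;
  \<open>U\<close> means that a letter \<open>i + 1\<close> becomes \<open>i\<close>,
  \<open>B\<close> that a letter \<open>-i\<close> becomes \<open>-(i + 1)\<close>. The invariance
  of \<open>tau\<close> in the second claim confines the effect of the move to these two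
  levels.\<close>

lemma mv_LU:
  assumes h: "C < c" "b + pos (E - d) < A + pos (c - C)"
  shows "mv (inv2 a A b B c C d E t s) (inv2 (a + 1) A b B (c - 1) C d E t s)"
    "tau A b B (tau C d E t s) (sig (c - 1) C d E t s) = tau A b B (tau C d E t s) (sig c C d E t s)"
proof -
  note p = pos_facts[of "E - d"] pos_facts[of "c - C"]
  note f = lev_facts[of A b "tau C d E t s" "sig c C d E t s" B a] lev_facts[of A b "tau C d E t s" "sig (c - 1) C d E t s" B "a + 1"]
    lev_facts[of C d t s E c] lev_facts[of C d t s E "c - 1"]
  show "mv (inv2 a A b B c C d E t s) (inv2 (a + 1) A b B (c - 1) C d E t s)"
    unfolding inv2_def Let_def mv_def prod.case prod.inject using nn h p f by (smt (z3))
  show "tau A b B (tau C d E t s) (sig (c - 1) C d E t s) = tau A b B (tau C d E t s) (sig c C d E t s)"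
    using nn h p f by (smt (z3))
qed

lemma mv_RB:
  assumes h: "d \<le> E" "A + pos (c - C) \<le> b + pos (E - d)"
  shows "mv (inv2 a A b B c C d E t s) (inv2 a A b (B - 1) c C d (E + 1) t s)"
    "tau A b (B - 1) (tau C d (E + 1) t s) (sig c C d (E + 1) t s) = tau A b B (tau C d E t s) (sig c C d E t s)"
proof -
  note p = pos_facts[of "E - d"] pos_facts[of "c - C"]
  note f = lev_facts[of A b "tau C d E t s" "sig c C d E t s" B a] lev_facts[of A b "tau C d (E + 1) t s" "sig c C d (E + 1) t s" "B - 1" a]
    lev_facts[of C d t s E c] lev_facts[of C d t s "E + 1" c]
  show "mv (inv2 a A b B c C d E t s) (inv2 a A b (B - 1) c C d (E + 1) t s)"
    unfolding inv2_def Let_def mv_def prod.case prod.inject using nn h p f by (smt (z3))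
  show "tau A b (B - 1) (tau C d (E + 1) t s) (sig c C d (E + 1) t s) = tau A b B (tau C d E t s) (sig c C d E t s)"
    using nn h p f by (smt (z3))
qed

lemma mv_LB:
  assumes h: "c \<le> C" "b + pos (E - d) < A + pos (c - C)"
  shows "mv (inv2 a A b B c C d E t s) (inv2 a (A - 1) b B c (C + 1) d E t s)"
    "tau (A - 1) b B (tau (C + 1) d E t s) (sig c (C + 1) d E t s) = tau A b B (tau C d E t s) (sig c C d E t s)"
proof -
  note p = pos_facts[of "E - d"] pos_facts[of "c - C"]
  note f = lev_facts[of A b "tau C d E t s" "sig c C d E t s" B a] lev_facts[of "A - 1" b "tau (C + 1) d E t s" "sig c (C + 1) d E t s" B a]
    lev_facts[of C d t s E c] lev_facts[of "C + 1" d t s E c]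
  show "mv (inv2 a A b B c C d E t s) (inv2 a (A - 1) b B c (C + 1) d E t s)"
    unfolding inv2_def Let_def mv_def prod.case prod.inject using nn h p f by (cases rule: level_cases[where C = C and d = d and t = t and s = s]) (smt (z3))+
  show "tau (A - 1) b B (tau (C + 1) d E t s) (sig c (C + 1) d E t s) = tau A b B (tau C d E t s) (sig c C d E t s)"
    using nn h p f by (cases rule: level_cases[where C = C and d = d and t = t and s = s]) (smt (z3))+
qed

lemma mv_RU:
  assumes h: "E < d" "A + pos (c - C) \<le> b + pos (E - d)"
  shows "mv (inv2 a A b B c C d E t s) (inv2 a A (b + 1) B c C (d - 1) E t s)"
    "tau A (b + 1) B (tau C (d - 1) E t s) (sig c C (d - 1) E t s) = tau A b B (tau C d E t s) (sig c C d E t s)"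
proof -
  note p = pos_facts[of "E - d"] pos_facts[of "c - C"]
  note f = lev_facts[of A b "tau C d E t s" "sig c C d E t s" B a] lev_facts[of A "b + 1" "tau C (d - 1) E t s" "sig c C (d - 1) E t s" B a]
    lev_facts[of C d t s E c] lev_facts[of C "d - 1" t s E c]
  show "mv (inv2 a A b B c C d E t s) (inv2 a A (b + 1) B c C (d - 1) E t s)"
    unfolding inv2_def Let_def mv_def prod.case prod.inject using nn h p f by (cases rule: level_cases[where C = C and d = d and t = t and s = s]) (smt (z3))+
  show "tau A (b + 1) B (tau C (d - 1) E t s) (sig c C (d - 1) E t s) = tau A b B (tau C d E t s) (sig c C d E t s)"
    using nn h p f by (cases rule: level_cases[where C = C and d = d and t = t and s = s]) (smt (z3))+
qed

lemma mv_eps_eq: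
  shows "mv_eps (inv2 a A b B c C d E t s) = 2 * (B + pos (d - E) + pos (A + pos (c - C) - b - pos (E - d)))"
proof -
  note f = lev_facts[of A b "tau C d E t s" "sig c C d E t s" B a] lev_facts[of C d t s E c]
  have p: "pos (d - E) = max (d - E) 0" "pos (c - C) = max (c - C) 0" "pos (E - d) = max (E - d) 0"
    "pos (A + pos (c - C) - b - pos (E - d)) = max (A + pos (c - C) - b - pos (E - d)) 0" by (simp_all add: pos_def)
  show ?thesis unfolding inv2_def Let_def mv_eps_def prod.case prod.inject using nn f p unfolding max_def by (smt (z3))
qed

end

text \<open>Interchanging \<open>1\<close> and \<open>-1\<close> in both rows realizes the diagram
  automorphism that exchanges the nodes 0 and 1. The level of \<open>\<plusminus>1\<close> is read
  last, and its invariants survive the interchange because of the last two assumptions, the final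
  conditions in \<open>rel\<close>.\<close>

lemma swap_inv:
  assumes "ia a A b T S = ia a' A' b' T' S'" "ib B A b T = ib B' A' b' T'" "ik A b T S = ik A' b' T' S'" "ix A b T S = ix A' b' T' S'"
    and "sig a' A' b' B' T' S' = - sig a A b B T S" and "tau A' b' B' T' S' = tau A b B T S + sig a A b B T S"
  shows "ia A a B T S = ia A' a' B' T' S'" "ib b a B T = ib b' a' B' T'" "ik a B T S = ik a' B' T' S'" "ix a B T S = ix a' B' T' S'"
    "tau a' B' b' T' S' = tau a B b T S + sig A a B b T S"
proof -
  note f = lev_facts[of A b T S B a] lev_facts[of A' b' T' S' B' a']
  note g = lev_facts[of a B T S b A] lev_facts[of a' B' T' S' b' A']
  show "ia A a B T S = ia A' a' B' T' S'" using assms f g by (smt (z3))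
  show "ib b a B T = ib b' a' B' T'" using assms f g by (smt (z3))
  show "ik a B T S = ik a' B' T' S'" using assms f g by (smt (z3))
  show "ix a B T S = ix a' B' T' S'" using assms f g by (smt (z3))
  show "tau a' B' b' T' S' = tau a B b T S + sig A a B b T S" using assms f g by (smt (z3))
qed

context
  fixes a A b B c C d E t s a' A' b' B' c' C' d' E' t' s' T S T' S' :: int
  assumes inv: "inv2 a A b B c C d E t s = inv2 a' A' b' B' c' C' d' E' t' s'"
    and TS: "T = tau C d E t s" "S = sig c C d E t s" "T' = tau C' d' E' t' s'" "S' = sig c' C' d' E' t' s'"
    and st: "sig a' A' b' B' T' S' = - sig a A b B T S" "tau A' b' B' T' S' = tau A b B T S + sig a A b B T S"
    and nn: "0 \<le> a" "0 \<le> A" "0 \<le> b" "0 \<le> B" "0 \<le> c" "0 \<le> C" "0 \<le> d" "0 \<le> E" "0 \<le> a'" "0 \<le> A'" "0 \<le> b'" "0 \<le> B'" "0 \<le> c'" "0 \<le> C'" "0 \<le> d'" "0 \<le> E'"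
begin

lemmas level_facts = lev_facts[of A b T S B a] lev_facts[of A' b' T' S' B' a'] lev_facts[of C d t s E c] lev_facts[of C' d' t' s' E' c'] lev_facts[of a B T S b A]
  pos_facts[of "E - d"] pos_facts[of "c - C"] pos_facts[of "E' - d'"] pos_facts[of "c' - C'"]

text \<open>The arguments \<open>a B b\<close> of \<open>tau\<close> instead of \<open>A b B\<close>
  mean that \<open>1\<close> and \<open>-1\<close> have been interchanged, so a move at node 1 here
  is a move at node 0 there. The four lemmas give the additive form of \<open>coenergy_step\<close>,
  with the primed letters those of the image.\<close>

lemma H_LU:
  assumes h: "C < c" "b + pos (E - d) < A + pos (c - C)"
  shows "tau a B b T S - tau (a + 1) B b (tau C d E t s) (sig (c - 1) C d E t s) = (if b' + pos (E' - d') < A' + pos (c' - C') then 1 else 0)"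
proof -
  note f = level_facts lev_facts[of "a + 1" B "tau C d E t s" "sig (c - 1) C d E t s" b A] lev_facts[of C d t s E "c - 1"]
  show ?thesis
    using inv unfolding inv2_def Let_def prod.inject TS[symmetric] using TS st nn h f by (smt (z3))
qed

lemma H_RB:
  assumes h: "d \<le> E" "A + pos (c - C) \<le> b + pos (E - d)"
  shows "tau a B b T S - tau a (B - 1) b (tau C d (E + 1) t s) (sig c C d (E + 1) t s) = (if b' + pos (E' - d') < A' + pos (c' - C') then 1 else 0) - 1"
proof -
  note f = level_facts lev_facts[of a "B - 1" "tau C d (E + 1) t s" "sig c C d (E + 1) t s" b A] lev_facts[of C d t s "E + 1" c]
  show ?thesis
    using inv unfolding inv2_def Let_def prod.inject TS[symmetric] using TS st nn h f by (smt (z3))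
qed

lemma H_LB:
  assumes h: "c \<le> C" "b + pos (E - d) < A + pos (c - C)"
  shows "tau a B b T S - tau a B b (tau (C + 1) d E t s) (sig c (C + 1) d E t s) = (if b' + pos (E' - d') < A' + pos (c' - C') then 1 else 0)"
proof -
  note f = level_facts lev_facts[of a B "tau (C + 1) d E t s" "sig c (C + 1) d E t s" b A] lev_facts[of "C + 1" d t s E c]
  show ?thesis
    using inv unfolding inv2_def Let_def prod.inject TS[symmetric] using TS st nn h f by (cases rule: level_cases[where C = C and d = d and t = t and s = s]) (smt (z3))+
qed

lemma H_RU:
  assumes h: "E < d" "A + pos (c - C) \<le> b + pos (E - d)"
  shows "tau a B b T S - tau a B (b + 1) (tau C (d - 1) E t s) (sig c C (d - 1) E t s) = (if b' + pos (E' - d') < A' + pos (c' - C') then 1 else 0) - 1"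
proof -
  note f = level_facts lev_facts[of a B "tau C (d - 1) E t s" "sig c C (d - 1) E t s" "b + 1" A] lev_facts[of C "d - 1" t s E c]
  show ?thesis
    using inv unfolding inv2_def Let_def prod.inject TS[symmetric] using TS st nn h f by (cases rule: level_cases[where C = C and d = d and t = t and s = s]) (smt (z3))+
qed

end

section \<open>The fork of type D at the nodes \<open>n - 1\<close> and \<open>n\<close>\<close>

definition tau_end :: "int \<Rightarrow> int \<Rightarrow> int \<Rightarrow> int \<Rightarrow> int" where "tau_end g G h I = h + I - 2 * min G h - 2 * min g I"
definition sig_end :: "int \<Rightarrow> int \<Rightarrow> int \<Rightarrow> int \<Rightarrow> int" where "sig_end g G h I = g + G - h - I"

text \<open>The \<epsilon> of a pair at node \<open>n - 1\<close>, as \<open>peps_fork\<close>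
  shows, if neither row contains both \<open>n\<close> and \<open>-n\<close>. Interchanging
  \<open>g\<close> with \<open>G\<close> and \<open>h\<close> with \<open>I\<close> gives node
  \<open>n\<close>; \<open>fork_f\<close> is the corresponding \<phi>.\<close>

definition fork_e :: "int \<Rightarrow> int \<Rightarrow> int \<Rightarrow> int \<Rightarrow> int \<Rightarrow> int \<Rightarrow> int" where
  "fork_e C d E g h I = E + h + pos (C + g - d - I)"
definition fork_f :: "int \<Rightarrow> int \<Rightarrow> int \<Rightarrow> int \<Rightarrow> int \<Rightarrow> int \<Rightarrow> int" where
  "fork_f c C d g G I = c + G + pos (d + I - C - g)"

lemma fork_max: "fork_e C d E g h I = E + h + max (C + g - d - I) 0" "fork_f c C d g G I = c + G + max (d + I - C - g) 0"
  by (simp_all add: fork_e_def fork_f_def pos_def)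

text \<open>The counterpart of \<open>mv\<close> at node \<open>n - 2\<close>. The last four entries
  are the string lengths at the two fork nodes, which take the place of the invariants of the level
  above.\<close>

definition mvD :: "inv8 \<Rightarrow> inv8 \<Rightarrow> bool" where
  "mvD I J \<longleftrightarrow> (case I of (a1, b1, k1, x1, e, f, e', f') \<Rightarrow> let u = f - e - x1; v = f' - e' - x1 in
    (u \<le> 0 \<and> v \<le> 0 \<and> u + v + 2*k1 \<le> 0 \<and> J = (a1, b1-1, k1+1, x1+1, e+1, f, e'+1, f')) \<or>
    (u > 0 \<and> v \<le> 0 \<and> v + 2*k1 \<le> 0 \<and> J = (a1, b1, k1, x1+1, e, f-1, e'+1, f')) \<or>
    (v > 0 \<and> u \<le> 0 \<and> u + 2*k1 \<le> 0 \<and> J = (a1, b1, k1, x1+1, e+1, f, e', f'-1)) \<or>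
    (u > 0 \<and> v > 0 \<and> k1 \<le> 0 \<and> J = (a1, b1+1, k1-1, x1+1, e, f-1, e', f'-1)) \<or>
    (u + v + 2*k1 > 0 \<and> u + 2*k1 > 0 \<and> v + 2*k1 > 0 \<and> k1 > 0 \<and> J = (a1+1, b1, k1-1, x1-1, e, f-1, e', f'-1)))"

definition mvD_eps :: "inv8 \<Rightarrow> int" where
  "mvD_eps I = (case I of (a1, b1, k1, x1, e, f, e', f') \<Rightarrow> let u = f - e - x1; v = f' - e' - x1 in
    2*b1 + max 0 (max u (max v (max (u + v) (u + v + 2*k1)))))"

definition invD :: "int \<Rightarrow> int \<Rightarrow> int \<Rightarrow> int \<Rightarrow> int \<Rightarrow> int \<Rightarrow> int \<Rightarrow> int \<Rightarrow> int \<Rightarrow> int \<Rightarrow> int \<Rightarrow> int \<Rightarrow> inv8" where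
  "invD a A b B c C d E g G h I = (let t = tau_end g G h I; s = sig_end g G h I; T = tau C d E t s; S = sig c C d E t s in
    (ia a A b T S, ib B A b T, ik A b T S, ix A b T S, fork_e C d E g h I, fork_f c C d g G I, fork_e C d E G I h, fork_f c C d G g h))"

lemma mvD_det: "mvD I J \<Longrightarrow> mvD I J' \<Longrightarrow> J = J'"
proof -
  obtain a1 b1 k1 x1 e f e' f' where I: "I = (a1, b1, k1, x1, e, f, e', f')" by (cases I) auto
  show "mvD I J \<Longrightarrow> mvD I J' \<Longrightarrow> J = J'"
    unfolding mvD_def Let_def I prod.case by (elim disjE conjE) ((hypsubst, rule refl) | linarith)+
qed

lemma mvD_rev:
  assumes "mvD I J" "mvD I' J" shows "I = I'"
proof -
  obtain a1 b1 k1 x1 a2 b2 k2 x2 where I: "I = (a1, b1, k1, x1, a2, b2, k2, x2)" by (cases I) auto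
  obtain a1' b1' k1' x1' a2' b2' k2' x2' where I': "I' = (a1', b1', k1', x1', a2', b2', k2', x2')" by (cases I') auto
  obtain a0 b0 k0 x0 a9 b9 k9 x9 where J: "J = (a0, b0, k0, x0, a9, b9, k9, x9)" by (cases J) auto
  show ?thesis using assms unfolding mvD_def Let_def I I' J prod.case prod.inject by (smt (z3))
qed

context
  fixes a A b B c C d E g G h I t s :: int
  assumes nn: "0 \<le> a" "0 \<le> A" "0 \<le> b" "0 \<le> B" "0 \<le> c" "0 \<le> C" "0 \<le> d" "0 \<le> E" "0 \<le> g" "0 \<le> G" "0 \<le> h" "0 \<le> I" "g = 0 \<or> G = 0" "h = 0 \<or> I = 0"
  defines "t \<equiv> tau_end g G h I" and "s \<equiv> sig_end g G h I"
begin

lemma end_values: "t = h + I - 2 * (if g \<le> I then g else I) - 2 * (if G \<le> h then G else h)" "s = g + G - h - I"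
  by (simp_all add: t_def s_def tau_end_def sig_end_def min_def)

lemma mvD_LU:
  assumes h: "C < c" "b + pos (E - d) < A + pos (c - C)"
  shows "mvD (invD a A b B c C d E g G h I) (invD (a + 1) A b B (c - 1) C d E g G h I)"
proof -
  note p = pos_facts[of "E - d"] pos_facts[of "c - C"]
  note f = lev_facts[of A b "tau C d E t s" "sig c C d E t s" B a] lev_facts[of A b "tau C d E t s" "sig (c - 1) C d E t s" B "a + 1"]
    lev_facts[of C d t s E c] lev_facts[of C d t s E "c - 1"]
  show ?thesis unfolding invD_def Let_def t_def[symmetric] s_def[symmetric] mvD_def fork_max prod.case prod.inject max_def
    using nn h end_values p f by (smt (z3))
qed

lemma mvD_RB:
  assumes h: "d \<le> E" "A + pos (c - C) \<le> b + pos (E - d)"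
  shows "mvD (invD a A b B c C d E g G h I) (invD a A b (B - 1) c C d (E + 1) g G h I)"
proof -
  note p = pos_facts[of "E - d"] pos_facts[of "c - C"]
  note f = lev_facts[of A b "tau C d E t s" "sig c C d E t s" B a] lev_facts[of A b "tau C d (E + 1) t s" "sig c C d (E + 1) t s" "B - 1" a]
    lev_facts[of C d t s E c] lev_facts[of C d t s "E + 1" c]
  show ?thesis unfolding invD_def Let_def t_def[symmetric] s_def[symmetric] mvD_def fork_max prod.case prod.inject max_def
    using nn h end_values p f by (smt (z3))
qed

lemma mvD_LB:
  assumes h: "c \<le> C" "b + pos (E - d) < A + pos (c - C)"
  shows "mvD (invD a A b B c C d E g G h I) (invD a (A - 1) b B c (C + 1) d E g G h I)"
proof -
  note p = pos_facts[of "E - d"] pos_facts[of "c - C"]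
  note f = lev_facts[of A b "tau C d E t s" "sig c C d E t s" B a] lev_facts[of "A - 1" b "tau (C + 1) d E t s" "sig c (C + 1) d E t s" B a]
    lev_facts[of C d t s E c] lev_facts[of "C + 1" d t s E c]
  show ?thesis unfolding invD_def Let_def t_def[symmetric] s_def[symmetric] mvD_def fork_max prod.case prod.inject max_def
    using nn h end_values p f by (cases rule: level_cases[where C = C and d = d and t = t and s = s]) (smt (z3))+
qed

lemma mvD_RU:
  assumes h: "E < d" "A + pos (c - C) \<le> b + pos (E - d)"
  shows "mvD (invD a A b B c C d E g G h I) (invD a A (b + 1) B c C (d - 1) E g G h I)"
proof -
  note p = pos_facts[of "E - d"] pos_facts[of "c - C"]
  note f = lev_facts[of A b "tau C d E t s" "sig c C d E t s" B a] lev_facts[of A "b + 1" "tau C (d - 1) E t s" "sig c C (d - 1) E t s" B a]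
    lev_facts[of C d t s E c] lev_facts[of C "d - 1" t s E c]
  show ?thesis unfolding invD_def Let_def t_def[symmetric] s_def[symmetric] mvD_def fork_max prod.case prod.inject max_def
    using nn h end_values p f by (cases rule: level_cases[where C = C and d = d and t = t and s = s]) (smt (z3))+
qed

lemma mvD_eps_eq: "mvD_eps (invD a A b B c C d E g G h I) = 2 * (B + pos (d - E) + pos (A + pos (c - C) - b - pos (E - d)))"
proof -
  note f = lev_facts[of A b "tau C d E t s" "sig c C d E t s" B a] lev_facts[of C d t s E c]
  have p: "pos (d - E) = max (d - E) 0" "pos (c - C) = max (c - C) 0" "pos (E - d) = max (E - d) 0"
    "pos (A + pos (c - C) - b - pos (E - d)) = max (A + pos (c - C) - b - pos (E - d)) 0" by (simp_all only: pos_def)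
  show ?thesis unfolding invD_def Let_def t_def[symmetric] s_def[symmetric] mvD_eps_def fork_max prod.case
    using nn end_values f p unfolding max_def by (smt (z3))
qed

end

text \<open>The string lengths at the fork nodes carry enough information to control the level of
  \<open>\<plusminus>(n - 1)\<close>, so a relation may record them in place of the invariants of
  that level.\<close>

lemma end_gen:
  assumes "fork_e C d E g h I = fork_e C' d' E' g' h' I'" "fork_f c C d g G I = fork_f c' C' d' g' G' I'"
    "fork_e C d E G I h = fork_e C' d' E' G' I' h'" "fork_f c C d G g h = fork_f c' C' d' G' g' h'"
    and nn: "0 \<le> g" "0 \<le> G" "0 \<le> h" "0 \<le> I" "g = 0 \<or> G = 0" "h = 0 \<or> I = 0"
     "0 \<le> g'" "0 \<le> G'" "0 \<le> h'" "0 \<le> I'" "g' = 0 \<or> G' = 0" "h' = 0 \<or> I' = 0"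
    and t: "t = tau_end g G h I" "s = sig_end g G h I" "t' = tau_end g' G' h' I'" "s' = sig_end g' G' h' I'"
  shows "ia c C d t s = ia c' C' d' t' s'" "ib E C d t = ib E' C' d' t'" "ik C d t s = ik C' d' t' s'" "ix C d t s = ix C' d' t' s'"
proof -
  note f = lev_facts[of C d t s E c] lev_facts[of C' d' t' s' E' c']
  note ts = t[unfolded tau_end_def sig_end_def min_def]
  note e = assms(1-4)[unfolded fork_max max_def]
  note k = e ts nn f
  show "ia c C d t s = ia c' C' d' t' s'" using k by (smt (z3))
  show "ib E C d t = ib E' C' d' t'" using k by (smt (z3))
  show "ik C d t s = ik C' d' t' s'" using k by (smt (z3))
  show "ix C d t s = ix C' d' t' s'" using k by (smt (z3))
qed

text \<open>A move at node \<open>n - 1\<close> changes the letters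
  \<open>\<plusminus>(n - 1)\<close> and \<open>\<plusminus>n\<close> together, so only the state
  after both levels can be compared. The four lemmas below are the four ways to hit a factor and a
  letter.\<close>

definition fork_step :: "int \<Rightarrow> int \<Rightarrow> int \<Rightarrow> int \<Rightarrow> int \<Rightarrow> int \<Rightarrow> int \<Rightarrow> int \<Rightarrow> int \<Rightarrow> int \<Rightarrow> int \<Rightarrow> int \<Rightarrow> int \<Rightarrow> int \<Rightarrow> int \<Rightarrow> int \<Rightarrow> bool" where
  "fork_step c C d E g G h I c' C' d' E' g' G' h' I' \<longleftrightarrow>
     fork_e C' d' E' g' h' I' = fork_e C d E g h I - 1 \<and> fork_f c' C' d' g' G' I' = fork_f c C d g G I + 1 \<and>
     fork_e C' d' E' G' I' h' = fork_e C d E G I h \<and> fork_f c' C' d' G' g' h' = fork_f c C d G g h \<and>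
     tau C' d' E' (tau_end g' G' h' I') (sig_end g' G' h' I') = tau C d E (tau_end g G h I) (sig_end g G h I) \<and>
     sig c' C' d' E' (tau_end g' G' h' I') (sig_end g' G' h' I') = sig c C d E (tau_end g G h I) (sig_end g G h I)"

context
  fixes c C d E g G h I :: int
  assumes nn: "0 \<le> g" "0 \<le> G" "0 \<le> h" "0 \<le> I" "g = 0 \<or> G = 0" "h = 0 \<or> I = 0"
begin

lemma fork_step_1:
  assumes "d + I < C + g" "g > 0"
  shows "fork_step c C d E g G h I (c+1) C d E (g-1) G h I"
proof -
  define t s t' s' where t: "t = tau_end g G h I" "s = sig_end g G h I" "t' = tau_end (g-1) G h I" "s' = sig_end (g-1) G h I"
  note ts = t[unfolded tau_end_def sig_end_def min_def]
  note f = lev_facts[of C d t s E c] lev_facts[of "C" "d" t' s' "E" "c+1"]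
  show ?thesis
    unfolding fork_step_def t[symmetric] fork_max max_def
  proof (intro conjI)
    show "tau C d E t' s' = tau C d E t s" using nn assms ts f by (smt (z3))
    show "sig (c+1) C d E t' s' = sig c C d E t s" using nn assms ts f by (smt (z3))
  qed (use nn assms in \<open>smt (z3)\<close>)+
qed

lemma fork_step_2:
  assumes "d + I < C + g" "g = 0"
  shows "fork_step c C d E g G h I c (C-1) d E g (G+1) h I"
proof -
  define t s t' s' where t: "t = tau_end g G h I" "s = sig_end g G h I" "t' = tau_end g (G+1) h I" "s' = sig_end g (G+1) h I"
  note ts = t[unfolded tau_end_def sig_end_def min_def]
  note f = lev_facts[of C d t s E c] lev_facts[of "C-1" "d" t' s' "E" "c"]
  show ?thesis
    unfolding fork_step_def t[symmetric] fork_max max_def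
  proof (intro conjI)
    show "tau (C-1) d E t' s' = tau C d E t s" using nn assms ts f by (smt (z3))
    show "sig c (C-1) d E t' s' = sig c C d E t s" using nn assms ts f by (smt (z3))
  qed (use nn assms in \<open>smt (z3)\<close>)+
qed

lemma fork_step_3:
  assumes "C + g \<le> d + I" "h > 0"
  shows "fork_step c C d E g G h I c C (d+1) E g G (h-1) I"
proof -
  define t s t' s' where t: "t = tau_end g G h I" "s = sig_end g G h I" "t' = tau_end g G (h-1) I" "s' = sig_end g G (h-1) I"
  note ts = t[unfolded tau_end_def sig_end_def min_def]
  note f = lev_facts[of C d t s E c] lev_facts[of "C" "d+1" t' s' "E" "c"]
  show ?thesis
    unfolding fork_step_def t[symmetric] fork_max max_def
  proof (intro conjI)
    show "tau C (d+1) E t' s' = tau C d E t s" using nn assms ts f by (smt (z3))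
    show "sig c C (d+1) E t' s' = sig c C d E t s" using nn assms ts f by (smt (z3))
  qed (use nn assms in \<open>smt (z3)\<close>)+
qed

lemma fork_step_4:
  assumes "C + g \<le> d + I" "h = 0"
  shows "fork_step c C d E g G h I c C d (E-1) g G h (I+1)"
proof -
  define t s t' s' where t: "t = tau_end g G h I" "s = sig_end g G h I" "t' = tau_end g G h (I+1)" "s' = sig_end g G h (I+1)"
  note ts = t[unfolded tau_end_def sig_end_def min_def]
  note f = lev_facts[of C d t s E c] lev_facts[of "C" "d" t' s' "E-1" "c"]
  show ?thesis
    unfolding fork_step_def t[symmetric] fork_max max_def
  proof (intro conjI)
    show "tau C d (E-1) t' s' = tau C d E t s" using nn assms ts f by (smt (z3))
    show "sig c C d (E-1) t' s' = sig c C d E t s" using nn assms ts f by (smt (z3))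
  qed (use nn assms in \<open>smt (z3)\<close>)+
qed

end

text \<open>Here \<open>s\<close> and \<open>t\<close> are the letters read so far on the left and
  on the right, and \<open>h\<close> is the deficit of \<open>tau\<close> against \<open>t\<close>.
  The new deficit is a minimum of terms that are nonnegative together with \<open>s\<close>,
  \<open>t\<close>, \<open>h\<close>, plus twice a letter count.\<close>

lemma tau_coenergy:
  "b + B + t - tau A b B (t - h) (s - t) = min (min (s + pos (A - b)) (h + \<bar>A - b\<bar>)) (t + pos (b - A)) + 2 * min A b"
  unfolding tau_def et_def th_def pos_def max_def min_def by (smt (z3))

context
  fixes a A b B T S a' A' b' B' T' S' :: int
  assumes inv: "ia a A b T S = ia a' A' b' T' S'" "ib B A b T = ib B' A' b' T'" "ik A b T S = ik A' b' T' S'" "ix A b T S = ix A' b' T' S'"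
    and st: "sig a' A' b' B' T' S' = - sig a A b B T S" "tau A' b' B' T' S' = tau A b B T S + sig a A b B T S"
begin

text \<open>This lets the padding be stripped: \<open>B\<close> and \<open>B'\<close> count the
  letters \<open>-1\<close> of the two right rows, and positive \<open>sig\<close> says that the
  left row is the longer one.\<close>

lemma lowest_mono:
  assumes "0 < sig a A b B T S" shows "B \<le> B'"
  using inv st assms lev_facts[of A b T S B a] lev_facts[of A' b' T' S' B' a'] by (smt (z3))

text \<open>Embedded rows with virtual letters contain \<open>1\<close> and \<open>-1\<close>
  equally often. Under this symmetry the difference of \<open>b'\<close> and the final
  \<open>tau\<close> is a function of the unprimed data before the last level.\<close>

lemma virtual_depth:
  assumes "a = A" "b = B" "a' = A'" "b' = B'"
  shows "b' = tau A b B T S - T + A + min 0 (S + T + 2 * min 0 (A - b))"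
  using inv st assms lev_facts[of A b T S B a] lev_facts[of A' b' T' S' B' a'] unfolding min_def by (smt (z3))

text \<open>When \<open>\<plusminus>1\<close> are virtual, the letter \<open>-2\<close> takes over
  the role of \<open>-1\<close> in the padding, so the comparison has to reach one level
  further.\<close>

lemma virtual_lowest_mono:
  assumes "a = A" "b = B" "a' = A'" "b' = B'" "0 < sig a A b B T S"
    and i2: "ia c C d t s = ia c' C' d' t' s'" "ib E C d t = ib E' C' d' t'" "ik C d t s = ik C' d' t' s'" "ix C d t s = ix C' d' t' s'"
    and TS: "T = tau C d E t s" "S = sig c C d E t s" "T' = tau C' d' E' t' s'" "S' = sig c' C' d' E' t' s'"
    and nn: "0 \<le> a" "0 \<le> b" "0 \<le> a'" "0 \<le> b'"
  shows "E \<le> E'"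
  using inv st assms lev_facts[of A b T S B a] lev_facts[of A' b' T' S' B' a'] lev_facts[of C d t s E c] lev_facts[of C' d' t' s' E' c']
  by (smt (z3))

end

section \<open>Single rows\<close>

definition row_eps :: "affine_type \<Rightarrow> nat \<Rightarrow> nat \<Rightarrow> nat \<Rightarrow> row \<Rightarrow> int" where
  "row_eps X n s i b =
    (if X = A1 then (if i = 0 then b 1 else b (int i + 1))
     else if i = 0 then
       (if X \<in> {B1, D1, A2_odd} then b 1 + pos (b 2 - b (-2))
        else if X \<in> {A2_even, D2} then int s - row_size X n b + 2 * pos (b 1 - b (-1))
        else (int s - row_size X n b) div 2 + pos (b 1 - b (-1)))
     else if i = n then
       (if X \<in> {C1, A2_odd, A2_even} then b (- int n)
        else if X = D1 then b (- (int n - 1)) + b (- int n) else 2 * b (- int n) + b 0)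
     else b (- int i) + pos (b (int i + 1) - b (- (int i + 1))))"

definition row_phi :: "affine_type \<Rightarrow> nat \<Rightarrow> nat \<Rightarrow> nat \<Rightarrow> row \<Rightarrow> int" where
  "row_phi X n s i b =
    (if X = A1 then (if i = 0 then b (int n + 1) else b (int i))
     else if i = 0 then
       (if X \<in> {B1, D1, A2_odd} then b (-1) + pos (b (-2) - b 2)
        else if X \<in> {A2_even, D2} then int s - row_size X n b + 2 * pos (b (-1) - b 1)
        else (int s - row_size X n b) div 2 + pos (b (-1) - b 1))
     else if i = n then
       (if X \<in> {C1, A2_odd, A2_even} then b (int n)
        else if X = D1 then b (int n - 1) + b (int n) else 2 * b (int n) + b 0)
     else b (int i) + pos (b (- (int i + 1)) - b (int i + 1)))"

definition good_rank :: "affine_type \<Rightarrow> nat \<Rightarrow> bool" where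
  "good_rank X n \<longleftrightarrow> rank_ok X n \<or> X = D1 \<and> 3 \<le> n"

lemma finite_letters [simp]: "finite (letters X n)"
  by (simp add: letters_def)

lemma row_size_add [simp]: "l \<in> letters X n \<Longrightarrow> row_size X n (add_letter l d b) = row_size X n b + d"
proof -
  assume l: "l \<in> letters X n"
  have "row_size X n (add_letter l d b) = (b l + d) + (\<Sum>l\<in>letters X n - {l}. b l)"
    unfolding row_size_def using l by (subst sum.remove[of _ l]) (auto simp: add_letter_def intro!: sum.cong)
  moreover have "row_size X n b = b l + (\<Sum>l\<in>letters X n - {l}. b l)"
    unfolding row_size_def using l by (subst sum.remove[of _ l]) auto
  ultimately show ?thesis by simp
qed

lemma row_size_change [simp]: "p \<in> letters X n \<Longrightarrow> q \<in> letters X n \<Longrightarrow> row_size X n (change p q b) = row_size X n b"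
  by (simp add: change_def)

lemma change_apply: "change p q b l = b l + (if l = q then 1 else 0) - (if l = p then 1 else 0)"
  and add_letter_apply: "add_letter l d b k = b k + (if k = l then d else 0)"
  by (auto simp: change_def add_letter_def)

lemma change_change: "change q p (change p q b) = b"
  and add_add: "d + d' = 0 \<Longrightarrow> add_letter l d' (add_letter l d b) = b"
  by (auto simp: change_apply add_letter_apply fun_eq_iff)

lemma change_in:
  assumes "b \<in> KR_rows X n s" "p \<in> letters X n" "q \<in> letters X n" "p \<noteq> q"
  shows "change p q b \<in> KR_rows X n s \<longleftrightarrow> 0 < b p \<and> (X \<in> {B1, D2, A2_even_dagger} \<longrightarrow> change p q b 0 \<le> 1) \<and>
    (X = D1 \<longrightarrow> change p q b (int n) = 0 \<or> change p q b (- int n) = 0)"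
proof -
  have 1: "(\<forall>l. 0 \<le> change p q b l) \<longleftrightarrow> 0 < b p"
    using assms(1,4) unfolding KR_rows_def by (auto simp: change_apply split: if_splits)
  have 2: "\<forall>l. l \<notin> letters X n \<longrightarrow> change p q b l = 0"
    using assms unfolding KR_rows_def by (auto simp: change_apply)
  show ?thesis using assms(1) 1 2 row_size_change[OF assms(2,3)] unfolding KR_rows_def by auto
qed

lemma add_in:
  assumes "b \<in> KR_rows X n s" "l \<in> letters X n" "X \<noteq> D1" "l \<noteq> 0"
  shows "add_letter l d b \<in> KR_rows X n s \<longleftrightarrow> 0 \<le> b l + d \<and> size_ok X s (row_size X n b + d)"
proof -
  have 1: "(\<forall>k. 0 \<le> add_letter l d b k) \<longleftrightarrow> 0 \<le> b l + d"
    using assms(1) unfolding KR_rows_def by (auto simp: add_letter_apply split: if_splits)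
  have 2: "\<forall>k. k \<notin> letters X n \<longrightarrow> add_letter l d b k = 0" "add_letter l d b 0 = b 0"
    using assms unfolding KR_rows_def by (auto simp: add_letter_apply)
  show ?thesis using assms(1,3) 1 2 row_size_add[OF assms(2)] unfolding KR_rows_def by auto
qed

text \<open>The demands of \<open>regularI\<close> at one node, phrased with the total operations on
  integer rows: a move gives zero if it leaves \<open>KR_rows\<close>.\<close>

definition node_ok :: "affine_type \<Rightarrow> nat \<Rightarrow> nat \<Rightarrow> nat \<Rightarrow> row \<Rightarrow> bool" where
  "node_ok X n s i b \<longleftrightarrow>
    0 \<le> row_eps X n s i b \<and> 0 \<le> row_phi X n s i b \<and>
    (e_row X n i b \<in> KR_rows X n s \<longleftrightarrow> 0 < row_eps X n s i b) \<and>
    (f_row X n i b \<in> KR_rows X n s \<longleftrightarrow> 0 < row_phi X n s i b) \<and>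
    (0 < row_eps X n s i b \<longrightarrow> f_row X n i (e_row X n i b) = b \<and>
      row_eps X n s i (e_row X n i b) = row_eps X n s i b - 1 \<and> row_phi X n s i (e_row X n i b) = row_phi X n s i b + 1) \<and>
    (0 < row_phi X n s i b \<longrightarrow> e_row X n i (f_row X n i b) = b)"

lemma rows_nonneg: "b \<in> KR_rows X n s \<Longrightarrow> 0 \<le> b l" by (simp add: KR_rows_def)

lemma node_ok_A1:
  assumes b: "b \<in> KR_rows A1 n s" and i: "i \<le> n" "1 \<le> n"
  shows "node_ok A1 n s i b"
proof -
  have l: "l \<in> letters A1 n \<longleftrightarrow> 1 \<le> l \<and> l \<le> int n + 1" for l by (simp add: letters_def)
  note nn = rows_nonneg[OF b]
  show ?thesis
  proof (cases "i = 0")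
    case True
    then show ?thesis using i nn
      by (simp add: node_ok_def row_eps_def row_phi_def e_row_def f_row_def e_zero_def f_zero_def change_in[OF b] l change_change change_apply)
  next
    case False
    then have "e_row A1 n i b = change (int i + 1) (int i) b" "f_row A1 n i b = change (int i) (int i + 1) b" for b
      using i by (auto simp: e_row_def f_row_def e_last_def f_last_def e_mid_def f_mid_def)
    then show ?thesis using i nn False
      by (simp add: node_ok_def row_eps_def row_phi_def change_in[OF b] l change_change change_apply)
  qed
qed

context
  fixes X n s b assumes X: "X \<noteq> A1" "good_rank X n" and b: "b \<in> KR_rows X n s"
begin

lemma letters_iff: "l \<in> letters X n \<longleftrightarrow> - int n \<le> l \<and> l \<le> int n \<and> (X \<in> {B1, D2, A2_even_dagger} \<or> l \<noteq> 0)"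
  using X by (auto simp: letters_def)

lemma nn: "0 \<le> b l" using b by (simp add: KR_rows_def)

lemma node_ok_mid:
  assumes i: "1 \<le> i" "i < n"
  shows "node_ok X n s i b"
proof -
  obtain j where j: "int i = j" by blast
  have jn: "1 \<le> j" "j + 1 \<le> int n" using i j by auto
  have l: "j \<in> letters X n" "j + 1 \<in> letters X n" "- j \<in> letters X n" "- (j + 1) \<in> letters X n"
    using jn by (auto simp: letters_iff)
  have D: "X = D1 \<Longrightarrow> b (int n) = 0 \<or> b (- int n) = 0" and D0: "X \<in> {B1, D2, A2_even_dagger} \<Longrightarrow> b 0 \<le> 1"
    using b by (auto simp: KR_rows_def)
  note r = e_row_def f_row_def e_mid_def f_mid_def j X
  have E: "e_row X n i b = (if b (j + 1) > b (- (j + 1)) then change (j + 1) j b else change (- j) (- (j + 1)) b)"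
    "f_row X n i b = (if b (j + 1) \<ge> b (- (j + 1)) then change j (j + 1) b else change (- (j + 1)) (- j) b)" for b
    using i by (simp_all add: r)
  have ep: "row_eps X n s i b = b (- j) + pos (b (j + 1) - b (- (j + 1)))" "row_phi X n s i b = b j + pos (b (- (j + 1)) - b (j + 1))" for b
    using i by (simp_all add: row_eps_def row_phi_def j X)
  note n4 = nn[of j] nn[of "j+1"] nn[of "-j"] nn[of "-(j+1)"]
  \<comment> \<open>For \<open>j + 1 = n\<close> in type D the comparison of letters also protects
    the condition that \<open>n\<close> and \<open>-n\<close> do not occur together.\<close>
  have i1: "change (j + 1) j b \<in> KR_rows X n s \<longleftrightarrow> 0 < b (j + 1)" if "b (j + 1) > b (- (j + 1))"
    using change_in[OF b l(2,1)] jn D D0 that nn[of "- int n"] by (cases "int n = j + 1") (auto simp: change_apply)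
  have i2: "change (- j) (- (j + 1)) b \<in> KR_rows X n s \<longleftrightarrow> 0 < b (- j)" if "b (j + 1) \<le> b (- (j + 1))"
    using change_in[OF b l(3,4)] jn D D0 that n4 by (cases "int n = j + 1") (auto simp: change_apply)
  have i3: "change j (j + 1) b \<in> KR_rows X n s \<longleftrightarrow> 0 < b j" if "b (j + 1) \<ge> b (- (j + 1))"
    using change_in[OF b l(1,2)] jn D D0 that n4 by (cases "int n = j + 1") (auto simp: change_apply)
  have i4: "change (- (j + 1)) (- j) b \<in> KR_rows X n s \<longleftrightarrow> 0 < b (- (j + 1))" if "b (j + 1) < b (- (j + 1))"
    using change_in[OF b l(4,3)] jn D D0 that n4 by (cases "int n = j + 1") (auto simp: change_apply)
  show ?thesis
    unfolding node_ok_def ep E using n4 jn i1 i2 i3 i4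
    by (cases "b (j + 1) > b (- (j + 1))"; cases "b (j + 1) = b (- (j + 1))")
      (auto simp: pos_def change_change change_apply)
qed

lemma node_ok_last:
  shows "node_ok X n s n b"
proof -
  have n: "1 \<le> int n" using X by (cases X) (auto simp: good_rank_def)
  have DD: "X = D1 \<Longrightarrow> (b (int n) = 0 \<or> b (- int n) = 0) \<and> 3 \<le> int n" and D0: "X \<in> {B1, D2, A2_even_dagger} \<Longrightarrow> b 0 \<le> 1"
    using b X by (auto simp: KR_rows_def good_rank_def)
  obtain m where m: "int n = m" by blast
  note n4 = nn[of m] nn[of "- m"] nn[of "m - 1"] nn[of "- (m - 1)"] nn[of 0]
  note n = n[unfolded m]
  have nz: "n \<noteq> 0" using n m by auto
  consider (C) "X \<in> {C1, A2_odd, A2_even}" | (D) "X = D1" | (B) "X \<in> {B1, D2, A2_even_dagger}"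
    using X by (cases X) auto
  then show ?thesis
  proof cases
    case C
    have E: "e_row X n n b = change (- m) m b" "f_row X n n b = change m (- m) b" for b
      using C X nz by (auto simp: e_row_def f_row_def e_last_def f_last_def m)
    have ep: "row_eps X n s n b = b (- m)" "row_phi X n s n b = b m" for b
      using C X nz by (auto simp: row_eps_def row_phi_def m)
    have l: "m \<in> letters X n" "- m \<in> letters X n" using n by (auto simp: letters_iff m)
    show ?thesis unfolding node_ok_def ep E
      using change_in[OF b l(1,2)] change_in[OF b l(2,1)] n n4 C by (auto simp: change_change change_apply)
  next
    case D
    have E: "e_row X n n b = (if b (- m) = 0 then change (- (m - 1)) m b else change (- m) (m - 1) b)"
      "f_row X n n b = (if b m \<ge> 1 then change m (- (m - 1)) b else change (m - 1) (- m) b)" for b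
      using D X nz by (auto simp: e_row_def f_row_def e_last_def f_last_def m)
    have ep: "row_eps X n s n b = b (- (m - 1)) + b (- m)" "row_phi X n s n b = b (m - 1) + b m" for b
      using D X nz by (auto simp: row_eps_def row_phi_def m)
    have d: "b m = 0 \<or> b (- m) = 0" "3 \<le> m" using DD[OF D] m by auto
    have l: "m \<in> letters X n" "- m \<in> letters X n" "m - 1 \<in> letters X n" "- (m - 1) \<in> letters X n"
      using d by (auto simp: letters_iff m)
    have i: "change (- (m - 1)) m b \<in> KR_rows X n s \<longleftrightarrow> 0 < b (- (m - 1))" if "b (- m) = 0"
      using change_in[OF b l(4,1)] d D that n4 by (auto simp: change_apply m)
    have i2: "change (- m) (m - 1) b \<in> KR_rows X n s \<longleftrightarrow> 0 < b (- m)" if "b (- m) \<noteq> 0"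
      using change_in[OF b l(2,3)] d D that n4 by (auto simp: change_apply m)
    have i3: "change m (- (m - 1)) b \<in> KR_rows X n s \<longleftrightarrow> 0 < b m" if "b m \<ge> 1"
      using change_in[OF b l(1,4)] d D that n4 by (auto simp: change_apply m)
    have i4: "change (m - 1) (- m) b \<in> KR_rows X n s \<longleftrightarrow> 0 < b (m - 1)" if "b m = 0"
      using change_in[OF b l(3,2)] d D that n4 by (auto simp: change_apply m)
    show ?thesis unfolding node_ok_def ep E using i i2 i3 i4 d n4
      by (cases "b m = 0"; cases "b (- m) = 0") (auto simp: change_change change_apply)
  next
    case B
    have E: "e_row X n n b = (if b 0 = 0 then change (- m) 0 b else change 0 m b)"
      "f_row X n n b = (if b 0 = 0 then change m 0 b else change 0 (- m) b)" for b
      using B X nz by (auto simp: e_row_def f_row_def e_last_def f_last_def m)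
    have ep: "row_eps X n s n b = 2 * b (- m) + b 0" "row_phi X n s n b = 2 * b m + b 0" for b
      using B X nz by (auto simp: row_eps_def row_phi_def m)
    have l: "m \<in> letters X n" "- m \<in> letters X n" "0 \<in> letters X n" using n B by (auto simp: letters_iff m)
    have B': "X \<noteq> D1" using B by auto
    have i: "change (- m) 0 b \<in> KR_rows X n s \<longleftrightarrow> 0 < b (- m)" "change m 0 b \<in> KR_rows X n s \<longleftrightarrow> 0 < b m" if "b 0 = 0"
      using change_in[OF b l(2,3)] change_in[OF b l(1,3)] n B' that by (auto simp: change_apply)
    have i': "change 0 m b \<in> KR_rows X n s" "change 0 (- m) b \<in> KR_rows X n s" if "b 0 = 1"
      using change_in[OF b l(3,1)] change_in[OF b l(3,2)] n B' that by (auto simp: change_apply)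
    consider "b 0 = 0" | "b 0 = 1" using D0[OF B] n4 by linarith
    then show ?thesis
    proof cases
      case 1
      then show ?thesis unfolding node_ok_def ep E using i[OF 1] n4(1,2) n by (simp add: change_change change_apply)
    next
      case 2
      then show ?thesis unfolding node_ok_def ep E using i'[OF 2] n4(1,2) n by (simp add: change_change change_apply)
    qed
  qed
qed

lemma node_ok_zero:
  shows "node_ok X n s 0 b"
proof -
  have n: "1 \<le> n" using X by (cases X) (auto simp: good_rank_def)
  have sz: "size_ok X s (row_size X n b)" using b by (simp add: KR_rows_def)
  note n4 = nn[of 1] nn[of "- 1"] nn[of 2] nn[of "- 2"]
  consider (F) "X \<in> {B1, D1, A2_odd}" | (E) "X \<in> {A2_even, D2}" | (C) "X \<in> {C1, A2_even_dagger}"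
    using X by (cases X) auto
  then show ?thesis
  proof cases
    case F
    have n3: "3 \<le> n" using F X by (auto simp: good_rank_def)
    have E: "e_row X n 0 b = (if b 2 > b (-2) then change 2 (-1) b else change 1 (-2) b)"
      "f_row X n 0 b = (if b 2 \<ge> b (-2) then change (-1) 2 b else change (-2) 1 b)" for b
      using F X by (auto simp: e_row_def f_row_def e_zero_def f_zero_def)
    have ep: "row_eps X n s 0 b = b 1 + pos (b 2 - b (-2))" "row_phi X n s 0 b = b (-1) + pos (b (-2) - b 2)" for b
      using F X by (auto simp: row_eps_def row_phi_def)
    have l: "1 \<in> letters X n" "-1 \<in> letters X n" "2 \<in> letters X n" "-2 \<in> letters X n" using n3 by (auto simp: letters_iff)
    have D: "X = D1 \<Longrightarrow> b (int n) = 0 \<or> b (- int n) = 0" and D0: "X = B1 \<Longrightarrow> b 0 \<le> 1"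
      using b by (auto simp: KR_rows_def)
    have i: "change 2 (-1) b \<in> KR_rows X n s \<longleftrightarrow> 0 < b 2" "change 1 (-2) b \<in> KR_rows X n s \<longleftrightarrow> 0 < b 1"
      "change (-1) 2 b \<in> KR_rows X n s \<longleftrightarrow> 0 < b (-1)" "change (-2) 1 b \<in> KR_rows X n s \<longleftrightarrow> 0 < b (-2)"
      using change_in[OF b l(3,2)] change_in[OF b l(1,4)] change_in[OF b l(2,3)] change_in[OF b l(4,1)] D D0 n3 F
      by (auto simp: change_apply)
    show ?thesis unfolding node_ok_def ep E using i n4
      by (cases "b 2 > b (-2)"; cases "b 2 = b (-2)") (auto simp: pos_def change_change change_apply)
  next
    case E
    have l: "1 \<in> letters X n" "-1 \<in> letters X n" using n by (auto simp: letters_iff)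
    have E': "e_row X n 0 b = (if b 1 > b (-1) then add_letter 1 (-1) b else add_letter (-1) 1 b)"
      "f_row X n 0 b = (if b 1 \<ge> b (-1) then add_letter 1 1 b else add_letter (-1) (-1) b)" for b
      using E X by (auto simp: e_row_def f_row_def e_zero_def f_zero_def)
    have ep: "row_eps X n s 0 b = int s - row_size X n b + 2 * pos (b 1 - b (-1))"
      "row_phi X n s 0 b = int s - row_size X n b + 2 * pos (b (-1) - b 1)" for b
      using E X by (auto simp: row_eps_def row_phi_def)
    have so: "size_ok X s m \<longleftrightarrow> m \<le> int s" for m using E by (auto simp: size_ok_def)
    note i = add_in[OF b l(1), of "-1"] add_in[OF b l(1), of 1] add_in[OF b l(2), of "-1"] add_in[OF b l(2), of 1]
    show ?thesis unfolding node_ok_def ep E' using i n4 E sz l unfolding so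
      by (cases "b 1 > b (-1)"; cases "b 1 = b (-1)") (auto simp: pos_def add_add add_letter_apply)
  next
    case C
    have l: "1 \<in> letters X n" "-1 \<in> letters X n" using n by (auto simp: letters_iff)
    have E': "e_row X n 0 b = (if b 1 \<ge> b (-1) + 2 then add_letter 1 (-2) b
        else if b 1 = b (-1) + 1 then change 1 (-1) b else add_letter (-1) 2 b)"
      "f_row X n 0 b = (if b 1 \<ge> b (-1) then add_letter 1 2 b
        else if b 1 = b (-1) - 1 then change (-1) 1 b else add_letter (-1) (-2) b)" for b
      using C X by (auto simp: e_row_def f_row_def e_zero_def f_zero_def)
    have ev: "even (int s - row_size X n b)" "row_size X n b \<le> int s" using sz C unfolding size_ok_def by auto
    \<comment> \<open>In these types boxes are missing in pairs, and \<open>h\<close> is the number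
      of pairs that node 0 can still fill.\<close>
    obtain h where h: "int s - row_size X n b = 2 * h" using ev(1) by (rule evenE)
    then have h: "int s - row_size X n b = 2 * h" "0 \<le> h" using ev(2) by auto
    have ep: "row_eps X n s 0 b = (int s - row_size X n b) div 2 + pos (b 1 - b (-1))"
      "row_phi X n s 0 b = (int s - row_size X n b) div 2 + pos (b (-1) - b 1)" for b
      using C X by (auto simp: row_eps_def row_phi_def)
    have so: "size_ok X s (row_size X n b + 2) \<longleftrightarrow> 0 < h" "size_ok X s (row_size X n b + - 2)"
      using C h by (auto simp: size_ok_def) presburger+
    have s2: "(int s - (row_size X n b + 2)) div 2 = h - 1" "(int s - (row_size X n b - 2)) div 2 = h + 1" "(int s - row_size X n b) div 2 = h" using h by auto
    have z: "X \<in> {B1, D2, A2_even_dagger} \<Longrightarrow> b 0 \<le> 1" using b by (auto simp: KR_rows_def)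
    have sz': "row_size X n (add_letter 1 d b) = row_size X n b + d" "row_size X n (add_letter (-1) d b) = row_size X n b + d"
      "row_size X n (change 1 (-1) b) = row_size X n b" "row_size X n (change (-1) 1 b) = row_size X n b" for d using l by auto
    have XD: "X \<noteq> D1" using C by auto
    have m: "add_letter 1 (-2) b \<in> KR_rows X n s \<longleftrightarrow> 2 \<le> b 1" "add_letter (-1) (-2) b \<in> KR_rows X n s \<longleftrightarrow> 2 \<le> b (-1)"
      "add_letter 1 2 b \<in> KR_rows X n s \<longleftrightarrow> 0 < h" "add_letter (-1) 2 b \<in> KR_rows X n s \<longleftrightarrow> 0 < h"
      using add_in[OF b l(1) XD, of "-2"] add_in[OF b l(1) XD, of 2] add_in[OF b l(2) XD, of "-2"] add_in[OF b l(2) XD, of 2] so n4(1,2) by auto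
    have c: "change 1 (-1) b \<in> KR_rows X n s \<longleftrightarrow> 0 < b 1" "change (-1) 1 b \<in> KR_rows X n s \<longleftrightarrow> 0 < b (-1)"
      using change_in[OF b l] change_in[OF b l(2,1)] XD z by (auto simp: change_apply)
    note v = ep s2 sz' m c add_add change_change add_letter_apply change_apply
    consider "b 1 \<ge> b (-1) + 2" | "b 1 = b (-1) + 1" | "b 1 = b (-1)" | "b 1 = b (-1) - 1" | "b 1 \<le> b (-1) - 2" by linarith
    then show ?thesis
    proof cases
      case 1
      then show ?thesis unfolding node_ok_def E' using n4(1,2) h(2) by (simp add: v pos_def)
    next
      case 2
      then show ?thesis unfolding node_ok_def E' using n4(1,2) h(2) by (simp add: v pos_def)
    next
      case 3
      then show ?thesis unfolding node_ok_def E' using n4(1,2) h(2) by (simp add: v pos_def)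
    next
      case 4
      then show ?thesis unfolding node_ok_def E' using n4(1,2) h(2) by (simp add: v pos_def)
    next
      case 5
      then show ?thesis unfolding node_ok_def E' using n4(1,2) h(2) by (simp add: v pos_def)
    qed
  qed
qed

end

lemma node_ok: "good_rank X n \<Longrightarrow> b \<in> KR_rows X n s \<Longrightarrow> i \<le> n \<Longrightarrow> node_ok X n s i b"
  using node_ok_A1[of b n s i] node_ok_mid[of X n b s i] node_ok_last[of X n b s] node_ok_zero[of X n b s]
  by (cases "X = A1"; cases "i = 0"; cases "i = n") (auto simp: good_rank_def)

lemma row_size_le: "b \<in> KR_rows X n s \<Longrightarrow> 0 \<le> row_size X n b \<and> row_size X n b \<le> int s"
  unfolding KR_rows_def size_ok_def row_size_def by (auto intro: sum_nonneg split: if_splits)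

lemma finite_KR_rows: "finite (KR_rows X n s)"
proof (rule finite_subset)
  show "KR_rows X n s \<subseteq> {f. \<forall>x. (x \<in> letters X n \<longrightarrow> f x \<in> {0..int s}) \<and> (x \<notin> letters X n \<longrightarrow> f x = 0)}"
  proof (safe)
    fix b x assume b: "b \<in> KR_rows X n s" and x: "x \<in> letters X n"
    have "b x \<le> row_size X n b" unfolding row_size_def by (rule member_le_sum) (use b x in \<open>auto simp: KR_rows_def\<close>)
    then show "b x \<in> {0..int s}" using row_size_le[OF b] rows_nonneg[OF b] by auto
  qed (auto simp: KR_rows_def)
  show "finite {f. \<forall>x. (x \<in> letters X n \<longrightarrow> f x \<in> {0..int s}) \<and> (x \<notin> letters X n \<longrightarrow> f x = 0)}"
    by (rule finite_set_of_finite_funs) auto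
qed

definition power_row :: "int \<Rightarrow> nat \<Rightarrow> row" where "power_row l m = (\<lambda>k. if k = l then int m else 0)"

lemma row_size_power [simp]: "l \<in> letters X n \<Longrightarrow> row_size X n (power_row l m) = int m"
  by (simp add: row_size_def power_row_def)

lemma good_rank_pos: "good_rank X n \<Longrightarrow> 1 \<le> n"
  by (cases X) (auto simp: good_rank_def)

lemma power_row_in:
  "good_rank X n \<Longrightarrow> l \<in> letters X n \<Longrightarrow> l \<noteq> 0 \<Longrightarrow> size_ok X s (int m) \<Longrightarrow> power_row l m \<in> KR_rows X n s"
  by (auto simp: KR_rows_def power_row_def[of l m] row_size_def good_rank_def)

lemma one_letter: "1 \<le> n \<Longrightarrow> 1 \<in> letters X n" by (auto simp: letters_def)

lemma KR_simps [simp]: "carr (KR X n s) = KR_rows X n s" "uvec (KR X n s) = power_row 1 s"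
  "eop (KR X n s) i b = (if i \<le> n \<and> e_row X n i b \<in> KR_rows X n s then Some (e_row X n i b) else None)"
  "fop (KR X n s) i b = (if i \<le> n \<and> f_row X n i b \<in> KR_rows X n s then Some (f_row X n i b) else None)"
  by (simp_all add: KR_def power_row_def)

lemma KR_reg:
  assumes "good_rank X n"
  shows KR_regular: "regular {0..n} (KR X n s)"
    and KR_eps: "i \<le> n \<Longrightarrow> b \<in> KR_rows X n s \<Longrightarrow> int (eps (KR X n s) i b) = row_eps X n s i b"
    and KR_phi: "i \<le> n \<Longrightarrow> b \<in> KR_rows X n s \<Longrightarrow> int (phi (KR X n s) i b) = row_phi X n s i b"
proof -
  note ok = node_ok[OF assms, unfolded node_ok_def]
  have *: "regular {0..n} (KR X n s) \<and> (\<forall>i\<in>{0..n}. \<forall>b\<in>carr (KR X n s).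
    eps (KR X n s) i b = nat (row_eps X n s i b) \<and> phi (KR X n s) i b = nat (row_phi X n s i b))"
  proof (rule regularI)
    show "finite (carr (KR X n s))" by (simp add: finite_KR_rows)
    show "uvec (KR X n s) \<in> carr (KR X n s)"
      using power_row_in[OF assms one_letter[OF good_rank_pos[OF assms]], of s s] by (simp add: size_ok_def)
    fix i b assume i: "i \<in> {0..n}" and b: "b \<in> carr (KR X n s)"
    note o = ok[of b s i]
    show "eop (KR X n s) i b = None \<longleftrightarrow> nat (row_eps X n s i b) = 0" "fop (KR X n s) i b = None \<longleftrightarrow> nat (row_phi X n s i b) = 0"
      using o i b by auto
    fix b'
    show "b' \<in> carr (KR X n s) \<and> fop (KR X n s) i b' = Some b \<and>
       nat (row_eps X n s i b) = Suc (nat (row_eps X n s i b')) \<and> nat (row_phi X n s i b') = Suc (nat (row_phi X n s i b))"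
      if "eop (KR X n s) i b = Some b'"
    proof -
      have b': "b' = e_row X n i b" "b' \<in> KR_rows X n s" "i \<le> n" using that by (auto split: if_splits)
      then show ?thesis using o ok[OF b'(2,3)] b by auto
    qed
    show "b' \<in> carr (KR X n s) \<and> eop (KR X n s) i b' = Some b" if "fop (KR X n s) i b = Some b'"
      using o b that by (auto split: if_splits)
  qed
  then show "regular {0..n} (KR X n s)" by blast
  show "i \<le> n \<Longrightarrow> b \<in> KR_rows X n s \<Longrightarrow> int (eps (KR X n s) i b) = row_eps X n s i b"
    "i \<le> n \<Longrightarrow> b \<in> KR_rows X n s \<Longrightarrow> int (phi (KR X n s) i b) = row_phi X n s i b"
    using * ok[of b s i] by auto
qed

section \<open>Raising rows to \<open>uvec\<close>, and the rigidity of \<open>uvec\<close>\<close>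

lemma terminating:
  fixes w :: "'b \<Rightarrow> int"
  assumes B: "regular I B" "J \<subseteq> I" and b: "b \<in> carr B" "P b"
    and dec: "\<And>i b b'. i \<in> J \<Longrightarrow> b \<in> carr B \<Longrightarrow> P b \<Longrightarrow> eop B i b = Some b' \<Longrightarrow> w b' < w b \<and> P b'"
  shows "\<exists>b'\<in>carr B. epath J B b b' \<and> P b' \<and> (\<forall>i\<in>J. eps B i b' = 0)"
  using b
proof (induction "card {c \<in> carr B. w c < w b}" arbitrary: b rule: less_induct)
  case less
  show ?case
  proof (cases "\<forall>i\<in>J. eps B i b = 0")
    case True
    then show ?thesis using less.prems by (intro bexI[of _ b]) auto
  next
    case False
    then obtain i where i: "i \<in> J" "0 < eps B i b" by auto
    then obtain b1 where b1: "eop B i b = Some b1" using regular_e_ex[OF B(1), of i b] B(2) less.prems by auto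
    have d: "w b1 < w b" "P b1" using dec[OF i(1) less.prems b1] by auto
    have c: "b1 \<in> carr B" using regular_e(1)[OF B(1) _ less.prems(1) b1] i B(2) by auto
    have "card {c \<in> carr B. w c < w b1} < card {c \<in> carr B. w c < w b}"
      by (rule psubset_card_mono) (use regular_finite[OF B(1)] d c in auto)
    from less.hyps[OF this c d(2)] obtain b' where b': "b' \<in> carr B" "epath J B b1 b'" "P b'" "\<forall>i\<in>J. eps B i b' = 0" by blast
    then show ?thesis using epath_trans[OF epath_step[OF i(1) b1]] by blast
  qed
qed

lemma sum_change:
  fixes g :: "int \<Rightarrow> int"
  assumes "p \<in> letters X n" "q \<in> letters X n"
  shows "(\<Sum>l\<in>letters X n. g l * change p q b l) = (\<Sum>l\<in>letters X n. g l * b l) + g q - g p"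
proof -
  have "(\<Sum>l\<in>letters X n. g l * change p q b l) = (\<Sum>l\<in>letters X n. g l * b l + (if l = q then g l else 0) - (if l = p then g l else 0))"
    by (intro sum.cong refl) (auto simp: change_apply algebra_simps)
  then show ?thesis using assms by (simp add: sum.distrib sum_subtractf)
qed

definition fork_type :: "affine_type \<Rightarrow> bool" where "fork_type X \<longleftrightarrow> X \<in> {B1, D1, A2_odd}"

text \<open>The position of a letter in the order of the crystal graph, and that in the order for the nodes other than 1.\<close>

definition rank1 :: "nat \<Rightarrow> int \<Rightarrow> int" where
  "rank1 n l = (if 0 < l then l else if l = 0 then int n + 1 else 2 * int n + 2 + l)"

definition rank0 :: "nat \<Rightarrow> int \<Rightarrow> int" where
  "rank0 n l = (if l = 1 then 2 * int n + 2 else if l = -1 then 0 else rank1 n l)"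

text \<open>Raising replaces one letter by an earlier one, which makes the weighted letter sums
  decrease in \<open>terminating\<close>. Node 1 is left out for \<open>rank0\<close>, where the
  letter \<open>1\<close> comes last.\<close>

lemma e_row_cases:
  assumes X: "good_rank X n" and i: "1 \<le> i" "i \<le> n" and b: "b \<in> KR_rows X n s" and e: "e_row X n i b \<in> KR_rows X n s"
  obtains p q where "e_row X n i b = change p q b" "p \<in> letters X n" "q \<in> letters X n" "rank1 n q < rank1 n p"
    "2 \<le> i \<Longrightarrow> \<not> X = A1 \<Longrightarrow> rank0 n q < rank0 n p"
proof -
  have "\<exists>p q. e_row X n i b = change p q b \<and> p \<in> letters X n \<and> q \<in> letters X n \<and> rank1 n q < rank1 n p \<and>
    (2 \<le> i \<longrightarrow> X \<noteq> A1 \<longrightarrow> rank0 n q < rank0 n p)"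
  proof (cases "X = A1")
    case True
    then have "e_row X n i b = change (int i + 1) (int i) b" using i by (auto simp: e_row_def e_last_def e_mid_def)
    then show ?thesis using i True by (intro exI[of _ "int i + 1"] exI[of _ "int i"]) (auto simp: letters_def rank1_def)
  next
    case A: False
    show ?thesis
    proof (cases "i = n")
      case False
      then have "e_row X n i b = (if b (int i + 1) > b (- (int i + 1)) then change (int i + 1) (int i) b else change (- int i) (- (int i + 1)) b)"
        using A i by (simp add: e_row_def e_mid_def)
      moreover have "int i < int n" using False i by simp
      ultimately show ?thesis using i A
        by (cases "b (int i + 1) > b (- (int i + 1))")
         (rule exI[of _ "int i + 1"], rule exI[of _ "int i"], simp add: letters_def rank1_def rank0_def,
          rule exI[of _ "- int i"], rule exI[of _ "- (int i + 1)"], simp add: letters_def rank1_def rank0_def)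
    next
      case True
      consider (C) "X \<in> {C1, A2_odd, A2_even}" | (D) "X = D1" "3 \<le> n" | (B) "X \<in> {B1, D2, A2_even_dagger}"
        using A X by (cases X) (auto simp: good_rank_def)
      then show ?thesis
      proof cases
        case C
        then show ?thesis using i A True
          by (intro exI[of _ "- int n"] exI[of _ "int n"]) (auto simp: e_row_def e_last_def letters_def rank1_def rank0_def)
      next
        case D
        have "e_row X n i b = (if b (- int n) = 0 then change (- (int n - 1)) (int n) b else change (- int n) (int n - 1) b)"
          using D True by (simp add: e_row_def e_last_def)
        then show ?thesis using D
          by (cases "b (- int n) = 0")
           (rule exI[of _ "- (int n - 1)"], rule exI[of _ "int n"], simp add: letters_def rank1_def rank0_def,
            rule exI[of _ "- int n"], rule exI[of _ "int n - 1"], simp add: letters_def rank1_def rank0_def)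
      next
        case B
        have "e_row X n i b = (if b 0 = 0 then change (- int n) 0 b else change 0 (int n) b)"
          using B True i by (auto simp: e_row_def e_last_def)
        then show ?thesis using B i True
          by (cases "b 0 = 0")
           (rule exI[of _ "- int n"], rule exI[of _ "0"], force simp add: letters_def rank1_def rank0_def,
            rule exI[of _ "0"], rule exI[of _ "int n"], force simp add: letters_def rank1_def rank0_def)
      qed
    qed
  qed
  then show ?thesis using that by blast
qed

context
  fixes X n assumes X: "good_rank X n"
begin

lemma n1: "1 \<le> n" by (rule good_rank_pos[OF X])

lemma eps_row: "i \<le> n \<Longrightarrow> b \<in> KR_rows X n s \<Longrightarrow> eps (KR X n s) i b = 0 \<longleftrightarrow> row_eps X n s i b = 0"
  and phi_row: "i \<le> n \<Longrightarrow> b \<in> KR_rows X n s \<Longrightarrow> phi (KR X n s) i b = 0 \<longleftrightarrow> row_phi X n s i b = 0"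
  using KR_eps[OF X, of i b s] KR_phi[OF X, of i b s] by auto

lemma row_eq_power:
  assumes b: "b \<in> KR_rows X n s" and l: "l \<in> letters X n" "\<And>k. k \<noteq> l \<Longrightarrow> b k = 0"
  shows "b = power_row l (nat (b l))" "row_size X n b = b l"
proof -
  show 1: "b = power_row l (nat (b l))" using rows_nonneg[OF b, of l] l(2) by (auto simp: power_row_def)
  show "row_size X n b = b l" using arg_cong[OF 1, of "row_size X n"] l(1) rows_nonneg[OF b, of l] by simp
qed

lemma row_eq_power_size:
  assumes "b \<in> KR_rows X n s" "l \<in> letters X n" "\<And>k. k \<noteq> l \<Longrightarrow> b k = 0" "row_size X n b = int m"
  shows "b = power_row l m"
  using row_eq_power[OF assms(1-3)] assms(4) by (metis nat_int)

text \<open>Node \<open>n\<close> clears the letters \<open>-n\<close> and \<open>0\<close>, the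
  nodes below it clear the other negative letters, and the \<open>pos\<close> terms then leave no
  positive letter except \<open>1\<close>.\<close>

lemma highest_row:
  assumes b: "b \<in> KR_rows X n s" and e: "\<forall>i\<in>{1..n}. eps (KR X n s) i b = 0"
  shows "b = power_row 1 (nat (b 1))" "row_size X n b = b 1"
proof -
  have e: "row_eps X n s i b = 0" if "1 \<le> i" "i \<le> n" for i using e eps_row[OF that(2) b] that by auto
  note nn = rows_nonneg[OF b]
  have out: "b k = 0" if "k \<notin> letters X n" for k using b that by (simp add: KR_rows_def)
  have "b k = 0" if k: "k \<noteq> 1" for k
  proof (cases "X = A1")
    case True
    have "b k = 0" if "2 \<le> k" "k \<le> int n + 1" using e[of "nat (k - 1)"] that by (auto simp: row_eps_def True)
    then show ?thesis using out[of k] k by (cases "k \<in> letters X n") (auto simp: letters_def True)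
  next
    case False
    have step: "b (- int i) = 0 \<and> b (int i + 1) \<le> b (- (int i + 1))" if "1 \<le> i" "i < n" for i
      using e[of i] that nn[of "- int i"] False by (auto simp: row_eps_def pos_def max_def split: if_splits)
    have neg: "b (- k) = 0 \<and> b (k + 1) \<le> b (- (k + 1))" if "1 \<le> k" "k < int n" for k
      using that step[of "nat k"] by (auto simp: nat_less_iff)
    have last: "b (- int n) = 0 \<and> b 0 = 0"
      using e[of n] n1 nn[of "- int n"] nn[of 0] nn[of "- (int n - 1)"] False out[of 0] X
      by (cases X) (auto simp: row_eps_def letters_def good_rank_def)
    have neg0: "b (- k) = 0" if "1 \<le> k" "k \<le> int n" for k using neg[of k] last that by (cases "k = int n") auto
    have pos: "b k = 0" if "2 \<le> k" "k \<le> int n" for k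
    proof -
      have "b (k - 1 + 1) \<le> b (- (k - 1 + 1))" using neg[of "k - 1"] that by simp
      then show ?thesis using neg0[of k] nn[of k] that by simp
    qed
    show ?thesis
    proof (cases "k \<in> letters X n")
      case True
      then have kn: "- int n \<le> k" "k \<le> int n" using False by (auto simp: letters_def split: if_splits)
      consider "k = 0" | "2 \<le> k" | "k < 0" using k by linarith
      then show ?thesis using last pos[of k] neg0[of "- k"] kn by cases auto
    qed (rule out)
  qed
  from row_eq_power[OF b one_letter[OF n1] this] show "b = power_row 1 (nat (b 1))" "row_size X n b = b 1" by auto
qed

end

definition low :: "affine_type \<Rightarrow> nat \<Rightarrow> int" where "low X n = (if X = A1 then int n + 1 else -1)"
text \<open>For fork types these are the classical nodes after the exchange of 0 and 1. In the other
  types node 0 alone leads from \<open>uvec\<close> to the row of letters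
  \<open>low X n\<close>.\<close>

definition outer :: "affine_type \<Rightarrow> nat \<Rightarrow> nat set" where "outer X n = (if fork_type X then insert 0 {2..n} else {0})"

lemma power_row_apply: "power_row l m k = (if k = l then int m else 0)"
  by (simp add: power_row_def)

context
  fixes X n assumes X: "good_rank X n"
begin

lemma low_letter: "low X n \<in> letters X n" "low X n \<noteq> 0" "low X n \<noteq> 1"
  using n1[OF X] by (auto simp: low_def letters_def)

lemma low_row: "power_row (low X n) s \<in> KR_rows X n s"
  by (rule power_row_in[OF X low_letter(1,2)]) (simp add: size_ok_def)

lemma u_row: "power_row 1 s \<in> KR_rows X n s"
  by (rule power_row_in[OF X one_letter[OF n1[OF X]]]) (simp_all add: size_ok_def)

lemma raise_to_highest:
  assumes b: "b \<in> KR_rows X n s"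
  shows "\<exists>m. power_row 1 m \<in> KR_rows X n s \<and> int m = row_size X n b \<and> epath {1..n} (KR X n s) b (power_row 1 m)"
proof -
  have "\<exists>c\<in>carr (KR X n s). epath {1..n} (KR X n s) b c \<and> row_size X n c = row_size X n b \<and> (\<forall>i\<in>{1..n}. eps (KR X n s) i c = 0)"
  proof (rule terminating[where P = "\<lambda>c. row_size X n c = row_size X n b" and w = "\<lambda>c. \<Sum>l\<in>letters X n. rank1 n l * c l", OF KR_regular[OF X]])
    fix i c c' assume i: "i \<in> {1..n}" and c: "c \<in> carr (KR X n s)" and P: "row_size X n c = row_size X n b"
      and e: "eop (KR X n s) i c = Some c'"
    have c': "c' = e_row X n i c" "e_row X n i c \<in> KR_rows X n s" using e by (auto split: if_splits)
    obtain p q where pq: "e_row X n i c = change p q c" "p \<in> letters X n" "q \<in> letters X n" "rank1 n q < rank1 n p"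
      using e_row_cases[OF X _ _ _ c'(2)] i c by (metis KR_simps(1) atLeastAtMost_iff)
    then show "(\<Sum>l\<in>letters X n. rank1 n l * c' l) < (\<Sum>l\<in>letters X n. rank1 n l * c l) \<and> row_size X n c' = row_size X n b"
      unfolding c'(1) pq(1) sum_change[OF pq(2,3)] using P by simp
  qed (use b in auto)
  then obtain c where c: "c \<in> KR_rows X n s" "epath {1..n} (KR X n s) b c" "row_size X n c = row_size X n b"
    "\<forall>i\<in>{1..n}. eps (KR X n s) i c = 0" by auto
  note h = highest_row[OF X c(1,4)]
  define m where "m = nat (c 1)"
  have "c = power_row 1 m" using h(1) by (simp only: m_def)
  moreover have "int m = row_size X n b" using h(2) c(3) rows_nonneg[OF c(1), of 1] by (simp add: m_def)
  ultimately show ?thesis using c(1,2) by blast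
qed

lemma low_to_u: "epath {1..n} (KR X n s) (power_row (low X n) s) (power_row 1 s)"
  using raise_to_highest[OF low_row[of s]] low_letter by auto

lemma to_low_A1:
  assumes A: "X = A1"
  shows "epath {0} (KR X n s) (power_row 1 s) (power_row (low X n) s)"
proof -
  have l: "k \<in> letters X n \<longleftrightarrow> 1 \<le> k \<and> k \<le> int n + 1" for k by (simp add: letters_def A)
  have "\<exists>c\<in>carr (KR X n s). epath {0} (KR X n s) (power_row 1 s) c \<and> (\<forall>k. k \<noteq> 1 \<longrightarrow> k \<noteq> low X n \<longrightarrow> c k = 0) \<and> (\<forall>i\<in>{0}. eps (KR X n s) i c = 0)"
  proof (rule terminating[where P = "\<lambda>c. \<forall>k. k \<noteq> 1 \<longrightarrow> k \<noteq> low X n \<longrightarrow> c k = 0" and w = "\<lambda>c. c 1", OF KR_regular[OF X]])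
    fix i c c' assume "i \<in> {0::nat}" "c \<in> carr (KR X n s)" and P: "\<forall>k. k \<noteq> 1 \<longrightarrow> k \<noteq> low X n \<longrightarrow> c k = 0"
      and "eop (KR X n s) i c = Some c'"
    then have "c' = change 1 (int n + 1) c" by (auto simp: e_row_def e_zero_def A split: if_splits)
    then show "c' 1 < c 1 \<and> (\<forall>k. k \<noteq> 1 \<longrightarrow> k \<noteq> low X n \<longrightarrow> c' k = 0)" using P n1[OF X] by (auto simp: change_apply low_def A)
  qed (use u_row in \<open>auto simp: power_row_def\<close>)
  then obtain c where c: "c \<in> KR_rows X n s" "epath {0} (KR X n s) (power_row 1 s) c" "\<forall>k. k \<noteq> 1 \<longrightarrow> k \<noteq> low X n \<longrightarrow> c k = 0"
    "eps (KR X n s) 0 c = 0" by auto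
  have "c 1 = 0" using c(4) eps_row[OF X _ c(1), of 0] by (simp add: row_eps_def A)
  then have "c k = 0" if "k \<noteq> low X n" for k using c(3) that by (cases "k = 1") auto
  note z0 = this
  have "row_size X n c = int s" using c(1) by (simp add: KR_rows_def size_ok_def A)
  with z0 have "c = power_row (low X n) s" by (intro row_eq_power_size[OF X c(1) low_letter(1)])
  then show ?thesis using c(2) by simp
qed

text \<open>The argument for the classical highest row, repeated with the order
  \<open>rank0\<close>, in which \<open>-1\<close> comes first.\<close>

lemma to_low_fork:
  assumes F: "fork_type X"
  shows "epath (outer X n) (KR X n s) (power_row 1 s) (power_row (low X n) s)"
proof -
  have A: "X \<noteq> A1" and F': "X \<in> {B1, D1, A2_odd}" using F by (auto simp: fork_type_def)
  have n3: "3 \<le> n" using F' X by (auto simp: good_rank_def)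
  have J: "outer X n = insert 0 {2..n}" using F by (simp add: outer_def)
  have lt: "1 \<in> letters X n" "-1 \<in> letters X n" "2 \<in> letters X n" "-2 \<in> letters X n" using n3 A by (auto simp: letters_def)
  have "\<exists>c\<in>carr (KR X n s). epath (outer X n) (KR X n s) (power_row 1 s) c \<and> True \<and> (\<forall>i\<in>outer X n. eps (KR X n s) i c = 0)"
  proof (rule terminating[where P = "\<lambda>_. True" and w = "\<lambda>c. \<Sum>l\<in>letters X n. rank0 n l * c l", OF KR_regular[OF X]])
    fix i c c' assume i: "i \<in> outer X n" and c: "c \<in> carr (KR X n s)" and e: "eop (KR X n s) i c = Some c'"
    have c': "c' = e_row X n i c" "e_row X n i c \<in> KR_rows X n s" using e by (auto split: if_splits)
    have "\<exists>p q. e_row X n i c = change p q c \<and> p \<in> letters X n \<and> q \<in> letters X n \<and> rank0 n q < rank0 n p"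
    proof (cases "i = 0")
      case True
      then have "e_row X n i c = (if c 2 > c (-2) then change 2 (-1) c else change 1 (-2) c)"
        using F' by (auto simp: e_row_def e_zero_def)
      then show ?thesis using lt n3
        by (cases "c 2 > c (-2)") (rule exI[of _ 2], rule exI[of _ "-1"], simp add: rank0_def rank1_def,
           rule exI[of _ 1], rule exI[of _ "-2"], simp add: rank0_def rank1_def)
    next
      case False
      then have i2: "2 \<le> i" "i \<le> n" using i J by auto
      then show ?thesis using e_row_cases[OF X _ i2(2) _ c'(2)] c A by (metis KR_simps(1) one_le_numeral order_trans)
    qed
    then obtain p q where pq: "e_row X n i c = change p q c" "p \<in> letters X n" "q \<in> letters X n" "rank0 n q < rank0 n p" by blast
    show "(\<Sum>l\<in>letters X n. rank0 n l * c' l) < (\<Sum>l\<in>letters X n. rank0 n l * c l) \<and> True"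
      unfolding c'(1) pq(1) sum_change[OF pq(2,3)] using pq(4) by simp
  qed (use u_row J in auto)
  then obtain c where c: "c \<in> KR_rows X n s" "epath (outer X n) (KR X n s) (power_row 1 s) c"
    "\<forall>i\<in>outer X n. eps (KR X n s) i c = 0" by auto
  note nn = rows_nonneg[OF c(1)]
  have e: "row_eps X n s i c = 0" if "i = 0 \<or> 2 \<le> i" "i \<le> n" for i using c(3) J eps_row[OF X that(2) c(1)] that by auto
  have out: "c k = 0" if "k \<notin> letters X n" for k using c(1) that by (simp add: KR_rows_def)
  have step: "c (- int i) = 0 \<and> c (int i + 1) \<le> c (- (int i + 1))" if "2 \<le> i" "i < n" for i
    using e[of i] that nn[of "- int i"] A by (auto simp: row_eps_def pos_def max_def split: if_splits)
  have neg: "c (- k) = 0 \<and> c (k + 1) \<le> c (- (k + 1))" if "2 \<le> k" "k < int n" for k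
    using that step[of "nat k"] by (auto simp: nat_less_iff)
  have last: "c (- int n) = 0 \<and> c 0 = 0"
    using e[of n] n3 nn[of "- int n"] nn[of 0] nn[of "- (int n - 1)"] F' out[of 0]
    by (auto simp: row_eps_def letters_def)
  have neg0: "c (- k) = 0" if "2 \<le> k" "k \<le> int n" for k using neg[of k] last that by (cases "k = int n") auto
  have pos3: "c k = 0" if "3 \<le> k" "k \<le> int n" for k
  proof -
    have "c (k - 1 + 1) \<le> c (- (k - 1 + 1))" using neg[of "k - 1"] that by simp
    then show ?thesis using neg0[of k] nn[of k] that by simp
  qed
  have z: "c 1 = 0" "c 2 = 0"
    using e[of 0] neg0[of 2] n3 nn[of 1] nn[of 2] F' by (auto simp: row_eps_def pos_def max_def split: if_splits)
  have "c k = 0" if k: "k \<noteq> low X n" for k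
  proof (cases "k \<in> letters X n")
    case True
    then have kn: "- int n \<le> k" "k \<le> int n" using A by (auto simp: letters_def split: if_splits)
    consider "k = 0" | "k = 1" | "k = 2" | "3 \<le> k" | "k \<le> -2" using k A unfolding low_def by (simp split: if_splits) linarith
    then show ?thesis using last z pos3[of k] neg0[of "- k"] kn by cases auto
  qed (rule out)
  note z0 = this
  have "row_size X n c = int s" using c(1) F' by (auto simp: KR_rows_def size_ok_def)
  with z0 have "c = power_row (low X n) s" by (intro row_eq_power_size[OF X c(1) low_letter(1)])
  then show ?thesis using c(2) by simp
qed

text \<open>Here \<open>m\<close> may be smaller than \<open>s\<close>: node 0 first uses up the
  letters \<open>1\<close> and then fills the row with \<open>-1\<close>. So the tops of all
  classical summands reach the same row, as \<open>zigzag\<close> requires.\<close>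

lemma to_low_C:
  assumes F: "\<not> fork_type X" "X \<noteq> A1" and m: "power_row 1 m \<in> KR_rows X n s"
  shows "epath {0} (KR X n s) (power_row 1 m) (power_row (low X n) s)"
proof -
  let ?P = "\<lambda>c. (\<forall>k. k \<noteq> 1 \<longrightarrow> k \<noteq> -1 \<longrightarrow> c k = 0) \<and> (c 1 = (0::int) \<or> c (-1) = 0)"
  have low: "low X n = -1" using F by (simp add: low_def)
  consider (E) "X \<in> {A2_even, D2}" | (C) "X \<in> {C1, A2_even_dagger}" using F by (cases X) (auto simp: fork_type_def)
  note types = this
  have "\<exists>c\<in>carr (KR X n s). epath {0} (KR X n s) (power_row 1 m) c \<and> ?P c \<and> (\<forall>i\<in>{0}. eps (KR X n s) i c = 0)"
  proof (rule terminating[where w = "\<lambda>c. c 1 - c (-1)", OF KR_regular[OF X]])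
    fix i c c' assume i: "i \<in> {0::nat}" and cc: "c \<in> carr (KR X n s)" and P: "?P c" and e: "eop (KR X n s) i c = Some c'"
    have c': "c' = e_zero X n c" using e i by (auto simp: e_row_def split: if_splits)
    have nn: "0 \<le> c 1" "0 \<le> c (-1)" using cc by (auto intro: rows_nonneg)
    show "c' 1 - c' (-1) < c 1 - c (-1) \<and> ?P c'" unfolding c' using types P nn
      by cases (auto simp: e_zero_def add_letter_apply change_apply)
  qed (use m n1[OF X] in \<open>auto simp: power_row_def\<close>)
  then obtain c where c: "c \<in> KR_rows X n s" "epath {0} (KR X n s) (power_row 1 m) c" "?P c" "eps (KR X n s) 0 c = 0" by auto
  have nn: "0 \<le> c 1" "0 \<le> c (-1)" using c(1) by (auto intro: rows_nonneg)
  have e: "row_eps X n s 0 c = 0" using c(4) eps_row[OF X _ c(1), of 0] by simp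
  note le = row_size_le[OF c(1)]
  have *: "row_size X n c = int s \<and> c 1 \<le> c (-1)"
    using types
  proof cases
    case E
    then show ?thesis using e le by (auto simp: row_eps_def pos_def max_def split: if_splits)
  next
    case C
    then have ev: "even (int s - row_size X n c)" using c(1) unfolding KR_rows_def size_ok_def by auto
    have "(int s - row_size X n c) div 2 + pos (c 1 - c (-1)) = 0" using e C by (auto simp: row_eps_def)
    moreover have "0 \<le> (int s - row_size X n c) div 2" using le by simp
    ultimately have "(int s - row_size X n c) div 2 = 0" "pos (c 1 - c (-1)) = 0" using pos_nonneg[of "c 1 - c (-1)"] by linarith+
    then show ?thesis using ev le pos_ge[of "c 1 - c (-1)"] by (auto elim!: evenE simp del: even_diff)
  qed
  then have "c 1 = 0" using c(3) nn by auto
  then have "c k = 0" if "k \<noteq> low X n" for k using c(3) that low by (cases "k = 1") auto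
  note z0 = this
  have "c = power_row (low X n) s" using z0 * by (intro row_eq_power_size[OF X c(1) low_letter(1)]) auto
  then show ?thesis using c(2) by simp
qed

lemma KR_pivot: "pivot {1..n} (outer X n) (KR X n s) (power_row (low X n) s)"
proof -
  have e: "row_eps X n s i (power_row 1 s) = 0" if "1 \<le> i" "i \<le> n" for i
    using that X by (cases X) (auto simp: row_eps_def power_row_def pos_def good_rank_def)
  have f: "row_phi X n s i (power_row 1 s) = 0" if "i \<in> outer X n" for i
    using that X one_letter[OF n1[OF X]] by (cases X) (auto simp: row_phi_def power_row_apply pos_def good_rank_def outer_def fork_type_def)
  have e': "row_eps X n s i (power_row (low X n) s) = 0" if "i \<in> outer X n" for i
    using that X low_letter by (cases X) (auto simp: row_eps_def power_row_apply low_def pos_def good_rank_def outer_def fork_type_def)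
  have f': "row_phi X n s i (power_row (low X n) s) = 0" if "1 \<le> i" "i \<le> n" for i
    using that X by (cases X) (auto simp: row_phi_def power_row_def low_def pos_def good_rank_def)
  have i: "i \<le> n" if "i \<in> outer X n" for i using that by (auto simp: outer_def split: if_splits)
  have p: "epath (outer X n) (KR X n s) (power_row 1 s) (power_row (low X n) s)"
    using to_low_A1[of s] to_low_fork[of s] to_low_C[OF _ _ u_row, of s] by (cases "X = A1"; cases "fork_type X") (auto simp: outer_def fork_type_def)
  show ?thesis unfolding pivot_def
    using e f e' f' i p low_to_u[of s] low_row[of s] u_row[of s] by (auto simp: eps_row[OF X] phi_row[OF X])
qed

lemma KR_zigzag: "zigzag {1..n} (outer X n) (KR X n s) (power_row (low X n) s)"
  unfolding zigzag_def
proof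
  fix b assume b: "b \<in> carr (KR X n s)"
  then obtain m where m: "power_row 1 m \<in> KR_rows X n s" "int m = row_size X n b" "epath {1..n} (KR X n s) b (power_row 1 m)"
    using raise_to_highest[of b s] by auto
  have e: "row_eps X n s i (power_row 1 m) = 0" if "1 \<le> i" "i \<le> n" for i
    using that X by (cases X) (auto simp: row_eps_def power_row_def pos_def good_rank_def)
  have "m = s \<or> epath (outer X n) (KR X n s) (power_row 1 m) (power_row (low X n) s)"
  proof (cases "fork_type X \<or> X = A1")
    case True
    then show ?thesis using b m(2) by (auto simp: fork_type_def KR_rows_def size_ok_def)
  next
    case False
    then show ?thesis using to_low_C[OF _ _ m(1)] by (auto simp: outer_def)
  qed
  then show "\<exists>b'. epath {1..n} (KR X n s) b b' \<and> (\<forall>i\<in>{1..n}. eps (KR X n s) i b' = 0) \<and>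
    (b' = uvec (KR X n s) \<or> epath (outer X n) (KR X n s) b' (power_row (low X n) s))"
    using m(1,3) e by (intro exI[of _ "power_row 1 m"]) (auto simp: eps_row[OF X])
qed

lemma nodes: "{0..n} = {1..n} \<union> outer X n" using n1[OF X] by (auto simp: outer_def)

lemma KR_rises: "rises {0..n} (KR X n s)"
  unfolding rises_def
proof
  fix b assume "b \<in> carr (KR X n s)"
  then obtain b' where b': "epath {1..n} (KR X n s) b b'" "b' = uvec (KR X n s) \<or> epath (outer X n) (KR X n s) b' (power_row (low X n) s)"
    using KR_zigzag unfolding zigzag_def by blast
  have m: "{1..n} \<subseteq> {0..n}" "outer X n \<subseteq> {0..n}" using nodes by auto
  show "epath {0..n} (KR X n s) b (uvec (KR X n s))"
    using b'(2) epath_trans[OF epath_mono[OF b'(1) m(1)] epath_trans[OF epath_mono[OF _ m(2)] epath_mono[OF low_to_u m(1)]]]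
      epath_mono[OF b'(1) m(1)] by auto
qed

lemma KR_conn2: "rises {0..n} (KR X n s \<otimes>\<^sub>c KR X n t)"
  by (rule rises_tensor[OF KR_regular[OF X] KR_regular[OF X] nodes KR_pivot KR_pivot KR_zigzag KR_rises])

lemma KR_conn3: "rises {0..n} (KR X n r \<otimes>\<^sub>c (KR X n s \<otimes>\<^sub>c KR X n t))"
proof -
  have m: "{1..n} \<subseteq> {0..n}" "outer X n \<subseteq> {0..n}" using nodes by auto
  show ?thesis
    by (rule rises_tensor[OF KR_regular[OF X] regular_tensor[OF KR_regular[OF X] KR_regular[OF X]] nodes KR_pivot
      pivot_tensor[OF KR_regular[OF X] KR_regular[OF X] m KR_pivot KR_pivot] KR_zigzag KR_conn2])
qed

text \<open>The value of \<phi> at node 1 replaces the weight: \<open>uvec\<close> maximizes it, and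
  it separates the powers of the letter \<open>1\<close>.\<close>

lemma phi1_le: "b \<in> KR_rows X n s \<Longrightarrow> row_phi X n s 1 b \<le> row_phi X n s 1 (power_row 1 s)"
  and phi1_power: "row_phi X n s 1 (power_row 1 m) = row_phi X n s 1 (power_row 1 s) \<longleftrightarrow> m = s"
proof -
  have two: "b k + b l \<le> int s" if "b \<in> KR_rows X n s" "k \<in> letters X n" "l \<in> letters X n" "k \<noteq> l" for k l b
  proof -
    have "sum b {k, l} \<le> row_size X n b" unfolding row_size_def by (rule sum_mono2) (use that in \<open>auto simp: KR_rows_def\<close>)
    then show ?thesis using row_size_le[OF that(1)] that(4) by simp
  qed
  have one: "b k \<le> int s" if "b \<in> KR_rows X n s" "k \<in> letters X n" for k b
  proof -
    have "sum b {k} \<le> row_size X n b" unfolding row_size_def by (rule sum_mono2) (use that in \<open>auto simp: KR_rows_def\<close>)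
    then show ?thesis using row_size_le[OF that(1)] by simp
  qed
  have u: "row_phi X n s 1 (power_row 1 m) = (if X = A2_even_dagger \<and> n = 1 then 2 * int m else int m)" for m
    using X by (cases X) (auto simp: row_phi_def power_row_def pos_def good_rank_def)
  then show "row_phi X n s 1 (power_row 1 m) = row_phi X n s 1 (power_row 1 s) \<longleftrightarrow> m = s" by auto
  assume b: "b \<in> KR_rows X n s"
  show "row_phi X n s 1 b \<le> row_phi X n s 1 (power_row 1 s)"
  proof (cases "X \<noteq> A1 \<and> 2 \<le> n")
    case True
    then have "row_phi X n s 1 b = b 1 + pos (b (-2) - b 2) \<or> (X = D1 \<and> False)" using X
      by (auto simp: row_phi_def)
    moreover have l: "1 \<in> letters X n" "-2 \<in> letters X n" using True by (auto simp: letters_def)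
    moreover have "b 1 + b (-2) \<le> int s" by (rule two[OF b l]) simp
    moreover have "b 1 \<le> int s" by (rule one[OF b l(1)])
    ultimately show ?thesis using True u[of s] rows_nonneg[OF b, of 2] by (auto simp: pos_def)
  next
    case False
    then have c: "X = A1 \<or> (n = 1 \<and> (X = A2_even \<or> X = A2_even_dagger))" using X n1[OF X] by (cases X) (auto simp: good_rank_def)
    have "b 1 \<le> int s" by (rule one[OF b one_letter[OF n1[OF X]]])
    moreover have "b 1 + b 0 \<le> int s" if "X = A2_even_dagger" using two[OF b, of 1 0] that n1[OF X] by (simp add: letters_def)
    ultimately show ?thesis using c u[of s] by (auto simp: row_phi_def)
  qed
qed

text \<open>The vanishing \<epsilon> make the right row classically highest, hence a power of
  \<open>1\<close>. The two values of \<phi> at node 1 add up to the sum of their maxima, so each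
  factor attains its own.\<close>

lemma KR_rigid: "u_rigid {0..n} (KR X n s \<otimes>\<^sub>c KR X n t) (KR X n t \<otimes>\<^sub>c KR X n s)"
  unfolding u_rigid_def
proof (intro ballI impI)
  note reg = KR_regular[OF X]
  fix v assume v: "v \<in> carr (KR X n t \<otimes>\<^sub>c KR X n s)" and h: "\<forall>i\<in>{0..n}. eps (KR X n s \<otimes>\<^sub>c KR X n t) i (uvec (KR X n s \<otimes>\<^sub>c KR X n t)) = eps (KR X n t \<otimes>\<^sub>c KR X n s) i v \<and>
      phi (KR X n s \<otimes>\<^sub>c KR X n t) i (uvec (KR X n s \<otimes>\<^sub>c KR X n t)) = phi (KR X n t \<otimes>\<^sub>c KR X n s) i v"
  obtain x y where xy: "v = (x, y)" "x \<in> KR_rows X n t" "y \<in> KR_rows X n s" using v by auto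
  have u0: "eps (KR X n s) i (power_row 1 s) = 0" if "1 \<le> i" "i \<le> n" for i s
    using KR_pivot[of s] that unfolding pivot_def by auto
  have f0: "phi (KR X n s) i (power_row 1 s) = 0" if "2 \<le> i" "i \<le> n" for i s
    using that X phi_row[OF X that(2) u_row, of s] by (cases X) (auto simp: row_phi_def power_row_def pos_def good_rank_def)
  have e: "eps (KR X n s) i y = 0 \<and> eps (KR X n t) i x \<le> phi (KR X n s) i y" if "1 \<le> i" "i \<le> n" for i
    using h[rule_format, of i] that xy u_row u0[OF that] by (auto simp: eps_tensor[OF reg reg])
  have y1: "y = power_row 1 (nat (y 1))" by (rule highest_row(1)[OF X xy(3)]) (use e in auto)
  have f: "phi (KR X n t) 1 x + (phi (KR X n s) 1 y - eps (KR X n t) 1 x) = phi (KR X n s) 1 (power_row 1 s) + phi (KR X n t) 1 (power_row 1 t)"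
    using h[rule_format, of 1] n1[OF X] xy u_row u0[of 1] by (auto simp: phi_tensor[OF reg reg])
  have le: "phi (KR X n s) 1 b \<le> phi (KR X n s) 1 (power_row 1 s)" if "b \<in> KR_rows X n s" for b s
    using phi1_le[OF that] KR_phi[OF X n1[OF X] that] KR_phi[OF X n1[OF X] u_row, of s] by simp
  have eq: "phi (KR X n s) 1 y = phi (KR X n s) 1 (power_row 1 s)" "phi (KR X n t) 1 x = phi (KR X n t) 1 (power_row 1 t)" "eps (KR X n t) 1 x = 0"
    using f le[OF xy(2)] le[OF xy(3)] e[of 1] n1[OF X] by auto
  have yu: "y = power_row 1 s"
    using phi1_power[of s "nat (y 1)"] eq(1) y1 KR_phi[OF X n1[OF X] xy(3)] KR_phi[OF X n1[OF X] u_row, of s] by simp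
  have "eps (KR X n t) i x = 0" if "1 \<le> i" "i \<le> n" for i using e[OF that] f0[of i s] eq(3) that yu by (cases "i = 1") auto
  then have x1: "x = power_row 1 (nat (x 1))" by (intro highest_row(1)[OF X xy(2)]) auto
  have "x = power_row 1 t"
    using phi1_power[of t "nat (x 1)"] eq(2) x1 KR_phi[OF X n1[OF X] xy(2)] KR_phi[OF X n1[OF X] u_row, of t] by simp
  then show "v = uvec (KR X n t \<otimes>\<^sub>c KR X n s)" using yu xy(1) by simp
qed

end

section \<open>Pairs of rows of type D\<close>

text \<open>Index \<open>k\<close> is the state after all letters of absolute value at least
  \<open>M - k\<close>; the final state therefore has index \<open>N - 1\<close>.\<close>

primrec lv :: "int \<Rightarrow> row \<Rightarrow> row \<Rightarrow> nat \<Rightarrow> int \<times> int" where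
  "lv M x y 0 = (tau_end (x M) (x (- M)) (y M) (y (- M)), sig_end (x M) (x (- M)) (y M) (y (- M)))"
| "lv M x y (Suc k) = (let i = M - 1 - int k; t = fst (lv M x y k); s = snd (lv M x y k) in
    (tau (x (- i)) (y i) (y (- i)) t s, sig (x i) (x (- i)) (y i) (y (- i)) t s))"

text \<open>Index \<open>k\<close> belongs to the letters \<open>\<plusminus>(M - 1 - k)\<close> and
  uses the state before they are read.\<close>

definition linv :: "int \<Rightarrow> row \<Rightarrow> row \<Rightarrow> nat \<Rightarrow> int \<times> int \<times> int \<times> int" where
  "linv M x y k = (let i = M - 1 - int k; t = fst (lv M x y k); s = snd (lv M x y k) in
    (ia (x i) (x (- i)) (y i) t s, ib (y (- i)) (x (- i)) (y i) t, ik (x (- i)) (y i) t s, ix (x (- i)) (y i) t s))"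

text \<open>For valid pairs these are \<epsilon> and \<phi> at node \<open>M - 1\<close>, then
  \<epsilon> and \<phi> at node \<open>M\<close>.\<close>

definition einv :: "int \<Rightarrow> row \<Rightarrow> row \<Rightarrow> int \<times> int \<times> int \<times> int" where
  "einv M x y = (let c = x (M - 1); C = x (- (M - 1)); d = y (M - 1); E = y (- (M - 1)); g = x M; G = x (- M); h = y M; I = y (- M) in
    (fork_e C d E g h I, fork_f c C d g G I, fork_e C d E G I h, fork_f c C d G g h))"

definition join :: "int \<times> int \<times> int \<times> int \<Rightarrow> int \<times> int \<times> int \<times> int \<Rightarrow> inv8" where
  "join = (\<lambda>(a, b, c, d) v. (a, b, c, d, v))"

lemma join_inject: "join u v = join u' v' \<longleftrightarrow> u = u' \<and> v = v'"
  by (auto simp: join_def split: prod.splits)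

text \<open>Raising at node \<open>i\<close> as a total map on pairs of integer rows. Whether the
  result still lies in the crystal is a separate question.\<close>

definition pmid :: "int \<Rightarrow> row \<times> row \<Rightarrow> row \<times> row" where
  "pmid i = (\<lambda>(x, y). if y i + pos (y (- (i + 1)) - y (i + 1)) < x (- i) + pos (x (i + 1) - x (- (i + 1)))
     then (e_mid D1 i x, y) else (x, e_mid D1 i y))"

lemma lv_cong:
  assumes "\<And>j. M - int k \<le> j \<Longrightarrow> j \<le> M \<Longrightarrow> x' j = x j \<and> x' (- j) = x (- j) \<and> y' j = y j \<and> y' (- j) = y (- j)"
  shows "lv M x' y' k = lv M x y k"
  using assms
proof (induction k)
  case (Suc k)
  have "lv M x' y' k = lv M x y k" by (rule Suc.IH) (use Suc.prems in auto)
  then show ?case using Suc.prems[of "M - 1 - int k"] by simp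
qed simp

lemma inv2_lv:
  assumes "i = M - 2 - int k"
  shows "inv2 (x i) (x (- i)) (y i) (y (- i)) (x (i + 1)) (x (- (i + 1))) (y (i + 1)) (y (- (i + 1))) (fst (lv M x y k)) (snd (lv M x y k)) =
    join (linv M x y (Suc k)) (linv M x y k)"
proof -
  have l: "M - 1 - int (Suc k) = i" "M - 1 - int k = i + 1" using assms by auto
  show ?thesis by (simp only: inv2_def linv_def join_def Let_def lv.simps fst_conv snd_conv prod.case l)
qed

lemma invD_lv:
  assumes "i = M - 2"
  shows "invD (x i) (x (- i)) (y i) (y (- i)) (x (i + 1)) (x (- (i + 1))) (y (i + 1)) (y (- (i + 1))) (x M) (x (- M)) (y M) (y (- M)) =
    join (linv M x y (Suc 0)) (einv M x y)"
proof -
  have l: "M - 1 - int (Suc 0) = i" "M - 1 - int 0 = i + 1" "M - 1 = i + 1" using assms by auto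
  show ?thesis unfolding linv_def lv.simps Let_def fst_conv snd_conv l(1,2) einv_def invD_def join_def prod.case
    unfolding l(3) ..
qed

context
  fixes M i :: int and k :: nat and x y x1 y1 :: row
  assumes i: "i = M - 2 - int k" "1 \<le> i" and nn: "\<And>l. 0 \<le> x l" "\<And>l. 0 \<le> y l" and p: "pmid i (x, y) = (x1, y1)"
begin

lemma pmid_out: "j \<noteq> i \<Longrightarrow> j \<noteq> i + 1 \<Longrightarrow> j \<noteq> - i \<Longrightarrow> j \<noteq> - (i + 1) \<Longrightarrow> x1 j = x j \<and> y1 j = y j"
  using p by (auto simp: pmid_def e_mid_def change_apply split: if_splits)

lemma pmid_lv_low: "j \<le> k \<Longrightarrow> lv M x1 y1 j = lv M x y j"
  by (rule lv_cong) (use i pmid_out in auto)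

lemma pmid_cases:
  obtains (LU) "x (- (i + 1)) < x (i + 1)" "y i + pos (y (- (i + 1)) - y (i + 1)) < x (- i) + pos (x (i + 1) - x (- (i + 1)))"
      "x1 i = x i + 1" "x1 (- i) = x (- i)" "y1 i = y i" "y1 (- i) = y (- i)" "x1 (i + 1) = x (i + 1) - 1" "x1 (- (i + 1)) = x (- (i + 1))" "y1 (i + 1) = y (i + 1)" "y1 (- (i + 1)) = y (- (i + 1))"
  | (LB) "x (i + 1) \<le> x (- (i + 1))" "y i + pos (y (- (i + 1)) - y (i + 1)) < x (- i) + pos (x (i + 1) - x (- (i + 1)))"
      "x1 i = x i" "x1 (- i) = x (- i) - 1" "y1 i = y i" "y1 (- i) = y (- i)" "x1 (i + 1) = x (i + 1)" "x1 (- (i + 1)) = x (- (i + 1)) + 1" "y1 (i + 1) = y (i + 1)" "y1 (- (i + 1)) = y (- (i + 1))"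
  | (RU) "y (- (i + 1)) < y (i + 1)" "x (- i) + pos (x (i + 1) - x (- (i + 1))) \<le> y i + pos (y (- (i + 1)) - y (i + 1))"
      "x1 i = x i" "x1 (- i) = x (- i)" "y1 i = y i + 1" "y1 (- i) = y (- i)" "x1 (i + 1) = x (i + 1)" "x1 (- (i + 1)) = x (- (i + 1))" "y1 (i + 1) = y (i + 1) - 1" "y1 (- (i + 1)) = y (- (i + 1))"
  | (RB) "y (i + 1) \<le> y (- (i + 1))" "x (- i) + pos (x (i + 1) - x (- (i + 1))) \<le> y i + pos (y (- (i + 1)) - y (i + 1))"
      "x1 i = x i" "x1 (- i) = x (- i)" "y1 i = y i" "y1 (- i) = y (- i) - 1" "x1 (i + 1) = x (i + 1)" "x1 (- (i + 1)) = x (- (i + 1))" "y1 (i + 1) = y (i + 1)" "y1 (- (i + 1)) = y (- (i + 1)) + 1"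
proof (cases "y i + pos (y (- (i + 1)) - y (i + 1)) < x (- i) + pos (x (i + 1) - x (- (i + 1)))")
  case l: True
  show ?thesis
  proof (cases "x (- (i + 1)) < x (i + 1)")
    case c: True
      have e: "x1 = change (i + 1) i x" "y1 = y" using p l c by (auto simp: pmid_def e_mid_def)
      show ?thesis by (rule LU) (use i(2) l c in \<open>simp_all add: e change_apply\<close>)
  next
    case c: False
      have e: "x1 = change (- i) (- (i + 1)) x" "y1 = y" using p l c by (auto simp: pmid_def e_mid_def)
      show ?thesis by (rule LB) (use i(2) l c in \<open>simp_all add: e change_apply\<close>)
  qed
next
  case l: False
  show ?thesis
  proof (cases "y (- (i + 1)) < y (i + 1)")
    case c: True
      have e: "y1 = change (i + 1) i y" "x1 = x" using p l c by (auto simp: pmid_def e_mid_def)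
      show ?thesis by (rule RU) (use i(2) l c in \<open>simp_all add: e change_apply\<close>)
  next
    case c: False
      have e: "y1 = change (- i) (- (i + 1)) y" "x1 = x" using p l c by (auto simp: pmid_def e_mid_def)
      show ?thesis by (rule RB) (use i(2) l c in \<open>simp_all add: e change_apply\<close>)
  qed
qed

text \<open>Since \<open>tau\<close> comes out unchanged in all four cases, no level below those of
  \<open>\<plusminus>(i + 1)\<close> and \<open>\<plusminus>i\<close> notices the move.\<close>

lemma pmid_mv:
  shows "mv (join (linv M x y (Suc k)) (linv M x y k)) (join (linv M x1 y1 (Suc k)) (linv M x1 y1 k)) \<and>
    fst (lv M x1 y1 (Suc (Suc k))) = fst (lv M x y (Suc (Suc k)))"
proof -
  have lvl: "M - 1 - int (Suc k) = i" "M - 1 - int k = i + 1" using i by auto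
  have T: "fst (lv M x y (Suc (Suc k))) = tau (x (- i)) (y i) (y (- i)) (tau (x (- (i + 1))) (y (i + 1)) (y (- (i + 1))) (fst (lv M x y k)) (snd (lv M x y k)))
    (sig (x (i + 1)) (x (- (i + 1))) (y (i + 1)) (y (- (i + 1))) (fst (lv M x y k)) (snd (lv M x y k)))" for x y
    by (simp only: lv.simps Let_def fst_conv snd_conv lvl)
  note c = inv2_lv[OF i(1), symmetric] T pmid_lv_low[OF order_refl]
  show ?thesis
  proof (cases rule: pmid_cases)
    case LU show ?thesis unfolding c LU(3-) using mv_LU[OF nn(1,1,2,2,1,1,2,2) LU(1,2)] by blast
  next
    case LB show ?thesis unfolding c LB(3-) using mv_LB[OF nn(1,1,2,2,1,1,2,2) LB(1,2)] by blast
  next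
    case RU show ?thesis unfolding c RU(3-) using mv_RU[OF nn(1,1,2,2,1,1,2,2) RU(1,2)] by blast
  next
    case RB show ?thesis unfolding c RB(3-) using mv_RB[OF nn(1,1,2,2,1,1,2,2) RB(1,2)] by blast
  qed
qed

lemma pmid_mvD:
  assumes k: "k = 0" and e: "x M = 0 \<or> x (- M) = 0" "y M = 0 \<or> y (- M) = 0"
  shows "mvD (join (linv M x y (Suc 0)) (einv M x y)) (join (linv M x1 y1 (Suc 0)) (einv M x1 y1))"
proof -
  have i': "i = M - 2" using i k by simp
  have o: "x1 M = x M" "x1 (- M) = x (- M)" "y1 M = y M" "y1 (- M) = y (- M)" using pmid_out[of M] pmid_out[of "- M"] i i' by auto
  note c = invD_lv[OF i', symmetric] o
  note n = nn(1,1,2,2,1,1,2,2,1,1,2,2) e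
  show ?thesis
  proof (cases rule: pmid_cases)
    case LU show ?thesis unfolding c LU(3-) by (rule mvD_LU[OF n LU(1,2)])
  next
    case LB show ?thesis unfolding c LB(3-) by (rule mvD_LB[OF n LB(1,2)])
  next
    case RU show ?thesis unfolding c RU(3-) by (rule mvD_RU[OF n RU(1,2)])
  next
    case RB show ?thesis unfolding c RB(3-) by (rule mvD_RB[OF n RB(1,2)])
  qed
qed

lemma pmid_lv_high: "int (j + (k + 2)) \<le> M - 1 \<Longrightarrow> lv M x1 y1 (j + (k + 2)) = lv M x y (j + (k + 2))"
proof (induction j)
  case 0
  have lvl: "M - 1 - int (Suc k) = i" "M - 1 - int k = i + 1" using i by auto
  have S: "snd (lv M x y (Suc (Suc k))) = x i + x (- i) - y i - y (- i) + (x (i + 1) + x (- (i + 1)) - y (i + 1) - y (- (i + 1)) + snd (lv M x y k))" for x y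
    by (simp only: lv.simps Let_def fst_conv snd_conv lvl sig_lin)
  have "snd (lv M x1 y1 (Suc (Suc k))) = snd (lv M x y (Suc (Suc k)))"
    unfolding S pmid_lv_low[OF order_refl] by (cases rule: pmid_cases) auto
  then show ?case using pmid_mv by (simp add: prod_eq_iff del: lv.simps)
next
  case (Suc j)
  have "x1 l = x l \<and> x1 (- l) = x (- l) \<and> y1 l = y l \<and> y1 (- l) = y (- l)" if "l = M - 1 - int (j + (k + 2))" for l
    using pmid_out[of l] pmid_out[of "- l"] i Suc.prems that by auto
  then show ?case using Suc.IH Suc.prems by (simp add: Let_def)
qed

end

lemma lv_Suc_eq:
  "lv M x' y' k = lv M x y k \<Longrightarrow> l = M - 1 - int k \<Longrightarrow> x' l = x l \<and> y' l = y l \<and> x' (- l) = x (- l) \<and> y' (- l) = y (- l) \<Longrightarrow>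
    lv M x' y' (Suc k) = lv M x y (Suc k)"
  by (simp only: lv.simps Let_def)

lemma mv_eq: "mv I J \<Longrightarrow> mv I' J' \<Longrightarrow> J' = J \<longleftrightarrow> I' = I"
  using mv_det mv_rev by blast

lemma mvD_eq: "mvD I J \<Longrightarrow> mvD I' J' \<Longrightarrow> J' = J \<longleftrightarrow> I' = I"
  using mvD_det mvD_rev by blast

lemma all_split2:
  fixes P Q :: "nat \<Rightarrow> bool"
  assumes "1 \<le> k" "Suc k \<le> m" and PQ: "P (Suc k) \<and> P k \<longleftrightarrow> Q (Suc k) \<and> Q k"
    and other: "\<And>j. j \<le> m \<Longrightarrow> j \<noteq> k \<Longrightarrow> j \<noteq> Suc k \<Longrightarrow> P j \<longleftrightarrow> Q j"
  shows "(\<forall>j. 1 \<le> j \<longrightarrow> j \<le> m \<longrightarrow> P j) \<longleftrightarrow> (\<forall>j. 1 \<le> j \<longrightarrow> j \<le> m \<longrightarrow> Q j)"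
proof -
  have k: "1 \<le> k" "k \<le> m" "1 \<le> Suc k" "Suc k \<le> m" using assms(1,2) by auto
  show ?thesis
  proof (intro iffI allI impI)
    fix j assume h: "\<forall>j. 1 \<le> j \<longrightarrow> j \<le> m \<longrightarrow> P j" and j: "1 \<le> j" "j \<le> m"
    show "Q j" using h[rule_format, OF k(1,2)] h[rule_format, OF k(3,4)] PQ other[OF j(2)] h[rule_format, OF j]
      by (cases "j = k"; cases "j = Suc k") auto
  next
    fix j assume h: "\<forall>j. 1 \<le> j \<longrightarrow> j \<le> m \<longrightarrow> Q j" and j: "1 \<le> j" "j \<le> m"
    show "P j" using h[rule_format, OF k(1,2)] h[rule_format, OF k(3,4)] PQ other[OF j(2)] h[rule_format, OF j]
      by (cases "j = k"; cases "j = Suc k") auto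
  qed
qed

lemma all_split1:
  fixes P Q :: "nat \<Rightarrow> bool"
  assumes "Suc 0 \<le> m" and PQ: "P (Suc 0) \<and> E \<longleftrightarrow> Q (Suc 0) \<and> F"
    and other: "\<And>j. j \<le> m \<Longrightarrow> 2 \<le> j \<Longrightarrow> P j \<longleftrightarrow> Q j"
  shows "(\<forall>j. 1 \<le> j \<longrightarrow> j \<le> m \<longrightarrow> P j) \<and> E \<longleftrightarrow> (\<forall>j. 1 \<le> j \<longrightarrow> j \<le> m \<longrightarrow> Q j) \<and> F"
proof -
  have split: "(\<forall>j. 1 \<le> j \<longrightarrow> j \<le> m \<longrightarrow> R j) \<longleftrightarrow> R (Suc 0) \<and> (\<forall>j. j \<le> m \<longrightarrow> 2 \<le> j \<longrightarrow> R j)" for R :: "nat \<Rightarrow> bool"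
  proof (intro iffI conjI allI impI)
    fix j assume h: "R (Suc 0) \<and> (\<forall>j. j \<le> m \<longrightarrow> 2 \<le> j \<longrightarrow> R j)" and j: "1 \<le> j" "j \<le> m"
    show "R j" using h j by (cases "j = Suc 0") auto
  qed (use assms(1) in auto)
  have "(\<forall>j. j \<le> m \<longrightarrow> 2 \<le> j \<longrightarrow> P j) \<longleftrightarrow> (\<forall>j. j \<le> m \<longrightarrow> 2 \<le> j \<longrightarrow> Q j)" using other by auto
  then show ?thesis unfolding split using PQ by blast
qed

definition valid :: "int \<Rightarrow> row \<times> row \<Rightarrow> bool" where
  "valid M = (\<lambda>(x, y). (\<forall>l. 0 \<le> x l \<and> 0 \<le> y l) \<and> (x M = 0 \<or> x (- M) = 0) \<and> (y M = 0 \<or> y (- M) = 0))"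

text \<open>For \<open>m = 1\<close> this realizes the diagram automorphism exchanging the nodes 0
  and 1, for \<open>m = n\<close> the one exchanging \<open>n - 1\<close> and
  \<open>n\<close>.\<close>

definition sw :: "int \<Rightarrow> row \<Rightarrow> row" where
  "sw m b = (\<lambda>l. if l = m then b (- m) else if l = - m then b m else b l)"

definition sw2 :: "int \<Rightarrow> row \<times> row \<Rightarrow> row \<times> row" where "sw2 m = (\<lambda>(x, y). (sw m x, sw m y))"

lemma sw_apply: "sw m b l = (if l = m then b (- m) else if l = - m then b m else b l)" by (simp add: sw_def)
lemma sw_other: "l \<noteq> m \<and> l \<noteq> - m \<Longrightarrow> sw m b l = b l" by (simp add: sw_def)
lemma sw_sw [simp]: "sw m (sw m b) = b" by (auto simp: sw_def)
lemma sw2_sw2 [simp]: "sw2 m (sw2 m p) = p" by (cases p) (simp add: sw2_def)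

lemma valid_sw2 [simp]: "valid M p \<Longrightarrow> valid M (sw2 m p)"
  by (cases p) (auto simp: valid_def sw2_def sw_apply)

text \<open>This relation turns out to be the graph of the R-matrix.\<close>

definition rel :: "nat \<Rightarrow> int \<Rightarrow> int \<Rightarrow> row \<times> row \<Rightarrow> row \<times> row \<Rightarrow> bool" where
  "rel N s t = (\<lambda>(x, y) (x', y'). let M = int N in
    (\<forall>k. 1 \<le> k \<longrightarrow> k \<le> N - 2 \<longrightarrow> linv M x' y' k = linv M x y k) \<and> einv M x' y' = einv M x y \<and>
    snd (lv M x y (N - 1)) = s - t \<and> snd (lv M x' y' (N - 1)) = t - s \<and>
    fst (lv M x' y' (N - 1)) = fst (lv M x y (N - 1)) + (s - t))"

definition peps :: "int \<Rightarrow> row \<times> row \<Rightarrow> int" where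
  "peps i = (\<lambda>(x, y). y (- i) + pos (y (i + 1) - y (- (i + 1))) +
    pos (x (- i) + pos (x (i + 1) - x (- (i + 1))) - y i - pos (y (- (i + 1)) - y (i + 1))))"

definition pphi :: "int \<Rightarrow> row \<times> row \<Rightarrow> int" where
  "pphi i = (\<lambda>(x, y). x i + pos (x (- (i + 1)) - x (i + 1)) +
    pos (y i + pos (y (- (i + 1)) - y (i + 1)) - x (- i) - pos (x (i + 1) - x (- (i + 1)))))"

definition wt :: "int \<Rightarrow> row \<times> row \<Rightarrow> int" where "wt i = (\<lambda>(x, y). x i - x (- i) + y i - y (- i))"

text \<open>Weights can be read off the invariants, so only \<epsilon> needs the maximum formulas
  and \<phi> follows.\<close>

lemma pphi_peps: "pphi i p = peps i p + wt i p - wt (i + 1) p"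
  by (cases p) (auto simp: pphi_def peps_def wt_def pos_def)

lemma wt_linv: "linv M x y k = (a, b, c, d) \<Longrightarrow> wt (M - 1 - int k) (x, y) = a - b + d - c"
  unfolding linv_def wt_def Let_def ia_def ib_def ik_def ix_def th_def et_def pos_def by (auto simp: max_def)

context
  fixes N :: nat and M :: int assumes N: "3 \<le> N" and M: "M = int N"
begin

lemma pmid_fork:
  assumes v: "valid M (x, y)" and p: "pmid (M - 1) (x, y) = (x1, y1)"
  shows "fork_step (x (M-1)) (x (-(M-1))) (y (M-1)) (y (-(M-1))) (x M) (x (-M)) (y M) (y (-M))
    (x1 (M-1)) (x1 (-(M-1))) (y1 (M-1)) (y1 (-(M-1))) (x1 M) (x1 (-M)) (y1 M) (y1 (-M))"
proof -
  have nn: "\<And>l. 0 \<le> x l" "\<And>l. 0 \<le> y l" and e: "x M = 0 \<or> x (- M) = 0" "y M = 0 \<or> y (- M) = 0"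
    using v by (auto simp: valid_def)
  have ps: "pos (x M - x (- M)) = x M" "pos (y (- M) - y M) = y (- M)"
    using e nn[of M] nn[of "- M"] by (auto simp: pos_def)
  have m: "1 \<le> M - 1" "M - 1 = (M - 1 + 2) - 2 - int 0" "M - 1 + 1 = M" using N M by auto
  note n = nn(1)[of M] nn(1)[of "- M"] nn(2)[of M] nn(2)[of "- M"] e
  show ?thesis
  proof (cases rule: pmid_cases[OF m(2,1) nn p, case_names LU LB RU RB])
    case LU
    note L = LU[unfolded m(3) ps]
    show ?thesis unfolding L(3-) by (rule fork_step_1[OF n]) (use L(1,2) n in auto)
  next
    case LB
    note L = LB[unfolded m(3) ps]
    show ?thesis unfolding L(3-) by (rule fork_step_2[OF n]) (use L(1,2) n in auto)
  next
    case RU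
    note L = RU[unfolded m(3) ps]
    show ?thesis unfolding L(3-) by (rule fork_step_3[OF n]) (use L(1,2) n in auto)
  next
    case RB
    note L = RB[unfolded m(3) ps]
    show ?thesis unfolding L(3-) by (rule fork_step_4[OF n]) (use L(1,2) n in auto)
  qed
qed

lemma pmid_fork_eff:
  assumes v: "valid M (x, y)" and p: "pmid (M - 1) (x, y) = (x1, y1)"
  shows "einv M x1 y1 = (case einv M x y of (e, f, e', f') \<Rightarrow> (e - 1, f + 1, e', f'))"
    and "1 \<le> j \<Longrightarrow> j \<le> N - 1 \<Longrightarrow> lv M x1 y1 j = lv M x y j"
    and "1 \<le> j \<Longrightarrow> j \<le> N - 2 \<Longrightarrow> linv M x1 y1 j = linv M x y j"
proof -
  note f = pmid_fork[OF v p, unfolded fork_step_def]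
  have nn: "\<And>l. 0 \<le> x l" "\<And>l. 0 \<le> y l" using v by (auto simp: valid_def)
  have out: "x1 l = x l \<and> y1 l = y l \<and> x1 (- l) = x (- l) \<and> y1 (- l) = y (- l)" if "1 \<le> l" "l \<le> M - 2" for l
    using pmid_out[of "M - 1" "M - 1 + 2" 0 x y x1 y1 l, OF _ _ nn p] pmid_out[of "M - 1" "M - 1 + 2" 0 x y x1 y1 "- l", OF _ _ nn p] that N M by auto
  show "einv M x1 y1 = (case einv M x y of (e, f, e', f') \<Rightarrow> (e - 1, f + 1, e', f'))"
    using f by (simp add: einv_def Let_def)
  have lvj: "lv M x1 y1 (Suc j) = lv M x y (Suc j)" if "Suc j \<le> N - 1" for j
    using that
  proof (induction j)
    case 0
    show ?case using f by (simp add: Let_def)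
  next
    case (Suc j)
    have "lv M x1 y1 (Suc j) = lv M x y (Suc j)" by (rule Suc.IH) (use Suc.prems in simp)
    moreover have "1 \<le> M - 1 - int (Suc j)" "M - 1 - int (Suc j) \<le> M - 2" using Suc.prems N M by auto
    ultimately show ?case by (intro lv_Suc_eq[of M x1 y1 "Suc j" x y "M - 1 - int (Suc j)"] out refl)
  qed
  then show lv: "1 \<le> j \<Longrightarrow> j \<le> N - 1 \<Longrightarrow> lv M x1 y1 j = lv M x y j" for j by (cases j) auto
  show "1 \<le> j \<Longrightarrow> j \<le> N - 2 \<Longrightarrow> linv M x1 y1 j = linv M x y j"
    using lv[of j] out[of "M - 1 - int j"] N M by (auto simp: linv_def Let_def)
qed

lemma pmid_eff:
  assumes v: "valid M (x, y)" and p: "pmid i (x, y) = (x1, y1)" and i: "1 \<le> i" "i = M - 2 - int k"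
  shows "lv M x1 y1 (N - 1) = lv M x y (N - 1)"
    and "j \<le> N - 2 \<Longrightarrow> j \<noteq> k \<Longrightarrow> j \<noteq> Suc k \<Longrightarrow> linv M x1 y1 j = linv M x y j"
    and "1 \<le> k \<Longrightarrow> einv M x1 y1 = einv M x y"
    and "mv (join (linv M x y (Suc k)) (linv M x y k)) (join (linv M x1 y1 (Suc k)) (linv M x1 y1 k))"
    and "k = 0 \<Longrightarrow> mvD (join (linv M x y (Suc 0)) (einv M x y)) (join (linv M x1 y1 (Suc 0)) (einv M x1 y1))"
proof -
  have nn: "\<And>l. 0 \<le> x l" "\<And>l. 0 \<le> y l" and e: "x M = 0 \<or> x (- M) = 0" "y M = 0 \<or> y (- M) = 0"
    using v by (auto simp: valid_def)
  note out = pmid_out[OF i(2,1) nn p]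
  have k: "k + 2 \<le> N - 1" using i N M by auto
  have high: "lv M x1 y1 m = lv M x y m" if "k + 2 \<le> m" "m \<le> N - 1" for m
  proof -
    have "m - (k + 2) + (k + 2) = m" "int m \<le> M - 1" using that N M by auto
    then show ?thesis using pmid_lv_high[OF i(2,1) nn p, of "m - (k + 2)"] by (simp only:)
  qed
  show "lv M x1 y1 (N - 1) = lv M x y (N - 1)" by (rule high[OF k order_refl])
  show "mv (join (linv M x y (Suc k)) (linv M x y k)) (join (linv M x1 y1 (Suc k)) (linv M x1 y1 k))"
    using pmid_mv[OF i(2,1) nn p] by blast
  show "k = 0 \<Longrightarrow> mvD (join (linv M x y (Suc 0)) (einv M x y)) (join (linv M x1 y1 (Suc 0)) (einv M x1 y1))"
    using pmid_mvD[OF i(2,1) nn p _ e] by blast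
  show "einv M x1 y1 = einv M x y" if "1 \<le> k"
    using out[of M] out[of "M - 1"] out[of "- M"] out[of "- (M - 1)"] i that by (simp add: einv_def)
  show "linv M x1 y1 j = linv M x y j" if j: "j \<le> N - 2" "j \<noteq> k" "j \<noteq> Suc k"
  proof -
    have "lv M x1 y1 j = lv M x y j"
    proof (cases "j < k")
      case True then show ?thesis using pmid_lv_low[OF i(2,1) nn p, of j] by simp
    next
      case False
      then show ?thesis using j by (intro high) auto
    qed
    moreover have "x1 l = x l \<and> y1 l = y l \<and> x1 (- l) = x (- l) \<and> y1 (- l) = y (- l)" if "l = M - 1 - int j" for l
      using out[of l] out[of "- l"] i j that N M by auto
    ultimately show ?thesis by (simp add: linv_def Let_def)
  qed
qed

text \<open>Levels away from the move keep their invariants, and at the levels involved the move is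
  a partial bijection of invariants. The equivalence in the conclusion serves raising and lowering
  alike.\<close>

lemma rel_pmid:
  assumes v: "valid M p" "valid M q" and i: "1 \<le> i" "i \<le> M - 1"
  shows "rel N s t (pmid i p) (pmid i q) \<longleftrightarrow> rel N s t p q"
proof -
  obtain x y x' y' where p: "p = (x, y)" and q: "q = (x', y')" by fastforce
  obtain x1 y1 x1' y1' where p1: "pmid i (x, y) = (x1, y1)" and q1: "pmid i (x', y') = (x1', y1')" by fastforce
  note v = v[unfolded p q]
  show ?thesis
  proof (cases "i = M - 1")
    case True
    note f = pmid_fork_eff[OF v(1) p1[unfolded True]] and g = pmid_fork_eff[OF v(2) q1[unfolded True]]
    have "einv M x1' y1' = einv M x1 y1 \<longleftrightarrow> einv M x' y' = einv M x y"
      unfolding f(1) g(1) by (auto split: prod.splits)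
    then show ?thesis unfolding p q p1 q1 rel_def Let_def prod.case M[symmetric]
      using f(2)[of "N - 1"] g(2)[of "N - 1"] f(3) g(3) N by simp
  next
    case False
    define k where "k = nat (M - 2 - i)"
    have k: "i = M - 2 - int k" using False i by (simp add: k_def)
    note f = pmid_eff[OF v(1) p1 i(1) k] and g = pmid_eff[OF v(2) q1 i(1) k]
    have kN: "Suc k \<le> N - 2" using k i N M by auto
    have *: "(\<forall>j. 1 \<le> j \<longrightarrow> j \<le> N - 2 \<longrightarrow> linv M x1' y1' j = linv M x1 y1 j) \<and> einv M x1' y1' = einv M x1 y1 \<longleftrightarrow>
      (\<forall>j. 1 \<le> j \<longrightarrow> j \<le> N - 2 \<longrightarrow> linv M x' y' j = linv M x y j) \<and> einv M x' y' = einv M x y"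
    proof (cases "k = 0")
      case False
      have "(\<forall>j. 1 \<le> j \<longrightarrow> j \<le> N - 2 \<longrightarrow> linv M x1' y1' j = linv M x1 y1 j) \<longleftrightarrow>
          (\<forall>j. 1 \<le> j \<longrightarrow> j \<le> N - 2 \<longrightarrow> linv M x' y' j = linv M x y j)"
      proof (rule all_split2)
        show "linv M x1' y1' (Suc k) = linv M x1 y1 (Suc k) \<and> linv M x1' y1' k = linv M x1 y1 k \<longleftrightarrow>
          linv M x' y' (Suc k) = linv M x y (Suc k) \<and> linv M x' y' k = linv M x y k"
          using mv_eq[OF f(4) g(4)] unfolding join_inject .
        show "1 \<le> k" "Suc k \<le> N - 2" using False kN by auto
        fix j assume j: "j \<le> N - 2" "j \<noteq> k" "j \<noteq> Suc k"
        show "linv M x1' y1' j = linv M x1 y1 j \<longleftrightarrow> linv M x' y' j = linv M x y j" unfolding f(2)[OF j] g(2)[OF j] ..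
      qed
      note eq = this
      have k1: "1 \<le> k" using False by simp
      show ?thesis unfolding f(3)[OF k1] g(3)[OF k1] eq ..
    next
      case True
      show ?thesis
      proof (rule all_split1)
        show "linv M x1' y1' (Suc 0) = linv M x1 y1 (Suc 0) \<and> einv M x1' y1' = einv M x1 y1 \<longleftrightarrow>
          linv M x' y' (Suc 0) = linv M x y (Suc 0) \<and> einv M x' y' = einv M x y"
          using mvD_eq[OF f(5)[OF True] g(5)[OF True]] unfolding join_inject .
        show "Suc 0 \<le> N - 2" using kN by simp
        fix j assume "j \<le> N - 2" "2 \<le> j"
        then have j: "j \<le> N - 2" "j \<noteq> k" "j \<noteq> Suc k" using True by auto
        show "linv M x1' y1' j = linv M x1 y1 j \<longleftrightarrow> linv M x' y' j = linv M x y j" unfolding f(2)[OF j] g(2)[OF j] ..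
      qed
    qed
    show ?thesis unfolding p q p1 q1 rel_def Let_def prod.case M[symmetric] f(1) g(1) using * by blast
  qed
qed

lemma lv_sw:
  assumes "m = M \<or> m = 1" "j \<le> (if m = M then N - 1 else N - 2)"
  shows "lv M (sw m x) (sw m y) j = lv M x y j"
  using assms(2)
proof (induction j)
  case 0
  then show ?case using assms(1) N M by (auto simp: sw_apply tau_end_def sig_end_def)
next
  case (Suc j)
  then have "lv M (sw m x) (sw m y) j = lv M x y j" by simp
  moreover have l: "l \<noteq> m \<and> l \<noteq> - m" "- l \<noteq> m \<and> - l \<noteq> - m" if "l = M - 1 - int j" for l using Suc.prems assms(1) N M that by (auto split: if_splits)
  have "sw m x l = x l \<and> sw m y l = y l \<and> sw m x (- l) = x (- l) \<and> sw m y (- l) = y (- l)" if "l = M - 1 - int j" for l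
    using l[OF that] by (simp add: sw_other)
  ultimately show ?case by (intro lv_Suc_eq[of M "sw m x" "sw m y" j x y "M - 1 - int j"]) auto
qed

lemma linv_sw:
  assumes "m = M \<or> m = 1" "j \<le> (if m = M then N - 2 else N - 3)"
  shows "linv M (sw m x) (sw m y) j = linv M x y j"
proof -
  have lv: "lv M (sw m x) (sw m y) j = lv M x y j" by (rule lv_sw) (use assms in \<open>auto split: if_splits\<close>)
  have l: "l \<noteq> m \<and> l \<noteq> - m" "- l \<noteq> m \<and> - l \<noteq> - m" if "l = M - 1 - int j" for l using assms N M that by (auto split: if_splits)
  show ?thesis by (simp only: linv_def Let_def lv sw_other[OF l(1)[OF refl]] sw_other[OF l(2)[OF refl]])
qed

text \<open>The starting state is symmetric under exchanging \<open>M\<close> and \<open>-M\<close>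
  in both rows, so all states stay the same and only the two halves of \<open>einv\<close> are
  interchanged.\<close>

lemma rel_sw_last: "rel N s t (sw2 M p) (sw2 M q) \<longleftrightarrow> rel N s t p q"
proof -
  have e: "einv M (sw M x) (sw M y) = (case einv M x y of (e, f, e', f') \<Rightarrow> (e', f', e, f))" for x y
    using N M by (simp add: einv_def Let_def sw_apply)
  have "einv M (sw M x') (sw M y') = einv M (sw M x) (sw M y) \<longleftrightarrow> einv M x' y' = einv M x y" for x y x' y'
    unfolding e by (auto split: prod.splits)
  then show ?thesis
    by (cases p; cases q) (simp add: rel_def sw2_def Let_def M[symmetric] lv_sw linv_sw)
qed

lemma level1:
  "lv M x y (N - 1) = (tau (x (- 1)) (y 1) (y (- 1)) (fst (lv M x y (N - 2))) (snd (lv M x y (N - 2))),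
     sig (x 1) (x (- 1)) (y 1) (y (- 1)) (fst (lv M x y (N - 2))) (snd (lv M x y (N - 2))))"
  "linv M x y (N - 2) = (ia (x 1) (x (- 1)) (y 1) (fst (lv M x y (N - 2))) (snd (lv M x y (N - 2))), ib (y (- 1)) (x (- 1)) (y 1) (fst (lv M x y (N - 2))),
     ik (x (- 1)) (y 1) (fst (lv M x y (N - 2))) (snd (lv M x y (N - 2))), ix (x (- 1)) (y 1) (fst (lv M x y (N - 2))) (snd (lv M x y (N - 2))))"
proof -
  have l: "N - 1 = Suc (N - 2)" "M - 1 - int (N - 2) = 1" using N M by auto
  show "lv M x y (N - 1) = (tau (x (- 1)) (y 1) (y (- 1)) (fst (lv M x y (N - 2))) (snd (lv M x y (N - 2))),
     sig (x 1) (x (- 1)) (y 1) (y (- 1)) (fst (lv M x y (N - 2))) (snd (lv M x y (N - 2))))"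
    unfolding l(1) lv.simps Let_def l(2) ..
  show "linv M x y (N - 2) = (ia (x 1) (x (- 1)) (y 1) (fst (lv M x y (N - 2))) (snd (lv M x y (N - 2))), ib (y (- 1)) (x (- 1)) (y 1) (fst (lv M x y (N - 2))),
     ik (x (- 1)) (y 1) (fst (lv M x y (N - 2))) (snd (lv M x y (N - 2))), ix (x (- 1)) (y 1) (fst (lv M x y (N - 2))) (snd (lv M x y (N - 2))))"
    unfolding linv_def Let_def l(2) ..
qed

text \<open>Only the last level sees the interchange, and the conditions on the final states in
  \<open>rel\<close> are the hypotheses that \<open>swap_inv\<close> needs there.\<close>

lemma rel_sw_first1:
  assumes "rel N s t p q" shows "rel N s t (sw2 1 p) (sw2 1 q)"
proof -
  obtain x y x' y' where p: "p = (x, y)" and q: "q = (x', y')" by fastforce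
  note r = assms[unfolded p q rel_def Let_def prod.case M[symmetric]]
  have l2: "linv M x' y' (N - 2) = linv M x y (N - 2)" using r N by auto
  have l: "lv M (sw 1 x) (sw 1 y) (N - 2) = lv M x y (N - 2)" for x y by (rule lv_sw) (use N M in auto)
  have st: "snd (lv M x' y' (N - 1)) = - snd (lv M x y (N - 1))" "fst (lv M x' y' (N - 1)) = fst (lv M x y (N - 1)) + snd (lv M x y (N - 1))"
    using r by auto
  note sv = swap_inv[OF _ _ _ _ st(1)[unfolded level1 fst_conv snd_conv] st(2)[unfolded level1 fst_conv snd_conv]]
  note sv = sv[OF l2[symmetric, unfolded level1 prod.inject, THEN conjunct1]
     l2[symmetric, unfolded level1 prod.inject, THEN conjunct2, THEN conjunct1]
     l2[symmetric, unfolded level1 prod.inject, THEN conjunct2, THEN conjunct2, THEN conjunct1]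
     l2[symmetric, unfolded level1 prod.inject, THEN conjunct2, THEN conjunct2, THEN conjunct2]]
  have a: "sw 1 b 1 = b (- 1)" "sw 1 b (- 1) = b 1" for b by (simp_all add: sw_apply)
  have 1: "linv M (sw 1 x') (sw 1 y') (N - 2) = linv M (sw 1 x) (sw 1 y) (N - 2)"
    unfolding level1 l a using sv(1-4) by simp
  have "linv M (sw 1 x') (sw 1 y') k = linv M (sw 1 x) (sw 1 y) k" if "1 \<le> k" "k \<le> N - 2" for k
  proof (cases "k = N - 2")
    case False
    then show ?thesis using r that N M linv_sw[of 1 k] by auto
  qed (use 1 in simp)
  moreover have "einv M (sw 1 x') (sw 1 y') = einv M (sw 1 x) (sw 1 y)" using r N M by (simp add: einv_def sw_apply Let_def)
  moreover have "snd (lv M (sw 1 x) (sw 1 y) (N - 1)) = snd (lv M x y (N - 1))" for x y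
    unfolding level1 l a snd_conv sig_lin by simp
  moreover have "fst (lv M (sw 1 x') (sw 1 y') (N - 1)) = fst (lv M (sw 1 x) (sw 1 y) (N - 1)) + snd (lv M (sw 1 x) (sw 1 y) (N - 1))"
    unfolding level1 l a fst_conv snd_conv by (rule sv(5))
  ultimately show ?thesis using r unfolding p q rel_def Let_def sw2_def prod.case M[symmetric] by simp
qed

lemma rel_sw_first: "rel N s t (sw2 1 p) (sw2 1 q) \<longleftrightarrow> rel N s t p q"
  using rel_sw_first1[of s t p q] rel_sw_first1[of s t "sw2 1 p" "sw2 1 q"] by auto

lemma rel_wt:
  assumes r: "rel N s t p q" and i: "1 \<le> i" "i \<le> M - 1" shows "wt i q = wt i p"
proof -
  obtain x y x' y' where p: "p = (x, y)" and q: "q = (x', y')" by fastforce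
  note r = r[unfolded p q rel_def Let_def prod.case M[symmetric]]
  show ?thesis
  proof (cases "i = M - 1")
    case True
    have "2 * wt i (x, y) = (case einv M x y of (e, f, e', f') \<Rightarrow> f - e + f' - e')" for x y
      unfolding einv_def Let_def prod.case wt_def fork_e_def fork_f_def True pos_def by (auto simp: max_def)
    from this[of x y] this[of x' y'] show ?thesis using r unfolding p q by simp
  next
    case False
    define k where "k = nat (M - 1 - i)"
    have k: "i = M - 1 - int k" "1 \<le> k" "k \<le> N - 2" using False i N M by (auto simp: k_def)
    obtain a b c d where l: "linv M x y k = (a, b, c, d)" by (cases "linv M x y k") auto
    moreover have "linv M x' y' k = (a, b, c, d)" using r k l by auto
    ultimately show ?thesis unfolding p q using wt_linv[of M x y k] wt_linv[of M x' y' k] k(1) by simp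
  qed
qed

lemma peps_fork:
  assumes "valid M (x, y)"
  shows "peps (M - 1) (x, y) = fst (einv M x y)" "pphi (M - 1) (x, y) = fst (snd (einv M x y))"
proof -
  have nn: "0 \<le> x M" "0 \<le> x (- M)" "0 \<le> y M" "0 \<le> y (- M)" and e: "x M = 0 \<or> x (- M) = 0" "y M = 0 \<or> y (- M) = 0"
    using assms by (auto simp: valid_def)
  have ps: "pos (x M - x (- M)) = x M" "pos (x (- M) - x M) = x (- M)" "pos (y M - y (- M)) = y M" "pos (y (- M) - y M) = y (- M)"
    using e nn by (auto simp: pos_def)
  have m: "M - 1 + 1 = M" by simp
  show "peps (M - 1) (x, y) = fst (einv M x y)" "pphi (M - 1) (x, y) = fst (snd (einv M x y))"
    unfolding peps_def pphi_def prod.case m ps einv_def Let_def fst_conv snd_conv fork_e_def fork_f_def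
    by (simp_all add: algebra_simps)
qed

lemma rel_eps:
  assumes r: "rel N s t p q" and v: "valid M p" "valid M q" and i: "1 \<le> i" "i \<le> M - 1"
  shows "peps i q = peps i p" "pphi i q = pphi i p"
proof -
  obtain x y x' y' where p: "p = (x, y)" and q: "q = (x', y')" by fastforce
  note v = v[unfolded p q]
  note r' = r[unfolded p q rel_def Let_def prod.case M[symmetric]]
  have "peps i q = peps i p \<and> pphi i q = pphi i p"
  proof (cases "i = M - 1")
    case True
    then show ?thesis unfolding p q using peps_fork[OF v(1)] peps_fork[OF v(2)] r' by simp
  next
    case False
    define k where "k = nat (M - 2 - i)"
    have k: "i = M - 2 - int k" using False i by (simp add: k_def)
    have kN: "Suc k \<le> N - 2" using k i N M by auto
    have "peps i q = peps i p"
    proof (cases "k = 0")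
      case False
      have *: "2 * peps i (x, y) = mv_eps (join (linv M x y (Suc k)) (linv M x y k))" if "valid M (x, y)" for x y
        using that unfolding inv2_lv[OF k, symmetric] peps_def prod.case by (subst mv_eps_eq) (auto simp: valid_def algebra_simps)
      show ?thesis unfolding p q using *[OF v(1)] *[OF v(2)] r' kN False by simp
    next
      case True
      then have k': "i = M - 2" using k by simp
      have *: "2 * peps i (x, y) = mvD_eps (join (linv M x y (Suc 0)) (einv M x y))" if "valid M (x, y)" for x y
        using that unfolding invD_lv[OF k', symmetric] peps_def prod.case by (subst mvD_eps_eq) (auto simp: valid_def algebra_simps)
      show ?thesis unfolding p q using *[OF v(1)] *[OF v(2)] r' kN True by simp
    qed
    moreover have "wt i q = wt i p" "wt (i + 1) q = wt (i + 1) p" using rel_wt[OF r] i False by auto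
    ultimately show ?thesis unfolding pphi_peps by simp
  qed
  then show "peps i q = peps i p" "pphi i q = pphi i p" by auto
qed

end

definition pleft :: "int \<Rightarrow> row \<times> row \<Rightarrow> bool" where
  "pleft i = (\<lambda>(x, y). y i + pos (y (- (i + 1)) - y (i + 1)) < x (- i) + pos (x (i + 1) - x (- (i + 1))))"

section \<open>All nodes of type D, by conjugation with diagram automorphisms\<close>

definition nd :: "nat \<Rightarrow> nat \<Rightarrow> int" where "nd N i = (if i = 0 then 1 else if i = N then int N - 1 else int i)"
definition tw :: "nat \<Rightarrow> nat \<Rightarrow> row \<Rightarrow> row" where "tw N i = (if i = 0 then sw 1 else if i = N then sw (int N) else id)"
definition tw2 :: "nat \<Rightarrow> nat \<Rightarrow> row \<times> row \<Rightarrow> row \<times> row" where "tw2 N i = (\<lambda>(x, y). (tw N i x, tw N i y))"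

lemma tw2_alt: "tw2 N i p = (if i = 0 then sw2 1 p else if i = N then sw2 (int N) p else p)"
  by (cases p) (simp add: tw2_def tw_def sw2_def)

lemma tw2_tw2 [simp]: "tw2 N i (tw2 N i p) = p" by (simp add: tw2_alt)

lemma pmid_left: "pmid i p = (if pleft i p then (e_mid D1 i (fst p), snd p) else (fst p, e_mid D1 i (snd p)))"
  by (cases p) (simp add: pmid_def pleft_def)

context
  fixes N :: nat and M :: int assumes N: "3 \<le> N" and M: "M = int N"
begin

lemma good: "good_rank D1 N" using N by (simp add: good_rank_def)

lemma nd_bounds: "i \<le> N \<Longrightarrow> 1 \<le> nd N i \<and> nd N i \<le> M - 1"
  using N M by (auto simp: nd_def)

lemma valid_rows: "x \<in> KR_rows D1 N s \<Longrightarrow> y \<in> KR_rows D1 N t \<Longrightarrow> valid M (x, y)"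
  by (auto simp: valid_def KR_rows_def M)

lemma valid_tw2: "valid M p \<Longrightarrow> valid M (tw2 N i p)"
  by (simp add: tw2_alt M[symmetric])

text \<open>Nodes 0 and \<open>N\<close> are conjugated to 1 and \<open>N - 1\<close>, so the
  analysis of \<open>e_mid\<close> covers every node. For node \<open>N\<close> this uses that a row
  does not contain both \<open>N\<close> and \<open>-N\<close>.\<close>

lemma row_fork:
  assumes x: "x \<in> KR_rows D1 N s" and i: "i \<le> N"
  shows "row_eps D1 N s i x = tw N i x (- nd N i) + pos (tw N i x (nd N i + 1) - tw N i x (- (nd N i + 1)))"
    and "row_phi D1 N s i x = tw N i x (nd N i) + pos (tw N i x (- (nd N i + 1)) - tw N i x (nd N i + 1))"
    and "e_row D1 N i x = tw N i (e_mid D1 (nd N i) (tw N i x))"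
proof -
  have e: "x M = 0 \<or> x (- M) = 0" and nn: "0 \<le> x M" "0 \<le> x (- M)" using x by (auto simp: KR_rows_def M)
  have ps: "pos (x (- M) - x M) = x (- M)" "pos (x M - x (- M)) = x M" using e nn by (auto simp: pos_def)
  have m1: "M - 1 + 1 = M" "M \<noteq> 0" "3 \<le> M" "int N = M" using N M by auto
  show "row_eps D1 N s i x = tw N i x (- nd N i) + pos (tw N i x (nd N i + 1) - tw N i x (- (nd N i + 1)))"
    "row_phi D1 N s i x = tw N i x (nd N i) + pos (tw N i x (- (nd N i + 1)) - tw N i x (nd N i + 1))"
    using ps m1 N by (auto simp: row_eps_def row_phi_def tw_def nd_def sw_apply)
  show "e_row D1 N i x = tw N i (e_mid D1 (nd N i) (tw N i x))"
  proof -
    consider "i = 0" | "i = N" "i \<noteq> 0" | "i \<noteq> 0" "i \<noteq> N" by blast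
    then show ?thesis
    proof cases
      case 1
      then show ?thesis by (auto simp: e_row_def e_zero_def e_mid_def tw_def nd_def fun_eq_iff sw_apply change_apply)
    next
      case 2
      have "b 0 = 0 \<and> b 1 = b 1" if "b = x" for b :: row using x that by (auto simp: KR_rows_def letters_def)
      have c: "x (- M) = 0 \<longleftrightarrow> \<not> x (- M) > x M" using e nn by auto
      show ?thesis using 2 m1 e nn
        by (cases "x (- M) = 0")
          (auto simp: e_row_def e_last_def e_mid_def tw_def nd_def fun_eq_iff sw_apply change_apply c)
    next
      case 3
      then show ?thesis by (simp add: e_row_def tw_def nd_def)
    qed
  qed
qed

lemma D1_left:
  assumes "x \<in> KR_rows D1 N s" "y \<in> KR_rows D1 N t" "i \<le> N"
  shows "phi (KR D1 N t) i y < eps (KR D1 N s) i x \<longleftrightarrow> pleft (nd N i) (tw2 N i (x, y))"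
  unfolding of_nat_less_iff[where 'a = int, symmetric] KR_eps[OF good assms(3,1)] KR_phi[OF good assms(3,2)] row_fork(1)[OF assms(1,3)] row_fork(2)[OF assms(2,3)]
    pleft_def tw2_def prod.case ..

lemma D1_e:
  assumes "x \<in> KR_rows D1 N s" "y \<in> KR_rows D1 N t" "i \<le> N" "eop (KR D1 N s \<otimes>\<^sub>c KR D1 N t) i (x, y) = Some p"
  shows "p = tw2 N i (pmid (nd N i) (tw2 N i (x, y)))"
proof -
  have tt: "tw N i (tw N i b) = b" for b by (simp add: tw_def)
  show ?thesis
    using assms(4) row_fork(3)[OF assms(1,3)] row_fork(3)[OF assms(2,3)]
    unfolding eop_tensor D1_left[OF assms(1-3)] pmid_left
    by (auto simp: tw2_def tt split: if_splits)
qed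

lemma D1_eps:
  assumes "x \<in> KR_rows D1 N s" "y \<in> KR_rows D1 N t" "i \<le> N"
  shows "int (eps (KR D1 N s \<otimes>\<^sub>c KR D1 N t) i (x, y)) = peps (nd N i) (tw2 N i (x, y))"
    and "int (phi (KR D1 N s \<otimes>\<^sub>c KR D1 N t) i (x, y)) = pphi (nd N i) (tw2 N i (x, y))"
proof -
  have i: "i \<in> {0..N}" using assms(3) by simp
  have c: "x \<in> carr (KR D1 N s)" "y \<in> carr (KR D1 N t)" using assms by auto
  note t = eps_tensor[OF KR_regular[OF good] KR_regular[OF good] i c] phi_tensor[OF KR_regular[OF good] KR_regular[OF good] i c]
  note f = KR_eps[OF good assms(3,1)] KR_phi[OF good assms(3,1)] KR_eps[OF good assms(3,2)] KR_phi[OF good assms(3,2)]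
  have p: "int (a - b) = pos (int a - int b)" for a b by (auto simp: pos_def)
  show "int (eps (KR D1 N s \<otimes>\<^sub>c KR D1 N t) i (x, y)) = peps (nd N i) (tw2 N i (x, y))"
    "int (phi (KR D1 N s \<otimes>\<^sub>c KR D1 N t) i (x, y)) = pphi (nd N i) (tw2 N i (x, y))"
    unfolding t of_nat_add p f row_fork[OF assms(1,3)] row_fork[OF assms(2,3)]
    by (simp_all add: peps_def pphi_def tw2_def algebra_simps)
qed

lemma rel_tw2: "rel N s t (tw2 N i p) (tw2 N i q) \<longleftrightarrow> rel N s t p q"
  using rel_sw_first[OF N M] rel_sw_last[OF N M] by (simp add: tw2_alt M)

lemma rel_e:
  assumes "valid M p" "valid M q" "i \<le> N"
  shows "rel N s t (tw2 N i (pmid (nd N i) (tw2 N i p))) (tw2 N i (pmid (nd N i) (tw2 N i q))) \<longleftrightarrow> rel N s t p q"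
  unfolding rel_tw2 using rel_pmid[OF N M valid_tw2[OF assms(1)] valid_tw2[OF assms(2)], of "nd N i"] nd_bounds[OF assms(3)] rel_tw2 by simp

lemma D1_bisim: "bisim {0..N} (KR D1 N s \<otimes>\<^sub>c KR D1 N t) (KR D1 N t \<otimes>\<^sub>c KR D1 N s) (rel N (int s) (int t))"
  unfolding bisim_def
proof (intro ballI impI)
  fix p q i assume p: "p \<in> carr (KR D1 N s \<otimes>\<^sub>c KR D1 N t)" and q: "q \<in> carr (KR D1 N t \<otimes>\<^sub>c KR D1 N s)"
    and r: "rel N (int s) (int t) p q" and i: "i \<in> {0..N}"
  have i': "i \<le> N" using i by simp
  note reg = regular_tensor[OF KR_regular[OF good] KR_regular[OF good]]
  have v: "valid M p" "valid M q" using p q valid_rows by auto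
  have e: "p' = tw2 N i (pmid (nd N i) (tw2 N i p))"
    if "eop (KR D1 N s \<otimes>\<^sub>c KR D1 N t) i p = Some p'" "p \<in> carr (KR D1 N s \<otimes>\<^sub>c KR D1 N t)" for s t p p'
    using that D1_e[of "fst p" s "snd p" t i p'] i' by (cases p) auto
  have c: "valid M p" if "p \<in> carr (KR D1 N s \<otimes>\<^sub>c KR D1 N t)" for p s t using that valid_rows by auto
  have rr: "rel N (int s) (int t) (tw2 N i p) (tw2 N i q)" using r rel_tw2 by simp
  note pe = rel_eps[OF N M rr valid_tw2[OF v(1)] valid_tw2[OF v(2)] conjunct1[OF nd_bounds[OF i']] conjunct2[OF nd_bounds[OF i']]]
  have ep: "int (eps (KR D1 N s \<otimes>\<^sub>c KR D1 N t) i p) = peps (nd N i) (tw2 N i p)" "int (phi (KR D1 N s \<otimes>\<^sub>c KR D1 N t) i p) = pphi (nd N i) (tw2 N i p)"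
    if "p \<in> carr (KR D1 N s \<otimes>\<^sub>c KR D1 N t)" for p s t using D1_eps[of "fst p" s "snd p" t i] that i' by auto
  have ee: "eps (KR D1 N s \<otimes>\<^sub>c KR D1 N t) i p = eps (KR D1 N t \<otimes>\<^sub>c KR D1 N s) i q"
    "phi (KR D1 N s \<otimes>\<^sub>c KR D1 N t) i p = phi (KR D1 N t \<otimes>\<^sub>c KR D1 N s) i q"
    using ep[OF p] ep[OF q] pe by linarith+
  have E: "rel N (int s) (int t) p' q'" if "eop (KR D1 N s \<otimes>\<^sub>c KR D1 N t) i p = Some p'" "eop (KR D1 N t \<otimes>\<^sub>c KR D1 N s) i q = Some q'" for p' q'
    using rel_e[OF v i'] r e[OF that(1) p] e[OF that(2) q] by simp
  \<comment> \<open>Lowering is treated as raising read backwards, which works because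
    \<open>rel_e\<close> is an equivalence.\<close>
  have F: "rel N (int s) (int t) p' q'" if f: "fop (KR D1 N s \<otimes>\<^sub>c KR D1 N t) i p = Some p'" "fop (KR D1 N t \<otimes>\<^sub>c KR D1 N s) i q = Some q'" for p' q'
  proof -
    note a = regular_f(1,2)[OF reg i p f(1)] and b = regular_f(1,2)[OF reg i q f(2)]
    show ?thesis using rel_e[OF c[OF a(1)] c[OF b(1)] i'] r e[OF a(2,1)] e[OF b(2,1)] by simp
  qed
  show "eps (KR D1 N s \<otimes>\<^sub>c KR D1 N t) i p = eps (KR D1 N t \<otimes>\<^sub>c KR D1 N s) i q \<and>
    phi (KR D1 N s \<otimes>\<^sub>c KR D1 N t) i p = phi (KR D1 N t \<otimes>\<^sub>c KR D1 N s) i q \<and>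
    (\<forall>p' q'. eop (KR D1 N s \<otimes>\<^sub>c KR D1 N t) i p = Some p' \<longrightarrow> eop (KR D1 N t \<otimes>\<^sub>c KR D1 N s) i q = Some q' \<longrightarrow> rel N (int s) (int t) p' q') \<and>
    (\<forall>p' q'. fop (KR D1 N s \<otimes>\<^sub>c KR D1 N t) i p = Some p' \<longrightarrow> fop (KR D1 N t \<otimes>\<^sub>c KR D1 N s) i q = Some q' \<longrightarrow> rel N (int s) (int t) p' q')"
    using ee E F by blast
qed

lemma lv_zero:
  assumes "\<And>l. 2 \<le> \<bar>l\<bar> \<Longrightarrow> x l = 0 \<and> y l = 0" and "k \<le> N - 2"
  shows "lv M x y k = (0, 0)"
  using assms(2)
proof (induction k)
  case 0
  show ?case using assms(1)[of M] assms(1)[of "- M"] N M by (simp add: tau_end_def sig_end_def)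
next
  case (Suc k)
  have "2 \<le> \<bar>M - 1 - int k\<bar>" "2 \<le> \<bar>- (M - 1 - int k)\<bar>" using Suc.prems N M by auto
  then have z: "x (M - 1 - int k) = 0" "y (M - 1 - int k) = 0" "x (- (M - 1 - int k)) = 0" "y (- (M - 1 - int k)) = 0"
    using assms(1) by auto
  have IH: "lv M x y k = (0, 0)" using Suc by simp
  show ?case unfolding lv.simps Let_def IH z by (simp add: tau_def sig_def et_def th_def pos_def)
qed

lemma u_level:
  assumes "x = (\<lambda>l. if l = 1 then s else if l = -1 then s' else 0)" "y = (\<lambda>l. if l = 1 then t else if l = -1 then t' else 0)"
  shows "lv M x y (N - 1) = (tau s' t t' 0 0, sig s s' t t' 0 0)" "linv M x y (N - 2) = (ia s s' t 0 0, ib t' s' t 0, ik s' t 0 0, ix s' t 0 0)"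
    "k \<le> N - 3 \<Longrightarrow> linv M x y k = (0, 0, 0, 0)" "einv M x y = (0, 0, 0, 0)"
proof -
  have z: "x l = 0 \<and> y l = 0" if "2 \<le> \<bar>l\<bar>" for l using that assms by auto
  note l = lv_zero[OF z]
  have v: "x 1 = s" "x (- 1) = s'" "y 1 = t" "y (- 1) = t'" using assms by auto
  show "lv M x y (N - 1) = (tau s' t t' 0 0, sig s s' t t' 0 0)" "linv M x y (N - 2) = (ia s s' t 0 0, ib t' s' t 0, ik s' t 0 0, ix s' t 0 0)"
    unfolding level1[OF N M] v by (simp_all add: l)
  show "einv M x y = (0, 0, 0, 0)" using z[of M] z[of "- M"] z[of "M - 1"] z[of "- (M - 1)"] N M by (simp add: einv_def Let_def fork_e_def fork_f_def pos_def)
  show "linv M x y k = (0, 0, 0, 0)" if "k \<le> N - 3"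
  proof -
    have "2 \<le> \<bar>M - 1 - int k\<bar>" "2 \<le> \<bar>- (M - 1 - int k)\<bar>" using that N M by auto
    then have y: "x (M - 1 - int k) = 0" "y (M - 1 - int k) = 0" "x (- (M - 1 - int k)) = 0" "y (- (M - 1 - int k)) = 0" using z by auto
    have IH: "lv M x y k = (0, 0)" by (rule l) (use that in auto)
    show ?thesis unfolding linv_def Let_def IH y by (simp add: ia_def ib_def ik_def ix_def et_def th_def pos_def)
  qed
qed

lemma rel_u_gen:
  assumes nn: "0 \<le> s" "0 \<le> t"
  shows "rel N s t (\<lambda>l. if l = 1 then s else 0, \<lambda>l. if l = 1 then t else 0) (\<lambda>l. if l = 1 then t else 0, \<lambda>l. if l = 1 then s else 0)"
proof -
  have e: "(\<lambda>l :: int. if l = 1 then s else 0) = (\<lambda>l. if l = 1 then s else if l = - 1 then 0 else 0)" for s :: int by auto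
  note u = u_level[OF e e]
  show ?thesis unfolding rel_def Let_def prod.case M[symmetric]
  proof (intro conjI allI impI)
    fix k assume k: "1 \<le> k" "k \<le> N - 2"
    show "linv M (\<lambda>l. if l = 1 then t else 0) (\<lambda>l. if l = 1 then s else 0) k = linv M (\<lambda>l. if l = 1 then s else 0) (\<lambda>l. if l = 1 then t else 0) k"
    proof (cases "k = N - 2")
      case True
      show ?thesis unfolding True u(2) using nn by (simp add: ia_def ib_def ik_def ix_def et_def th_def pos_def)
    next
      case False
      then have "k \<le> N - 3" using k by simp
      then show ?thesis by (simp only: u(3))
    qed
  qed (use nn in \<open>simp_all only: u, simp_all add: tau_def sig_def et_def th_def pos_def\<close>)
qed

end

section \<open>The local coenergy of type D\<close>

definition band :: "int \<Rightarrow> nat \<Rightarrow> int set" where "band M k = {l. M - int k \<le> \<bar>l\<bar> \<and> \<bar>l\<bar> \<le> M}"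

lemma finite_band [simp]: "finite (band M k)"
  by (rule finite_subset[of _ "{- M..M}"]) (auto simp: band_def)

lemma sum_band_Suc:
  assumes "int k < M - 1" shows "sum b (band M (Suc k)) = sum b (band M k) + b (M - 1 - int k) + b (- (M - 1 - int k) :: int)"
proof -
  have "band M (Suc k) = insert (M - 1 - int k) (insert (- (M - 1 - int k)) (band M k))"
    using assms by (auto simp: band_def abs_if split: if_splits)
  moreover have "M - 1 - int k \<notin> band M k" "- (M - 1 - int k) \<notin> band M k" "M - 1 - int k \<noteq> - (M - 1 - int k)"
    using assms by (auto simp: band_def)
  ultimately show ?thesis by (simp add: algebra_simps)
qed

context
  fixes N :: nat and M :: int assumes N: "3 \<le> N" and M: "M = int N"
begin

lemma lv_sizes:
  assumes nn: "\<And>l. 0 \<le> x l" "\<And>l. 0 \<le> y l" and k: "k \<le> N - 1"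
  shows "snd (lv M x y k) = sum x (band M k) - sum y (band M k)" "fst (lv M x y k) \<le> sum y (band M k)"
proof -
  have "snd (lv M x y k) = sum x (band M k) - sum y (band M k) \<and> fst (lv M x y k) \<le> sum y (band M k)"
    using k
  proof (induction k)
    case 0
    have "band M 0 = {M, - M}" using N M by (auto simp: band_def)
    moreover have "M \<noteq> - M" using N M by auto
    ultimately show ?case using nn(1)[of M] nn(1)[of "- M"] nn(2)[of M] nn(2)[of "- M"] by (auto simp: tau_end_def sig_end_def min_def)
  next
    case (Suc k)
    have k: "int k < M - 1" using Suc.prems N M by auto
    define i where "i = M - 1 - int k"
    \<comment> \<open>Nonnegativity of the deficit \<open>h\<close> is the substance of the
      induction; \<open>tau_coenergy\<close> carries it to the next level.\<close>
    define s t h where "s = sum x (band M k)" "t = sum y (band M k)" "h = t - fst (lv M x y k)"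
    have IH: "snd (lv M x y k) = s - t" "fst (lv M x y k) = t - h" "0 \<le> h" using Suc by (auto simp: s_t_h_def)
    have st: "0 \<le> s" "0 \<le> t" using nn by (auto simp: s_t_h_def intro!: sum_nonneg)
    have l: "lv M x y (Suc k) = (tau (x (- i)) (y i) (y (- i)) (t - h) (s - t), sig (x i) (x (- i)) (y i) (y (- i)) (t - h) (s - t))"
      unfolding lv.simps Let_def IH i_def ..
    have "0 \<le> min (min (s + pos (x (- i) - y i)) (h + \<bar>x (- i) - y i\<bar>)) (t + pos (y i - x (- i))) + 2 * min (x (- i)) (y i)"
      using IH(3) st nn(1)[of "- i"] nn(2)[of i] by (auto simp: min_def)
    then have "tau (x (- i)) (y i) (y (- i)) (t - h) (s - t) \<le> t + y i + y (- i)"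
      using tau_coenergy[of "y i" "y (- i)" t "x (- i)" h s] by linarith
    then show ?case unfolding l fst_conv snd_conv sig_lin sum_band_Suc[OF k] i_def[symmetric] s_t_h_def[symmetric] by simp
  qed
  then show "snd (lv M x y k) = sum x (band M k) - sum y (band M k)" "fst (lv M x y k) \<le> sum y (band M k)" by auto
qed

lemma band_letters: "band M (N - 1) = letters D1 N"
  using N M by (auto simp: band_def letters_def)

text \<open>The final deficit. The last condition in \<open>rel\<close> says that a pair and its
  image have the same one; up to the scale of an embedding it is the local coenergy.\<close>

definition coen :: "nat \<Rightarrow> row \<times> row \<Rightarrow> int" where "coen t p = int t - fst (lv M (fst p) (snd p) (N - 1))"

lemma coen_nonneg:
  assumes "x \<in> KR_rows D1 N s" "y \<in> KR_rows D1 N t" shows "0 \<le> coen t (x, y)"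
proof -
  have "sum y (letters D1 N) = int t" using assms(2) by (simp add: KR_rows_def size_ok_def row_size_def)
  moreover have "fst (lv M x y (N - 1)) \<le> sum y (band M (N - 1))"
    by (rule lv_sizes(2)) (use assms in \<open>auto simp: KR_rows_def\<close>)
  ultimately show ?thesis unfolding band_letters by (simp add: coen_def)
qed

text \<open>The index 0, absent from \<open>rel\<close>, is recovered from \<open>einv\<close>
  through \<open>end_gen\<close>.\<close>

lemma rel_linv:
  assumes r: "rel N s t (x, y) (x', y')" and v: "valid M (x, y)" "valid M (x', y')" and k: "k \<le> N - 2"
  shows "linv M x' y' k = linv M x y k"
proof (cases "k = 0")
  case False
  then show ?thesis using r k by (simp add: rel_def Let_def M[symmetric])
next
  case True
  have e: "einv M x' y' = einv M x y" using r by (simp add: rel_def Let_def M[symmetric])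
  have n: "0 \<le> x M" "0 \<le> x (- M)" "0 \<le> y M" "0 \<le> y (- M)" "x M = 0 \<or> x (- M) = 0" "y M = 0 \<or> y (- M) = 0"
    "0 \<le> x' M" "0 \<le> x' (- M)" "0 \<le> y' M" "0 \<le> y' (- M)" "x' M = 0 \<or> x' (- M) = 0" "y' M = 0 \<or> y' (- M) = 0"
    using v by (auto simp: valid_def)
  note e = e[symmetric, unfolded einv_def Let_def prod.inject]
  have m: "M - 1 - int 0 = M - 1" by simp
  note g = end_gen[OF conjunct1[OF e] conjunct1[OF conjunct2[OF e]] conjunct1[OF conjunct2[OF conjunct2[OF e]]]
    conjunct2[OF conjunct2[OF conjunct2[OF e]]] n refl refl refl refl]
  show ?thesis unfolding linv_def Let_def True m lv.simps fst_conv snd_conv prod.inject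
    using g by simp
qed

lemma rel_level1:
  assumes r: "rel N s t (x, y) (x', y')"
  defines "T \<equiv> fst (lv M x y (N - 2))" and "S \<equiv> snd (lv M x y (N - 2))" and "T' \<equiv> fst (lv M x' y' (N - 2))" and "S' \<equiv> snd (lv M x' y' (N - 2))"
  shows "ia (x 1) (x (- 1)) (y 1) T S = ia (x' 1) (x' (- 1)) (y' 1) T' S'" "ib (y (- 1)) (x (- 1)) (y 1) T = ib (y' (- 1)) (x' (- 1)) (y' 1) T'"
    "ik (x (- 1)) (y 1) T S = ik (x' (- 1)) (y' 1) T' S'" "ix (x (- 1)) (y 1) T S = ix (x' (- 1)) (y' 1) T' S'"
    "sig (x' 1) (x' (- 1)) (y' 1) (y' (- 1)) T' S' = - sig (x 1) (x (- 1)) (y 1) (y (- 1)) T S"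
    "tau (x' (- 1)) (y' 1) (y' (- 1)) T' S' = tau (x (- 1)) (y 1) (y (- 1)) T S + sig (x 1) (x (- 1)) (y 1) (y (- 1)) T S"
    "sig (x 1) (x (- 1)) (y 1) (y (- 1)) T S = s - t"
proof -
  have "linv M x' y' (N - 2) = linv M x y (N - 2)" using r N by (simp add: rel_def Let_def M[symmetric])
  then show "ia (x 1) (x (- 1)) (y 1) T S = ia (x' 1) (x' (- 1)) (y' 1) T' S'" "ib (y (- 1)) (x (- 1)) (y 1) T = ib (y' (- 1)) (x' (- 1)) (y' 1) T'"
    "ik (x (- 1)) (y 1) T S = ik (x' (- 1)) (y' 1) T' S'" "ix (x (- 1)) (y 1) T S = ix (x' (- 1)) (y' 1) T' S'"
    unfolding level1(2)[OF N M] T_def S_def T'_def S'_def by simp_all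
  show "sig (x' 1) (x' (- 1)) (y' 1) (y' (- 1)) T' S' = - sig (x 1) (x (- 1)) (y 1) (y (- 1)) T S"
    "tau (x' (- 1)) (y' 1) (y' (- 1)) T' S' = tau (x (- 1)) (y 1) (y (- 1)) T S + sig (x 1) (x (- 1)) (y 1) (y (- 1)) T S"
    "sig (x 1) (x (- 1)) (y 1) (y (- 1)) T S = s - t"
    using r unfolding rel_def Let_def M[symmetric] prod.case level1(1)[OF N M] T_def S_def T'_def S'_def fst_conv snd_conv by simp_all
qed

lemma level2:
  "lv M x y (N - 2) = (tau (x (- (1 + 1))) (y (1 + 1)) (y (- (1 + 1))) (fst (lv M x y (N - 3))) (snd (lv M x y (N - 3))),
     sig (x (1 + 1)) (x (- (1 + 1))) (y (1 + 1)) (y (- (1 + 1))) (fst (lv M x y (N - 3))) (snd (lv M x y (N - 3))))"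
  "linv M x y (N - 3) = (ia (x (1 + 1)) (x (- (1 + 1))) (y (1 + 1)) (fst (lv M x y (N - 3))) (snd (lv M x y (N - 3))), ib (y (- (1 + 1))) (x (- (1 + 1))) (y (1 + 1)) (fst (lv M x y (N - 3))),
     ik (x (- (1 + 1))) (y (1 + 1)) (fst (lv M x y (N - 3))) (snd (lv M x y (N - 3))), ix (x (- (1 + 1))) (y (1 + 1)) (fst (lv M x y (N - 3))) (snd (lv M x y (N - 3))))"
proof -
  have l: "N - 2 = Suc (N - 3)" "M - 1 - int (N - 3) = 1 + 1" using N M by auto
  show "lv M x y (N - 2) = (tau (x (- (1 + 1))) (y (1 + 1)) (y (- (1 + 1))) (fst (lv M x y (N - 3))) (snd (lv M x y (N - 3))),
     sig (x (1 + 1)) (x (- (1 + 1))) (y (1 + 1)) (y (- (1 + 1))) (fst (lv M x y (N - 3))) (snd (lv M x y (N - 3))))"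
    unfolding l(1) lv.simps Let_def l(2) ..
  show "linv M x y (N - 3) = (ia (x (1 + 1)) (x (- (1 + 1))) (y (1 + 1)) (fst (lv M x y (N - 3))) (snd (lv M x y (N - 3))), ib (y (- (1 + 1))) (x (- (1 + 1))) (y (1 + 1)) (fst (lv M x y (N - 3))),
     ik (x (- (1 + 1))) (y (1 + 1)) (fst (lv M x y (N - 3))) (snd (lv M x y (N - 3))), ix (x (- (1 + 1))) (y (1 + 1)) (fst (lv M x y (N - 3))) (snd (lv M x y (N - 3))))"
    unfolding linv_def Let_def l(2) ..
qed

text \<open>Node 0 acts as node 1 between two interchanges of \<open>1\<close> and
  \<open>-1\<close>, so \<open>coen\<close> is evaluated on interchanged pairs while the move takes
  place at node 1.\<close>

lemma coen_step:
  assumes v: "valid M P" "valid M Q" and r: "rel N s t P Q"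
  shows "coen u (sw2 1 (pmid 1 P)) - coen u (sw2 1 P) = (if pleft 1 P then 1 else 0) - (if pleft 1 Q then 0 else 1)"
proof -
  obtain x y x' y' where P: "P = (x, y)" and Q: "Q = (x', y')" by fastforce
  obtain x1 y1 where p1: "pmid 1 (x, y) = (x1, y1)" by fastforce
  note v = v[unfolded P Q] and r = r[unfolded P Q]
  have nn: "\<And>l. 0 \<le> x l" "\<And>l. 0 \<le> y l" and nn': "\<And>l. 0 \<le> x' l" "\<And>l. 0 \<le> y' l" using v by (auto simp: valid_def)
  have k: "1 = M - 2 - int (N - 3)" "(1::int) \<le> 1" using N M by auto
  have lvsw: "fst (lv M (sw 1 x) (sw 1 y) (N - 1)) = tau (x 1) (y (- 1)) (y 1) (fst (lv M x y (N - 2))) (snd (lv M x y (N - 2)))" for x y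
  proof -
    have "lv M (sw 1 x) (sw 1 y) (N - 2) = lv M x y (N - 2)" by (rule lv_sw[OF N M]) (use N M in auto)
    then show ?thesis unfolding level1[OF N M] by (simp add: sw_apply)
  qed
  note low = pmid_lv_low[OF k nn p1 order_refl]
  have TS1: "fst (lv M x1 y1 (N - 2)) = tau (x1 (- (1 + 1))) (y1 (1 + 1)) (y1 (- (1 + 1))) (fst (lv M x y (N - 3))) (snd (lv M x y (N - 3)))"
    "snd (lv M x1 y1 (N - 2)) = sig (x1 (1 + 1)) (x1 (- (1 + 1))) (y1 (1 + 1)) (y1 (- (1 + 1))) (fst (lv M x y (N - 3))) (snd (lv M x y (N - 3)))"
    unfolding level2 low by simp_all
  have inv: "inv2 (x 1) (x (- 1)) (y 1) (y (- 1)) (x (1 + 1)) (x (- (1 + 1))) (y (1 + 1)) (y (- (1 + 1))) (fst (lv M x y (N - 3))) (snd (lv M x y (N - 3))) =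
    inv2 (x' 1) (x' (- 1)) (y' 1) (y' (- 1)) (x' (1 + 1)) (x' (- (1 + 1))) (y' (1 + 1)) (y' (- (1 + 1))) (fst (lv M x' y' (N - 3))) (snd (lv M x' y' (N - 3)))"
    unfolding inv2_lv[OF k(1)] join_inject using rel_linv[OF r v, of "Suc (N - 3)"] rel_linv[OF r v, of "N - 3"] N by simp
  have TS: "fst (lv M x y (N - 2)) = tau (x (- (1 + 1))) (y (1 + 1)) (y (- (1 + 1))) (fst (lv M x y (N - 3))) (snd (lv M x y (N - 3)))"
    "snd (lv M x y (N - 2)) = sig (x (1 + 1)) (x (- (1 + 1))) (y (1 + 1)) (y (- (1 + 1))) (fst (lv M x y (N - 3))) (snd (lv M x y (N - 3)))" for x y
    unfolding level2 by simp_all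
  note ctx = inv TS TS rel_level1(5,6)[OF r] nn(1,1,2,2,1,1,2,2) nn'(1,1,2,2,1,1,2,2)
  have "fst (lv M (sw 1 x) (sw 1 y) (N - 1)) - fst (lv M (sw 1 x1) (sw 1 y1) (N - 1)) =
      (if pleft 1 (x, y) then 1 else 0) - (if pleft 1 (x', y') then 0 else 1)"
    unfolding lvsw TS1
  proof (cases rule: pmid_cases[OF k nn p1, case_names LU LB RU RB])
    case LU
    show "tau (x 1) (y (- 1)) (y 1) (fst (lv M x y (N - 2))) (snd (lv M x y (N - 2))) - tau (x1 1) (y1 (- 1)) (y1 1)
      (tau (x1 (- (1 + 1))) (y1 (1 + 1)) (y1 (- (1 + 1))) (fst (lv M x y (N - 3))) (snd (lv M x y (N - 3))))
      (sig (x1 (1 + 1)) (x1 (- (1 + 1))) (y1 (1 + 1)) (y1 (- (1 + 1))) (fst (lv M x y (N - 3))) (snd (lv M x y (N - 3)))) =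
      (if pleft 1 (x, y) then 1 else 0) - (if pleft 1 (x', y') then 0 else 1)"
      unfolding LU(3-) H_LU[OF ctx LU(1,2)] pleft_def prod.case using LU(2) by simp
  next
    case LB
    show "tau (x 1) (y (- 1)) (y 1) (fst (lv M x y (N - 2))) (snd (lv M x y (N - 2))) - tau (x1 1) (y1 (- 1)) (y1 1)
      (tau (x1 (- (1 + 1))) (y1 (1 + 1)) (y1 (- (1 + 1))) (fst (lv M x y (N - 3))) (snd (lv M x y (N - 3))))
      (sig (x1 (1 + 1)) (x1 (- (1 + 1))) (y1 (1 + 1)) (y1 (- (1 + 1))) (fst (lv M x y (N - 3))) (snd (lv M x y (N - 3)))) =
      (if pleft 1 (x, y) then 1 else 0) - (if pleft 1 (x', y') then 0 else 1)"
      unfolding LB(3-) H_LB[OF ctx LB(1,2)] pleft_def prod.case using LB(2) by simp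
  next
    case RU
    show "tau (x 1) (y (- 1)) (y 1) (fst (lv M x y (N - 2))) (snd (lv M x y (N - 2))) - tau (x1 1) (y1 (- 1)) (y1 1)
      (tau (x1 (- (1 + 1))) (y1 (1 + 1)) (y1 (- (1 + 1))) (fst (lv M x y (N - 3))) (snd (lv M x y (N - 3))))
      (sig (x1 (1 + 1)) (x1 (- (1 + 1))) (y1 (1 + 1)) (y1 (- (1 + 1))) (fst (lv M x y (N - 3))) (snd (lv M x y (N - 3)))) =
      (if pleft 1 (x, y) then 1 else 0) - (if pleft 1 (x', y') then 0 else 1)"
      unfolding RU(3-) H_RU[OF ctx RU(1,2)] pleft_def prod.case using RU(2) by simp
  next
    case RB
    show "tau (x 1) (y (- 1)) (y 1) (fst (lv M x y (N - 2))) (snd (lv M x y (N - 2))) - tau (x1 1) (y1 (- 1)) (y1 1)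
      (tau (x1 (- (1 + 1))) (y1 (1 + 1)) (y1 (- (1 + 1))) (fst (lv M x y (N - 3))) (snd (lv M x y (N - 3))))
      (sig (x1 (1 + 1)) (x1 (- (1 + 1))) (y1 (1 + 1)) (y1 (- (1 + 1))) (fst (lv M x y (N - 3))) (snd (lv M x y (N - 3)))) =
      (if pleft 1 (x, y) then 1 else 0) - (if pleft 1 (x', y') then 0 else 1)"
      unfolding RB(3-) H_RB[OF ctx RB(1,2)] pleft_def prod.case using RB(2) by simp
  qed
  then show ?thesis unfolding P Q p1 by (simp add: coen_def sw2_def)
qed

lemma coen_e:
  assumes x: "x \<in> KR_rows D1 N s" "y \<in> KR_rows D1 N t" and i: "1 \<le> i" "i \<le> N"
    and e: "eop (KR D1 N s \<otimes>\<^sub>c KR D1 N t) i (x, y) = Some p"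
  shows "coen u p = coen u (x, y)"
proof -
  have p: "p = tw2 N i (pmid (nd N i) (tw2 N i (x, y)))" by (rule D1_e[OF N M x i(2) e])
  have v: "valid M (tw2 N i (x, y))" by (rule valid_tw2[OF N M valid_rows[OF N M x]])
  obtain x0 y0 where q: "tw2 N i (x, y) = (x0, y0)" by fastforce
  obtain x1 y1 where q1: "pmid (nd N i) (x0, y0) = (x1, y1)" by fastforce
  have tw: "lv M (fst (tw2 N i q)) (snd (tw2 N i q)) (N - 1) = lv M (fst q) (snd q) (N - 1)" for q
    using i N M lv_sw[OF N M, of M "N - 1"] by (cases q) (auto simp: tw2_def tw_def)
  have "lv M x1 y1 (N - 1) = lv M x0 y0 (N - 1)"
  proof (cases "nd N i = M - 1")
    case True
    show ?thesis by (rule pmid_fork_eff(2)[OF N M v[unfolded q] q1[unfolded True]]) (use N in auto)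
  next
    case False
    then have "nd N i = M - 2 - int (nat (M - 2 - nd N i))" using nd_bounds[OF N M i(2)] by simp
    then show ?thesis using pmid_eff(1)[OF N M v[unfolded q] q1 conjunct1[OF nd_bounds[OF N M i(2)]]] by blast
  qed
  then show ?thesis using tw[of "(x1, y1)"] tw[of "(x, y)"] unfolding p q q1 coen_def by simp
qed

end

section \<open>Padding and virtual letters in type D\<close>

context
  fixes N :: nat and M :: int assumes N: "3 \<le> N" and M: "M = int N"
begin

lemma lowest_grows:
  assumes "rel N s t (x, y) (y', x')" "t < s" shows "y (- 1) \<le> x' (- 1)"
  by (rule lowest_mono[OF rel_level1(1-6)[OF N M assms(1)]]) (use rel_level1(7)[OF N M assms(1)] assms(2) in simp)

text \<open>The number of letters \<open>-1\<close> of the right row enters \<open>tau\<close> only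
  as a summand of the last level, so \<open>tau\<close> grows as much as the length does.\<close>

lemma coen_pad: "coen N M (t + c) (x, add_letter (- 1) (int c) y) = coen N M t (x, y)"
proof -
  have "lv M x (add_letter (- 1) (int c) y) (N - 2) = lv M x y (N - 2)"
    by (rule lv_cong) (use N M in \<open>auto simp: add_letter_apply\<close>)
  then show ?thesis unfolding coen_def[OF N M] fst_conv snd_conv level1[OF N M] by (simp add: add_letter_apply tau_def)
qed

context
  fixes s t x y x' y'
  assumes r: "rel N s t (x, y) (y', x')" and v: "valid M (x, y)" "valid M (y', x')"
    and virt: "x 1 = x (- 1)" "y 1 = y (- 1)" "y' 1 = y' (- 1)" "x' 1 = x' (- 1)"
begin

lemma virtual_lowest_grows: "t < s \<Longrightarrow> y (- 2) \<le> x' (- 2)"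
proof -
  assume ts: "t < s"
  have l3: "linv M y' x' (N - 3) = linv M x y (N - 3)" by (rule rel_linv[OF N M r v]) simp
  note i2 = l3[symmetric, unfolded level2[OF N M] prod.inject]
  have TS: "fst (lv M x y (N - 2)) = tau (x (- (1 + 1))) (y (1 + 1)) (y (- (1 + 1))) (fst (lv M x y (N - 3))) (snd (lv M x y (N - 3)))"
    "snd (lv M x y (N - 2)) = sig (x (1 + 1)) (x (- (1 + 1))) (y (1 + 1)) (y (- (1 + 1))) (fst (lv M x y (N - 3))) (snd (lv M x y (N - 3)))" for x y
    unfolding level2[OF N M] by simp_all
  have nn: "0 \<le> x 1" "0 \<le> y 1" "0 \<le> y' 1" "0 \<le> x' 1" using v by (auto simp: valid_def)
  have p: "0 < sig (x 1) (x (- 1)) (y 1) (y (- 1)) (fst (lv M x y (N - 2))) (snd (lv M x y (N - 2)))"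
    using rel_level1(7)[OF N M r] ts by simp
  have "y (- (1 + 1)) \<le> x' (- (1 + 1))"
    by (rule virtual_lowest_mono[OF rel_level1(1-6)[OF N M r] virt p conjunct1[OF i2] conjunct1[OF conjunct2[OF i2]]
      conjunct1[OF conjunct2[OF conjunct2[OF i2]]] conjunct2[OF conjunct2[OF conjunct2[OF i2]]] TS TS nn])
  then show ?thesis by simp
qed

text \<open>The right side no longer mentions the image. It thus computes the sum of the coenergy
  and the missing boxes stored in the image row from the pair alone.\<close>

lemma virtual_coen: "x' 1 + coen N M u (x, y) = int u - fst (lv M x y (N - 2)) + x 1 +
    min 0 (snd (lv M x y (N - 2)) + fst (lv M x y (N - 2)) + 2 * min 0 (x 1 - y 1))"
  using virtual_depth[OF rel_level1(1-6)[OF N M r] virt] virt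
  unfolding coen_def[OF N M] fst_conv snd_conv level1[OF N M] by simp

end

text \<open>Additional letters \<open>-2\<close> increase \<open>tau\<close> and decrease
  \<open>sig\<close> by the same amount at level 2, so neither \<open>u - tau\<close> nor
  \<open>tau + sig\<close> in \<open>virtual_coen\<close> changes.\<close>

lemma virtual_coen_pad:
  assumes r: "rel N s t (x, y) (y', x')" "rel N s t' (x, add_letter (- 2) (int c) y) (y2', x2')"
    and v: "valid M (x, y)" "valid M (y', x')" "valid M (x, add_letter (- 2) (int c) y)" "valid M (y2', x2')"
    and virt: "x 1 = x (- 1)" "y 1 = y (- 1)" "y' 1 = y' (- 1)" "x' 1 = x' (- 1)" "y2' 1 = y2' (- 1)" "x2' 1 = x2' (- 1)"
  shows "x2' 1 + coen N M (u + c) (x, add_letter (- 2) (int c) y) = x' 1 + coen N M u (x, y)"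
proof -
  let ?y = "add_letter (- 2) (int c) y"
  have a: "?y 1 = y 1" "?y (- 1) = y (- 1)" by (auto simp: add_letter_apply)
  have "lv M x ?y (N - 3) = lv M x y (N - 3)"
    by (rule lv_cong) (use N M in \<open>auto simp: add_letter_apply\<close>)
  then have "lv M x ?y (N - 2) = (fst (lv M x y (N - 2)) + int c, snd (lv M x y (N - 2)) - int c)"
    unfolding level2[OF N M] by (simp add: add_letter_apply tau_def sig_def)
  then show ?thesis
    unfolding virtual_coen[OF r(1) v(1,2) virt(1-4)] virtual_coen[OF r(2) v(3,4) virt(1) trans[OF a(1) trans[OF virt(2) a(2)[symmetric]]] virt(5,6)] a
    by simp
qed

text \<open>The vectors \<open>uvec\<close> of an embedded type become powers of the letter
  \<open>1\<close>, or of \<open>2\<close> if \<open>\<plusminus>1\<close> are virtual; this lemma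
  and the next start the bisimulation in the two cases.\<close>

lemma rel_coen_one:
  assumes nn: "0 \<le> s" "0 \<le> t"
  defines "p \<equiv> (\<lambda>l :: int. if l = 1 then s else 0 :: int, \<lambda>l :: int. if l = 1 then t else 0 :: int)"
  shows "rel N s t p (snd p, fst p)" "fst (lv M (fst p) (snd p) (N - 1)) = t"
proof -
  show "rel N s t p (snd p, fst p)" unfolding p_def fst_conv snd_conv by (rule rel_u_gen[OF N M nn])
  have e: "(\<lambda>l :: int. if l = 1 then s else 0) = (\<lambda>l. if l = 1 then s else if l = - 1 then 0 else 0)" for s :: int by auto
  show "fst (lv M (fst p) (snd p) (N - 1)) = t"
    unfolding p_def fst_conv snd_conv u_level(1)[OF N M e e] using nn by (simp add: tau_def et_def th_def pos_def)
qed

lemma rel_coen_two: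
  assumes nn: "0 \<le> s" "0 \<le> t"
  defines "p \<equiv> (\<lambda>l :: int. if l = 2 then s else 0 :: int, \<lambda>l :: int. if l = 2 then t else 0 :: int)"
  shows "rel N s t p (snd p, fst p)" "fst (lv M (fst p) (snd p) (N - 1)) = t"
proof -
  let ?b = "\<lambda>s (l :: int). if l = 2 then s else 0 :: int"
  have z: "lv M (?b s) (?b t) k = (0, 0)" if "k \<le> N - 3" for k s t
  proof -
    have "lv M (?b s) (?b t) k = lv M (\<lambda>_. 0) (\<lambda>_. 0) k" by (rule lv_cong) (use that N M in auto)
    also have "\<dots> = (0, 0)" by (rule lv_zero[OF N M]) (use that in auto)
    finally show ?thesis .
  qed
  have v: "?b s (1 + 1) = s" "?b s (- (1 + 1)) = 0" "?b s 1 = 0" "?b s (- 1) = 0" for s by auto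
  have l2: "lv M (?b s) (?b t) (N - 2) = (t, s - t)" if "0 \<le> s" "0 \<le> t" for s t
    unfolding level2[OF N M] z[OF order_refl] v using that by (simp add: tau_def sig_def et_def th_def pos_def)
  have l1: "lv M (?b s) (?b t) (N - 1) = (t, s - t)" if "0 \<le> s" "0 \<le> t" for s t
    unfolding level1[OF N M] l2[OF that] v using that by (simp add: tau_def sig_def et_def th_def pos_def)
  have i1: "linv M (?b s) (?b t) (N - 2) = (0, 0, s + t, s + t)" if "0 \<le> s" "0 \<le> t" for s t
    unfolding level1[OF N M] l2[OF that] v using that by (simp add: ia_def ib_def ik_def ix_def et_def th_def pos_def)
  have i2: "linv M (?b s) (?b t) (N - 3) = (s + t, 0, 0, 0)" if "0 \<le> s" "0 \<le> t" for s t
    unfolding level2[OF N M] z[OF order_refl] v using that by (simp add: ia_def ib_def ik_def ix_def et_def th_def pos_def)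
  have i3: "linv M (?b s) (?b t) k = (0, 0, 0, 0)" if "k < N - 3" for k s t
  proof -
    have "k \<le> N - 3" "M - 1 - int k \<noteq> 2" "- (M - 1 - int k) \<noteq> 2" using that N M by auto
    then show ?thesis unfolding linv_def Let_def z[OF \<open>k \<le> N - 3\<close>] by (simp add: ia_def ib_def ik_def ix_def et_def th_def pos_def)
  qed
  have e: "einv M (?b t) (?b s) = einv M (?b s) (?b t)"
    using nn N M by (auto simp: einv_def Let_def fork_e_def fork_f_def pos_def)
  show "fst (lv M (fst p) (snd p) (N - 1)) = t" unfolding p_def fst_conv snd_conv l1[OF nn] ..
  show "rel N s t p (snd p, fst p)"
    unfolding p_def fst_conv snd_conv rel_def Let_def prod.case M[symmetric] l1[OF nn] l1[OF nn(2,1)]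
  proof (intro conjI allI impI e)
    fix k assume "1 \<le> k" "k \<le> N - 2"
    then consider "k = N - 2" | "k = N - 3" | "k < N - 3" by linarith
    then show "linv M (?b t) (?b s) k = linv M (?b s) (?b t) k"
      by cases (simp_all only: i1[OF nn] i1[OF nn(2,1)] i2[OF nn] i2[OF nn(2,1)] i3 add.commute)
  qed simp_all
qed

end

section \<open>Embeddings into type D\<close>

text \<open>The bounds hold at every step of the word. So a left factor walks undisturbed next to a
  right factor with \<phi> at most \<open>e\<close>, and a right factor next to a left factor with
  \<epsilon> at most \<open>f\<close>.\<close>

primrec ewalk :: "nat \<Rightarrow> nat \<Rightarrow> int \<Rightarrow> int \<Rightarrow> nat list \<Rightarrow> row \<Rightarrow> row \<Rightarrow> bool" where
  "ewalk N s e f [] c c' \<longleftrightarrow> c = c'"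
| "ewalk N s e f (j # js) c c' \<longleftrightarrow> e < row_eps D1 N s j c \<and> f \<le> row_phi D1 N s j c \<and> ewalk N s e f js (e_row D1 N j c) c'"

primrec pwalk :: "nat \<Rightarrow> nat \<Rightarrow> nat \<Rightarrow> bool \<Rightarrow> nat list \<Rightarrow> row \<times> row \<Rightarrow> row \<times> row \<Rightarrow> bool" where
  "pwalk N s t b [] p p' \<longleftrightarrow> p = p'"
| "pwalk N s t b (j # js) p p' \<longleftrightarrow> (\<exists>p1. eop (KR D1 N s \<otimes>\<^sub>c KR D1 N t) j p = Some p1 \<and>
     (phi (KR D1 N t) j (snd p) < eps (KR D1 N s) j (fst p)) = b \<and> pwalk N s t b js p1 p')"

context
  fixes N :: nat assumes N: "3 \<le> N"
begin

lemma e_in: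
  assumes "c \<in> KR_rows D1 N s" "j \<le> N" "0 < row_eps D1 N s j c"
  shows "eop (KR D1 N s) j c = Some (e_row D1 N j c)" "e_row D1 N j c \<in> KR_rows D1 N s"
  using node_ok[OF good[OF N refl] assms(1,2)] assms(2,3) by (auto simp: node_ok_def)

lemma pwalk_left:
  assumes "ewalk N s e f js c c'" "c \<in> KR_rows D1 N s" "y \<in> KR_rows D1 N t" "0 \<le> e"
    and "\<And>j. j \<in> set js \<Longrightarrow> j \<le> N \<and> row_phi D1 N t j y \<le> e"
  shows "pwalk N s t True js (c, y) (c', y)"
  using assms
proof (induction js arbitrary: c)
  case (Cons j js)
  then have j: "j \<le> N" "e < row_eps D1 N s j c" "row_phi D1 N t j y \<le> e" by auto
  note c1 = e_in[OF Cons.prems(2) j(1)]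
  have l: "phi (KR D1 N t) j y < eps (KR D1 N s) j c"
    using KR_eps[OF good[OF N refl] j(1) Cons.prems(2)] KR_phi[OF good[OF N refl] j(1) Cons.prems(3)] j by linarith
  have "pwalk N s t True js (e_row D1 N j c, y) (c', y)"
    by (rule Cons.IH) (use Cons.prems c1 j in auto)
  then show ?case using l c1(1) j Cons.prems(4) by (auto simp: eop_tensor simp del: KR_simps)
qed simp

lemma pwalk_right:
  assumes "ewalk N t e f js c c'" "c \<in> KR_rows D1 N t" "x \<in> KR_rows D1 N s" "0 \<le> e"
    and "\<And>j. j \<in> set js \<Longrightarrow> j \<le> N \<and> row_eps D1 N s j x \<le> f"
  shows "pwalk N s t False js (x, c) (x, c')"
  using assms
proof (induction js arbitrary: c)
  case (Cons j js)
  then have j: "j \<le> N" "e < row_eps D1 N t j c" "f \<le> row_phi D1 N t j c" "row_eps D1 N s j x \<le> f" by auto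
  note c1 = e_in[OF Cons.prems(2) j(1)]
  have l: "\<not> phi (KR D1 N t) j c < eps (KR D1 N s) j x"
    using KR_eps[OF good[OF N refl] j(1) Cons.prems(3)] KR_phi[OF good[OF N refl] j(1) Cons.prems(2)] j by linarith
  have "pwalk N s t False js (x, e_row D1 N j c) (x, c')"
    by (rule Cons.IH) (use Cons.prems c1 j in auto)
  then show ?case using l c1(1) j Cons.prems(4) by (auto simp: eop_tensor simp del: KR_simps)
qed simp

text \<open>The sides \<open>b\<close> and \<open>b'\<close> are constant along the word, hence each
  letter 0 in it contributes the same coenergy step.\<close>

lemma pwalk_rel:
  assumes "pwalk N s t b js p p'" "pwalk N t s b' js q q'" "p \<in> carr (KR D1 N s \<otimes>\<^sub>c KR D1 N t)" "q \<in> carr (KR D1 N t \<otimes>\<^sub>c KR D1 N s)"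
    and "\<And>j. j \<in> set js \<Longrightarrow> j \<le> N"
  shows "rel N (int s) (int t) p' q' \<longleftrightarrow> rel N (int s) (int t) p q"
    and "rel N (int s) (int t) p q \<Longrightarrow> coen N (int N) t p' - coen N (int N) t p =
      int (count_list js 0) * ((if b then 1 else 0) - (if b' then 0 else 1))"
proof -
  have "(rel N (int s) (int t) p' q' \<longleftrightarrow> rel N (int s) (int t) p q) \<and> (rel N (int s) (int t) p q \<longrightarrow> coen N (int N) t p' - coen N (int N) t p =
      int (count_list js 0) * ((if b then 1 else 0) - (if b' then 0 else 1)))"
    using assms
  proof (induction js arbitrary: p q)
    case (Cons j js)
    have j: "j \<le> N" "j \<in> {0..N}" using Cons.prems(5) by auto
    obtain p1 where p1: "eop (KR D1 N s \<otimes>\<^sub>c KR D1 N t) j p = Some p1" "(phi (KR D1 N t) j (snd p) < eps (KR D1 N s) j (fst p)) = b" "pwalk N s t b js p1 p'"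
      using Cons.prems(1) by auto
    obtain q1 where q1: "eop (KR D1 N t \<otimes>\<^sub>c KR D1 N s) j q = Some q1" "(phi (KR D1 N s) j (snd q) < eps (KR D1 N t) j (fst q)) = b'" "pwalk N t s b' js q1 q'"
      using Cons.prems(2) by auto
    note g = good[OF N refl]
    note reg = regular_tensor[OF KR_regular[OF g] KR_regular[OF g]]
    note ep = regular_e(1,2)[OF reg j(2) Cons.prems(3) p1(1)] and eq = regular_e(1,2)[OF reg j(2) Cons.prems(4) q1(1)]
    have IH: "(rel N (int s) (int t) p' q' \<longleftrightarrow> rel N (int s) (int t) p1 q1) \<and> (rel N (int s) (int t) p1 q1 \<longrightarrow> coen N (int N) t p' - coen N (int N) t p1 =
      int (count_list js 0) * ((if b then 1 else 0) - (if b' then 0 else 1)))"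
      by (rule Cons.IH[OF p1(3) q1(3) ep(1) eq(1)]) (use Cons.prems(5) in auto)
    note bs = D1_bisim[OF N refl, of s t]
    have r: "rel N (int s) (int t) p1 q1 \<longleftrightarrow> rel N (int s) (int t) p q"
    proof
      assume "rel N (int s) (int t) p q"
      from bisimD(3)[OF bs this Cons.prems(3,4) j(2) p1(1) q1(1)] show "rel N (int s) (int t) p1 q1" .
    next
      assume "rel N (int s) (int t) p1 q1"
      from bisimD(4)[OF bs this ep(1) eq(1) j(2) ep(2) eq(2)] show "rel N (int s) (int t) p q" .
    qed
    have "coen N (int N) t p1 - coen N (int N) t p = (if j = 0 then (if b then 1 else 0) - (if b' then 0 else 1) else 0)"
      if R: "rel N (int s) (int t) p q"
    proof -
      obtain x y x' y' where pq: "p = (x, y)" "q = (x', y')" by fastforce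
      have c: "x \<in> KR_rows D1 N s" "y \<in> KR_rows D1 N t" "x' \<in> KR_rows D1 N t" "y' \<in> KR_rows D1 N s" using Cons.prems(3,4) pq by auto
      show ?thesis
      proof (cases "j = 0")
        case False
        then show ?thesis using coen_e[OF N refl c(1,2) _ j(1), of p1 t] p1(1) pq(1) by simp
      next
        case True
        have v: "valid (int N) (tw2 N 0 p)" "valid (int N) (tw2 N 0 q)"
          using valid_tw2[OF N refl] valid_rows[OF N refl] c pq by auto
        have rr: "rel N (int s) (int t) (tw2 N 0 p) (tw2 N 0 q)" using R rel_tw2[OF N refl] by simp
        have n0: "nd N 0 = 1" by (simp add: nd_def)
        have t0: "tw2 N 0 p = sw2 1 p" for p by (simp add: tw2_alt)
        have "p1 = tw2 N 0 (pmid 1 (tw2 N 0 p))" using D1_e[OF N refl c(1,2) j(1)] p1(1) True pq n0 by simp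
        moreover have "p = tw2 N 0 (tw2 N 0 p)" by simp
        ultimately have "coen N (int N) t p1 - coen N (int N) t p = (if pleft 1 (tw2 N 0 p) then 1 else 0) - (if pleft 1 (tw2 N 0 q) then 0 else 1)"
          using coen_step[OF N refl v rr, of t] by (simp add: t0)
        moreover have "pleft 1 (tw2 N 0 p) = b" using D1_left[OF N refl c(1,2) j(1)] p1(2) True pq n0 by simp
        moreover have "pleft 1 (tw2 N 0 q) = b'" using D1_left[OF N refl c(3,4) j(1)] q1(2) True pq n0 by simp
        ultimately show ?thesis using True by simp
      qed
    qed
    then show ?case using IH r by (auto simp: algebra_simps)
  qed simp
  then show "rel N (int s) (int t) p' q' \<longleftrightarrow> rel N (int s) (int t) p q"
    "rel N (int s) (int t) p q \<Longrightarrow> coen N (int N) t p' - coen N (int N) t p =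
      int (count_list js 0) * ((if b then 1 else 0) - (if b' then 0 else 1))" by auto
qed

end

lemma row_coenergy_pad:
  assumes "X \<noteq> A1" "1 \<le> n"
  shows "row_coenergy X n (t + c) (add_letter (- 1) (int c) y) = row_coenergy X n t y"
  using assms by (simp add: row_coenergy_def letters_def)

lemma pad_row:
  assumes X: "good_rank X n" "X \<noteq> A1" and y: "y \<in> KR_rows X n t"
  shows "add_letter (- 1) (int c) y \<in> KR_rows X n (t + c)"
proof -
  have l: "- 1 \<in> letters X n" using good_rank_pos[OF X(1)] X(2) by (auto simp: letters_def)
  have n: "X = D1 \<Longrightarrow> int n \<noteq> - 1 \<and> - int n \<noteq> - 1" using X(1) by (auto simp: good_rank_def)
  show ?thesis using y l n unfolding KR_rows_def
    by (auto simp: add_letter_apply size_ok_def split: if_splits)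
qed

lemma unpad_row:
  assumes X: "good_rank X n" "X \<noteq> A1" and y: "y \<in> KR_rows X n (t + c)" "int c \<le> y (- 1)"
  shows "add_letter (- 1) (- int c) y \<in> KR_rows X n t"
proof -
  have l: "- 1 \<in> letters X n" using good_rank_pos[OF X(1)] X(2) by (auto simp: letters_def)
  have n: "X = D1 \<Longrightarrow> int n \<noteq> - 1 \<and> - int n \<noteq> - 1" using X(1) by (auto simp: good_rank_def)
  show ?thesis using y l n unfolding KR_rows_def
    by (auto simp: add_letter_apply size_ok_def split: if_splits)
qed

text \<open>A virtual crystal. All nodes of \<open>word i\<close> have string lengths
  \<open>mul i\<close> times those of node \<open>i\<close>, so both sides compare tensor factors
  alike. \<open>d\<close> scales the rows, \<open>l0\<close> is the virtual image of the letter
  \<open>1\<close>, and \<open>g\<close> is the scale between the coenergies.\<close>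

locale D_embedding =
  fixes X :: affine_type and n N d :: nat and v :: "nat \<Rightarrow> row \<Rightarrow> row" and word :: "nat \<Rightarrow> nat list"
    and mul :: "nat \<Rightarrow> int" and g :: nat and l0 :: int
  assumes rank: "good_rank X n" and N: "3 \<le> N" and g: "0 < g" and l0: "l0 = 1 \<or> l0 = 2" and d: "0 < d"
    and v_in: "b \<in> KR_rows X n s \<Longrightarrow> v s b \<in> KR_rows D1 N (d * s)"
    and v_u: "v s (power_row 1 s) = power_row l0 (d * s)"
    and word_ne: "i \<le> n \<Longrightarrow> word i \<noteq> []" and word_le: "i \<le> n \<Longrightarrow> j \<in> set (word i) \<Longrightarrow> j \<le> N"
    and word_pos: "1 \<le> i \<Longrightarrow> i \<le> n \<Longrightarrow> 0 \<notin> set (word i)" and word_zero: "count_list (word 0) 0 = g"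
    and mul: "i \<le> n \<Longrightarrow> 0 < mul i"
    and v_eps: "i \<le> n \<Longrightarrow> j \<in> set (word i) \<Longrightarrow> b \<in> KR_rows X n s \<Longrightarrow> row_eps D1 N (d * s) j (v s b) = mul i * row_eps X n s i b"
    and v_phi: "i \<le> n \<Longrightarrow> j \<in> set (word i) \<Longrightarrow> b \<in> KR_rows X n s \<Longrightarrow> row_phi D1 N (d * s) j (v s b) = mul i * row_phi X n s i b"
    and v_walk: "i \<le> n \<Longrightarrow> b \<in> KR_rows X n s \<Longrightarrow> 0 < row_eps X n s i b \<Longrightarrow>
      ewalk N (d * s) (mul i * (row_eps X n s i b - 1)) (mul i * row_phi X n s i b) (word i) (v s b) (v s (e_row X n i b))"
begin

abbreviation KX :: "nat \<Rightarrow> row crystal" where "KX \<equiv> KR X n"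
definition V :: "nat \<Rightarrow> nat \<Rightarrow> row \<times> row \<Rightarrow> row \<times> row" where "V s t = (\<lambda>(x, y). (v s x, v t y))"
definition Rel :: "nat \<Rightarrow> nat \<Rightarrow> row \<times> row \<Rightarrow> row \<times> row \<Rightarrow> bool" where
  "Rel s t p q \<longleftrightarrow> rel N (int (d * s)) (int (d * t)) (V s t p) (V t s q)"

lemma regX: "regular {0..n} (KX s)" by (rule KR_regular[OF rank])
lemma regX2: "regular {0..n} (KX s \<otimes>\<^sub>c KX t)" by (rule regular_tensor[OF regX regX])

lemma V_in: "p \<in> carr (KX s \<otimes>\<^sub>c KX t) \<Longrightarrow> V s t p \<in> carr (KR D1 N (d * s) \<otimes>\<^sub>c KR D1 N (d * t))"
  using v_in by (auto simp: V_def)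

lemma tensor_walk:
  assumes i: "i \<le> n" and xy: "x \<in> KR_rows X n s" "y \<in> KR_rows X n t" and e: "eop (KX s \<otimes>\<^sub>c KX t) i (x, y) = Some p'"
  shows "pwalk N (d * s) (d * t) (phi (KX t) i y < eps (KX s) i x) (word i) (V s t (x, y)) (V s t p')"
proof -
  note ep = KR_eps[OF rank i xy(1)] KR_phi[OF rank i xy(2)]
  have nn: "0 \<le> row_phi X n t i y" "0 \<le> row_eps X n s i x" using ep by linarith+
  show ?thesis
  proof (cases "phi (KX t) i y < eps (KX s) i x")
    case True
    then have p': "p' = (e_row X n i x, y)" using e by (auto simp: eop_tensor split: if_splits)
    \<comment> \<open>A strict inequality of integers leaves a gap of one; multiplied by
      \<open>mul i\<close>, it covers the loss of \<epsilon> that \<open>v_walk\<close> allows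
      within the word.\<close>
    have lt: "row_phi X n t i y \<le> row_eps X n s i x - 1" "0 < row_eps X n s i x" using True ep by linarith+
    have "pwalk N (d * s) (d * t) True (word i) (v s x, v t y) (v s (e_row X n i x), v t y)"
    proof (rule pwalk_left[OF N v_walk[OF i xy(1) lt(2)] v_in[OF xy(1)] v_in[OF xy(2)]])
      show "0 \<le> mul i * (row_eps X n s i x - 1)" using mul[OF i] lt(2) by simp
      show "j \<le> N \<and> row_phi D1 N (d * t) j (v t y) \<le> mul i * (row_eps X n s i x - 1)" if "j \<in> set (word i)" for j
        using word_le[OF i that] v_phi[OF i that xy(2)] mult_left_mono[OF lt(1), of "mul i"] mul[OF i] by simp
    qed
    then show ?thesis using True by (simp add: p' V_def)
  next
    case False
    then obtain y' where y': "eop (KX t) i y = Some y'" "p' = (x, y')" using e by (auto simp: eop_tensor simp del: KR_simps)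
    then have p': "p' = (x, e_row X n i y)" by (auto split: if_splits)
    have pos: "0 < row_eps X n t i y"
    proof -
      have "eps (KX t) i y \<noteq> 0" using regular_e_None[OF regX, of i y t] i xy(2) y'(1) by (auto simp del: KR_simps(3))
      then show ?thesis using KR_eps[OF rank i xy(2)] by linarith
    qed
    have le: "row_eps X n s i x \<le> row_phi X n t i y" using False ep by linarith
    have "pwalk N (d * s) (d * t) False (word i) (v s x, v t y) (v s x, v t (e_row X n i y))"
    proof (rule pwalk_right[OF N v_walk[OF i xy(2) pos] v_in[OF xy(2)] v_in[OF xy(1)]])
      show "0 \<le> mul i * (row_eps X n t i y - 1)" using mul[OF i] pos by simp
      show "j \<le> N \<and> row_eps D1 N (d * s) j (v s x) \<le> mul i * row_phi X n t i y" if "j \<in> set (word i)" for j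
        using word_le[OF i that] v_eps[OF i that xy(1)] mult_left_mono[OF le, of "mul i"] mul[OF i] by simp
    qed
    then show ?thesis using False by (simp add: p' V_def)
  qed
qed

lemma tensor_eps:
  assumes i: "i \<le> n" "j \<in> set (word i)" and xy: "x \<in> KR_rows X n s" "y \<in> KR_rows X n t"
  shows "int (eps (KR D1 N (d * s) \<otimes>\<^sub>c KR D1 N (d * t)) j (V s t (x, y))) = mul i * int (eps (KX s \<otimes>\<^sub>c KX t) i (x, y))"
    and "int (phi (KR D1 N (d * s) \<otimes>\<^sub>c KR D1 N (d * t)) j (V s t (x, y))) = mul i * int (phi (KX s \<otimes>\<^sub>c KX t) i (x, y))"
proof -
  have j: "j \<le> N" by (rule word_le[OF i])
  note gN = good[OF N refl]
  have p: "int (a - b) = pos (int a - int b)" for a b by (auto simp: pos_def)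
  have m: "mul i * pos a = pos (mul i * a)" for a
    using mul[OF i(1)] by (auto simp: pos_def max_def mult_le_0_iff)
  have ts: "eps (KR D1 N (d * s) \<otimes>\<^sub>c KR D1 N (d * t)) j (v s x, v t y) = eps (KR D1 N (d * t)) j (v t y) + (eps (KR D1 N (d * s)) j (v s x) - phi (KR D1 N (d * t)) j (v t y))"
    "phi (KR D1 N (d * s) \<otimes>\<^sub>c KR D1 N (d * t)) j (v s x, v t y) = phi (KR D1 N (d * s)) j (v s x) + (phi (KR D1 N (d * t)) j (v t y) - eps (KR D1 N (d * s)) j (v s x))"
    by (rule eps_tensor[OF KR_regular[OF gN] KR_regular[OF gN]] phi_tensor[OF KR_regular[OF gN] KR_regular[OF gN]];
        use j v_in xy in simp)+
  have ts': "eps (KX s \<otimes>\<^sub>c KX t) i (x, y) = eps (KX t) i y + (eps (KX s) i x - phi (KX t) i y)"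
    "phi (KX s \<otimes>\<^sub>c KX t) i (x, y) = phi (KX s) i x + (phi (KX t) i y - eps (KX s) i x)"
    by (rule eps_tensor[OF regX regX] phi_tensor[OF regX regX]; use i xy in simp)+
  show "int (eps (KR D1 N (d * s) \<otimes>\<^sub>c KR D1 N (d * t)) j (V s t (x, y))) = mul i * int (eps (KX s \<otimes>\<^sub>c KX t) i (x, y))"
    "int (phi (KR D1 N (d * s) \<otimes>\<^sub>c KR D1 N (d * t)) j (V s t (x, y))) = mul i * int (phi (KX s \<otimes>\<^sub>c KX t) i (x, y))"
    unfolding V_def prod.case ts ts' of_nat_add p KR_eps[OF gN j v_in[OF xy(1)]] KR_eps[OF gN j v_in[OF xy(2)]] KR_phi[OF gN j v_in[OF xy(1)]] KR_phi[OF gN j v_in[OF xy(2)]]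
      KR_eps[OF rank i(1) xy(1)] KR_eps[OF rank i(1) xy(2)] KR_phi[OF rank i(1) xy(1)] KR_phi[OF rank i(1) xy(2)]
      v_eps[OF i xy(1)] v_eps[OF i xy(2)] v_phi[OF i xy(1)] v_phi[OF i xy(2)]
    by (simp_all add: distrib_left m right_diff_distrib)
qed

lemma walk_rel:
  assumes i: "i \<le> n" and p: "p \<in> carr (KX s \<otimes>\<^sub>c KX t)" and q: "q \<in> carr (KX t \<otimes>\<^sub>c KX s)"
    and e: "eop (KX s \<otimes>\<^sub>c KX t) i p = Some p'" "eop (KX t \<otimes>\<^sub>c KX s) i q = Some q'"
  shows "Rel s t p' q' \<longleftrightarrow> Rel s t p q"
    and "Rel s t p q \<Longrightarrow> coen N (int N) (d * t) (V s t p') - coen N (int N) (d * t) (V s t p) =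
      int (count_list (word i) 0) * ((if phi (KX t) i (snd p) < eps (KX s) i (fst p) then 1 else 0) - (if phi (KX s) i (snd q) < eps (KX t) i (fst q) then 0 else 1))"
proof -
  obtain x y x' y' where pq: "p = (x, y)" "q = (x', y')" by fastforce
  have c: "x \<in> KR_rows X n s" "y \<in> KR_rows X n t" "x' \<in> KR_rows X n t" "y' \<in> KR_rows X n s" using p q pq by auto
  note w = tensor_walk[OF i c(1,2) e(1)[unfolded pq]] tensor_walk[OF i c(3,4) e(2)[unfolded pq]]
  note r = pwalk_rel[OF N w V_in[OF p[unfolded pq]] V_in[OF q[unfolded pq]] word_le[OF i]]
  show "Rel s t p' q' \<longleftrightarrow> Rel s t p q" using r(1) unfolding Rel_def pq .
  show "Rel s t p q \<Longrightarrow> coen N (int N) (d * t) (V s t p') - coen N (int N) (d * t) (V s t p) =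
      int (count_list (word i) 0) * ((if phi (KX t) i (snd p) < eps (KX s) i (fst p) then 1 else 0) - (if phi (KX s) i (snd q) < eps (KX t) i (fst q) then 0 else 1))"
    using r(2) unfolding Rel_def pq fst_conv snd_conv .
qed

lemma Rel_bisim: "bisim {0..n} (KX s \<otimes>\<^sub>c KX t) (KX t \<otimes>\<^sub>c KX s) (Rel s t)"
  unfolding bisim_def
proof (intro ballI impI conjI allI)
  fix p q i assume p: "p \<in> carr (KX s \<otimes>\<^sub>c KX t)" and q: "q \<in> carr (KX t \<otimes>\<^sub>c KX s)" and r: "Rel s t p q" and i: "i \<in> {0..n}"
  have i': "i \<le> n" using i by simp
  obtain j where j: "j \<in> set (word i)" using word_ne[OF i'] by (cases "word i") auto
  have jN: "j \<in> {0..N}" using word_le[OF i' j] by simp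
  obtain x y x' y' where pq: "p = (x, y)" "q = (x', y')" by fastforce
  have c: "x \<in> KR_rows X n s" "y \<in> KR_rows X n t" "x' \<in> KR_rows X n t" "y' \<in> KR_rows X n s" using p q pq by auto
  note bs = bisimD(1,2)[OF D1_bisim[OF N refl] r[unfolded Rel_def] V_in[OF p] V_in[OF q] jN]
  have m: "mul i \<noteq> 0" using mul[OF i'] by simp
  show "eps (KX s \<otimes>\<^sub>c KX t) i p = eps (KX t \<otimes>\<^sub>c KX s) i q" "phi (KX s \<otimes>\<^sub>c KX t) i p = phi (KX t \<otimes>\<^sub>c KX s) i q"
    using bs tensor_eps[OF i' j c(1,2)] tensor_eps[OF i' j c(3,4)] m unfolding pq by simp_all
  show "Rel s t p' q'" if "eop (KX s \<otimes>\<^sub>c KX t) i p = Some p'" "eop (KX t \<otimes>\<^sub>c KX s) i q = Some q'" for p' q'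
    using walk_rel(1)[OF i' p q that] r by simp
  show "Rel s t p' q'" if f: "fop (KX s \<otimes>\<^sub>c KX t) i p = Some p'" "fop (KX t \<otimes>\<^sub>c KX s) i q = Some q'" for p' q'
    using walk_rel(1)[OF i' regular_f(1)[OF regX2 i p f(1)] regular_f(1)[OF regX2 i q f(2)] regular_f(2)[OF regX2 i p f(1)] regular_f(2)[OF regX2 i q f(2)]] r by simp
qed

lemma Rel_u: "Rel s t (uvec (KX s \<otimes>\<^sub>c KX t)) (uvec (KX t \<otimes>\<^sub>c KX s))" "coen N (int N) (d * t) (V s t (uvec (KX s \<otimes>\<^sub>c KX t))) = 0"
proof -
  have e: "V s t (uvec (KX s \<otimes>\<^sub>c KX t)) = (\<lambda>l. if l = l0 then int (d * s) else 0, \<lambda>l. if l = l0 then int (d * t) else 0)" for s t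
    by (simp add: V_def v_u) (simp add: power_row_def)
  have nn: "0 \<le> int (d * s)" "0 \<le> int (d * t)" by auto
  note a = rel_coen_one[OF N refl nn] rel_coen_two[OF N refl nn]
  show "Rel s t (uvec (KX s \<otimes>\<^sub>c KX t)) (uvec (KX t \<otimes>\<^sub>c KX s))"
    unfolding Rel_def e using l0 a(1,3) by auto
  show "coen N (int N) (d * t) (V s t (uvec (KX s \<otimes>\<^sub>c KX t))) = 0"
    unfolding coen_def[OF N refl] e using l0 a(2,4) by auto
qed

lemma R_exists:
  obtains R where "crystal_iso {0..n} (KX s \<otimes>\<^sub>c KX t) (KX t \<otimes>\<^sub>c KX s) R" "\<And>p. p \<in> carr (KX s \<otimes>\<^sub>c KX t) \<Longrightarrow> Rel s t p (R p)"
  using bisim_iso[OF regX2 regX2 KR_conn2[OF rank] KR_conn2[OF rank] Rel_bisim Rel_u(1) KR_rigid[OF rank] KR_rigid[OF rank]] by blast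

lemma comb_R_Rel:
  shows "crystal_iso {0..n} (KX s \<otimes>\<^sub>c KX t) (KX t \<otimes>\<^sub>c KX s) (comb_R n (KX s) (KX t))"
    and "p \<in> carr (KX s \<otimes>\<^sub>c KX t) \<Longrightarrow> Rel s t p (comb_R n (KX s) (KX t) p)"
proof -
  obtain R where R: "crystal_iso {0..n} (KX s \<otimes>\<^sub>c KX t) (KX t \<otimes>\<^sub>c KX s) R" "\<And>p. p \<in> carr (KX s \<otimes>\<^sub>c KX t) \<Longrightarrow> Rel s t p (R p)"
    using R_exists by blast
  note c = comb_R_iso[OF regX regX KR_conn2[OF rank] KR_rigid[OF rank] R(1)]
  show "crystal_iso {0..n} (KX s \<otimes>\<^sub>c KX t) (KX t \<otimes>\<^sub>c KX s) (comb_R n (KX s) (KX t))" by (rule c(1))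
  show "p \<in> carr (KX s \<otimes>\<^sub>c KX t) \<Longrightarrow> Rel s t p (comb_R n (KX s) (KX t) p)" using R(2)[of p] c(2)[of p] by simp
qed

text \<open>All changes of \<open>coen\<close> are multiples of \<open>g\<close>, and floor division
  turns them into unit steps.\<close>

definition h :: "nat \<Rightarrow> nat \<Rightarrow> row \<times> row \<Rightarrow> nat" where "h s t p = nat (coen N (int N) (d * t) (V s t p) div int g)"

lemma int_h: "p \<in> carr (KX s \<otimes>\<^sub>c KX t) \<Longrightarrow> int (h s t p) = coen N (int N) (d * t) (V s t p) div int g"
proof -
  assume p: "p \<in> carr (KX s \<otimes>\<^sub>c KX t)"
  obtain x y where xy: "p = (x, y)" by fastforce
  have "0 \<le> coen N (int N) (d * t) (V s t p)"
    using coen_nonneg[OF N refl, of "v s x" "d * s" "v t y" "d * t"] v_in p by (auto simp: xy V_def)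
  then show ?thesis using g by (simp add: h_def pos_imp_zdiv_nonneg_iff)
qed

lemma h_props:
  shows "h s t (uvec (KX s \<otimes>\<^sub>c KX t)) = 0"
    and "i \<in> {1..n} \<Longrightarrow> p \<in> carr (KX s \<otimes>\<^sub>c KX t) \<Longrightarrow> eop (KX s \<otimes>\<^sub>c KX t) i p = Some p' \<Longrightarrow> h s t p' = h s t p"
    and "p \<in> carr (KX s \<otimes>\<^sub>c KX t) \<Longrightarrow> eop (KX s \<otimes>\<^sub>c KX t) 0 p = Some p' \<Longrightarrow> int (h s t p') - int (h s t p) =
        coenergy_step (e0_left (KX s) (KX t) p) (e0_left (KX t) (KX s) (comb_R n (KX s) (KX t) p))"
proof -
  show "h s t (uvec (KX s \<otimes>\<^sub>c KX t)) = 0" unfolding h_def Rel_u(2) by simp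
  have st: "coen N (int N) (d * t) (V s t p') - coen N (int N) (d * t) (V s t p) =
      int (count_list (word i) 0) * ((if phi (KX t) i (snd p) < eps (KX s) i (fst p) then 1 else 0) -
       (if phi (KX s) i (snd (comb_R n (KX s) (KX t) p)) < eps (KX t) i (fst (comb_R n (KX s) (KX t) p)) then 0 else 1))"
    if i: "i \<le> n" and p: "p \<in> carr (KX s \<otimes>\<^sub>c KX t)" and e: "eop (KX s \<otimes>\<^sub>c KX t) i p = Some p'" for i
  proof -
    have c: "comb_R n (KX s) (KX t) p \<in> carr (KX t \<otimes>\<^sub>c KX s)" "eop (KX t \<otimes>\<^sub>c KX s) i (comb_R n (KX s) (KX t) p) = Some (comb_R n (KX s) (KX t) p')"
      using comb_R_Rel(1)[of s t] p e i unfolding crystal_iso_def crystal_morphism_def by (auto simp del: carr_tensor)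
    show ?thesis by (rule walk_rel(2)[OF i p c(1) e c(2) comb_R_Rel(2)[OF p]])
  qed
  show "h s t p' = h s t p" if "i \<in> {1..n}" "p \<in> carr (KX s \<otimes>\<^sub>c KX t)" "eop (KX s \<otimes>\<^sub>c KX t) i p = Some p'"
    using st[of i] word_pos[of i] that by (simp add: h_def del: carr_tensor)
  assume p: "p \<in> carr (KX s \<otimes>\<^sub>c KX t)" and e: "eop (KX s \<otimes>\<^sub>c KX t) 0 p = Some p'"
  have p': "p' \<in> carr (KX s \<otimes>\<^sub>c KX t)" using regular_e(1)[OF regX2 _ p e] by simp
  show "int (h s t p') - int (h s t p) =
        coenergy_step (e0_left (KX s) (KX t) p) (e0_left (KX t) (KX s) (comb_R n (KX s) (KX t) p))"
  proof -
    let ?D = "(if phi (KX t) 0 (snd p) < eps (KX s) 0 (fst p) then 1 else 0) -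
       (if phi (KX s) 0 (snd (comb_R n (KX s) (KX t) p)) < eps (KX t) 0 (fst (comb_R n (KX s) (KX t) p)) then 0 else 1) :: int"
    have "coen N (int N) (d * t) (V s t p') = coen N (int N) (d * t) (V s t p) + int g * ?D"
      using st[of 0, OF _ p e] word_zero by simp
    then have "int (h s t p') = int (h s t p) + ?D" unfolding int_h[OF p] int_h[OF p'] using g by simp
    then show ?thesis by (simp add: coenergy_step_alt e0_left_def split_beta)
  qed
qed

sublocale KR_family X n
proof
  show "regular {0..n} (KR X n s)" for s by (rule regX)
  show "rises {0..n} (KR X n s \<otimes>\<^sub>c KR X n t)" for s t by (rule KR_conn2[OF rank])
  show "rises {0..n} (KR X n r \<otimes>\<^sub>c (KR X n s \<otimes>\<^sub>c KR X n t))" for r s t by (rule KR_conn3[OF rank])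
  show "u_rigid {0..n} (KR X n s \<otimes>\<^sub>c KR X n t) (KR X n t \<otimes>\<^sub>c KR X n s)" for s t by (rule KR_rigid[OF rank])
  show "\<exists>g. crystal_iso {0..n} (KR X n s \<otimes>\<^sub>c KR X n t) (KR X n t \<otimes>\<^sub>c KR X n s) g" for s t using comb_R_Rel(1) by blast
  show "\<exists>h :: row \<times> row \<Rightarrow> nat. h (uvec (KR X n s \<otimes>\<^sub>c KR X n t)) = 0 \<and>
      (\<forall>i\<in>{1..n}. \<forall>p\<in>carr (KR X n s \<otimes>\<^sub>c KR X n t). \<forall>p'. eop (KR X n s \<otimes>\<^sub>c KR X n t) i p = Some p' \<longrightarrow> h p' = h p) \<and>
      (\<forall>p\<in>carr (KR X n s \<otimes>\<^sub>c KR X n t). \<forall>p'. eop (KR X n s \<otimes>\<^sub>c KR X n t) 0 p = Some p' \<longrightarrow> int (h p') - int (h p) =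
        coenergy_step (e0_left (KR X n s) (KR X n t) p)
          (e0_left (KR X n t) (KR X n s) (comb_R n (KR X n s) (KR X n t) p)))" for s t
    using h_props(1)[of s t] h_props(2)[where s = s and t = t] h_props(3)[where s = s and t = t] by (intro exI[of _ "h s t"]) blast
qed

lemma local_coenergy_h:
  assumes "p \<in> carr (KX s \<otimes>\<^sub>c KX t)" shows "local_coenergy n (KX s) (KX t) p = h s t p"
  by (rule local_coenergy_eq[where h = "h s t", OF regX regX conn2 h_props(2) h_props(1) h_props(3) assms])

end

text \<open>In \<open>A2_even_dagger\<close> of rank 1 the node 1 is also the last node, where
  \<epsilon> counts every letter \<open>-1\<close> twice.\<close>

definition pad_shift :: "affine_type \<Rightarrow> nat \<Rightarrow> nat \<Rightarrow> nat \<Rightarrow> nat" where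
  "pad_shift X n c i = (if i = 1 then (if i = n \<and> X = A2_even_dagger then 2 * c else c) else 0)"

text \<open>The letter \<open>-1\<close> of \<open>X\<close> corresponds to \<open>-l0\<close>.  If \<open>l0 = 2\<close>, the letters \<open>\<plusminus>1\<close> of type D record the missing boxes.\<close>

locale D_padding = D_embedding +
  assumes XA: "X \<noteq> A1"
    and v_pad: "y \<in> KR_rows X n t \<Longrightarrow> v (t + c) (add_letter (- 1) (int c) y) = add_letter (- l0) (int (d * c)) (v t y)"
    and v_low: "y \<in> KR_rows X n t \<Longrightarrow> int d * y (- 1) \<le> v t y (- l0) \<and> v t y (- l0) < int d * (y (- 1) + 1)"
    and v_virtual: "l0 = 2 \<Longrightarrow> y \<in> KR_rows X n t \<Longrightarrow> v t y 1 = v t y (- 1) \<and> v t y 1 = int g * int (row_coenergy X n t y)"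
    and no_coenergy: "l0 = 1 \<Longrightarrow> row_coenergy X n t y = 0"
begin

sublocale KR_padded X n "\<lambda>c. add_letter (- 1) (int c)" "pad_shift X n"
proof
  note nn1 = good_rank_pos[OF rank]
  fix y t c i assume y: "y \<in> carr (KR X n t)"
  then have y': "y \<in> KR_rows X n t" by simp
  note py = pad_row[OF rank XA y', of c]
  show "add_letter (- 1) (int c) y \<in> carr (KR X n (t + c))" using py by simp
  show "row_coenergy X n (t + c) (add_letter (- 1) (int c) y) = row_coenergy X n t y" by (rule row_coenergy_pad[OF XA nn1])
  assume i: "1 \<le> i" "i \<le> n"
  have ph1: "row_phi X n (t + c) i (add_letter (- 1) (int c) y) = row_phi X n t i y"
    using i XA rank by (cases X) (auto simp: row_phi_def add_letter_apply good_rank_def)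
  have ph2: "row_eps X n (t + c) i (add_letter (- 1) (int c) y) = row_eps X n t i y + int (pad_shift X n c i)"
    using i XA rank by (cases "i = n"; cases "i = 1"; cases X) (auto simp: row_eps_def pad_shift_def add_letter_apply good_rank_def)
  have ph3: "f_row X n i (add_letter (- 1) (int c) y) = add_letter (- 1) (int c) (f_row X n i y)"
  proof (cases "i = n")
    case True
    then have n: "f_row X n i b = f_last X (int n) b" for b using i by (simp add: f_row_def)
    have "X = D1 \<Longrightarrow> 3 \<le> n" using rank by (auto simp: good_rank_def)
    then show ?thesis unfolding n using i XA by (cases X) (auto simp: f_last_def add_letter_apply change_apply fun_eq_iff)
  next
    case False
    then show ?thesis using i XA by (auto simp: f_row_def f_mid_def add_letter_apply change_apply fun_eq_iff)
  qed
  show "phi (KR X n (t + c)) i (add_letter (- 1) (int c) y) = phi (KR X n t) i y"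
    using KR_phi[OF rank i(2) py] KR_phi[OF rank i(2) y'] ph1 by simp
  show "eps (KR X n (t + c)) i (add_letter (- 1) (int c) y) = eps (KR X n t) i y + pad_shift X n c i"
    using KR_eps[OF rank i(2) py] KR_eps[OF rank i(2) y'] ph2 by simp
  show "fop (KR X n (t + c)) i (add_letter (- 1) (int c) y) = map_option (add_letter (- 1) (int c)) (fop (KR X n t) i y)"
    using node_ok[OF rank py i(2)] node_ok[OF rank y' i(2)] i ph1 ph3 by (simp add: node_ok_def)
next
  show "inj (add_letter (- 1) (int c))" for c
    by (rule inj_on_inverseI[where g = "add_letter (- 1) (- int c)"]) (simp add: add_add)
next
  fix x b c y p q assume x: "x \<in> carr (KR X n (b + c + 1))" and y: "y \<in> carr (KR X n b)"
    and R: "comb_R n (KR X n (b + c + 1)) (KR X n (b + c)) (x, add_letter (- 1) (int c) y) = (p, q)"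
  have c: "(x, add_letter (- 1) (int c) y) \<in> carr (KR X n (b + c + 1) \<otimes>\<^sub>c KR X n (b + c))" using x y pad_row[OF rank XA, of y b c] by simp
  have pq: "p \<in> KR_rows X n (b + c)" "q \<in> KR_rows X n (b + c + 1)" using R_carr[of x "b + c + 1" "add_letter (- 1) (int c) y" "b + c"] c R by auto
  have r: "rel N (int (d * (b + c + 1))) (int (d * (b + c))) (v (b + c + 1) x, v (b + c) (add_letter (- 1) (int c) y)) (v (b + c) p, v (b + c + 1) q)"
    using comb_R_Rel(2)[OF c] unfolding R Rel_def V_def by simp
  have y': "y \<in> KR_rows X n b" "add_letter (- 1) (int c) y \<in> KR_rows X n (b + c)" using y pad_row[OF rank XA, of y b c] by auto
  have lt: "int (d * (b + c)) < int (d * (b + c + 1))" using d by simp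
  have x': "x \<in> KR_rows X n (b + c + 1)" using x by simp
  have "v (b + c) (add_letter (- 1) (int c) y) (- l0) \<le> v (b + c + 1) q (- l0)"
  proof (cases "l0 = 1")
    case True
    then show ?thesis using lowest_grows[OF N refl r lt] by simp
  next
    case False
    then have l2: "l0 = 2" using l0 by simp
    show ?thesis
      using virtual_lowest_grows[OF N refl r valid_rows[OF N refl v_in[OF x'] v_in[OF y'(2)]] valid_rows[OF N refl v_in[OF pq(1)] v_in[OF pq(2)]]
        conjunct1[OF v_virtual[OF l2 x']] conjunct1[OF v_virtual[OF l2 y'(2)]] conjunct1[OF v_virtual[OF l2 pq(1)]] conjunct1[OF v_virtual[OF l2 pq(2)]] lt] l2 by simp
  qed
  \<comment> \<open>Virtual letters count the letters \<open>-1\<close> up to less than one multiple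
    of \<open>d\<close>, so the comparison in type D descends to the integers.\<close>
  then have "int d * (y (- 1) + int c) < int d * (q (- 1) + 1)" using v_low[OF y'(2)] v_low[OF pq(2)] by (simp add: add_letter_apply)
  then have "y (- 1) + int c < q (- 1) + 1" using d by (simp only: mult_less_cancel_left_pos of_nat_0_less_iff)
  then have "int c \<le> q (- 1)" using rows_nonneg[OF y'(1), of "- 1"] by simp
  moreover have "b + c + 1 = b + 1 + c" by simp
  ultimately have "add_letter (- 1) (- int c) q \<in> KR_rows X n (b + 1)" using unpad_row[OF rank XA, of q "b + 1" c] pq(2) by simp
  moreover have "q = add_letter (- 1) (int c) (add_letter (- 1) (- int c) q)" by (simp add: add_add)
  ultimately show "\<exists>y'\<in>carr (KR X n (b + 1)). q = add_letter (- 1) (int c) y'" by auto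
next
  fix w r y t y1 w1 c y2 w2 assume w: "w \<in> carr (KR X n r)" and y: "y \<in> carr (KR X n t)"
    and R1: "comb_R n (KR X n r) (KR X n t) (w, y) = (y1, w1)" and R2: "comb_R n (KR X n r) (KR X n (t + c)) (w, add_letter (- 1) (int c) y) = (y2, w2)"
  let ?y = "add_letter (- 1) (int c) y"
  have c1: "(w, y) \<in> carr (KR X n r \<otimes>\<^sub>c KR X n t)" and c2: "(w, ?y) \<in> carr (KR X n r \<otimes>\<^sub>c KR X n (t + c))"
    using w y pad_row[OF rank XA, of y t c] by auto
  have m: "w \<in> KR_rows X n r" "y \<in> KR_rows X n t" "?y \<in> KR_rows X n (t + c)" "y1 \<in> KR_rows X n t" "w1 \<in> KR_rows X n r" "y2 \<in> KR_rows X n (t + c)" "w2 \<in> KR_rows X n r"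
    using c1 c2 R_carr[of w r y t y1 w1] R_carr[of w r ?y "t + c" y2 w2] R1 R2 by auto
  have H: "int (local_coenergy n (KR X n r) (KR X n t) (w, y)) = coen N (int N) (d * t) (v r w, v t y) div int g"
    "int (local_coenergy n (KR X n r) (KR X n (t + c)) (w, ?y)) = coen N (int N) (d * t + d * c) (v r w, add_letter (- l0) (int (d * c)) (v t y)) div int g"
    unfolding local_coenergy_h[OF c1] local_coenergy_h[OF c2] int_h[OF c1] int_h[OF c2] V_def prod.case v_pad[OF m(2)] distrib_left by simp_all
  have "int (local_coenergy n (KR X n r) (KR X n (t + c)) (w, ?y)) + int (row_coenergy X n r w2) =
    int (local_coenergy n (KR X n r) (KR X n t) (w, y)) + int (row_coenergy X n r w1)"
  proof (cases "l0 = 1")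
    case True
    then show ?thesis unfolding H using no_coenergy[OF True] coen_pad[OF N refl, of "d * t" "d * c" "v r w" "v t y"] by simp
  next
    case False
    then have l2: "l0 = 2" using l0 by simp
    note vv = v_virtual[OF l2]
    have r1: "rel N (int (d * r)) (int (d * t)) (v r w, v t y) (v t y1, v r w1)" using comb_R_Rel(2)[OF c1] unfolding R1 Rel_def V_def by simp
    have r2: "rel N (int (d * r)) (int (d * (t + c))) (v r w, add_letter (- 2) (int (d * c)) (v t y)) (v (t + c) y2, v r w2)"
      using comb_R_Rel(2)[OF c2] v_pad[OF m(2), of c] l2 unfolding R2 Rel_def V_def by simp
    have vp: "valid (int N) (v r w, add_letter (- 2) (int (d * c)) (v t y))" using valid_rows[OF N refl v_in[OF m(1)] v_in[OF m(3)]] v_pad[OF m(2), of c] l2 by simp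
    have "v r w2 1 + coen N (int N) (d * t + d * c) (v r w, add_letter (- 2) (int (d * c)) (v t y)) = v r w1 1 + coen N (int N) (d * t) (v r w, v t y)"
      by (rule virtual_coen_pad[OF N refl r1 r2 valid_rows[OF N refl v_in[OF m(1)] v_in[OF m(2)]] valid_rows[OF N refl v_in[OF m(4)] v_in[OF m(5)]] vp
        valid_rows[OF N refl v_in[OF m(6)] v_in[OF m(7)]] conjunct1[OF vv[OF m(1)]] conjunct1[OF vv[OF m(2)]] conjunct1[OF vv[OF m(4)]] conjunct1[OF vv[OF m(5)]]
        conjunct1[OF vv[OF m(6)]] conjunct1[OF vv[OF m(7)]]])
    then have e: "coen N (int N) (d * t + d * c) (v r w, add_letter (- 2) (int (d * c)) (v t y)) + int g * int (row_coenergy X n r w2) =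
      coen N (int N) (d * t) (v r w, v t y) + int g * int (row_coenergy X n r w1)"
      using conjunct2[OF vv[OF m(5)]] conjunct2[OF vv[OF m(7)]] by simp
    \<comment> \<open>The row coenergy is stored \<open>g\<close>-fold in the virtual letters and
      therefore passes exactly through the floor division.\<close>
    have "(a + int g * b) div int g = a div int g + b" for a b using g by simp
    from this[of "coen N (int N) (d * t + d * c) (v r w, add_letter (- 2) (int (d * c)) (v t y))" "int (row_coenergy X n r w2)"]
      this[of "coen N (int N) (d * t) (v r w, v t y)" "int (row_coenergy X n r w1)"]
    show ?thesis unfolding H l2 using e by simp
  qed
  then show "local_coenergy n (KR X n r) (KR X n (t + c)) (w, ?y) + row_coenergy X n r w2 =
      local_coenergy n (KR X n r) (KR X n t) (w, y) + row_coenergy X n r w1" by linarith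
qed

end

section \<open>The types other than A and D\<close>

definition has_zero :: "affine_type \<Rightarrow> bool" where "has_zero X \<longleftrightarrow> X \<in> {B1, D2, A2_even_dagger}"
text \<open>The value 1 marks the types whose row crystals are classically reducible: there the
  letters \<open>\<plusminus>1\<close> of type D are reserved for missing boxes and all other
  letters are shifted.\<close>

definition off :: "affine_type \<Rightarrow> nat" where "off X = (if X \<in> {C1, A2_even, A2_even_dagger, D2} then 1 else 0)"
text \<open>Doubling makes room for the letter 0, split into one \<open>n\<close> and one
  \<open>-n\<close>, and for a single missing box, stored as a pair \<open>1\<close>,
  \<open>-1\<close>. In \<open>C1\<close> boxes are missing in pairs, so rows stay undoubled and
  \<open>gap\<close> halves.\<close>

definition dbl :: "affine_type \<Rightarrow> nat" where "dbl X = (if X \<in> {B1, A2_even, A2_even_dagger, D2} then 2 else 1)"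
definition gam :: "affine_type \<Rightarrow> nat" where "gam X = (if off X = 0 then dbl X else if X = A2_even_dagger then 2 else 1)"
definition gap :: "affine_type \<Rightarrow> nat \<Rightarrow> nat \<Rightarrow> row \<Rightarrow> int" where
  "gap X n s b = (if X = C1 then (int s - row_size X n b) div 2 else int s - row_size X n b)"
definition sh :: "affine_type \<Rightarrow> int \<Rightarrow> int" where "sh X k = (if 0 < k then k + int (off X) else k - int (off X))"
definition unsh :: "affine_type \<Rightarrow> int \<Rightarrow> int" where "unsh X k = (if 0 < k then k - int (off X) else k + int (off X))"

text \<open>The letters of absolute value \<open>n + off X + 1\<close>, the largest in the target,
  never occur. Hence the two fork nodes see the same string lengths and together replace node
  \<open>n\<close>.\<close>

definition vD :: "affine_type \<Rightarrow> nat \<Rightarrow> nat \<Rightarrow> row \<Rightarrow> row" where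
  "vD X n s b = (\<lambda>l. if l = 0 \<or> int n + int (off X) < \<bar>l\<bar> then 0 else if \<bar>l\<bar> \<le> int (off X) then gap X n s b
     else int (dbl X) * b (unsh X l) + (if \<bar>l\<bar> = int n + int (off X) \<and> has_zero X then b 0 else 0))"

text \<open>The nodes folded together into one node of \<open>X\<close>, repeated as often as one
  move of \<open>X\<close> changes virtual letters.\<close>

definition wordD :: "affine_type \<Rightarrow> nat \<Rightarrow> nat \<Rightarrow> nat list" where
  "wordD X n i = (let N = n + off X + 1 in
    if i = 0 then (if off X = 0 then replicate (dbl X) 0 else if X = A2_even_dagger then [0, 1, 0, 1] else [0, 1])
    else if i = n then (if X = A2_even then [N - 1, N, N - 1, N] else [N - 1, N])
    else replicate (dbl X) (i + off X))"

definition mulD :: "affine_type \<Rightarrow> nat \<Rightarrow> nat \<Rightarrow> int" where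
  "mulD X n i = (if i = 0 then int (gam X) else if i = n then (if X = A2_even then 2 else 1) else int (dbl X))"

lemma ewalk_append: "ewalk N s e f js c c1 \<Longrightarrow> ewalk N s e f ks c1 c2 \<Longrightarrow> ewalk N s e f (js @ ks) c c2"
  by (induction js arbitrary: c) auto

text \<open>One passage through the nodes 0 and 1 when the letters \<open>1\<close> and \<open>-1\<close> occur equally often.\<close>

definition zero_pass :: "row \<Rightarrow> row" where
  "zero_pass c = (if c 2 > c (- 2) + 1 then change 2 1 (change 2 (- 1) c) else if c 2 = c (- 2) + 1 then change (- 1) (- 2) (change 2 (- 1) c)
     else change (- 1) (- 2) (change 1 (- 2) c))"

lemma ewalk_zero:
  assumes N: "3 \<le> N" and c: "c 1 = c (- 1)" and e: "e < c 1 + pos (c 2 - c (- 2))" "f \<le> c 1 + pos (c (- 2) - c 2)"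
  shows "ewalk N s e f [0, 1] c (zero_pass c)"
proof -
  have E0: "e_row D1 N 0 b = (if b 2 > b (-2) then change 2 (-1) b else change 1 (-2) b)" for b by (simp add: e_row_def e_zero_def)
  have E1: "e_row D1 N (Suc 0) b = (if b 2 > b (-2) then change 2 1 b else change (- 1) (- 2) b)" for b using N by (simp add: e_row_def e_mid_def)
  have ep: "row_eps D1 N s 0 b = b 1 + pos (b 2 - b (-2))" "row_phi D1 N s 0 b = b (-1) + pos (b (-2) - b 2)"
    "row_eps D1 N s (Suc 0) b = b (-1) + pos (b 2 - b (-2))" "row_phi D1 N s (Suc 0) b = b 1 + pos (b (-2) - b 2)" for b
    using N by (simp_all add: row_eps_def row_phi_def)
  consider "c 2 > c (- 2) + 1" | "c 2 = c (- 2) + 1" | "c 2 \<le> c (- 2)" by linarith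
  then show ?thesis using c e
    by cases (simp_all add: E0 E1 ep zero_pass_def change_apply pos_def)
qed

text \<open>Without letters \<open>\<plusminus>N\<close> the first fork node turns
  \<open>-(N - 1)\<close> into \<open>-N\<close>, and the second turns that letter into
  \<open>N - 1\<close>.\<close>

lemma ewalk_last:
  assumes N: "3 \<le> N" and c: "c (int N) = 0" "c (- int N) = 0" and e: "e < c (- (int N - 1))" "f \<le> c (int N - 1)"
  shows "ewalk N s e f [N - 1, N] c (change (- (int N - 1)) (int N - 1) c)"
proof -
  have n: "N - 1 \<noteq> 0" "N - 1 \<noteq> N" "int (N - 1) = int N - 1" "N \<noteq> 0" using N by auto
  have E: "e_row D1 N (N - 1) b = (if b (int N) > b (- int N) then change (int N) (int N - 1) b else change (- (int N - 1)) (- int N) b)"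
    "e_row D1 N N b = (if b (- int N) = 0 then change (- (int N - 1)) (int N) b else change (- int N) (int N - 1) b)" for b
    using n by (simp_all add: e_row_def e_mid_def e_last_def)
  have ep: "row_eps D1 N s (N - 1) b = b (- (int N - 1)) + pos (b (int N) - b (- int N))" "row_phi D1 N s (N - 1) b = b (int N - 1) + pos (b (- int N) - b (int N))"
    "row_eps D1 N s N b = b (- (int N - 1)) + b (- int N)" "row_phi D1 N s N b = b (int N - 1) + b (int N)" for b
    using n by (simp_all add: row_eps_def row_phi_def)
  have cc: "change (- int N) (int N - 1) (change (- (int N - 1)) (- int N) c) = change (- (int N - 1)) (int N - 1) c"
    by (auto simp: fun_eq_iff change_apply)
  have l: "- int N \<noteq> int N - 1" "- int N \<noteq> - (int N - 1)" "int N \<noteq> - int N" "int N - 1 \<noteq> - (int N - 1)" "int N \<noteq> - (int N - 1)" using N by auto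
  show ?thesis using c e N unfolding ewalk.simps E ep by (auto simp: change_apply pos_def l cc cc[simplified])
qed

locale folded_type =
  fixes X :: affine_type and n :: nat
  assumes rk: "rank_ok X n" and X: "X \<noteq> A1" "X \<noteq> D1"
begin

lemma grk: "good_rank X n" using rk by (simp add: good_rank_def)
lemma nX: "1 \<le> n" by (rule good_rank_pos[OF grk])
lemma N3: "3 \<le> n + off X + 1" using rk X by (cases X) (auto simp: off_def)
lemma dbl_zero: "has_zero X \<Longrightarrow> dbl X = 2" by (auto simp: has_zero_def dbl_def)
lemma fork_n: "off X = 0 \<Longrightarrow> 3 \<le> n" using rk X by (cases X) (auto simp: off_def)
lemma off_le: "off X \<le> 1" by (simp add: off_def)

lemma vD_sh:
  assumes "1 \<le> \<bar>k\<bar>" "\<bar>k\<bar> \<le> int n"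
  shows "vD X n s b (sh X k) = int (dbl X) * b k + (if \<bar>k\<bar> = int n \<and> has_zero X then b 0 else 0)"
  using assms by (auto simp: vD_def sh_def unsh_def abs_if split: if_splits)

lemma vD_one: "off X = 1 \<Longrightarrow> vD X n s b 1 = gap X n s b" "off X = 1 \<Longrightarrow> vD X n s b (- 1) = gap X n s b"
  using nX by (simp_all add: vD_def)

lemma vD_out: "l = 0 \<or> int n + int (off X) < \<bar>l\<bar> \<Longrightarrow> vD X n s b l = 0"
  by (auto simp: vD_def)

lemma letter_cases:
  fixes l :: int
  obtains (out) "l = 0 \<or> int n + int (off X) < \<bar>l\<bar>" | (one) "off X = 1" "l = 1" | (mone) "off X = 1" "l = - 1"
    | (sh) k where "l = sh X k" "1 \<le> \<bar>k\<bar>" "\<bar>k\<bar> \<le> int n"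
proof (cases "l = 0 \<or> int n + int (off X) < \<bar>l\<bar>")
  case False
  show ?thesis
  proof (cases "\<bar>l\<bar> \<le> int (off X)")
    case True
    then have "off X = 1" "l = 1 \<or> l = - 1" using False off_le by auto
    then show ?thesis using one mone by auto
  next
    case b: False
    have "l = sh X (unsh X l)" "1 \<le> \<bar>unsh X l\<bar>" "\<bar>unsh X l\<bar> \<le> int n"
      using False b by (auto simp: sh_def unsh_def abs_if split: if_splits)
    then show ?thesis by (rule sh)
  qed
qed (rule out)

lemma sh_eq: "k \<noteq> 0 \<Longrightarrow> k' \<noteq> 0 \<Longrightarrow> sh X k = sh X k' \<longleftrightarrow> k = k'" by (auto simp: sh_def split: if_splits)
lemma sh_not: "k \<noteq> 0 \<Longrightarrow> sh X k \<noteq> 0 \<and> (off X = 1 \<longrightarrow> sh X k \<noteq> 1 \<and> sh X k \<noteq> - 1)"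
  by (auto simp: sh_def)
lemma sh_in: "1 \<le> \<bar>k\<bar> \<Longrightarrow> \<bar>k\<bar> \<le> int n \<Longrightarrow> \<bar>sh X k\<bar> \<le> int n + int (off X)" by (auto simp: sh_def abs_if split: if_splits)

lemma letX: "k \<in> letters X n \<longleftrightarrow> \<bar>k\<bar> \<le> int n \<and> (has_zero X \<or> k \<noteq> 0)"
  using X by (auto simp: letters_def has_zero_def abs_le_iff)

lemma vD_change:
  assumes p: "1 \<le> \<bar>p\<bar>" "\<bar>p\<bar> \<le> int n" and q: "1 \<le> \<bar>q\<bar>" "\<bar>q\<bar> \<le> int n"
  shows "vD X n s (change p q b) l = vD X n s b l + int (dbl X) * ((if l = sh X q then 1 else 0) - (if l = sh X p then 1 else 0))"
proof -
  have l: "p \<in> letters X n" "q \<in> letters X n" using p q by (auto simp: letX)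
  have nz: "p \<noteq> 0" "q \<noteq> 0" using p q by auto
  have g: "gap X n s (change p q b) = gap X n s b" unfolding gap_def row_size_change[OF l] ..
  show ?thesis
  proof (cases l rule: letter_cases)
    case out
    then show ?thesis using vD_out[OF out] sh_in[OF p] sh_in[OF q] sh_not[OF nz(1)] sh_not[OF nz(2)] by auto
  next
    case one
    then show ?thesis using sh_not[OF nz(1)] sh_not[OF nz(2)] by (simp add: vD_one g)
  next
    case mone
    then show ?thesis using sh_not[OF nz(1)] sh_not[OF nz(2)] by (simp add: vD_one g)
  next
    case (sh k)
    then have "k \<noteq> 0" by auto
    then show ?thesis using sh nz by (simp add: vD_sh[OF sh(2,3)] sh_eq change_apply algebra_simps)
  qed
qed

lemma vD_add:
  assumes p: "p = 1 \<or> p = - 1" and o: "off X = 1"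
  shows "vD X n s (add_letter p a b) l = vD X n s b l + (if l = sh X p then int (dbl X) * a else if l = 1 \<or> l = - 1 then gap X n s (add_letter p a b) - gap X n s b else 0)"
proof -
  have nz: "p \<noteq> 0" and pn: "1 \<le> \<bar>p\<bar>" "\<bar>p\<bar> \<le> int n" using p nX by auto
  show ?thesis
  proof (cases l rule: letter_cases)
    case out
    then show ?thesis using vD_out[OF out] sh_in[OF pn] sh_not[OF nz] nX by auto
  next
    case one
    then show ?thesis using sh_not[OF nz] by (simp add: vD_one)
  next
    case mone
    then show ?thesis using sh_not[OF nz] by (simp add: vD_one)
  next
    case (sh k)
    then have "k \<noteq> 0" by auto
    then show ?thesis using sh nz p sh_not[of k] o by (auto simp: vD_sh[OF sh(2,3)] sh_eq add_letter_apply algebra_simps)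
  qed
qed

text \<open>A letter 0 counts once for \<open>n\<close> and once for \<open>-n\<close>, other
  letters twice. So \<open>-n\<close> to \<open>0\<close> and \<open>0\<close> to \<open>n\<close>
  have the same virtual effect.\<close>

lemma vD_last_zero:
  assumes "has_zero X" "p = - int n \<and> q = 0 \<or> p = 0 \<and> q = int n"
  shows "vD X n s (change p q b) l = vD X n s b l + (if l = sh X (int n) then 1 else 0) - (if l = sh X (- int n) then 1 else 0)"
proof -
  have l: "p \<in> letters X n" "q \<in> letters X n" using assms by (auto simp: letX)
  have n0: "int n \<noteq> 0" "- int n \<noteq> 0" and n1': "1 \<le> \<bar>int n\<bar>" "\<bar>int n\<bar> \<le> int n" "1 \<le> \<bar>- int n\<bar>" "\<bar>- int n\<bar> \<le> int n" using nX by auto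
  have g: "gap X n s (change p q b) = gap X n s b" unfolding gap_def row_size_change[OF l] ..
  show ?thesis
  proof (cases l rule: letter_cases)
    case out
    then show ?thesis using vD_out[OF out] sh_in[OF n1'(1,2)] sh_in[OF n1'(3,4)] sh_not[OF n0(1)] sh_not[OF n0(2)] by auto
  next
    case one
    then show ?thesis using sh_not[OF n0(1)] sh_not[OF n0(2)] by (simp add: vD_one g)
  next
    case mone
    then show ?thesis using sh_not[OF n0(1)] sh_not[OF n0(2)] by (simp add: vD_one g)
  next
    case (sh k)
    then have k: "k \<noteq> 0" by auto
    have "\<bar>k\<bar> = int n \<longleftrightarrow> k = int n \<or> k = - int n" by auto
    then show ?thesis using sh k assms nX dbl_zero[OF assms(1)]
      by (auto simp: vD_sh[OF sh(2,3)] sh_eq[OF k n0(1)] sh_eq[OF k n0(2)] change_apply)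
  qed
qed

lemma sum_sym: "(\<Sum>k\<in>{- int m..int m} - {0}. b k) = (\<Sum>k\<in>{1..int m}. b k + b (- k))" for b :: "int \<Rightarrow> int" and m
proof -
  have "{- int m..int m} - {0} = {1..int m} \<union> uminus ` {1..int m}" by (force simp: image_iff)
  moreover have "{1..int m} \<inter> uminus ` {1..int m} = {}" by auto
  moreover have "(\<Sum>k\<in>uminus ` {1..int m}. b k) = (\<Sum>k\<in>{1..int m}. b (- k))" by (subst sum.reindex) (auto simp: inj_on_def)
  ultimately show ?thesis by (simp add: sum.union_disjoint sum.distrib)
qed

text \<open>The last two terms compensate for the letter 0 and for the missing boxes, so that a
  virtual row has the full length which type D demands.\<close>

lemma vD_size: "row_size D1 (n + off X + 1) (vD X n s b) = int (dbl X) * (\<Sum>k\<in>letters X n - {0}. b k) + 2 * (if has_zero X then b 0 else 0) + 2 * int (off X) * gap X n s b"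
proof -
  let ?w = "vD X n s b" and ?o = "int (off X)" and ?f = "\<lambda>l. vD X n s b l + vD X n s b (- l)"
  have "row_size D1 (n + off X + 1) ?w = (\<Sum>l\<in>{1..int n + ?o + 1}. ?f l)"
    using sum_sym[of ?w "n + off X + 1"] by (simp add: row_size_def letters_def add.commute)
  also have "{1..int n + ?o + 1} = insert (int n + ?o + 1) {1..int n + ?o}" by auto
  also have "(\<Sum>l\<in>insert (int n + ?o + 1) {1..int n + ?o}. ?f l) = (\<Sum>l\<in>{1..int n + ?o}. ?f l)"
    by (subst sum.insert) (auto simp: vD_out)
  also have "{1..int n + ?o} = {1..?o} \<union> {1 + ?o..int n + ?o}" by auto
  also have "(\<Sum>l\<in>{1..?o} \<union> {1 + ?o..int n + ?o}. ?f l) = (\<Sum>l\<in>{1..?o}. ?f l) + (\<Sum>l\<in>{1 + ?o..int n + ?o}. ?f l)"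
    by (rule sum.union_disjoint) auto
  also have "(\<Sum>l\<in>{1..?o}. ?f l) = 2 * ?o * gap X n s b"
  proof (cases "off X = 0")
    case False
    then have "off X = 1" using off_le by simp
    then show ?thesis using vD_one[of s b] by simp
  qed simp
  also have "(\<Sum>l\<in>{1 + ?o..int n + ?o}. ?f l) = (\<Sum>k\<in>{1..int n}. ?f (k + ?o))"
    by (rule sum.reindex_bij_witness[of _ "\<lambda>k. k + ?o" "\<lambda>l. l - ?o"]) auto
  also have "\<dots> = (\<Sum>k\<in>{1..int n}. int (dbl X) * (b k + b (- k)) + (if k = int n then 2 * (if has_zero X then b 0 else 0) else 0))"
  proof (rule sum.cong[OF refl])
    fix k assume k: "k \<in> {1..int n}"
    have e: "k + ?o = sh X k" "- sh X k = sh X (- k)" using k by (auto simp: sh_def)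
    show "?f (k + ?o) = int (dbl X) * (b k + b (- k)) + (if k = int n then 2 * (if has_zero X then b 0 else 0) else 0)"
      unfolding e using vD_sh[of k s b] vD_sh[of "- k" s b] k by (auto simp: algebra_simps)
  qed
  also have "\<dots> = int (dbl X) * (\<Sum>k\<in>{1..int n}. b k + b (- k)) + 2 * (if has_zero X then b 0 else 0)"
    using nX by (simp add: sum.distrib distrib_left flip: sum_distrib_left)
  also have "(\<Sum>k\<in>{1..int n}. b k + b (- k)) = (\<Sum>k\<in>letters X n - {0}. b k)"
  proof -
    have "letters X n - {0} = {- int n..int n} - {0}" using X by (auto simp: letters_def)
    then show ?thesis using sum_sym[of b n] by simp
  qed
  finally show ?thesis by simp
qed

lemma vD_in:
  assumes b: "b \<in> KR_rows X n s" shows "vD X n s b \<in> KR_rows D1 (n + off X + 1) (dbl X * s)"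
proof -
  have nn: "0 \<le> b l" for l using b by (simp add: KR_rows_def)
  have sz: "size_ok X s (row_size X n b)" using b by (simp add: KR_rows_def)
  have sp: "row_size X n b = (\<Sum>k\<in>letters X n - {0}. b k) + (if has_zero X then b 0 else 0)"
    unfolding row_size_def by (cases "has_zero X") (auto simp: letX sum.remove[of _ 0] intro!: sum.cong)
  have gp: "0 \<le> gap X n s b" using row_size_le[OF b] by (cases "X = C1") (auto simp: gap_def)
  have "row_size D1 (n + off X + 1) (vD X n s b) = int (dbl X * s)"
    unfolding vD_size using sz sp X
    by (cases X) (auto simp: dbl_def off_def gap_def has_zero_def size_ok_def)
  moreover have "0 \<le> vD X n s b l" for l using nn gp by (simp add: vD_def)
  moreover have "vD X n s b l = 0" if "l \<notin> letters D1 (n + off X + 1)" for l using that by (intro vD_out) (auto simp: letters_def)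
  moreover have "vD X n s b (int (n + off X + 1)) = 0" by (rule vD_out) simp
  ultimately show ?thesis by (auto simp: KR_rows_def size_ok_def)
qed

lemma vD_u: "vD X n s (power_row 1 s) = power_row (int (off X) + 1) (dbl X * s)"
proof
  fix l :: int
  have g: "gap X n s (power_row 1 s) = 0"
  proof -
    have r: "row_size X n (power_row 1 s) = int s" using nX by (simp add: letX)
    show ?thesis unfolding gap_def r by simp
  qed
  have e: "int (off X) + 1 = sh X 1" by (simp add: sh_def)
  show "vD X n s (power_row 1 s) l = power_row (int (off X) + 1) (dbl X * s) l"
  proof (cases l rule: letter_cases)
    case out
    then show ?thesis using vD_out[OF out] nX by (auto simp: power_row_apply)
  next
    case (sh k)
    then have "k \<noteq> 0" by auto
    then show ?thesis unfolding e using sh by (auto simp: vD_sh[OF sh(2,3)] power_row_apply sh_eq)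
  qed (simp_all add: vD_one g power_row_apply)
qed

lemma funpow_change: "(change p q ^^ k) b l = b l + int k * ((if l = q then 1 else 0) - (if l = p then 1 else 0))"
  by (induction k) (simp_all add: change_apply algebra_simps)

lemma vD_change_eq:
  assumes "1 \<le> \<bar>p\<bar>" "\<bar>p\<bar> \<le> int n" "1 \<le> \<bar>q\<bar>" "\<bar>q\<bar> \<le> int n"
  shows "vD X n s (change p q b) = (change (sh X p) (sh X q) ^^ dbl X) (vD X n s b)"
  using vD_change[OF assms] by (simp add: fun_eq_iff funpow_change)

text \<open>The difference \<open>w A - w B\<close> is a multiple of \<open>d\<close>, so its sign
  cannot tip before the last of the \<open>d\<close> repetitions, and all of them change the same
  letter.\<close>

lemma ewalk_same:
  assumes E: "\<And>c. e_row D1 N j c = (if c A > c B then change A A' c else change B' B c)"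
    and ep: "\<And>c. row_eps D1 N s j c = c B' + pos (c A - c B)" "\<And>c. row_phi D1 N s j c = c A' + pos (c B - c A)"
    and d: "d = 1 \<or> d = 2" and ne: "distinct [A, B, A', B']" and w: "w A - w B = int d * u"
    and e: "e < w B' + pos (w A - w B) - (int d - 1)" "f \<le> w A' + pos (w B - w A)"
  shows "ewalk N s e f (replicate d j) w (if u > 0 then (change A A' ^^ d) w else (change B' B ^^ d) w)"
  using d
proof
  assume "d = 1"
  then show ?thesis using e w ne by (simp add: E ep)
next
  assume "d = 2"
  then have r: "replicate d j = [j, j]" "change p q ^^ d = change p q \<circ> change p q" for p q by (simp_all add: numeral_2_eq_2)
  show ?thesis using e w ne \<open>d = 2\<close> unfolding r by (auto simp: E ep change_apply pos_def)
qed

lemma dbl_cases: "dbl X = 1 \<or> dbl X = 2" by (simp add: dbl_def)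
lemma sh_int: "1 \<le> i \<Longrightarrow> sh X (int i) = int (i + off X)" "1 \<le> i \<Longrightarrow> sh X (- int i) = - int (i + off X)"
  "1 \<le> i \<Longrightarrow> sh X (int i + 1) = int (i + off X) + 1" "1 \<le> i \<Longrightarrow> sh X (- (int i + 1)) = - (int (i + off X) + 1)"
  "1 \<le> i \<Longrightarrow> sh X (- int i - 1) = - (int (i + off X) + 1)"
  by (auto simp: sh_def)

lemma mul_pos: "0 < m \<Longrightarrow> m * pos a = pos (m * a)" for m :: int
  by (auto simp: pos_def max_def mult_le_0_iff)

section \<open>Nodes strictly between 0 and \<open>n\<close> under folding\<close>

context
  fixes i assumes i: "1 \<le> i" "i < n"
begin

lemma mid_word: "wordD X n i = replicate (dbl X) (i + off X)" "mulD X n i = int (dbl X)"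
  using i by (simp_all add: wordD_def mulD_def)

lemma mid_D:
  "e_row D1 (n + off X + 1) (i + off X) c = (if c (sh X (int i + 1)) > c (sh X (- (int i + 1))) then change (sh X (int i + 1)) (sh X (int i)) c else change (sh X (- int i)) (sh X (- (int i + 1))) c)"
  "row_eps D1 (n + off X + 1) t (i + off X) c = c (sh X (- int i)) + pos (c (sh X (int i + 1)) - c (sh X (- (int i + 1))))"
  "row_phi D1 (n + off X + 1) t (i + off X) c = c (sh X (int i)) + pos (c (sh X (- (int i + 1))) - c (sh X (int i + 1)))"
  using i by (simp_all add: sh_int e_row_def e_mid_def row_eps_def row_phi_def)

lemma mid_X:
  "e_row X n i b = (if b (int i + 1) > b (- (int i + 1)) then change (int i + 1) (int i) b else change (- int i) (- (int i + 1)) b)"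
  "row_eps X n s i b = b (- int i) + pos (b (int i + 1) - b (- (int i + 1)))"
  "row_phi X n s i b = b (int i) + pos (b (- (int i + 1)) - b (int i + 1))"
  using i X by (simp_all add: e_row_def e_mid_def row_eps_def row_phi_def)

lemma mid_v:
  "vD X n s b (sh X (int i)) = int (dbl X) * b (int i)" "vD X n s b (sh X (- int i)) = int (dbl X) * b (- int i)"
  "vD X n s b (sh X (int i + 1)) - vD X n s b (sh X (- (int i + 1))) = int (dbl X) * (b (int i + 1) - b (- (int i + 1)))"
  "vD X n s b (sh X (- (int i + 1))) - vD X n s b (sh X (int i + 1)) = int (dbl X) * (b (- (int i + 1)) - b (int i + 1))"
  using i by (auto simp: vD_sh algebra_simps)

lemma mid_eps:
  "row_eps D1 (n + off X + 1) t (i + off X) (vD X n s b) = int (dbl X) * row_eps X n s i b"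
  "row_phi D1 (n + off X + 1) t (i + off X) (vD X n s b) = int (dbl X) * row_phi X n s i b"
  using dbl_cases unfolding mid_D mid_X mid_v distrib_left by (auto simp: mul_pos)

lemma mid_walk:
  "ewalk (n + off X + 1) t (int (dbl X) * (row_eps X n s i b - 1)) (int (dbl X) * row_phi X n s i b) (wordD X n i) (vD X n s b) (vD X n s (e_row X n i b))"
proof -
  let ?u = "b (int i + 1) - b (- (int i + 1))"
  have dd: "0 < int (dbl X)" using dbl_cases by auto
  have "ewalk (n + off X + 1) t (int (dbl X) * (row_eps X n s i b - 1)) (int (dbl X) * row_phi X n s i b) (replicate (dbl X) (i + off X)) (vD X n s b)
    (if ?u > 0 then (change (sh X (int i + 1)) (sh X (int i)) ^^ dbl X) (vD X n s b) else (change (sh X (- int i)) (sh X (- (int i + 1))) ^^ dbl X) (vD X n s b))"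
  proof (rule ewalk_same[OF mid_D dbl_cases])
    show "distinct [sh X (int i + 1), sh X (- (int i + 1)), sh X (int i), sh X (- int i)]" using i by (simp add: sh_eq)
    show "vD X n s b (sh X (int i + 1)) - vD X n s b (sh X (- (int i + 1))) = int (dbl X) * ?u" by (rule mid_v)
    show "int (dbl X) * (row_eps X n s i b - 1) < vD X n s b (sh X (- int i)) + pos (vD X n s b (sh X (int i + 1)) - vD X n s b (sh X (- (int i + 1)))) - (int (dbl X) - 1)"
      unfolding mid_v mid_X using dd by (simp add: distrib_left mul_pos right_diff_distrib)
    show "int (dbl X) * row_phi X n s i b \<le> vD X n s b (sh X (int i)) + pos (vD X n s b (sh X (- (int i + 1))) - vD X n s b (sh X (int i + 1)))"
      unfolding mid_v mid_X using dd by (simp add: distrib_left mul_pos)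
  qed
  moreover have "1 \<le> \<bar>int i\<bar>" "\<bar>int i\<bar> \<le> int n" "1 \<le> \<bar>- int i\<bar>" "\<bar>- int i\<bar> \<le> int n" "1 \<le> \<bar>int i + 1\<bar>" "\<bar>int i + 1\<bar> \<le> int n" "1 \<le> \<bar>- (int i + 1)\<bar>" "\<bar>- (int i + 1)\<bar> \<le> int n"
    using i by auto
  note e = vD_change_eq[OF this(5,6,1,2)] vD_change_eq[OF this(3,4,7,8)]
  ultimately show ?thesis unfolding mid_word mid_X e[symmetric] by (simp only: if_distrib[of "vD X n s"] diff_gt_0_iff_gt)
qed

end

section \<open>The last node under folding\<close>

lemma last_v:
  "vD X n s b (sh X (- int n)) = mulD X n n * row_eps X n s n b" "vD X n s b (sh X (int n)) = mulD X n n * row_phi X n s n b"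
proof -
  have n: "n \<noteq> 0" using nX by simp
  have n1: "1 \<le> \<bar>int n\<bar>" "\<bar>int n\<bar> \<le> int n" "1 \<le> \<bar>- int n\<bar>" "\<bar>- int n\<bar> \<le> int n" "\<bar>int n\<bar> = int n" "\<bar>- int n\<bar> = int n" using nX by auto
  have "int (dbl X) * a + (if has_zero X then z else 0) = mulD X n n * (if X \<in> {C1, A2_odd, A2_even} then a else 2 * a + z)" for a z
    using X n by (cases X) (simp_all add: mulD_def dbl_def has_zero_def)
  moreover have "row_eps X n s n b = (if X \<in> {C1, A2_odd, A2_even} then b (- int n) else 2 * b (- int n) + b 0)"
    "row_phi X n s n b = (if X \<in> {C1, A2_odd, A2_even} then b (int n) else 2 * b (int n) + b 0)"
    using X n by (simp_all add: row_eps_def row_phi_def)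
  ultimately show "vD X n s b (sh X (- int n)) = mulD X n n * row_eps X n s n b" "vD X n s b (sh X (int n)) = mulD X n n * row_phi X n s n b"
    unfolding vD_sh[OF n1(3,4)] vD_sh[OF n1(1,2)] n1(5,6) by simp_all
qed

lemma last_D:
  assumes j: "j = n + off X \<or> j = n + off X + 1"
  shows "row_eps D1 (n + off X + 1) t j (vD X n s b) = mulD X n n * row_eps X n s n b"
    and "row_phi D1 (n + off X + 1) t j (vD X n s b) = mulD X n n * row_phi X n s n b"
proof -
  obtain m where m: "n + off X = m" by simp
  have m0: "m \<noteq> 0" "m + 1 \<noteq> 0" "m \<noteq> m + 1" "int (m + 1) = int m + 1" using nX m by auto
  have o: "vD X n s b (int m + 1) = 0" "vD X n s b (- (int m + 1)) = 0" by (rule vD_out; simp add: m[symmetric])+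
  note l = last_v[of s b, unfolded sh_int[OF nX] m]
  have D: "row_eps D1 (m + 1) t m c = c (- int m) + pos (c (int m + 1) - c (- (int m + 1)))"
    "row_eps D1 (m + 1) t (m + 1) c = c (- int m) + c (- (int m + 1))"
    "row_phi D1 (m + 1) t m c = c (int m) + pos (c (- (int m + 1)) - c (int m + 1))"
    "row_phi D1 (m + 1) t (m + 1) c = c (int m) + c (int m + 1)" for c
    using m0 by (simp_all add: row_eps_def row_phi_def add.commute)
  show "row_eps D1 (n + off X + 1) t j (vD X n s b) = mulD X n n * row_eps X n s n b"
    "row_phi D1 (n + off X + 1) t j (vD X n s b) = mulD X n n * row_phi X n s n b"
    using j unfolding m l[symmetric] by (elim disjE; simp only: D o pos_def; simp; fail)+
qed

lemma last_walk:
  "ewalk (n + off X + 1) t (mulD X n n * (row_eps X n s n b - 1)) (mulD X n n * row_phi X n s n b) (wordD X n n) (vD X n s b) (vD X n s (e_row X n n b))"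
proof -
  let ?N = "n + off X + 1" and ?p = "- (int (n + off X + 1) - 1)" and ?q = "int (n + off X + 1) - 1"
  have pq: "?p = sh X (- int n)" "?q = sh X (int n)" using sh_int(1,2)[OF nX] by auto
  have ne: "?p \<noteq> ?q" using nX by auto
  have o: "c ?p = vD X n s b ?p \<Longrightarrow> True" for c by simp
  have W: "ewalk ?N t e f [?N - 1, ?N] c (change ?p ?q c)"
    if "c (int ?N) = 0" "c (- int ?N) = 0" "e < c ?p" "f \<le> c ?q" for c e f by (rule ewalk_last[OF N3 that])
  have o: "vD X n s b (int ?N) = 0" "vD X n s b (- int ?N) = 0" by (rule vD_out; simp)+
  have en: "e_row X n n b = e_last X (int n) b" using nX by (simp add: e_row_def)
  have n1: "1 \<le> \<bar>int n\<bar>" "\<bar>int n\<bar> \<le> int n" "1 \<le> \<bar>- int n\<bar>" "\<bar>- int n\<bar> \<le> int n" using nX by auto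
  note vc = vD_change_eq[OF n1(3,4,1,2), of s b, folded pq]
  note lv = last_v[of s b, folded pq]
  show ?thesis
  \<comment> \<open>Here a whole doubled letter moves from \<open>-n\<close> to \<open>n\<close> in
    one step and the pair of fork nodes is run through twice. In the other types a single passage
    suffices.\<close>
  proof (cases "X = A2_even")
    case True
    let ?c = "change ?p ?q (vD X n s b)"
    have m: "mulD X n n = 2" "dbl X = 2" using True nX by (simp_all add: mulD_def dbl_def)
    have w: "wordD X n n = [?N - 1, ?N] @ [?N - 1, ?N]" using True nX by (simp add: wordD_def Let_def)
    have "ewalk ?N t (mulD X n n * (row_eps X n s n b - 1)) (mulD X n n * row_phi X n s n b) [?N - 1, ?N] (vD X n s b) ?c"
      by (rule W[OF o]) (simp_all only: lv m, simp_all)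
    moreover have "ewalk ?N t (mulD X n n * (row_eps X n s n b - 1)) (mulD X n n * row_phi X n s n b) [?N - 1, ?N] ?c (change ?p ?q ?c)"
    proof (rule W)
      show "?c (int ?N) = 0" "?c (- int ?N) = 0" using o by (auto simp: change_apply)
      have "?c ?p = vD X n s b ?p - 1" "?c ?q = vD X n s b ?q + 1" using ne by (auto simp: change_apply)
      then show "mulD X n n * (row_eps X n s n b - 1) < ?c ?p" "mulD X n n * row_phi X n s n b \<le> ?c ?q"
        unfolding lv m by simp_all
    qed
    ultimately have "ewalk ?N t (mulD X n n * (row_eps X n s n b - 1)) (mulD X n n * row_phi X n s n b) (wordD X n n) (vD X n s b) (change ?p ?q ?c)"
      unfolding w by (rule ewalk_append)
    moreover have "vD X n s (e_row X n n b) = change ?p ?q ?c"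
      unfolding en using True vc m by (simp add: e_last_def numeral_2_eq_2)
    ultimately show ?thesis by simp
  next
    case False
    have m: "mulD X n n = 1" using False nX by (simp add: mulD_def)
    have w: "wordD X n n = [?N - 1, ?N]" using False nX by (simp add: wordD_def Let_def)
    have "ewalk ?N t (mulD X n n * (row_eps X n s n b - 1)) (mulD X n n * row_phi X n s n b) [?N - 1, ?N] (vD X n s b) (change ?p ?q (vD X n s b))"
      by (rule W[OF o]) (simp_all only: lv m, simp_all)
    moreover have "vD X n s (e_row X n n b) = change ?p ?q (vD X n s b)"
    proof (cases "has_zero X")
      case True
      then have "e_row X n n b = (if b 0 = 0 then change (- int n) 0 b else change 0 (int n) b)" unfolding en by (auto simp: e_last_def has_zero_def)
      moreover have "vD X n s (change (- int n) 0 b) = change ?p ?q (vD X n s b)" "vD X n s (change 0 (int n) b) = change ?p ?q (vD X n s b)"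
        unfolding pq(1) unfolding pq(2) by (rule ext, subst vD_last_zero[OF True], simp, simp add: change_apply)+
      ultimately show ?thesis by simp
    next
      case z: False
      then have "dbl X = 1" "e_row X n n b = change (- int n) (int n) b" using False X unfolding en
        by (cases X; simp add: dbl_def has_zero_def e_last_def)+
      then show ?thesis using vc by simp
    qed
    ultimately show ?thesis unfolding w by simp
  qed
qed

end

section \<open>Node 0 under folding\<close>

context folded_type
begin

lemma zero_eps_fork:
  assumes o: "off X = 0"
  shows "row_eps D1 (n + off X + 1) t 0 (vD X n s b) = mulD X n 0 * row_eps X n s 0 b"
    and "row_phi D1 (n + off X + 1) t 0 (vD X n s b) = mulD X n 0 * row_phi X n s 0 b"
proof -
  have n: "3 \<le> n" by (rule fork_n[OF o])
  have XX: "X \<in> {B1, A2_odd}" using X o by (cases X) (auto simp: off_def)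
  have S: "sh X k = k" for k using o by (simp add: sh_def)
  have v: "vD X n s b k = int (dbl X) * b k" if "k = 1 \<or> k = - 1 \<or> k = 2 \<or> k = - 2" for k
    using vD_sh[of k s b] that n unfolding S by auto
  have dd: "0 < int (dbl X)" using dbl_cases by auto
  have m: "mulD X n 0 = int (dbl X)" using o by (simp add: mulD_def gam_def)
  have E: "row_eps X n s 0 b = b 1 + pos (b 2 - b (- 2))" "row_phi X n s 0 b = b (- 1) + pos (b (- 2) - b 2)"
    using XX by (auto simp: row_eps_def row_phi_def)
  show "row_eps D1 (n + off X + 1) t 0 (vD X n s b) = mulD X n 0 * row_eps X n s 0 b"
    "row_phi D1 (n + off X + 1) t 0 (vD X n s b) = mulD X n 0 * row_phi X n s 0 b"
    unfolding m E distrib_left mul_pos[OF dd] by (simp_all add: row_eps_def row_phi_def v right_diff_distrib)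
qed

lemma zero_walk_fork:
  assumes o: "off X = 0"
  shows "ewalk (n + off X + 1) t (mulD X n 0 * (row_eps X n s 0 b - 1)) (mulD X n 0 * row_phi X n s 0 b) (wordD X n 0) (vD X n s b) (vD X n s (e_row X n 0 b))"
proof -
  have n: "3 \<le> n" by (rule fork_n[OF o])
  have XX: "X \<in> {B1, A2_odd}" using X o by (cases X) (auto simp: off_def)
  have S: "sh X k = k" for k using o by (simp add: sh_def)
  have v: "vD X n s b k = int (dbl X) * b k" if "k = 1 \<or> k = - 1 \<or> k = 2 \<or> k = - 2" for k
    using vD_sh[of k s b] that n unfolding S by auto
  have v': "vD X n s b 1 = int (dbl X) * b 1" "vD X n s b 2 = int (dbl X) * b 2" "vD X n s b (- 1) = int (dbl X) * b (- 1)" "vD X n s b (- 2) = int (dbl X) * b (- 2)"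
    by (rule v; simp)+
  have dd: "0 < int (dbl X)" using dbl_cases by auto
  have m: "mulD X n 0 = int (dbl X)" using o by (simp add: mulD_def gam_def)
  have E: "row_eps X n s 0 b = b 1 + pos (b 2 - b (- 2))" "row_phi X n s 0 b = b (- 1) + pos (b (- 2) - b 2)"
    using XX by (auto simp: row_eps_def row_phi_def)
  have e0: "e_row X n 0 b = (if b 2 > b (- 2) then change 2 (- 1) b else change 1 (- 2) b)"
    using XX by (auto simp: e_row_def e_zero_def)
  have w: "wordD X n 0 = replicate (dbl X) 0" using o by (simp add: wordD_def Let_def)
  have "ewalk (n + off X + 1) t (mulD X n 0 * (row_eps X n s 0 b - 1)) (mulD X n 0 * row_phi X n s 0 b) (replicate (dbl X) 0) (vD X n s b)
    (if b 2 - b (- 2) > 0 then (change 2 (- 1) ^^ dbl X) (vD X n s b) else (change 1 (- 2) ^^ dbl X) (vD X n s b))"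
  proof (rule ewalk_same[OF _ _ _ dbl_cases])
    show "e_row D1 (n + off X + 1) 0 c = (if c (- 2) < c 2 then change 2 (- 1) c else change 1 (- 2) c)" for c
      by (simp add: e_row_def e_zero_def)
    show "row_eps D1 (n + off X + 1) t 0 c = c 1 + pos (c 2 - c (- 2))" "row_phi D1 (n + off X + 1) t 0 c = c (- 1) + pos (c (- 2) - c 2)" for c
      by (simp_all add: row_eps_def row_phi_def)
    show "distinct [2, - 2, - 1, 1 :: int]" by simp
    show "vD X n s b 2 - vD X n s b (- 2) = int (dbl X) * (b 2 - b (- 2))" unfolding v' by (simp add: right_diff_distrib)
    show "mulD X n 0 * (row_eps X n s 0 b - 1) < vD X n s b 1 + pos (vD X n s b 2 - vD X n s b (- 2)) - (int (dbl X) - 1)"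
      unfolding v' m E using dd by (simp add: distrib_left mul_pos right_diff_distrib)
    show "mulD X n 0 * row_phi X n s 0 b \<le> vD X n s b (- 1) + pos (vD X n s b (- 2) - vD X n s b 2)"
      unfolding v' m E using dd by (simp add: distrib_left mul_pos right_diff_distrib)
  qed
  moreover have "vD X n s (change 2 (- 1) b) = (change 2 (- 1) ^^ dbl X) (vD X n s b)" "vD X n s (change 1 (- 2) b) = (change 1 (- 2) ^^ dbl X) (vD X n s b)"
    using vD_change_eq[of 2 "- 1" s b] vD_change_eq[of 1 "- 2" s b] n unfolding S by simp_all
  ultimately show ?thesis unfolding e0 w by (simp split: if_splits)
qed

context
  assumes o: "off X = 1"
begin

lemma virtual_letters: "vD X n s b 1 = gap X n s b" "vD X n s b (- 1) = gap X n s b"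
  "vD X n s b 2 - vD X n s b (- 2) = int (dbl X) * (b 1 - b (- 1))" "vD X n s b (- 2) - vD X n s b 2 = int (dbl X) * (b (- 1) - b 1)"
  "vD X n s b 2 = int (dbl X) * b 1 + (if n = 1 \<and> has_zero X then b 0 else 0)"
  "vD X n s b (- 2) = int (dbl X) * b (- 1) + (if n = 1 \<and> has_zero X then b 0 else 0)"
proof -
  show "vD X n s b 1 = gap X n s b" "vD X n s b (- 1) = gap X n s b" using vD_one o by auto
  have s: "sh X 1 = 2" "sh X (- 1) = - 2" using o by (simp_all add: sh_def)
  show a: "vD X n s b 2 = int (dbl X) * b 1 + (if n = 1 \<and> has_zero X then b 0 else 0)"
    "vD X n s b (- 2) = int (dbl X) * b (- 1) + (if n = 1 \<and> has_zero X then b 0 else 0)"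
    using vD_sh[of 1 s b] vD_sh[of "- 1" s b] nX unfolding s by auto
  show "vD X n s b 2 - vD X n s b (- 2) = int (dbl X) * (b 1 - b (- 1))" "vD X n s b (- 2) - vD X n s b 2 = int (dbl X) * (b (- 1) - b 1)"
    unfolding a by (simp_all add: right_diff_distrib)
qed

lemma zero_X:
  assumes b: "b \<in> KR_rows X n s"
  shows "mulD X n 0 * row_eps X n s 0 b = gap X n s b + pos (int (dbl X) * (b 1 - b (- 1)))"
    and "mulD X n 0 * row_phi X n s 0 b = gap X n s b + pos (int (dbl X) * (b (- 1) - b 1))"
    and "gap X n s b = int (gam X) * int (row_coenergy X n s b)"
proof -
  have sz: "size_ok X s (row_size X n b)" using b by (simp add: KR_rows_def)
  have le: "row_size X n b \<le> int s" by (rule conjunct2[OF row_size_le[OF b]])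
  have h: "2 * ((int s - row_size X n b) div 2) = int s - row_size X n b" if "X = A2_even_dagger"
    using sz that by (simp add: size_ok_def)
  have g: "gap X n s b = int (gam X) * ((int s - row_size X n b) div (if X \<in> {A2_even, D2} then 1 else 2))"
    using h o X by (cases X) (simp_all add: gap_def gam_def off_def)
  have XX: "X \<in> {C1, A2_even, A2_even_dagger, D2}" using o by (auto simp: off_def split: if_splits)
  have p2: "2 * pos a = pos (2 * a)" for a by (simp add: pos_def)
  show "gap X n s b = int (gam X) * int (row_coenergy X n s b)" unfolding g using XX le by (auto simp: row_coenergy_def)
  show "mulD X n 0 * row_eps X n s 0 b = gap X n s b + pos (int (dbl X) * (b 1 - b (- 1)))"
    "mulD X n 0 * row_phi X n s 0 b = gap X n s b + pos (int (dbl X) * (b (- 1) - b 1))"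
    unfolding g using XX by (auto simp: mulD_def row_eps_def row_phi_def gam_def dbl_def off_def pos_def max_def)
qed

lemma zero_eps_virtual:
  assumes b: "b \<in> KR_rows X n s" and j: "j = 0 \<or> j = 1"
  shows "row_eps D1 (n + off X + 1) t j (vD X n s b) = mulD X n 0 * row_eps X n s 0 b"
    and "row_phi D1 (n + off X + 1) t j (vD X n s b) = mulD X n 0 * row_phi X n s 0 b"
proof -
  have N: "1 \<noteq> n + off X + 1" using nX o by simp
  have "row_eps D1 (n + off X + 1) t j c = c 1 + pos (c 2 - c (- 2))" "row_phi D1 (n + off X + 1) t j c = c 1 + pos (c (- 2) - c 2)" if "c 1 = c (- 1)" for c
    using j N that by (auto simp: row_eps_def row_phi_def)
  then show "row_eps D1 (n + off X + 1) t j (vD X n s b) = mulD X n 0 * row_eps X n s 0 b"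
    "row_phi D1 (n + off X + 1) t j (vD X n s b) = mulD X n 0 * row_phi X n s 0 b"
    unfolding zero_X(1,2)[OF b] by (simp_all add: virtual_letters(1-4))
qed

lemma vD_add_one:
  "vD X n s (add_letter 1 a b) l = vD X n s b l + (if l = 2 then int (dbl X) * a else if l = 1 \<or> l = - 1 then gap X n s (add_letter 1 a b) - gap X n s b else 0)"
  "vD X n s (add_letter (- 1) a b) l = vD X n s b l + (if l = - 2 then int (dbl X) * a else if l = 1 \<or> l = - 1 then gap X n s (add_letter (- 1) a b) - gap X n s b else 0)"
  using vD_add[of 1 s a b l] vD_add[of "- 1" s a b l] o by (simp_all add: sh_def)

lemma gap_add:
  assumes "p = 1 \<or> p = - 1"
  shows "gap X n s (add_letter p a b) = (if X = C1 then (int s - row_size X n b - a) div 2 else int s - row_size X n b - a)"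
proof -
  have l: "p \<in> letters X n" using assms nX by (auto simp: letX)
  show ?thesis unfolding gap_def row_size_add[OF l] by (simp add: algebra_simps)
qed

lemma vD_change_one: "vD X n s (change 1 (- 1) b) l = vD X n s b l + int (dbl X) * ((if l = - 2 then 1 else 0) - (if l = 2 then 1 else 0))"
  using vD_change[of 1 "- 1" s b l] nX o by (simp add: sh_def)

lemma zero_walk_virtual:
  assumes b: "b \<in> KR_rows X n s"
  shows "ewalk (n + off X + 1) t (mulD X n 0 * (row_eps X n s 0 b - 1)) (mulD X n 0 * row_phi X n s 0 b) (wordD X n 0) (vD X n s b) (vD X n s (e_row X n 0 b))"
proof -
  let ?w = "vD X n s b" and ?N = "n + off X + 1" and ?e = "mulD X n 0 * (row_eps X n s 0 b - 1)" and ?f = "mulD X n 0 * row_phi X n s 0 b"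
  have w1: "?w 1 = ?w (- 1)" unfolding virtual_letters ..
  have e: "?e = ?w 1 + pos (?w 2 - ?w (- 2)) - int (gam X)" "?f = ?w 1 + pos (?w (- 2) - ?w 2)"
    unfolding right_diff_distrib zero_X(1,2)[OF b] by (simp_all add: virtual_letters(1-4) mulD_def right_diff_distrib)
  have E0: "e_row X n 0 b = e_zero X n b" by (simp add: e_row_def)
  note W = ewalk_zero[OF N3]
  note d = virtual_letters(3)[of s b]
  show ?thesis
  proof (cases "X = A2_even_dagger")
    case False
    have g: "gam X = 1" using False o by (simp add: gam_def)
    have wd: "wordD X n 0 = [0, 1]" using False o by (simp add: wordD_def Let_def)
    have "ewalk ?N t ?e ?f [0, 1] ?w (zero_pass ?w)" by (rule W[OF w1]) (simp_all add: e g)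
    moreover have "zero_pass ?w = vD X n s (e_row X n 0 b)"
    proof (cases "X = C1")
      case True
      then have d1: "dbl X = 1" by (simp add: dbl_def)
      have ga: "gap X n s (add_letter 1 (- 2) b) = gap X n s b + 1" "gap X n s (add_letter (- 1) 2 b) = gap X n s b - 1"
        unfolding gap_add[of 1, simplified] gap_add[of "- 1", simplified] using True by (simp_all add: gap_def)
      have e0: "e_zero X n b = (if b 1 \<ge> b (- 1) + 2 then add_letter 1 (- 2) b else if b 1 = b (- 1) + 1 then change 1 (- 1) b else add_letter (- 1) 2 b)"
        using True by (auto simp: e_zero_def)
      show ?thesis unfolding E0 e0 using d
        by (auto simp: fun_eq_iff zero_pass_def d1 vD_add_one vD_change_one ga change_apply)
    next
      case c: False
      then have XX: "X = A2_even \<or> X = D2" using False o by (auto simp: off_def split: if_splits)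
      then have d1: "dbl X = 2" by (auto simp: dbl_def)
      have ga: "gap X n s (add_letter 1 (- 1) b) = gap X n s b + 1" "gap X n s (add_letter (- 1) 1 b) = gap X n s b - 1"
        unfolding gap_add[of 1, simplified] gap_add[of "- 1", simplified] using c by (simp_all add: gap_def)
      have e0: "e_zero X n b = (if b 1 > b (- 1) then add_letter 1 (- 1) b else add_letter (- 1) 1 b)" using XX by (auto simp: e_zero_def)
      \<comment> \<open>Parity rules out the middle branch of \<open>zero_pass\<close>.\<close>
      have "2 * b 1 - 2 * b (- 1) \<noteq> 1" by presburger
      then show ?thesis unfolding E0 e0 using d
        by (auto simp: fun_eq_iff zero_pass_def d1 vD_add_one ga change_apply)
    qed
    ultimately show ?thesis unfolding wd by simp
  next
    case True
    have g: "gam X = 2" "dbl X = 2" using True o by (simp_all add: gam_def dbl_def)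
    have wd: "wordD X n 0 = [0, 1] @ [0, 1]" using True o by (simp add: wordD_def Let_def)
    have p1: "zero_pass ?w 1 = zero_pass ?w (- 1)" "zero_pass ?w 1 + pos (zero_pass ?w 2 - zero_pass ?w (- 2)) = ?w 1 + pos (?w 2 - ?w (- 2)) - 1"
      "zero_pass ?w 1 + pos (zero_pass ?w (- 2) - zero_pass ?w 2) \<ge> ?w 1 + pos (?w (- 2) - ?w 2)"
      using w1 by (auto simp: zero_pass_def change_apply pos_def)
    have "ewalk ?N t ?e ?f [0, 1] ?w (zero_pass ?w)" by (rule W[OF w1]) (simp_all add: e g)
    moreover have "ewalk ?N t ?e ?f [0, 1] (zero_pass ?w) (zero_pass (zero_pass ?w))"
      by (rule W[OF p1(1)]) (use p1(2,3) in \<open>simp_all add: e g\<close>)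
    ultimately have "ewalk ?N t ?e ?f (wordD X n 0) ?w (zero_pass (zero_pass ?w))" unfolding wd by (rule ewalk_append)
    moreover have "zero_pass (zero_pass ?w) = vD X n s (e_row X n 0 b)"
    proof -
      have ga: "gap X n s (add_letter 1 (- 2) b) = gap X n s b + 2" "gap X n s (add_letter (- 1) 2 b) = gap X n s b - 2"
        unfolding gap_add[of 1, simplified] gap_add[of "- 1", simplified] using True by (simp_all add: gap_def)
      have e0: "e_zero X n b = (if b 1 \<ge> b (- 1) + 2 then add_letter 1 (- 2) b else if b 1 = b (- 1) + 1 then change 1 (- 1) b else add_letter (- 1) 2 b)"
        using True by (auto simp: e_zero_def)
      \<comment> \<open>Doubled letters differ by an even number, before and after the first
        passage, so the middle branch of \<open>zero_pass\<close> occurs in neither.\<close>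
      have z: "zero_pass c = (if c 2 - c (- 2) > 1 then change 2 1 (change 2 (- 1) c) else change (- 1) (- 2) (change 1 (- 2) c))"
        if "even (c 2 - c (- 2))" for c using that by (auto simp: zero_pass_def)
      have ev: "even (?w 2 - ?w (- 2))" unfolding d g by simp
      then have ev2: "even (zero_pass ?w 2 - zero_pass ?w (- 2))" unfolding z[OF ev] by (simp add: change_apply)
      consider "b 1 \<ge> b (- 1) + 2" | "b 1 = b (- 1) + 1" | "b 1 \<le> b (- 1)" by linarith
      then show ?thesis unfolding z[OF ev2] unfolding z[OF ev] E0 e0 using d
        by cases (auto simp: fun_eq_iff g vD_add_one vD_change_one ga change_apply)
    qed
    ultimately show ?thesis by simp
  qed
qed

end

lemma off_cases: "off X = 0 \<or> off X = 1" by (simp add: off_def)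

lemma word_letters: "j \<in> set (wordD X n i) \<Longrightarrow> i \<le> n \<Longrightarrow>
    i = 0 \<and> off X = 0 \<and> j = 0 \<or> i = 0 \<and> off X = 1 \<and> (j = 0 \<or> j = 1) \<or> i = n \<and> (j = n + off X \<or> j = n + off X + 1) \<or>
    1 \<le> i \<and> i < n \<and> j = i + off X"
  using off_cases by (auto simp: wordD_def Let_def split: if_splits)

sublocale D_embedding X n "n + off X + 1" "dbl X" "vD X n" "wordD X n" "mulD X n" "gam X" "int (off X) + 1"
proof
  show "good_rank X n" by (rule grk)
  show "3 \<le> n + off X + 1" by (rule N3)
  show "0 < gam X" "0 < dbl X" by (simp_all add: gam_def dbl_def)
  show "int (off X) + 1 = 1 \<or> int (off X) + 1 = 2" using off_cases by auto
  show "vD X n s b \<in> KR_rows D1 (n + off X + 1) (dbl X * s)" if "b \<in> KR_rows X n s" for b s by (rule vD_in[OF that])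
  show "vD X n s (power_row 1 s) = power_row (int (off X) + 1) (dbl X * s)" for s by (rule vD_u)
  show "wordD X n i \<noteq> []" for i by (simp add: wordD_def Let_def dbl_def)
  show "count_list (wordD X n 0) 0 = gam X" using off_cases by (auto simp: wordD_def Let_def gam_def dbl_def numeral_2_eq_2)
  show "0 < mulD X n i" for i by (simp add: mulD_def gam_def dbl_def)
  show "0 \<notin> set (wordD X n i)" if "1 \<le> i" "i \<le> n" for i using word_letters[of 0 i] that nX by auto
  fix i j s b assume i: "i \<le> n" and b: "b \<in> KR_rows X n s"
  have "ewalk (n + off X + 1) (dbl X * s) (mulD X n i * (row_eps X n s i b - 1)) (mulD X n i * row_phi X n s i b) (wordD X n i) (vD X n s b) (vD X n s (e_row X n i b))"
    if "0 < row_eps X n s i b"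
  proof -
    consider "i = 0" "off X = 0" | "i = 0" "off X = 1" | "i = n" | "1 \<le> i" "i < n" using i off_cases by linarith
    then show ?thesis
    proof cases
      case 1
      show ?thesis unfolding 1(1) by (rule zero_walk_fork[OF 1(2)])
    next
      case 2
      show ?thesis unfolding 2(1) by (rule zero_walk_virtual[OF 2(2) b])
    next
      case 3
      show ?thesis unfolding 3 by (rule last_walk)
    next
      case 4
      show ?thesis unfolding mid_word(2)[OF 4] by (rule mid_walk[OF 4])
    qed
  qed
  then show "0 < row_eps X n s i b \<Longrightarrow> ewalk (n + off X + 1) (dbl X * s) (mulD X n i * (row_eps X n s i b - 1)) (mulD X n i * row_phi X n s i b) (wordD X n i) (vD X n s b) (vD X n s (e_row X n i b))" .
  assume j: "j \<in> set (wordD X n i)"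
  consider "i = 0" "off X = 0" "j = 0" | "i = 0" "off X = 1" "j = 0 \<or> j = 1" | "i = n" "j = n + off X \<or> j = n + off X + 1" | "1 \<le> i" "i < n" "j = i + off X"
    using word_letters[OF j i] by argo
  then show "row_eps D1 (n + off X + 1) (dbl X * s) j (vD X n s b) = mulD X n i * row_eps X n s i b"
    "row_phi D1 (n + off X + 1) (dbl X * s) j (vD X n s b) = mulD X n i * row_phi X n s i b"
    using zero_eps_fork zero_eps_virtual[OF _ b] last_D mid_eps mid_word(2) by (cases; metis)+
next
  fix i j assume "i \<le> n" "j \<in> set (wordD X n i)"
  then show "j \<le> n + off X + 1" using word_letters[of j i] by auto
qed

lemma pad_v:
  assumes y: "y \<in> KR_rows X n t"
  shows "vD X n (t + c) (add_letter (- 1) (int c) y) = add_letter (- (int (off X) + 1)) (int (dbl X * c)) (vD X n t y)"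
proof
  fix l
  have l1: "- 1 \<in> letters X n" using nX by (auto simp: letX)
  have g: "gap X n (t + c) (add_letter (- 1) (int c) y) = gap X n t y" unfolding gap_def row_size_add[OF l1] by simp
  have m: "- (int (off X) + 1) = sh X (- 1)" by (simp add: sh_def)
  show "vD X n (t + c) (add_letter (- 1) (int c) y) l = add_letter (- (int (off X) + 1)) (int (dbl X * c)) (vD X n t y) l"
    unfolding m
  proof (cases l rule: letter_cases)
    case out
    then show "vD X n (t + c) (add_letter (- 1) (int c) y) l = add_letter (sh X (- 1)) (int (dbl X * c)) (vD X n t y) l"
      using vD_out[OF out] sh_in[of "- 1"] sh_not[of "- 1"] nX by (auto simp: add_letter_apply)
  next
    case one
    then show "vD X n (t + c) (add_letter (- 1) (int c) y) l = add_letter (sh X (- 1)) (int (dbl X * c)) (vD X n t y) l"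
      using sh_not[of "- 1"] by (simp add: vD_one g add_letter_apply)
  next
    case mone
    then show "vD X n (t + c) (add_letter (- 1) (int c) y) l = add_letter (sh X (- 1)) (int (dbl X * c)) (vD X n t y) l"
      using sh_not[of "- 1"] by (simp add: vD_one g add_letter_apply)
  next
    case (sh k)
    then have "k \<noteq> 0" by auto
    then show "vD X n (t + c) (add_letter (- 1) (int c) y) l = add_letter (sh X (- 1)) (int (dbl X * c)) (vD X n t y) l"
      using sh by (auto simp: vD_sh[OF sh(2,3)] sh_eq add_letter_apply algebra_simps)
  qed
qed

text \<open>In \<open>A2_even_dagger\<close> of rank 1 a letter 0 adds one virtual letter to those
  that come from \<open>-1\<close>; this is the slack in the upper bound.\<close>

lemma low_v:
  "y \<in> KR_rows X n t \<Longrightarrow> int (dbl X) * y (- 1) \<le> vD X n t y (- (int (off X) + 1)) \<and> vD X n t y (- (int (off X) + 1)) < int (dbl X) * (y (- 1) + 1)"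
proof -
  assume y: "y \<in> KR_rows X n t"
  have m: "- (int (off X) + 1) = sh X (- 1)" by (simp add: sh_def)
  have "has_zero X \<Longrightarrow> 0 \<le> y 0 \<and> y 0 \<le> 1" using y by (auto simp: has_zero_def KR_rows_def)
  moreover have "0 < dbl X" using dbl_cases by auto
  ultimately show ?thesis unfolding m using vD_sh[of "- 1" t y] nX dbl_zero by (auto simp: distrib_left)
qed

sublocale D_padding X n "n + off X + 1" "dbl X" "vD X n" "wordD X n" "mulD X n" "gam X" "int (off X) + 1"
proof
  show "X \<noteq> A1" by (rule X)
  fix y t assume y: "y \<in> KR_rows X n t"
  show "vD X n (t + c) (add_letter (- 1) (int c) y) = add_letter (- (int (off X) + 1)) (int (dbl X * c)) (vD X n t y)" for c
    by (rule pad_v[OF y])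
  show "int (dbl X) * y (- 1) \<le> vD X n t y (- (int (off X) + 1)) \<and> vD X n t y (- (int (off X) + 1)) < int (dbl X) * (y (- 1) + 1)"
    by (rule low_v[OF y])
  assume "int (off X) + 1 = 2"
  then have o: "off X = 1" by simp
  show "vD X n t y 1 = vD X n t y (- 1) \<and> vD X n t y 1 = int (gam X) * int (row_coenergy X n t y)"
    unfolding virtual_letters(1,2)[OF o] using zero_X(3)[OF o y] by simp
next
  fix t y assume "int (off X) + 1 = 1"
  then have "off X = 0" by simp
  then have "X \<in> {A1, B1, D1, A2_odd}" by (cases X) (auto simp: off_def)
  then show "row_coenergy X n t y = 0" by (simp add: row_coenergy_def)
qed

end

text \<open>Type D is embedded into itself with all scales 1 and one-letter words.\<close>

lemma D_padding_D1:
  assumes "3 \<le> n" shows "D_padding D1 n n 1 (\<lambda>s b. b) (\<lambda>i. [i]) (\<lambda>_. 1) 1 1"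
proof unfold_locales
  show "good_rank D1 n" using assms by (simp add: good_rank_def)
  then have g: "good_rank D1 n" .
  show "ewalk n (1 * s) (1 * (row_eps D1 n s i b - 1)) (1 * row_phi D1 n s i b) [i] b (e_row D1 n i b)" for s i b by simp
qed (use assms in \<open>auto simp: row_coenergy_def\<close>)

section \<open>Type A\<close>

definition psum :: "row \<Rightarrow> int \<Rightarrow> int" where "psum x k = (\<Sum>l\<in>{1..k}. x l)"
definition diff_sum :: "row \<Rightarrow> row \<Rightarrow> int \<Rightarrow> int" where "diff_sum x y k = psum y (k - 1) - psum x k"
text \<open>For rows \<open>x\<close> and \<open>y\<close> of lengths \<open>s\<close> and
  \<open>t\<close>, up to the summand \<open>s + psum y j - psum x j\<close>, this is the minimum
  over \<open>k\<close> of the letters of \<open>y\<close> minus those of \<open>x\<close>, summed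
  cyclically from \<open>j + 1\<close> to \<open>k\<close>, with the letters \<open>k\<close>
  counted for \<open>x\<close> only. The replacement of \<open>s\<close> by \<open>t\<close>
  accounts for the wrap-around.\<close>

definition cut :: "nat \<Rightarrow> int \<Rightarrow> int \<Rightarrow> row \<Rightarrow> row \<Rightarrow> int \<Rightarrow> int" where
  "cut n s t x y j = Min ((\<lambda>k. diff_sum x y k + (if j < k then s else t)) ` {1..int n + 1})"
definition swap_A :: "nat \<Rightarrow> int \<Rightarrow> int \<Rightarrow> row \<times> row \<Rightarrow> row \<times> row" where
  "swap_A n s t = (\<lambda>(x, y).
     (\<lambda>l. if l \<in> {1..int n + 1} then x l + cut n s t x y l - cut n s t x y (l - 1) else 0,
      \<lambda>l. if l \<in> {1..int n + 1} then y l + cut n s t x y (l - 1) - cut n s t x y l else 0))"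

lemma psum_Suc: "1 \<le> k \<Longrightarrow> psum x k = psum x (k - 1) + x k"
proof -
  assume "1 \<le> k"
  then have "{1..k} = insert k {1..k - 1}" by auto
  then show ?thesis by (simp add: psum_def)
qed

lemma psum_0 [simp]: "psum x 0 = 0" by (simp add: psum_def)

lemma psum_change: "psum (change p q x) k = psum x k + (if 1 \<le> q \<and> q \<le> k then 1 else 0) - (if 1 \<le> p \<and> p \<le> k then 1 else 0)"
proof -
  have "psum (change p q x) k = (\<Sum>l\<in>{1..k}. x l + (if l = q then 1 else 0) - (if l = p then 1 else 0))"
    by (simp add: psum_def change_apply)
  then show ?thesis by (simp add: sum.distrib sum_subtractf psum_def)
qed

lemma diff_sum_change:
  "diff_sum (change p q x) y k = diff_sum x y k + (if 1 \<le> p \<and> p \<le> k then 1 else 0) - (if 1 \<le> q \<and> q \<le> k then 1 else 0)"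
  "diff_sum x (change p q y) k = diff_sum x y k + (if 1 \<le> q \<and> q < k then 1 else 0) - (if 1 \<le> p \<and> p < k then 1 else 0)"
  by (auto simp: diff_sum_def psum_change)

definition mn :: "int \<Rightarrow> (int \<Rightarrow> int) \<Rightarrow> int set \<Rightarrow> int" where "mn K h A = Min (insert K (h ` A))"

text \<open>The bound \<open>K\<close> keeps the minimum over the remaining indices meaningful when there are none.\<close>

lemma Min_split:
  assumes A: "finite A" "u \<in> A" "v \<in> A" and K: "h u \<le> K"
  shows "Min (h ` A) = min (mn K h (A - {u, v})) (min (h u) (h v))"
proof (rule Min_eqI)
  show "finite (h ` A)" using A by simp
  have f: "finite (insert K (h ` (A - {u, v})))" using A by simp
  show "min (mn K h (A - {u, v})) (min (h u) (h v)) \<le> y" if "y \<in> h ` A" for y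
  proof -
    obtain k where k: "k \<in> A" "y = h k" using \<open>y \<in> h ` A\<close> by auto
    show ?thesis
    proof (cases "k = u \<or> k = v")
      case False
      then have "mn K h (A - {u, v}) \<le> y" unfolding mn_def using f k by (intro Min_le) auto
      then show ?thesis by simp
    qed (use k in auto)
  qed
  have "mn K h (A - {u, v}) \<in> insert K (h ` (A - {u, v}))" unfolding mn_def using f by (intro Min_in) auto
  then consider "mn K h (A - {u, v}) = K" | "mn K h (A - {u, v}) \<in> h ` A" by auto
  then show "min (mn K h (A - {u, v})) (min (h u) (h v)) \<in> h ` A"
    by cases (use A K in \<open>auto simp: min_def\<close>)
qed

lemma mn_shift: "finite A \<Longrightarrow> (\<And>k. k \<in> A \<Longrightarrow> h' k = h k + c) \<Longrightarrow> mn (K + c) h' A = mn K h A + c"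
proof -
  assume A: "finite A" and h: "\<And>k. k \<in> A \<Longrightarrow> h' k = h k + c"
  have "insert (K + c) (h' ` A) = (\<lambda>x. x + c) ` insert K (h ` A)" using h by force
  moreover have "Min ((\<lambda>x. x + c) ` insert K (h ` A)) = Min (insert K (h ` A)) + c"
    by (rule mono_Min_commute[symmetric]) (use A in \<open>auto simp: mono_def\<close>)
  ultimately show ?thesis unfolding mn_def by simp
qed

lemma mn_cong: "(\<And>k. k \<in> A \<Longrightarrow> h' k = h k) \<Longrightarrow> mn K h' A = mn K h A"
proof -
  assume "\<And>k. k \<in> A \<Longrightarrow> h' k = h k"
  then have "h' ` A = h ` A" by (rule image_cong[OF refl])
  then show ?thesis by (simp add: mn_def)
qed

text \<open>Isolates the two indices at which a move can alter the comparison; the minimum over all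
  others enters as a single number.\<close>

lemma cut_split:
  assumes "1 \<le> u" "u < v" "v \<le> int n + 1" "diff_sum x y u + \<bar>s\<bar> + \<bar>t\<bar> \<le> K"
  shows "cut n s t x y j = min (mn K (\<lambda>k. diff_sum x y k + (if j < k then s else t)) ({1..int n + 1} - {u, v}))
    (min (diff_sum x y u + (if j < u then s else t)) (diff_sum x y v + (if j < v then s else t)))"
  unfolding cut_def by (rule Min_split) (use assms in auto)

lemma cut_le: "1 \<le> k \<Longrightarrow> k \<le> int n + 1 \<Longrightarrow> cut n s t x y j \<le> diff_sum x y k + (if j < k then s else t)"
  unfolding cut_def by (rule Min_le) auto

lemma cut_attained:
  obtains k where "1 \<le> k" "k \<le> int n + 1" "cut n s t x y j = diff_sum x y k + (if j < k then s else t)"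
proof -
  have "cut n s t x y j \<in> (\<lambda>k. diff_sum x y k + (if j < k then s else t)) ` {1..int n + 1}"
    unfolding cut_def by (rule Min_in) auto
  then show ?thesis using that by auto
qed

text \<open>At \<open>j = 0\<close> every term carries \<open>s\<close>, at \<open>j = n + 1\<close>
  every term carries \<open>t\<close>.\<close>

lemma cut_ends: "cut n s t x y (int n + 1) = cut n s t x y 0 + t - s"
proof -
  obtain k where k: "1 \<le> k" "k \<le> int n + 1" "cut n s t x y 0 = diff_sum x y k + (if 0 < k then s else t)" by (rule cut_attained)
  obtain k' where k': "1 \<le> k'" "k' \<le> int n + 1" "cut n s t x y (int n + 1) = diff_sum x y k' + (if int n + 1 < k' then s else t)" by (rule cut_attained)
  show ?thesis using k k' cut_le[OF k(1,2), of s t x y "int n + 1"] cut_le[OF k'(1,2), of s t x y 0] by simp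
qed

text \<open>In type A \<open>e_i\<close> replaces the letter \<open>src i\<close> by
  \<open>dst n i\<close>. Reading the letters cyclically puts node 0 on a par with the
  others.\<close>

definition src :: "nat \<Rightarrow> int" where "src i = int i + 1"
definition dst :: "nat \<Rightarrow> nat \<Rightarrow> int" where "dst n i = (if i = 0 then int n + 1 else int i)"

lemma A1_node:
  assumes "i \<le> n"
  shows "e_row A1 n i b = change (src i) (dst n i) b" "row_eps A1 n s i b = b (src i)" "row_phi A1 n s i b = b (dst n i)"
  using assms by (auto simp: src_def dst_def e_row_def e_zero_def e_last_def e_mid_def row_eps_def row_phi_def)

context
  fixes n s t :: nat and x y :: row
  assumes n: "1 \<le> n" and x: "x \<in> KR_rows A1 n s" and y: "y \<in> KR_rows A1 n t"
begin

abbreviation "C \<equiv> cut n (int s) (int t) x y"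
abbreviation "G \<equiv> diff_sum x y"

lemma psum_row:
  assumes "b \<in> KR_rows A1 n m"
  shows "psum b (int n + 1) = int m" "0 \<le> psum b k" "k \<le> int n + 1 \<Longrightarrow> psum b k \<le> int m" "0 \<le> b l"
proof -
  have nn: "0 \<le> b l" for l using assms by (simp add: KR_rows_def)
  show "0 \<le> b l" by (rule nn)
  show e: "psum b (int n + 1) = int m" using assms by (simp add: KR_rows_def psum_def row_size_def letters_def size_ok_def)
  show "0 \<le> psum b k" unfolding psum_def by (rule sum_nonneg) (rule nn)
  assume "k \<le> int n + 1"
  then have "psum b k \<le> psum b (int n + 1)" unfolding psum_def by (intro sum_mono2) (auto simp: nn)
  then show "psum b k \<le> int m" using e by simp
qed

lemma G_Suc: "1 \<le> k \<Longrightarrow> G (k + 1) = G k + y k - x (k + 1)"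
  unfolding diff_sum_def using psum_Suc[of k y] psum_Suc[of "k + 1" x] by simp

lemma G_ends: "G 1 = - x 1" "G (int n + 1) = int t - y (int n + 1) - int s"
  unfolding diff_sum_def using psum_Suc[of 1 x] psum_Suc[of "int n + 1" y] psum_row(1)[OF x] psum_row(1)[OF y] by simp_all

lemma C_nonneg: "0 \<le> C 0"
proof -
  obtain k where k: "1 \<le> k" "k \<le> int n + 1" "C 0 = G k + (if 0 < k then int s else int t)" by (rule cut_attained)
  then show ?thesis using psum_row(2)[OF y, of "k - 1"] psum_row(3)[OF x k(2)] by (simp add: diff_sum_def)
qed

text \<open>From \<open>l - 1\<close> to \<open>l\<close> only the term \<open>k = l\<close> of the
  minimum changes, from \<open>s\<close> to \<open>t\<close>. If this term attains the minimum, a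
  cyclically neighbouring index provides the bound.\<close>

lemma swap_A_nonneg:
  assumes l: "1 \<le> l" "l \<le> int n + 1"
  shows "0 \<le> x l + C l - C (l - 1)" "0 \<le> y l + C (l - 1) - C l"
proof -
  note nx = psum_row(4)[OF x, of l] and ny = psum_row(4)[OF y, of l]
  obtain k where k: "1 \<le> k" "k \<le> int n + 1" "C l = G k + (if l < k then int s else int t)" by (rule cut_attained)
  show "0 \<le> x l + C l - C (l - 1)"
  proof (cases "k = l")
    case False
    then show ?thesis using cut_le[OF k(1,2), of "int s" "int t" x y "l - 1"] k(3) nx by auto
  next
    case True
    then have e: "C l = G l + int t" using k by simp
    show ?thesis
    proof (cases "l = 1")
      case True
      have "C 0 \<le> G (int n + 1) + int s" using cut_le[of "int n + 1" n "int s" "int t" x y 0] by simp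
      then show ?thesis using True e G_ends psum_row(4)[OF y, of "int n + 1"] by simp
    next
      case False
      then have "C (l - 1) \<le> G (l - 1) + int t" using cut_le[of "l - 1" n "int s" "int t" x y "l - 1"] l by simp
      moreover have "G l = G (l - 1) + y (l - 1) - x l" using G_Suc[of "l - 1"] l False by simp
      ultimately show ?thesis using e psum_row(4)[OF y, of "l - 1"] by simp
    qed
  qed
  obtain k where k: "1 \<le> k" "k \<le> int n + 1" "C (l - 1) = G k + (if l - 1 < k then int s else int t)" by (rule cut_attained)
  show "0 \<le> y l + C (l - 1) - C l"
  proof (cases "k = l")
    case False
    then show ?thesis using cut_le[OF k(1,2), of "int s" "int t" x y l] k(3) ny by auto
  next
    case True
    then have e: "C (l - 1) = G l + int s" using k by simp
    show ?thesis
    proof (cases "l = int n + 1")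
      case True
      have "C l \<le> G 1 + int t" using cut_le[of 1 n "int s" "int t" x y l] True n by simp
      then show ?thesis using True e G_ends psum_row(4)[OF x, of 1] by simp
    next
      case False
      then have "C l \<le> G (l + 1) + int s" using cut_le[of "l + 1" n "int s" "int t" x y l] l by simp
      moreover have "G (l + 1) = G l + y l - x (l + 1)" using G_Suc[of l] l by simp
      ultimately show ?thesis using e psum_row(4)[OF x, of "l + 1"] by simp
    qed
  qed
qed

lemma swap_A_in:
  assumes "swap_A n (int s) (int t) (x, y) = (u, v)"
  shows "u \<in> KR_rows A1 n t" "v \<in> KR_rows A1 n s"
proof -
  have uv: "u = (\<lambda>l. if l \<in> {1..int n + 1} then x l + C l - C (l - 1) else 0)" "v = (\<lambda>l. if l \<in> {1..int n + 1} then y l + C (l - 1) - C l else 0)"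
    using assms by (simp_all add: swap_A_def)
  have T: "(\<Sum>l\<in>{1..int m}. C l - C (l - 1)) = C (int m) - C 0" for m
  proof (induction m)
    case (Suc m)
    have "{1..int (Suc m)} = insert (int m + 1) {1..int m}" by auto
    then show ?case using Suc by (simp add: add.commute)
  qed simp
  have T1: "(\<Sum>l\<in>{1..int n + 1}. C l - C (l - 1)) = int t - int s"
    using T[of "Suc n"] cut_ends[of n "int s" "int t" x y] by (simp add: add.commute)
  have "row_size A1 n u = (\<Sum>l\<in>{1..int n + 1}. x l + (C l - C (l - 1)))" by (simp add: row_size_def letters_def uv add_diff_eq)
  also have "\<dots> = int t" using T1 psum_row(1)[OF x] by (simp add: sum.distrib psum_def)
  finally show "u \<in> KR_rows A1 n t" using swap_A_nonneg(1) unfolding KR_rows_def by (auto simp: uv letters_def size_ok_def)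
  have "row_size A1 n v = (\<Sum>l\<in>{1..int n + 1}. y l - (C l - C (l - 1)))" by (simp add: row_size_def letters_def uv diff_diff_eq2)
  also have "\<dots> = int s" using T1 psum_row(1)[OF y] by (simp add: sum_subtractf psum_def)
  finally show "v \<in> KR_rows A1 n s" using swap_A_nonneg(2) unfolding KR_rows_def by (auto simp: uv letters_def size_ok_def)
qed

end

section \<open>The type A map commutes with all raising operators\<close>

lemma cut_mid_left:
  fixes s t a b O1 :: int
  \<comment> \<open>Here \<open>a\<close> and \<open>b\<close> are the values of
    \<open>diff_sum\<close> at \<open>i\<close> and \<open>i + 1\<close>, \<open>O1\<close> is the
    minimum over the other indices, and \<open>Mm\<close>, \<open>M\<close>, \<open>Mp\<close> are
    the cuts at \<open>i - 1\<close>, \<open>i\<close>, \<open>i + 1\<close>.\<close>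
  assumes "b < a"
  defines "Mm \<equiv> min O1 (min (a + s) (b + s))" and "Mp \<equiv> min O1 (min (a + t) (b + t))" and "M \<equiv> min O1 (min (a + t) (b + s))"
  shows "min O1 (min (a - 1 + t) (b + s)) = M - (if 0 < a - b + Mp - Mm then 0 else 1)"
    and "min O1 (min (a - 1 + s) (b + s)) = Mm" "min O1 (min (a - 1 + t) (b + t)) = Mp"
  using assms by (auto simp: min_def)

lemma cut_mid_right:
  fixes s t a b O1 :: int
  assumes "a \<le> b"
  defines "Mm \<equiv> min O1 (min (a + s) (b + s))" and "Mp \<equiv> min O1 (min (a + t) (b + t))" and "M \<equiv> min O1 (min (a + t) (b + s))"
  shows "min O1 (min (a + t) (b + 1 + s)) = M + (if 0 < a - b + Mp - Mm then 1 else 0)"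
    and "min O1 (min (a + s) (b + 1 + s)) = Mm" "min O1 (min (a + t) (b + 1 + t)) = Mp"
  using assms by (auto simp: min_def)

lemma cut_mid_eps:
  fixes s t a b O1 :: int
  defines "Mm \<equiv> min O1 (min (a + s) (b + s))" and "Mp \<equiv> min O1 (min (a + t) (b + t))" and "M \<equiv> min O1 (min (a + t) (b + s))"
  shows "M - Mp + pos (a - b + Mp - Mm) = pos (a - b)" "M - Mm + pos (b - a + Mm - Mp) = pos (b - a)"
  unfolding Mm_def Mp_def M_def by (auto simp: min_def max_def pos_def)

text \<open>The analogue at node 0: \<open>a\<close> and \<open>b\<close> are the values at
  \<open>1\<close> and \<open>n + 1\<close>, while \<open>M + s\<close>, \<open>M1\<close> and
  \<open>Mn\<close> are the cuts at \<open>0\<close>, \<open>1\<close> and \<open>n\<close>.\<close>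

lemma cut_zero:
  fixes s t a b O1 :: int
  defines "M1 \<equiv> min (O1 + s) (min (a + t) (b + s))" and "Mn \<equiv> min (O1 + t) (min (a + t) (b + s))" and "M \<equiv> min O1 (min a b)"
  shows "M + s - M1 + pos (b - a + M1 - Mn) = pos (b - a - t + s)" "M + t - Mn + pos (a - b + Mn - M1) = pos (a - b + t - s)"
    and "0 < b - a - t + s \<Longrightarrow> min (O1 + 1) (min (a + 1) b) = M + (if 0 < b - a + M1 - Mn then 1 else 0)"
    and "b - a - t + s \<le> 0 \<Longrightarrow> min (O1 - 1) (min a (b - 1)) = M - (if 0 < b - a + M1 - Mn then 0 else 1)"
  unfolding M1_def Mn_def M_def by (auto simp: min_def max_def pos_def)

context
  fixes n s t :: nat and x y u v :: row
  assumes n: "1 \<le> n" and x: "x \<in> KR_rows A1 n s" and y: "y \<in> KR_rows A1 n t"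
    and uv: "swap_A n (int s) (int t) (x, y) = (u, v)"
begin

abbreviation "Ct \<equiv> cut n (int s) (int t) x y"
abbreviation "Gt \<equiv> diff_sum x y"

lemma u_eq: "u l = (if l \<in> {1..int n + 1} then x l + Ct l - Ct (l - 1) else 0)"
  and v_eq: "v l = (if l \<in> {1..int n + 1} then y l + Ct (l - 1) - Ct l else 0)"
  using uv by (auto simp: swap_A_def)

context
  fixes i :: nat assumes i: "1 \<le> i" "i \<le> n"
begin

text \<open>Every index other than \<open>i\<close> and \<open>i + 1\<close> lies on the same side
  of all three cut positions. \<open>K\<close> leaves room for a unit change, so the same bound
  serves before and after a move.\<close>

lemma mid_levels:
  fixes K :: int
  assumes K: "K = \<bar>Gt (int i)\<bar> + int s + int t + 2"
  defines "O1 \<equiv> mn K (\<lambda>k. Gt k + (if int i < k then int s else int t)) ({1..int n + 1} - {int i, int i + 1})"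
  shows "Ct (int i - 1) = min O1 (min (Gt (int i) + int s) (Gt (int i + 1) + int s))"
    and "Ct (int i) = min O1 (min (Gt (int i) + int t) (Gt (int i + 1) + int s))"
    and "Ct (int i + 1) = min O1 (min (Gt (int i) + int t) (Gt (int i + 1) + int t))"
proof -
  have c: "mn K (\<lambda>k. Gt k + (if j < k then int s else int t)) ({1..int n + 1} - {int i, int i + 1}) = O1"
    if "j = int i - 1 \<or> j = int i \<or> j = int i + 1" for j
    unfolding O1_def by (rule mn_cong) (use that in auto)
  have sp: "Ct j = min (mn K (\<lambda>k. Gt k + (if j < k then int s else int t)) ({1..int n + 1} - {int i, int i + 1}))
    (min (Gt (int i) + (if j < int i then int s else int t)) (Gt (int i + 1) + (if j < int i + 1 then int s else int t)))" for j
    by (rule cut_split) (use i K in auto)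
  show "Ct (int i - 1) = min O1 (min (Gt (int i) + int s) (Gt (int i + 1) + int s))"
    "Ct (int i) = min O1 (min (Gt (int i) + int t) (Gt (int i + 1) + int s))"
    "Ct (int i + 1) = min O1 (min (Gt (int i) + int t) (Gt (int i + 1) + int t))"
    unfolding sp by (simp_all add: c)
qed

lemma mid_diff: "Gt (int i) - Gt (int i + 1) = x (int i + 1) - y (int i)"
  using G_Suc[OF n x y, of "int i"] i by simp

lemma mid_new: "u (int i + 1) - v (int i) = Gt (int i) - Gt (int i + 1) + Ct (int i + 1) - Ct (int i - 1)"
  "v (int i) - u (int i + 1) = Gt (int i + 1) - Gt (int i) + Ct (int i - 1) - Ct (int i + 1)"
  "v (int i + 1) = y (int i + 1) + Ct (int i) - Ct (int i + 1)" "u (int i) = x (int i) + Ct (int i) - Ct (int i - 1)"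
  "v (int i) < u (int i + 1) \<longleftrightarrow> 0 < Gt (int i) - Gt (int i + 1) + Ct (int i + 1) - Ct (int i - 1)"
  using i mid_diff by (auto simp: u_eq v_eq)

lemma mid_string:
  "v (int i + 1) + pos (u (int i + 1) - v (int i)) = y (int i + 1) + pos (x (int i + 1) - y (int i))"
  "u (int i) + pos (v (int i) - u (int i + 1)) = x (int i) + pos (y (int i) - x (int i + 1))"
proof -
  have d: "y (int i) - x (int i + 1) = Gt (int i + 1) - Gt (int i)" using mid_diff by simp
  note e = cut_mid_eps[of "mn (\<bar>Gt (int i)\<bar> + int s + int t + 2) (\<lambda>k. Gt k + (if int i < k then int s else int t)) ({1..int n + 1} - {int i, int i + 1})"
    "Gt (int i)" "int t" "Gt (int i + 1)" "int s", folded mid_levels[OF refl]]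
  show "v (int i + 1) + pos (u (int i + 1) - v (int i)) = y (int i + 1) + pos (x (int i + 1) - y (int i))"
    unfolding mid_new(1,3) mid_diff[symmetric] using e(1) by simp
  show "u (int i) + pos (v (int i) - u (int i + 1)) = x (int i) + pos (y (int i) - x (int i + 1))"
    unfolding mid_new(2,4) d using e(2) by simp
qed

text \<open>Raising \<open>x\<close> lowers \<open>diff_sum\<close> at the index \<open>i\<close>
  alone. Only at the cut position \<open>i\<close> can this affect the minimum, and there it decides
  which row of the image changes.\<close>

lemma mid_cut_left:
  assumes L: "y (int i) < x (int i + 1)"
  shows "cut n (int s) (int t) (change (int i + 1) (int i) x) y j = Ct j - (if j = int i \<and> \<not> v (int i) < u (int i + 1) then 1 else 0)"
proof -
  let ?x = "change (int i + 1) (int i) x" and ?K = "\<bar>Gt (int i)\<bar> + int s + int t + 2"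
  have g: "diff_sum ?x y k = Gt k - (if k = int i then 1 else 0)" for k using i by (auto simp: diff_sum_change)
  have lt: "Gt (int i + 1) < Gt (int i)" using L mid_diff by simp
  have sp: "Ct j = min (mn ?K (\<lambda>k. Gt k + (if j < k then int s else int t)) ({1..int n + 1} - {int i, int i + 1}))
    (min (Gt (int i) + (if j < int i then int s else int t)) (Gt (int i + 1) + (if j < int i + 1 then int s else int t)))" for j
    by (rule cut_split) (use i in auto)
  have "cut n (int s) (int t) ?x y j = min (mn ?K (\<lambda>k. diff_sum ?x y k + (if j < k then int s else int t)) ({1..int n + 1} - {int i, int i + 1}))
    (min (diff_sum ?x y (int i) + (if j < int i then int s else int t)) (diff_sum ?x y (int i + 1) + (if j < int i + 1 then int s else int t)))"
    by (rule cut_split) (use i in \<open>auto simp: g\<close>)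
  also have "mn ?K (\<lambda>k. diff_sum ?x y k + (if j < k then int s else int t)) ({1..int n + 1} - {int i, int i + 1}) =
    mn ?K (\<lambda>k. Gt k + (if j < k then int s else int t)) ({1..int n + 1} - {int i, int i + 1})" by (rule mn_cong) (auto simp: g)
  finally have e: "cut n (int s) (int t) ?x y j = min (mn ?K (\<lambda>k. Gt k + (if j < k then int s else int t)) ({1..int n + 1} - {int i, int i + 1}))
    (min (Gt (int i) - 1 + (if j < int i then int s else int t)) (Gt (int i + 1) + (if j < int i + 1 then int s else int t)))" by (simp add: g)
  show ?thesis
  proof (cases "j = int i")
    case True
    show ?thesis unfolding e mid_new(5) unfolding True mid_levels[OF refl] using cut_mid_left(1)[OF lt] by simp
  next
    case False
    then show ?thesis unfolding e sp using lt by auto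
  qed
qed

lemma mid_cut_right:
  assumes L: "\<not> y (int i) < x (int i + 1)"
  shows "cut n (int s) (int t) x (change (int i + 1) (int i) y) j = Ct j + (if j = int i \<and> v (int i) < u (int i + 1) then 1 else 0)"
proof -
  let ?y = "change (int i + 1) (int i) y" and ?K = "\<bar>Gt (int i)\<bar> + int s + int t + 2"
  have g: "diff_sum x ?y k = Gt k + (if k = int i + 1 then 1 else 0)" for k using i by (auto simp: diff_sum_change)
  have le: "Gt (int i) \<le> Gt (int i + 1)" using L mid_diff by simp
  have sp: "Ct j = min (mn ?K (\<lambda>k. Gt k + (if j < k then int s else int t)) ({1..int n + 1} - {int i, int i + 1}))
    (min (Gt (int i) + (if j < int i then int s else int t)) (Gt (int i + 1) + (if j < int i + 1 then int s else int t)))" for j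
    by (rule cut_split) (use i in auto)
  have "cut n (int s) (int t) x ?y j = min (mn ?K (\<lambda>k. diff_sum x ?y k + (if j < k then int s else int t)) ({1..int n + 1} - {int i, int i + 1}))
    (min (diff_sum x ?y (int i) + (if j < int i then int s else int t)) (diff_sum x ?y (int i + 1) + (if j < int i + 1 then int s else int t)))"
    by (rule cut_split) (use i in \<open>auto simp: g\<close>)
  also have "mn ?K (\<lambda>k. diff_sum x ?y k + (if j < k then int s else int t)) ({1..int n + 1} - {int i, int i + 1}) =
    mn ?K (\<lambda>k. Gt k + (if j < k then int s else int t)) ({1..int n + 1} - {int i, int i + 1})" by (rule mn_cong) (auto simp: g)
  finally have e: "cut n (int s) (int t) x ?y j = min (mn ?K (\<lambda>k. Gt k + (if j < k then int s else int t)) ({1..int n + 1} - {int i, int i + 1}))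
    (min (Gt (int i) + (if j < int i then int s else int t)) (Gt (int i + 1) + 1 + (if j < int i + 1 then int s else int t)))" by (simp add: g)
  show ?thesis
  proof (cases "j = int i")
    case True
    show ?thesis unfolding e mid_new(5) unfolding True mid_levels[OF refl] using cut_mid_right(1)[OF le] by simp
  next
    case False
    then show ?thesis unfolding e sp using le by auto
  qed
qed

lemma mid_swap:
  "swap_A n (int s) (int t) (if y (int i) < x (int i + 1) then (change (int i + 1) (int i) x, y) else (x, change (int i + 1) (int i) y)) =
    (if v (int i) < u (int i + 1) then (change (int i + 1) (int i) u, v) else (u, change (int i + 1) (int i) v))"
proof (cases "y (int i) < x (int i + 1)")
  case True
  then show ?thesis using i by (auto simp: swap_A_def mid_cut_left[OF True] fun_eq_iff change_apply u_eq v_eq)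
next
  case False
  then show ?thesis using i by (auto simp: swap_A_def mid_cut_right[OF False] fun_eq_iff change_apply u_eq v_eq)
qed

end

lemma zero_split:
  assumes K: "diff_sum x' y' 1 + int s + int t \<le> K + c" and g: "\<And>k. 1 < k \<Longrightarrow> k < int n + 1 \<Longrightarrow> diff_sum x' y' k + (if j < k then int s else int t) = h k + c"
  shows "cut n (int s) (int t) x' y' j = min (mn K h ({1..int n + 1} - {1, int n + 1}) + c)
    (min (diff_sum x' y' 1 + (if j < 1 then int s else int t)) (diff_sum x' y' (int n + 1) + (if j < int n + 1 then int s else int t)))"
proof -
  have "cut n (int s) (int t) x' y' j = min (mn (K + c) (\<lambda>k. diff_sum x' y' k + (if j < k then int s else int t)) ({1..int n + 1} - {1, int n + 1}))
    (min (diff_sum x' y' 1 + (if j < 1 then int s else int t)) (diff_sum x' y' (int n + 1) + (if j < int n + 1 then int s else int t)))"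
    by (rule cut_split) (use n K in auto)
  also have "mn (K + c) (\<lambda>k. diff_sum x' y' k + (if j < k then int s else int t)) ({1..int n + 1} - {1, int n + 1}) = mn K h ({1..int n + 1} - {1, int n + 1}) + c"
    by (rule mn_shift) (use g in auto)
  finally show ?thesis .
qed

lemma zero_levels:
  defines "O1 \<equiv> mn (\<bar>Gt 1\<bar> + int s + int t + 2) Gt ({1..int n + 1} - {1, int n + 1})"
  shows "Ct 0 = min O1 (min (Gt 1) (Gt (int n + 1))) + int s"
    and "Ct 1 = min (O1 + int s) (min (Gt 1 + int t) (Gt (int n + 1) + int s))"
    and "Ct (int n) = min (O1 + int t) (min (Gt 1 + int t) (Gt (int n + 1) + int s))"
proof -
  have "Ct 0 = min (O1 + int s) (min (Gt 1 + (if (0::int) < 1 then int s else int t)) (Gt (int n + 1) + (if 0 < int n + 1 then int s else int t)))"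
    unfolding O1_def by (rule zero_split) auto
  then show "Ct 0 = min O1 (min (Gt 1) (Gt (int n + 1))) + int s" by (simp add: min_add_distrib_left)
  have "Ct 1 = min (O1 + int s) (min (Gt 1 + (if (1::int) < 1 then int s else int t)) (Gt (int n + 1) + (if 1 < int n + 1 then int s else int t)))"
    unfolding O1_def by (rule zero_split) auto
  then show "Ct 1 = min (O1 + int s) (min (Gt 1 + int t) (Gt (int n + 1) + int s))" using n by simp
  have "Ct (int n) = min (O1 + int t) (min (Gt 1 + (if int n < 1 then int s else int t)) (Gt (int n + 1) + (if int n < int n + 1 then int s else int t)))"
    unfolding O1_def by (rule zero_split) auto
  then show "Ct (int n) = min (O1 + int t) (min (Gt 1 + int t) (Gt (int n + 1) + int s))" using n by simp
qed

lemma zero_diff: "x 1 - y (int n + 1) = Gt (int n + 1) - Gt 1 - int t + int s" "y (int n + 1) - x 1 = Gt 1 - Gt (int n + 1) + int t - int s"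
  using G_ends[OF n x y] by simp_all

lemma zero_new: "u 1 - v (int n + 1) = Gt (int n + 1) - Gt 1 + Ct 1 - Ct (int n)" "v (int n + 1) - u 1 = Gt 1 - Gt (int n + 1) + Ct (int n) - Ct 1"
  "v 1 = y 1 + Ct 0 - Ct 1" "u (int n + 1) = x (int n + 1) + (Ct 0 - int s) + int t - Ct (int n)"
  "v (int n + 1) < u 1 \<longleftrightarrow> 0 < Gt (int n + 1) - Gt 1 + Ct 1 - Ct (int n)"
  using n zero_diff cut_ends[of n "int s" "int t" x y] by (auto simp: u_eq v_eq)

lemma zero_string:
  "v 1 + pos (u 1 - v (int n + 1)) = y 1 + pos (x 1 - y (int n + 1))"
  "u (int n + 1) + pos (v (int n + 1) - u 1) = x (int n + 1) + pos (y (int n + 1) - x 1)"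
proof -
  note e = cut_zero(1,2)[where ?O1.0 = "mn (\<bar>Gt 1\<bar> + int s + int t + 2) Gt ({1..int n + 1} - {1, int n + 1})" and a = "Gt 1" and b = "Gt (int n + 1)" and s = "int s" and t = "int t"]
  show "v 1 + pos (u 1 - v (int n + 1)) = y 1 + pos (x 1 - y (int n + 1))"
    unfolding zero_new(1,3) zero_diff(1) zero_levels using e(1) by simp
  show "u (int n + 1) + pos (v (int n + 1) - u 1) = x (int n + 1) + pos (y (int n + 1) - x 1)"
    unfolding zero_new(2,4) zero_diff(2) zero_levels using e(2) by simp
qed

text \<open>Node 0 moves a letter across the cyclic origin, so all values of \<open>diff_sum\<close>
  but the last shift, and with them all interior cuts. The cut at 0 changes only if the image is hit
  on the left too, which is the rule for a local coenergy.\<close>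

lemma zero_cut_left:
  assumes L: "y (int n + 1) < x 1"
  shows "1 \<le> j \<Longrightarrow> j \<le> int n \<Longrightarrow> cut n (int s) (int t) (change 1 (int n + 1) x) y j = Ct j + 1"
    and "cut n (int s) (int t) (change 1 (int n + 1) x) y 0 = Ct 0 + (if v (int n + 1) < u 1 then 1 else 0)"
proof -
  let ?x = "change 1 (int n + 1) x"
  have g: "diff_sum ?x y k = Gt k + 1" if "1 \<le> k" "k \<le> int n" for k using that by (auto simp: diff_sum_change)
  have g1: "diff_sum ?x y 1 = Gt 1 + 1" "diff_sum ?x y (int n + 1) = Gt (int n + 1)" using n by (auto simp: diff_sum_change)
  have lt: "0 < Gt (int n + 1) - Gt 1 - int t + int s" using L zero_diff by simp
  show "cut n (int s) (int t) ?x y j = Ct j + 1" if j: "1 \<le> j" "j \<le> int n"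
  proof -
    let ?h = "\<lambda>k. Gt k + (if j < k then int s else int t)" and ?K = "\<bar>Gt 1\<bar> + int s + int t + 2"
    have a: "Ct j = min (mn ?K ?h ({1..int n + 1} - {1, int n + 1}) + 0) (min (Gt 1 + (if j < 1 then int s else int t)) (Gt (int n + 1) + (if j < int n + 1 then int s else int t)))"
      by (rule zero_split) auto
    have b: "cut n (int s) (int t) ?x y j = min (mn ?K ?h ({1..int n + 1} - {1, int n + 1}) + 1) (min (diff_sum ?x y 1 + (if j < 1 then int s else int t)) (diff_sum ?x y (int n + 1) + (if j < int n + 1 then int s else int t)))"
      by (rule zero_split) (auto simp: g g1)
    show ?thesis unfolding a b g1 using j lt by (auto simp: min_def)
  qed
  let ?O1 = "mn (\<bar>Gt 1\<bar> + int s + int t + 2) Gt ({1..int n + 1} - {1, int n + 1})"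
  have "cut n (int s) (int t) ?x y 0 = min (?O1 + (int s + 1)) (min (diff_sum ?x y 1 + (if (0 :: int) < 1 then int s else int t)) (diff_sum ?x y (int n + 1) + (if 0 < int n + 1 then int s else int t)))"
    by (rule zero_split) (auto simp: g g1)
  also have "\<dots> = min (?O1 + 1) (min (Gt 1 + 1) (Gt (int n + 1))) + int s" unfolding g1 by (auto simp: min_def)
  finally show "cut n (int s) (int t) ?x y 0 = Ct 0 + (if v (int n + 1) < u 1 then 1 else 0)"
    unfolding zero_new(5) cut_zero(3)[OF lt] zero_levels by simp
qed

lemma zero_cut_right:
  assumes L: "\<not> y (int n + 1) < x 1"
  shows "1 \<le> j \<Longrightarrow> j \<le> int n \<Longrightarrow> cut n (int s) (int t) x (change 1 (int n + 1) y) j = Ct j - 1"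
    and "cut n (int s) (int t) x (change 1 (int n + 1) y) 0 = Ct 0 - (if v (int n + 1) < u 1 then 0 else 1)"
proof -
  let ?y = "change 1 (int n + 1) y"
  have g: "diff_sum x ?y k = Gt k - 1" if "1 < k" "k \<le> int n + 1" for k using that by (auto simp: diff_sum_change)
  have g1: "diff_sum x ?y 1 = Gt 1" "diff_sum x ?y (int n + 1) = Gt (int n + 1) - 1" using n by (auto simp: diff_sum_change)
  have lt: "Gt (int n + 1) - Gt 1 - int t + int s \<le> 0" using L zero_diff by simp
  show "cut n (int s) (int t) x ?y j = Ct j - 1" if j: "1 \<le> j" "j \<le> int n"
  proof -
    let ?h = "\<lambda>k. Gt k + (if j < k then int s else int t)" and ?K = "\<bar>Gt 1\<bar> + int s + int t + 2"
    have a: "Ct j = min (mn ?K ?h ({1..int n + 1} - {1, int n + 1}) + 0) (min (Gt 1 + (if j < 1 then int s else int t)) (Gt (int n + 1) + (if j < int n + 1 then int s else int t)))"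
      by (rule zero_split) auto
    have b: "cut n (int s) (int t) x ?y j = min (mn ?K ?h ({1..int n + 1} - {1, int n + 1}) + - 1) (min (diff_sum x ?y 1 + (if j < 1 then int s else int t)) (diff_sum x ?y (int n + 1) + (if j < int n + 1 then int s else int t)))"
      by (rule zero_split) (auto simp: g g1)
    show ?thesis unfolding a b g1 using j lt by (auto simp: min_def)
  qed
  let ?O1 = "mn (\<bar>Gt 1\<bar> + int s + int t + 2) Gt ({1..int n + 1} - {1, int n + 1})"
  have "cut n (int s) (int t) x ?y 0 = min (?O1 + (int s - 1)) (min (diff_sum x ?y 1 + (if (0 :: int) < 1 then int s else int t)) (diff_sum x ?y (int n + 1) + (if 0 < int n + 1 then int s else int t)))"
    by (rule zero_split) (auto simp: g g1)
  also have "\<dots> = min (?O1 - 1) (min (Gt 1) (Gt (int n + 1) - 1)) + int s" unfolding g1 by (auto simp: min_def)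
  finally show "cut n (int s) (int t) x ?y 0 = Ct 0 - (if v (int n + 1) < u 1 then 0 else 1)"
    unfolding zero_new(5) cut_zero(4)[OF lt] zero_levels by simp
qed

lemma zero_swap:
  "swap_A n (int s) (int t) (if y (int n + 1) < x 1 then (change 1 (int n + 1) x, y) else (x, change 1 (int n + 1) y)) =
    (if v (int n + 1) < u 1 then (change 1 (int n + 1) u, v) else (u, change 1 (int n + 1) v))"
proof (cases "y (int n + 1) < x 1")
  case True
  let ?x = "change 1 (int n + 1) x" and ?d = "if v (int n + 1) < u 1 then 1 else 0 :: int"
  have c: "cut n (int s) (int t) ?x y j = Ct j + (if j = 0 \<or> j = int n + 1 then ?d else 1)" if jj: "0 \<le> j" "j \<le> int n + 1" for j
  proof -
    consider "j = 0" | "1 \<le> j" "j \<le> int n" | "j = int n + 1" using jj by linarith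
    then show ?thesis
      by cases (use zero_cut_left[OF True] cut_ends[of n "int s" "int t" ?x y] cut_ends[of n "int s" "int t" x y] in auto)
  qed
  have "swap_A n (int s) (int t) (?x, y) = (\<lambda>l. if l \<in> {1..int n + 1} then ?x l + (Ct l + (if l = int n + 1 then ?d else 1)) - (Ct (l - 1) + (if l = 1 then ?d else 1)) else 0,
    \<lambda>l. if l \<in> {1..int n + 1} then y l + (Ct (l - 1) + (if l = 1 then ?d else 1)) - (Ct l + (if l = int n + 1 then ?d else 1)) else 0)"
    unfolding swap_A_def prod.case by (intro arg_cong2[where f = Pair] ext) (auto simp: c)
  also have "\<dots> = (if v (int n + 1) < u 1 then (change 1 (int n + 1) u, v) else (u, change 1 (int n + 1) v))"
    using n by (cases "v (int n + 1) < u 1") (auto simp: fun_eq_iff u_eq v_eq change_apply)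
  finally show ?thesis using True by simp
next
  case False
  let ?y = "change 1 (int n + 1) y" and ?d = "if v (int n + 1) < u 1 then 0 else 1 :: int"
  have c: "cut n (int s) (int t) x ?y j = Ct j - (if j = 0 \<or> j = int n + 1 then ?d else 1)" if jj: "0 \<le> j" "j \<le> int n + 1" for j
  proof -
    consider "j = 0" | "1 \<le> j" "j \<le> int n" | "j = int n + 1" using jj by linarith
    then show ?thesis
      by cases (use zero_cut_right[OF False] cut_ends[of n "int s" "int t" x ?y] cut_ends[of n "int s" "int t" x y] in auto)
  qed
  have "swap_A n (int s) (int t) (x, ?y) = (\<lambda>l. if l \<in> {1..int n + 1} then x l + (Ct l - (if l = int n + 1 then ?d else 1)) - (Ct (l - 1) - (if l = 1 then ?d else 1)) else 0,
    \<lambda>l. if l \<in> {1..int n + 1} then ?y l + (Ct (l - 1) - (if l = 1 then ?d else 1)) - (Ct l - (if l = int n + 1 then ?d else 1)) else 0)"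
    unfolding swap_A_def prod.case by (intro arg_cong2[where f = Pair] ext) (auto simp: c)
  also have "\<dots> = (if v (int n + 1) < u 1 then (change 1 (int n + 1) u, v) else (u, change 1 (int n + 1) v))"
    using n by (cases "v (int n + 1) < u 1") (auto simp: fun_eq_iff u_eq v_eq change_apply)
  finally show ?thesis using False by simp
qed

lemma swap_A_string:
  assumes "i \<le> n"
  shows "v (src i) + pos (u (src i) - v (dst n i)) = y (src i) + pos (x (src i) - y (dst n i))"
    "u (dst n i) + pos (v (dst n i) - u (src i)) = x (dst n i) + pos (y (dst n i) - x (src i))"
  using mid_string[of i] zero_string assms by (cases "i = 0"; simp add: src_def dst_def)+

lemma swap_A_e:
  assumes "i \<le> n"
  shows "swap_A n (int s) (int t) (if y (dst n i) < x (src i) then (change (src i) (dst n i) x, y) else (x, change (src i) (dst n i) y)) =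
    (if v (dst n i) < u (src i) then (change (src i) (dst n i) u, v) else (u, change (src i) (dst n i) v))"
proof (cases "i = 0")
  case True
  then have sd: "src i = 1" "dst n i = int n + 1" by (simp_all add: src_def dst_def)
  show ?thesis unfolding sd by (rule zero_swap)
next
  case False
  then have sd: "src i = int i + 1" "dst n i = int i" "1 \<le> i" by (simp_all add: src_def dst_def)
  show ?thesis unfolding sd(1,2) by (rule mid_swap[OF sd(3) assms])
qed

lemma cut_e:
  assumes "i \<le> n"
  defines "p' \<equiv> if y (dst n i) < x (src i) then (change (src i) (dst n i) x, y) else (x, change (src i) (dst n i) y)"
  shows "cut n (int s) (int t) (fst p') (snd p') 0 - Ct 0 = (if i = 0 then coenergy_step (y (dst n i) < x (src i)) (v (dst n i) < u (src i)) else 0)"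
proof (cases "i = 0")
  case True
  then show ?thesis unfolding p'_def using zero_cut_left(2) zero_cut_right(2) by (simp add: src_def dst_def coenergy_step_def)
next
  case False
  then show ?thesis unfolding p'_def using mid_cut_left[of i 0] mid_cut_right[of i 0] assms(1) by (simp add: src_def dst_def)
qed

end

section \<open>The R-matrix and the local coenergy of type A\<close>

context
  fixes n :: nat assumes n: "1 \<le> n"
begin

abbreviation "KA \<equiv> KR A1 n"

lemma good_A1: "good_rank A1 n" using n by (simp add: good_rank_def)
lemma reg_A1: "regular {0..n} (KA s)" by (rule KR_regular[OF good_A1])
lemma reg2_A1: "regular {0..n} (KA s \<otimes>\<^sub>c KA t)" by (rule regular_tensor[OF reg_A1 reg_A1])

lemma left_A1:
  assumes "i \<le> n" "x \<in> KR_rows A1 n s" "y \<in> KR_rows A1 n t"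
  shows "phi (KA t) i y < eps (KA s) i x \<longleftrightarrow> y (dst n i) < x (src i)"
  using KR_eps[OF good_A1 assms(1,2)] KR_phi[OF good_A1 assms(1,3)] unfolding A1_node[OF assms(1)] by linarith

lemma e_A1:
  assumes "i \<le> n" "x \<in> KR_rows A1 n s" "y \<in> KR_rows A1 n t" "eop (KA s \<otimes>\<^sub>c KA t) i (x, y) = Some p'"
  shows "p' = (if y (dst n i) < x (src i) then (change (src i) (dst n i) x, y) else (x, change (src i) (dst n i) y))"
  using assms(4) unfolding eop_tensor left_A1[OF assms(1-3)] by (auto simp: A1_node[OF assms(1)] split: if_splits)

lemma string_A1:
  assumes "i \<le> n" "x \<in> KR_rows A1 n s" "y \<in> KR_rows A1 n t"
  shows "int (eps (KA s \<otimes>\<^sub>c KA t) i (x, y)) = y (src i) + pos (x (src i) - y (dst n i))"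
    and "int (phi (KA s \<otimes>\<^sub>c KA t) i (x, y)) = x (dst n i) + pos (y (dst n i) - x (src i))"
proof -
  have "int (a - b) = pos (int a - int b)" for a b by (auto simp: pos_def)
  moreover have "eps (KA s \<otimes>\<^sub>c KA t) i (x, y) = eps (KA t) i y + (eps (KA s) i x - phi (KA t) i y)"
    "phi (KA s \<otimes>\<^sub>c KA t) i (x, y) = phi (KA s) i x + (phi (KA t) i y - eps (KA s) i x)"
    by (rule eps_tensor[OF reg_A1 reg_A1] phi_tensor[OF reg_A1 reg_A1]; use assms in simp)+
  ultimately show "int (eps (KA s \<otimes>\<^sub>c KA t) i (x, y)) = y (src i) + pos (x (src i) - y (dst n i))"
    "int (phi (KA s \<otimes>\<^sub>c KA t) i (x, y)) = x (dst n i) + pos (y (dst n i) - x (src i))"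
    using KR_eps[OF good_A1 assms(1,2)] KR_eps[OF good_A1 assms(1,3)] KR_phi[OF good_A1 assms(1,2)] KR_phi[OF good_A1 assms(1,3)]
    unfolding A1_node[OF assms(1)] by simp_all
qed

lemma swap_A_moves:
  assumes "i \<le> n" "p \<in> carr (KA s \<otimes>\<^sub>c KA t)" "eop (KA s \<otimes>\<^sub>c KA t) i p = Some p'"
    and "eop (KA t \<otimes>\<^sub>c KA s) i (swap_A n (int s) (int t) p) = Some q'"
  shows "swap_A n (int s) (int t) p' = q'"
proof -
  obtain x y u v where p: "p = (x, y)" "swap_A n (int s) (int t) p = (u, v)" by fastforce
  have xy: "x \<in> KR_rows A1 n s" "y \<in> KR_rows A1 n t" using assms(2) p by auto
  note uv = swap_A_in[OF n xy p(2)[unfolded p(1)]]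
  show ?thesis
    using swap_A_e[OF n xy p(2)[unfolded p(1)] assms(1)] e_A1[OF assms(1) xy assms(3)[unfolded p(1)]]
      e_A1[OF assms(1) uv assms(4)[unfolded p(2)]] by simp
qed

lemma swap_A_carr: "p \<in> carr (KA s \<otimes>\<^sub>c KA t) \<Longrightarrow> swap_A n (int s) (int t) p \<in> carr (KA t \<otimes>\<^sub>c KA s)"
proof -
  assume "p \<in> carr (KA s \<otimes>\<^sub>c KA t)"
  moreover obtain x y u v where p: "p = (x, y)" "swap_A n (int s) (int t) p = (u, v)" by fastforce
  ultimately have xy: "x \<in> KR_rows A1 n s" "y \<in> KR_rows A1 n t" by auto
  show ?thesis unfolding p(2) using swap_A_in[OF n xy p(2)[unfolded p(1)]] by simp
qed

lemma swap_A_eps: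
  assumes "i \<le> n" "p \<in> carr (KA s \<otimes>\<^sub>c KA t)"
  shows "eps (KA t \<otimes>\<^sub>c KA s) i (swap_A n (int s) (int t) p) = eps (KA s \<otimes>\<^sub>c KA t) i p"
    and "phi (KA t \<otimes>\<^sub>c KA s) i (swap_A n (int s) (int t) p) = phi (KA s \<otimes>\<^sub>c KA t) i p"
proof -
  obtain x y u v where p: "p = (x, y)" "swap_A n (int s) (int t) p = (u, v)" by fastforce
  have xy: "x \<in> KR_rows A1 n s" "y \<in> KR_rows A1 n t" using assms(2) p by auto
  note uv = swap_A_in[OF n xy p(2)[unfolded p(1)]]
  note e = string_A1[OF assms(1) xy] string_A1[OF assms(1) uv] swap_A_string[OF n xy p(2)[unfolded p(1)] assms(1)]
  show "eps (KA t \<otimes>\<^sub>c KA s) i (swap_A n (int s) (int t) p) = eps (KA s \<otimes>\<^sub>c KA t) i p" "phi (KA t \<otimes>\<^sub>c KA s) i (swap_A n (int s) (int t) p) = phi (KA s \<otimes>\<^sub>c KA t) i p"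
    using e unfolding p(2) unfolding p(1) by linarith+
qed

lemma swap_A_bisim: "bisim {0..n} (KA s \<otimes>\<^sub>c KA t) (KA t \<otimes>\<^sub>c KA s) (\<lambda>p q. swap_A n (int s) (int t) p = q)"
  unfolding bisim_def
proof (intro ballI impI conjI allI)
  fix p q i assume p: "p \<in> carr (KA s \<otimes>\<^sub>c KA t)" and q: "q \<in> carr (KA t \<otimes>\<^sub>c KA s)" "swap_A n (int s) (int t) p = q" and i: "i \<in> {0..n}"
  have i': "i \<le> n" using i by simp
  show "eps (KA s \<otimes>\<^sub>c KA t) i p = eps (KA t \<otimes>\<^sub>c KA s) i q" "phi (KA s \<otimes>\<^sub>c KA t) i p = phi (KA t \<otimes>\<^sub>c KA s) i q"
    using swap_A_eps[OF i' p] q by simp_all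
  show "swap_A n (int s) (int t) p' = q'" if "eop (KA s \<otimes>\<^sub>c KA t) i p = Some p'" "eop (KA t \<otimes>\<^sub>c KA s) i q = Some q'" for p' q'
    by (rule swap_A_moves[OF i' p that(1)]) (use that(2) q in simp)
  show "swap_A n (int s) (int t) p' = q'" if f: "fop (KA s \<otimes>\<^sub>c KA t) i p = Some p'" "fop (KA t \<otimes>\<^sub>c KA s) i q = Some q'" for p' q'
  proof -
    \<comment> \<open>The image of \<open>p'\<close> can be raised because string lengths agree; by
      the raising case the result is the image of \<open>p\<close>, and lowering it leads
      back.\<close>
    note p' = regular_f[OF reg2_A1 i p f(1)]
    let ?r = "swap_A n (int s) (int t) p'"
    have r: "?r \<in> carr (KA t \<otimes>\<^sub>c KA s)" by (rule swap_A_carr[OF p'(1)])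
    have "0 < eps (KA t \<otimes>\<^sub>c KA s) i ?r" unfolding swap_A_eps(1)[OF i' p'(1)] p'(3) by simp
    then obtain w where w: "eop (KA t \<otimes>\<^sub>c KA s) i ?r = Some w" using regular_e_ex[OF reg2_A1 i r] by blast
    have "swap_A n (int s) (int t) p = w" by (rule swap_A_moves[OF i' p'(1,2) w])
    then show ?thesis using regular_e(2)[OF reg2_A1 i r w] q f(2) by simp
  qed
qed

lemma psum_power: "psum (power_row 1 m) k = (if 1 \<le> k then int m else 0)"
  by (simp add: psum_def power_row_def)

lemma swap_A_u: "swap_A n (int s) (int t) (uvec (KA s \<otimes>\<^sub>c KA t)) = uvec (KA t \<otimes>\<^sub>c KA s)" "cut n (int s) (int t) (power_row 1 s) (power_row 1 t) 0 = 0"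
proof -
  let ?x = "power_row 1 s" and ?y = "power_row 1 t"
  have g: "diff_sum ?x ?y k = (if k = 1 then - int s else int t - int s)" if "1 \<le> k" for k using that by (auto simp: diff_sum_def psum_power)
  have c: "cut n (int s) (int t) ?x ?y j = (if 1 \<le> j then int t - int s else 0)" if j: "0 \<le> j" for j
  proof (rule antisym)
    show "cut n (int s) (int t) ?x ?y j \<le> (if 1 \<le> j then int t - int s else 0)"
      using cut_le[of 1 n "int s" "int t" ?x ?y j] j by (simp add: g split: if_splits)
    obtain k where k: "1 \<le> k" "k \<le> int n + 1" "cut n (int s) (int t) ?x ?y j = diff_sum ?x ?y k + (if j < k then int s else int t)" by (rule cut_attained)
    then show "(if 1 \<le> j then int t - int s else 0) \<le> cut n (int s) (int t) ?x ?y j" using j by (auto simp: g)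
  qed
  show "cut n (int s) (int t) ?x ?y 0 = 0" by (simp add: c)
  show "swap_A n (int s) (int t) (uvec (KA s \<otimes>\<^sub>c KA t)) = uvec (KA t \<otimes>\<^sub>c KA s)"
    by (auto simp: swap_A_def c power_row_apply fun_eq_iff)
qed

lemma swap_A_R:
  shows "crystal_iso {0..n} (KA s \<otimes>\<^sub>c KA t) (KA t \<otimes>\<^sub>c KA s) (comb_R n (KA s) (KA t))"
    and "p \<in> carr (KA s \<otimes>\<^sub>c KA t) \<Longrightarrow> comb_R n (KA s) (KA t) p = swap_A n (int s) (int t) p"
proof -
  obtain R where R: "crystal_iso {0..n} (KA s \<otimes>\<^sub>c KA t) (KA t \<otimes>\<^sub>c KA s) R" "\<And>p. p \<in> carr (KA s \<otimes>\<^sub>c KA t) \<Longrightarrow> swap_A n (int s) (int t) p = R p"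
    using bisim_iso[OF reg2_A1 reg2_A1 KR_conn2[OF good_A1] KR_conn2[OF good_A1] swap_A_bisim swap_A_u(1) KR_rigid[OF good_A1] KR_rigid[OF good_A1]] by blast
  note c = comb_R_iso[OF reg_A1 reg_A1 KR_conn2[OF good_A1] KR_rigid[OF good_A1] R(1)]
  show "crystal_iso {0..n} (KA s \<otimes>\<^sub>c KA t) (KA t \<otimes>\<^sub>c KA s) (comb_R n (KA s) (KA t))" by (rule c(1))
  show "p \<in> carr (KA s \<otimes>\<^sub>c KA t) \<Longrightarrow> comb_R n (KA s) (KA t) p = swap_A n (int s) (int t) p" using R(2)[of p] c(2)[of p] by simp
qed

text \<open>By \<open>cut_e\<close> the cut at the cyclic origin has exactly the differences
  prescribed for the local coenergy.\<close>

definition hA :: "nat \<Rightarrow> nat \<Rightarrow> row \<times> row \<Rightarrow> nat" where "hA s t p = nat (cut n (int s) (int t) (fst p) (snd p) 0)"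

lemma hA_step:
  assumes "i \<le> n" "p \<in> carr (KA s \<otimes>\<^sub>c KA t)" "eop (KA s \<otimes>\<^sub>c KA t) i p = Some p'"
  shows "int (hA s t p') - int (hA s t p) =
    (if i = 0 then coenergy_step (e0_left (KA s) (KA t) p) (e0_left (KA t) (KA s) (comb_R n (KA s) (KA t) p)) else 0)"
proof -
  obtain x y u v where p: "p = (x, y)" "swap_A n (int s) (int t) p = (u, v)" by fastforce
  obtain x' y' where p': "p' = (x', y')" by fastforce
  have xy: "x \<in> KR_rows A1 n s" "y \<in> KR_rows A1 n t" using assms(2) p by auto
  have "p' \<in> carr (KA s \<otimes>\<^sub>c KA t)" using regular_e(1)[OF reg2_A1 _ assms(2,3)] assms(1) by simp
  then have xy': "x' \<in> KR_rows A1 n s" "y' \<in> KR_rows A1 n t" using p' by auto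
  note uv = swap_A_in[OF n xy p(2)[unfolded p(1)]]
  have h: "int (hA s t p') - int (hA s t p) = cut n (int s) (int t) x' y' 0 - cut n (int s) (int t) x y 0"
    unfolding hA_def p p' fst_conv snd_conv using C_nonneg[OF n xy] C_nonneg[OF n xy'] by simp
  note e = e_A1[OF assms(1) xy assms(3)[unfolded p(1)]]
  have "cut n (int s) (int t) x' y' 0 - cut n (int s) (int t) x y 0 = (if i = 0 then coenergy_step (y (dst n i) < x (src i)) (v (dst n i) < u (src i)) else 0)"
    using cut_e[OF n xy p(2)[unfolded p(1)] assms(1), folded e] by (simp add: p')
  moreover have "e0_left (KA s) (KA t) p \<longleftrightarrow> y (dst n 0) < x (src 0)" "e0_left (KA t) (KA s) (swap_A n (int s) (int t) p) \<longleftrightarrow> v (dst n 0) < u (src 0)"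
    unfolding p(2) unfolding p(1) e0_left_def prod.case by (rule left_A1[OF _ xy] left_A1[OF _ uv]; simp)+
  ultimately show ?thesis unfolding h swap_A_R(2)[OF assms(2)] by simp
qed

lemma hA_u: "hA s t (uvec (KA s \<otimes>\<^sub>c KA t)) = 0"
  using swap_A_u(2)[of s t] by (simp add: hA_def)

lemma hA_class: "i \<in> {1..n} \<Longrightarrow> p \<in> carr (KA s \<otimes>\<^sub>c KA t) \<Longrightarrow> eop (KA s \<otimes>\<^sub>c KA t) i p = Some p' \<Longrightarrow> hA s t p' = hA s t p"
  using hA_step[of i p s t p'] by (simp del: KR_simps carr_tensor)

lemma hA_zero: "p \<in> carr (KA s \<otimes>\<^sub>c KA t) \<Longrightarrow> eop (KA s \<otimes>\<^sub>c KA t) 0 p = Some p' \<Longrightarrow>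
    int (hA s t p') - int (hA s t p) = coenergy_step (e0_left (KA s) (KA t) p) (e0_left (KA t) (KA s) (comb_R n (KA s) (KA t) p))"
  using hA_step[of 0 p s t p'] by (simp del: KR_simps carr_tensor)

lemma local_coenergy_hA: "p \<in> carr (KA s \<otimes>\<^sub>c KA t) \<Longrightarrow> local_coenergy n (KA s) (KA t) p = hA s t p"
  by (rule local_coenergy_eq[where h = "hA s t", OF reg_A1 reg_A1 KR_conn2[OF good_A1] hA_class hA_u hA_zero])

lemma KR_family_A1: "KR_family A1 n"
proof
  show "regular {0..n} (KA s)" for s by (rule reg_A1)
  show "rises {0..n} (KA s \<otimes>\<^sub>c KA t)" for s t by (rule KR_conn2[OF good_A1])
  show "rises {0..n} (KA r \<otimes>\<^sub>c (KA s \<otimes>\<^sub>c KA t))" for r s t by (rule KR_conn3[OF good_A1])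
  show "u_rigid {0..n} (KA s \<otimes>\<^sub>c KA t) (KA t \<otimes>\<^sub>c KA s)" for s t by (rule KR_rigid[OF good_A1])
  show "\<exists>g. crystal_iso {0..n} (KA s \<otimes>\<^sub>c KA t) (KA t \<otimes>\<^sub>c KA s) g" for s t using swap_A_R(1) by blast
  show "\<exists>h :: row \<times> row \<Rightarrow> nat. h (uvec (KA s \<otimes>\<^sub>c KA t)) = 0 \<and>
      (\<forall>i\<in>{1..n}. \<forall>p\<in>carr (KA s \<otimes>\<^sub>c KA t). \<forall>p'. eop (KA s \<otimes>\<^sub>c KA t) i p = Some p' \<longrightarrow> h p' = h p) \<and>
      (\<forall>p\<in>carr (KA s \<otimes>\<^sub>c KA t). \<forall>p'. eop (KA s \<otimes>\<^sub>c KA t) 0 p = Some p' \<longrightarrow> int (h p') - int (h p) =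
        coenergy_step (e0_left (KA s) (KA t) p) (e0_left (KA t) (KA s) (comb_R n (KA s) (KA t) p)))" for s t
    using hA_u[of s t] hA_class[where s = s and t = t] hA_zero[where s = s and t = t] by (intro exI[of _ "hA s t"]) blast
qed

section \<open>Padding in type A\<close>

lemma pad_A_row: "y \<in> KR_rows A1 n t \<Longrightarrow> add_letter (int n + 1) (int c) y \<in> KR_rows A1 n (t + c)"
  unfolding KR_rows_def by (auto simp: add_letter_apply size_ok_def letters_def split: if_splits)

lemma unpad_A_row: "y \<in> KR_rows A1 n (t + c) \<Longrightarrow> int c \<le> y (int n + 1) \<Longrightarrow> add_letter (int n + 1) (- int c) y \<in> KR_rows A1 n t"
  unfolding KR_rows_def by (auto simp: add_letter_apply size_ok_def letters_def split: if_splits)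

text \<open>The last letter of \<open>y\<close> lies beyond all partial sums up to
  \<open>k - 1\<close>, and the terms at \<open>j = 0\<close> do not contain the length of
  \<open>y\<close>.\<close>

lemma cut_pad_A: "cut n s (t + c) x (add_letter (int n + 1) c y) 0 = cut n s t x y 0"
proof -
  have "psum (add_letter (int n + 1) c y) (k - 1) = psum y (k - 1)" if "k \<le> int n + 1" for k
    unfolding psum_def by (rule sum.cong) (use that in \<open>auto simp: add_letter_apply\<close>)
  then have "(\<lambda>k. diff_sum x (add_letter (int n + 1) c y) k + (if 0 < k then s else t + c)) ` {1..int n + 1} =
    (\<lambda>k. diff_sum x y k + (if 0 < k then s else t)) ` {1..int n + 1}" by (intro image_cong) (auto simp: diff_sum_def)
  then show ?thesis by (simp add: cut_def)
qed

lemma KR_padded_A1: "KR_padded A1 n (\<lambda>c. add_letter (int n + 1) (int c)) (\<lambda>c i. if i = n then c else 0)"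
proof (rule KR_padded.intro[OF KR_family_A1], unfold_locales)
  fix y t c i assume y: "y \<in> carr (KA t)"
  then have y': "y \<in> KR_rows A1 n t" by simp
  note py = pad_A_row[OF y', of c]
  show "add_letter (int n + 1) (int c) y \<in> carr (KA (t + c))" using py by simp
  show "row_coenergy A1 n (t + c) (add_letter (int n + 1) (int c) y) = row_coenergy A1 n t y" by (simp add: row_coenergy_def)
  assume i: "1 \<le> i" "i \<le> n"
  have f: "f_row A1 n i b = change (int i) (int i + 1) b" for b using i by (auto simp: f_row_def f_last_def f_mid_def)
  have ph: "row_phi A1 n (t + c) i (add_letter (int n + 1) (int c) y) = row_phi A1 n t i y"
    "row_eps A1 n (t + c) i (add_letter (int n + 1) (int c) y) = row_eps A1 n t i y + int (if i = n then c else 0)"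
    using i by (auto simp: row_phi_def row_eps_def add_letter_apply)
  show "phi (KA (t + c)) i (add_letter (int n + 1) (int c) y) = phi (KA t) i y"
    using KR_phi[OF good_A1 i(2) py] KR_phi[OF good_A1 i(2) y'] ph by simp
  show "eps (KA (t + c)) i (add_letter (int n + 1) (int c) y) = eps (KA t) i y + (if i = n then c else 0)"
    using KR_eps[OF good_A1 i(2) py] KR_eps[OF good_A1 i(2) y'] ph by simp
  have "f_row A1 n i (add_letter (int n + 1) (int c) y) = add_letter (int n + 1) (int c) (f_row A1 n i y)"
    unfolding f by (auto simp: fun_eq_iff change_apply add_letter_apply)
  then show "fop (KA (t + c)) i (add_letter (int n + 1) (int c) y) = map_option (add_letter (int n + 1) (int c)) (fop (KA t) i y)"
    using node_ok[OF good_A1 py i(2)] node_ok[OF good_A1 y' i(2)] i ph by (simp add: node_ok_def)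
next
  show "inj (add_letter (int n + 1) (int c))" for c
    by (rule inj_on_inverseI[where g = "add_letter (int n + 1) (- int c)"]) (simp add: add_add)
next
  fix x b c y p q assume x: "x \<in> carr (KA (b + c + 1))" and y: "y \<in> carr (KA b)"
    and R: "comb_R n (KA (b + c + 1)) (KA (b + c)) (x, add_letter (int n + 1) (int c) y) = (p, q)"
  let ?y = "add_letter (int n + 1) (int c) y" and ?s = "b + c + 1" and ?t = "b + c"
  have xy: "x \<in> KR_rows A1 n ?s" "?y \<in> KR_rows A1 n ?t" using x y pad_A_row[of y b c] by auto
  then have sw: "swap_A n (int ?s) (int ?t) (x, ?y) = (p, q)" using R swap_A_R(2)[of "(x, ?y)" ?s ?t] by simp
  \<comment> \<open>Only the term \<open>k = n + 1\<close> differs between the two cuts, and there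
    the longer length is replaced by the shorter one.\<close>
  have "cut n (int ?s) (int ?t) x ?y (int n + 1) \<le> cut n (int ?s) (int ?t) x ?y (int n)"
  proof -
    obtain k where k: "1 \<le> k" "k \<le> int n + 1" "cut n (int ?s) (int ?t) x ?y (int n) = diff_sum x ?y k + (if int n < k then int ?s else int ?t)" by (rule cut_attained)
    then show ?thesis using cut_le[OF k(1,2), of "int ?s" "int ?t" x ?y "int n + 1"] by (auto split: if_splits)
  qed
  then have "?y (int n + 1) \<le> q (int n + 1)" using sw by (auto simp: swap_A_def)
  then have "int c \<le> q (int n + 1)" using rows_nonneg[of y A1 n b "int n + 1"] y by (simp add: add_letter_apply)
  moreover have "q \<in> KR_rows A1 n (b + 1 + c)" using swap_A_in(2)[OF n xy sw] by simp
  ultimately have "add_letter (int n + 1) (- int c) q \<in> KR_rows A1 n (b + 1)" using unpad_A_row by blast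
  moreover have "q = add_letter (int n + 1) (int c) (add_letter (int n + 1) (- int c) q)" by (simp add: add_add)
  ultimately show "\<exists>y'\<in>carr (KA (b + 1)). q = add_letter (int n + 1) (int c) y'" by auto
next
  fix w r y t y1 w1 c y2 w2 assume w: "w \<in> carr (KA r)" and y: "y \<in> carr (KA t)"
  have c: "(w, y) \<in> carr (KA r \<otimes>\<^sub>c KA t)" "(w, add_letter (int n + 1) (int c) y) \<in> carr (KA r \<otimes>\<^sub>c KA (t + c))"
    using w y pad_A_row[of y t c] by auto
  show "local_coenergy n (KA r) (KA (t + c)) (w, add_letter (int n + 1) (int c) y) + row_coenergy A1 n r w2 =
      local_coenergy n (KA r) (KA t) (w, y) + row_coenergy A1 n r w1"
    unfolding local_coenergy_hA[OF c(1)] local_coenergy_hA[OF c(2)] hA_def using cut_pad_A[of "int r" "int t" "int c" w y] by (simp add: row_coenergy_def)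
qed

end

theorem theorem4p3:
  fixes X :: affine_type and n a b :: nat
  assumes "rank_ok X n" and "b + 2 \<le> a"
  shows "\<exists>rs :: row \<times> row \<Rightarrow> row \<times> row.
    crystal_morphism {1..n} (KR X n a \<otimes>\<^sub>c KR X n b) (KR X n (a - 1) \<otimes>\<^sub>c KR X n (b + 1)) rs \<and>
    inj_on rs (carr (KR X n a \<otimes>\<^sub>c KR X n b)) \<and>
    (\<forall>ss. (\<forall>s\<in>set ss. 1 \<le> s) \<longrightarrow>
       crystal_morphism {1..n} (KR_tensor X n (ss @ [a, b])) (KR_tensor X n (ss @ [a - 1, b + 1]))
         (id_tensor (length ss) rs) \<and>
       inj_on (id_tensor (length ss) rs) (carr (KR_tensor X n (ss @ [a, b]))) \<and>
       preserves_coenergy X n (ss @ [a, b]) (ss @ [a - 1, b + 1]) (id_tensor (length ss) rs))"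
proof -
  have "\<exists>rs :: row \<times> row \<Rightarrow> row \<times> row.
    crystal_morphism {1..n} (KR X n a \<otimes>\<^sub>c KR X n b) (KR X n (a - 1) \<otimes>\<^sub>c KR X n (b + 1)) rs \<and>
    inj_on rs (carr (KR X n a \<otimes>\<^sub>c KR X n b)) \<and>
    (\<forall>ss. crystal_morphism {1..n} (KR_tensor X n (ss @ [a, b])) (KR_tensor X n (ss @ [a - 1, b + 1]))
         (id_tensor (length ss) rs) \<and>
       inj_on (id_tensor (length ss) rs) (carr (KR_tensor X n (ss @ [a, b]))) \<and>
       preserves_coenergy X n (ss @ [a, b]) (ss @ [a - 1, b + 1]) (id_tensor (length ss) rs))"
  proof (cases "X = A1 \<or> X = D1")
    case False
    then interpret folded_type X n by unfold_locales (use assms(1) in auto)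
    show ?thesis by (rule row_splitting[OF assms(2)])
  next
    case True
    then show ?thesis
    proof
      assume X: "X = A1"
      then have n: "1 \<le> n" using assms(1) by simp
      show ?thesis unfolding X by (rule KR_padded.row_splitting[OF KR_padded_A1[OF n] assms(2)])
    next
      assume X: "X = D1"
      then have n: "3 \<le> n" using assms(1) by simp
      interpret D_padding D1 n n 1 "\<lambda>s b. b" "\<lambda>i. [i]" "\<lambda>_. 1" 1 1 by (rule D_padding_D1[OF n])
      show ?thesis unfolding X by (rule row_splitting[OF assms(2)])
    qed
  qed
  then show ?thesis by blast
qed

end
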